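(* Let $k\ge3$, let $\mathcal{H}$ be an affine hyperplane in $\mathbb{R}^k$ with normal direction $\boldsymbol{\alpha}=(1,\alpha_2,\ldots,\alpha_k)$, and assume $\omega_2(\mathcal{H}):=\max_{2\le i<j\le k}\omega^*(\alpha_i,\alpha_j)<\infty$. Let $(f_n)_{n=1}^\infty$ be an admissible function system and let $\mu_\eta$ be as in the context ($\eta>0$ small). Then \[ |V_N(\mu_\eta)-V_N(\lambda)|\ll\sum_{n,n'\le N}\lambda(f_n)\lambda(f_{n'})\,u(n,n'),\qquad u(n,n')=(nn')^{(2\omega_2(\mathcal{H})+4-k+O(\tau)+o(1))/(2k)}, \] where the $O(\tau)$ term is bounded by a constant (depending on $k$ and $\mathcal{H}$) times $\tau$, the $o(1)$ term tends to $0$ as $nn'\to\infty$, and the implied constant and the convergence implicit in $o(1)$ are uniform in $\eta$ and $N$.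
   Context: The dual exponent of $\mathbf{x}\in\mathbb{R}^d$ is $\omega^*(\mathbf{x})=\sup\{w:\|\mathbf{n}\cdot\mathbf{x}\|<\|\mathbf{n}\|_\infty^{-w}\text{ for infinitely many }\mathbf{n}\in\mathbb{Z}^d\}$, where $\|\cdot\|$ is the distance to the nearest integer. $\lambda$ is Lebesgue measure on $[0,1]^k$, $\lambda(f)=\int_{[0,1]^k}f$, and for a probability density $\nu$ on $\mathbb{R}^k$, $V_N(\nu)=\int_{\mathbb{R}^k}\bigl(\sum_{n\le N}(f_n(\mathbf{x})-\lambda(f_n))\bigr)^2\nu(\mathbf{x})\,d\mathbf{x}$ (for $\lambda$: integral over $[0,1]^k$). Construction of $\mu_\eta$: fix a box $\mathcal{B}=\prod_{i<k}[-B_i,B_i]\subset\mathbb{R}^{k-1}$, small constants $r_1,\ldots,r_{k-1}>0$, non-zero smooth bump functions $\beta_1,\ldots,\beta_k:\mathbb{R}\to[0,1]$ supported on $[-2,2]$; let $\mu_\eta^\dagger$ be the probability density on $\mathbb{R}^k$ proportional to $(x',x_k)\mapsto(1_{\mathcal{B}}*g)(x')\beta_k(x_k/\eta)$ with $g(x')=\prod_{i<k}\beta_i(x_i/r_i)$; $\mu_\eta$ is its image under a fixed rotation sending the $x_k$-direction to the direction $\boldsymbol\alpha$ followed by a fixed translation so that $\{x_k=0\}$ goes to $\mathcal{H}$. Admissible systems: fix $\tau\in(0,1/k)$ and $\mathbf{y}\in\mathbb{R}^k$. For $m\in\mathbb{N}$ let $D_m=[2^{m-1},2^m)$. For each $m$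 choose a finite index set $I_m$ and, for $i\in I_m$, $1\le j\le k$, numbers $d_{i,j}=d_{i,j,m}>0$ with $d_{i,j}\le1/(2n)$ and $n^{-(1+1/k+\tau)}\ll d_{i,j}\ll n^{-(1+1/k-\tau)}$ for all $n\in D_m$, such that $\prod_jd_{i,j}$ does not depend on $i$. To each $(i,j)$ associate $\mathcal{U}_{i,j}$ equal to $[0,nd_{i,j})$ ("first type") or $[nd_{i,j}/2,nd_{i,j})$ ("second type"). For $n\in D_m$ let $A_n=\bigcup_{i\in I_m}\{\mathbf{x}\in[0,1]^k:\|nx_j-y_j\|\in\mathcal{U}_{i,j}\ \forall j\}$, required to be a disjoint union and to satisfy Property $\mathcal{P}_n(\mathbf{y})$: modulo $\mathbb{Z}^k$, $A_n=\mathcal{Z}+n^{-1}(\mathbf{y}+\mathbb{Z}^k)$ for a strongly star-shaped $\mathcal{Z}\subseteq[-1/2,1/2]^k$ ($\mathbf{x}\in\mathcal{Z}$, $|z_j|\le|x_j|\ \forall j\Rightarrow\mathbf{z}\in\mathcal{Z}$). With non-zero smooth bump functions $\omega_1,\omega_2:\mathbb{R}\to[0,1]$ supported on $\{|x|<1\}$ and $\{1/2\le|x|<1\}$ respectively, put $b_{i,j}=\omega_1$ for first type and $\omega_2$ for second type, and $f_n(\mathbf{x})=\sum_{i\in I_m}\sum_{\mathbf{a}\in\mathbb{Z}^k}\prod_jb_{i,j}\bigl((x_j-(a_j+y_j)/n)/d_{i,j}\bigr)$ for $n\in D_m$. *)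

theory Defs
  imports "HOL-Analysis.Analysis"
begin

text \<open>
  The space \<open>\<real>\<^sup>k\<close> is \<^typ>\<open>real ^ 'n\<close> with \<open>k = CARD('n)\<close>.  The sort \<open>{finite, wellorder}\<close> orders the
  coordinates, so that the coordinates \<open>1\<close> and \<open>k\<close> are the least and the greatest index.
\<close>

definition fst_idx :: "'n::{finite,wellorder}" where
  "fst_idx = Min UNIV"

definition last_idx :: "'n::{finite,wellorder}" where
  "last_idx = Max UNIV"


section \<open>The dual exponent\<close>

definition nint_dist :: "real \<Rightarrow> real" where
  "nint_dist x = \<bar>x - of_int (round x)\<bar>"

definition real_vec :: "int ^ 'd \<Rightarrow> real ^ 'd" where
  "real_vec a = (\<chi> j. of_int (a $ j))"

text \<open>The supremum is taken in \<^typ>\<open>ereal\<close>, since the exponent may be infinite.\<close>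

definition dual_exponent :: "real ^ 'd \<Rightarrow> ereal" where
  "dual_exponent x =
     Sup {ereal w | w. infinite {n :: int ^ 'd.
       nint_dist (real_vec n \<bullet> x) < infnorm (real_vec n) powr (- w)}}"

text \<open>
  \<open>\<omega>\<^sub>2(\<H>)\<close> for a hyperplane \<open>\<H>\<close> with normal vector \<open>\<alpha>\<close>, where \<open>\<alpha>\<^sub>1 = 1\<close>; this normalisation makes \<open>\<alpha>\<close>
  a function of \<open>\<H>\<close>.
\<close>

definition omega2 :: "real ^ 'n::{finite,wellorder} \<Rightarrow> ereal" where
  "omega2 \<alpha> =
     Max {dual_exponent (vector [\<alpha> $ i, \<alpha> $ j] :: real ^ 2) | i j. fst_idx < i \<and> i < j}"


section \<open>Bump functions\<close>

definition smooth :: "(real \<Rightarrow> real) \<Rightarrow> bool" where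
  "smooth b \<longleftrightarrow> (\<forall>m x. (deriv ^^ m) b field_differentiable at x)"

definition bump :: "real set \<Rightarrow> (real \<Rightarrow> real) \<Rightarrow> bool" where
  "bump S b \<longleftrightarrow> smooth b \<and> range b \<subseteq> {0..1} \<and> (\<exists>x. b x \<noteq> 0) \<and> (\<forall>x. x \<notin> S \<longrightarrow> b x = 0)"


section \<open>The densities near the hyperplane\<close>

text \<open>
  Points of \<open>\<real>\<^sup>k\<^sup>-\<^sup>1\<close> are functions on the index set \<open>{..<last_idx}\<close>, with Lebesgue measure given by the
  product measure.
\<close>

definition lebesgue_low :: "('n::{finite,wellorder} \<Rightarrow> real) measure" where
  "lebesgue_low = (\<Pi>\<^sub>M i\<in>{..<last_idx}. lborel)"

definition box_low :: "('n::{finite,wellorder} \<Rightarrow> real) \<Rightarrow> ('n \<Rightarrow> real) set" where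
  "box_low B = {u. \<forall>i<last_idx. u i \<in> {- B i..B i}}"

definition bump_low ::
    "('n::{finite,wellorder} \<Rightarrow> real) \<Rightarrow> ('n \<Rightarrow> real \<Rightarrow> real) \<Rightarrow> ('n \<Rightarrow> real) \<Rightarrow> real" where
  "bump_low r \<beta> u = (\<Prod>i<last_idx. \<beta> i (u i / r i))"

definition smoothed_box ::
    "('n::{finite,wellorder} \<Rightarrow> real) \<Rightarrow> ('n \<Rightarrow> real) \<Rightarrow> ('n \<Rightarrow> real \<Rightarrow> real) \<Rightarrow> ('n \<Rightarrow> real) \<Rightarrow> real"
  where
  "smoothed_box B r \<beta> v =
     (\<integral>u. indicator (box_low B) u * bump_low r \<beta> (\<lambda>i. v i - u i) \<partial>lebesgue_low)"

definition mu_dagger_raw ::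
    "('n::{finite,wellorder} \<Rightarrow> real) \<Rightarrow> ('n \<Rightarrow> real) \<Rightarrow> ('n \<Rightarrow> real \<Rightarrow> real) \<Rightarrow> real \<Rightarrow> real ^ 'n::{finite,wellorder} \<Rightarrow> real"
  where
  "mu_dagger_raw B r \<beta> \<eta> x = smoothed_box B r \<beta> (($) x) * \<beta> last_idx (x $ last_idx / \<eta>)"

definition mu_dagger ::
    "('n::{finite,wellorder} \<Rightarrow> real) \<Rightarrow> ('n \<Rightarrow> real) \<Rightarrow> ('n \<Rightarrow> real \<Rightarrow> real) \<Rightarrow> real \<Rightarrow> real ^ 'n::{finite,wellorder} \<Rightarrow> real"
  where
  "mu_dagger B r \<beta> \<eta> x =
     mu_dagger_raw B r \<beta> \<eta> x / (\<integral>z. mu_dagger_raw B r \<beta> \<eta> z \<partial>lborel)"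

definition rigid_motion :: "real ^ 'n::{finite,wellorder} ^ 'n::{finite,wellorder} \<Rightarrow> real ^ 'n::{finite,wellorder} \<Rightarrow> real ^ 'n::{finite,wellorder} \<Rightarrow> real ^ 'n::{finite,wellorder}" where
  "rigid_motion Q t x = Q *v x + t"

text \<open>
  The rigid motion preserves Lebesgue measure, so the image of the density \<open>\<mu>\<^sup>\<dagger>\<close> is its composition
  with the inverse motion.
\<close>

definition mu ::
    "('n::{finite,wellorder} \<Rightarrow> real) \<Rightarrow> ('n \<Rightarrow> real) \<Rightarrow> ('n \<Rightarrow> real \<Rightarrow> real) \<Rightarrow>
     real ^ 'n::{finite,wellorder} ^ 'n::{finite,wellorder} \<Rightarrow> real ^ 'n::{finite,wellorder} \<Rightarrow> real \<Rightarrow> real ^ 'n::{finite,wellorder} \<Rightarrow> real"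
  where
  "mu B r \<beta> Q t \<eta> x = mu_dagger B r \<beta> \<eta> (inv (rigid_motion Q t) x)"

definition mu_data ::
    "real ^ 'n::{finite,wellorder} \<Rightarrow> (real ^ 'n::{finite,wellorder}) set \<Rightarrow>
     ('n \<Rightarrow> real) \<Rightarrow> ('n \<Rightarrow> real) \<Rightarrow> ('n \<Rightarrow> real \<Rightarrow> real) \<Rightarrow> real ^ 'n::{finite,wellorder} ^ 'n::{finite,wellorder} \<Rightarrow> real ^ 'n::{finite,wellorder} \<Rightarrow> bool"
  where
  "mu_data \<alpha> H B r \<beta> Q t \<longleftrightarrow>
     (\<forall>i<last_idx. 0 < B i \<and> 0 < r i) \<and>
     (\<forall>i. bump {-2..2} (\<beta> i)) \<and>
     rotation_matrix Q \<and>
     Q *v axis last_idx 1 = (1 / norm \<alpha>) *\<^sub>R \<alpha> \<and>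
     rigid_motion Q t ` {x. x $ last_idx = 0} = H"


section \<open>Admissible function systems\<close>

definition dyadic_block :: "nat \<Rightarrow> nat set" where
  "dyadic_block m = {2 ^ (m - 1)..<2 ^ m}"

definition dyadic_index :: "nat \<Rightarrow> nat" where
  "dyadic_index n = (THE m. n \<in> dyadic_block m)"

text \<open>\<open>ft\<close> tells whether the pair \<open>(i, j)\<close> is of the first type; \<open>s\<close> is \<open>d\<^sub>i\<^sub>,\<^sub>j\<close>.\<close>

definition target_interval :: "bool \<Rightarrow> nat \<Rightarrow> real \<Rightarrow> real set" where
  "target_interval ft n s = (if ft then {0..<real n * s} else {real n * s / 2..<real n * s})"

definition piece ::
    "real ^ 'n \<Rightarrow> (nat \<Rightarrow> 'n \<Rightarrow> real) \<Rightarrow> (nat \<Rightarrow> 'n \<Rightarrow> bool) \<Rightarrow> nat \<Rightarrow> nat \<Rightarrow> (real ^ 'n) set" where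
  "piece y d ft n i =
     {x \<in> cbox 0 1. \<forall>j. nint_dist (real n * x $ j - y $ j) \<in> target_interval (ft i j) n (d i j)}"

definition strongly_star_shaped :: "(real ^ 'n) set \<Rightarrow> bool" where
  "strongly_star_shaped Z \<longleftrightarrow> (\<forall>x\<in>Z. \<forall>z. (\<forall>j. \<bar>z $ j\<bar> \<le> \<bar>x $ j\<bar>) \<longrightarrow> z \<in> Z)"

text \<open>Equality modulo \<open>\<int>\<^sup>k\<close> is stated as equality of the sets of all integer translates.\<close>

definition property_P :: "real ^ 'n \<Rightarrow> nat \<Rightarrow> (real ^ 'n) set \<Rightarrow> bool" where
  "property_P y n A \<longleftrightarrow>
     (\<exists>Z. (\<forall>x\<in>Z. \<forall>j. x $ j \<in> {-1/2..1/2}) \<and> strongly_star_shaped Z \<and>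
        {x + real_vec a | x a. x \<in> A} =
        {z + (1 / real n) *\<^sub>R (y + real_vec a) + real_vec b | z a b. z \<in> Z})"

definition system_function ::
    "real ^ 'n \<Rightarrow> (nat \<Rightarrow> nat set) \<Rightarrow> (nat \<Rightarrow> nat \<Rightarrow> 'n \<Rightarrow> real) \<Rightarrow> (nat \<Rightarrow> nat \<Rightarrow> 'n \<Rightarrow> bool) \<Rightarrow>
     (real \<Rightarrow> real) \<Rightarrow> (real \<Rightarrow> real) \<Rightarrow> nat \<Rightarrow> real ^ 'n \<Rightarrow> real"
  where
  "system_function y I d ft \<omega>\<^sub>1 \<omega>\<^sub>2 n x =
     (let m = dyadic_index n in
      \<Sum>i\<in>I m. infsum (\<lambda>a :: int ^ 'n.
        \<Prod>j\<in>UNIV. (if ft m i j then \<omega>\<^sub>1 else \<omega>\<^sub>2)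
          ((x $ j - (of_int (a $ j) + y $ j) / real n) / d m i j)) UNIV)"

text \<open>
  The index sets \<open>I\<^sub>m\<close> are finite, so they are taken inside \<^typ>\<open>nat\<close>.  The constants \<open>c\<^sub>1\<close> and \<open>c\<^sub>2\<close> are
  the implied constants in the size condition on \<open>d\<^sub>i\<^sub>,\<^sub>j\<^sub>,\<^sub>m\<close>.
\<close>

definition admissible_system :: "real \<Rightarrow> (nat \<Rightarrow> real ^ 'n \<Rightarrow> real) \<Rightarrow> bool" where
  "admissible_system \<tau> f \<longleftrightarrow>
     (\<exists>y I d ft \<omega>\<^sub>1 \<omega>\<^sub>2.
        (\<forall>m\<ge>1. finite (I m)) \<and>
        (\<forall>m\<ge>1. \<forall>i\<in>I m. \<forall>j. 0 < d m i j) \<and>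
        (\<forall>m\<ge>1. \<forall>i\<in>I m. \<forall>j. \<forall>n\<in>dyadic_block m. d m i j \<le> 1 / (2 * real n)) \<and>
        (\<exists>c\<^sub>1>0. \<exists>c\<^sub>2>0. \<forall>m\<ge>1. \<forall>i\<in>I m. \<forall>j. \<forall>n\<in>dyadic_block m.
           c\<^sub>1 * real n powr (- (1 + 1 / real CARD('n) + \<tau>)) \<le> d m i j \<and>
           d m i j \<le> c\<^sub>2 * real n powr (- (1 + 1 / real CARD('n) - \<tau>))) \<and>
        (\<forall>m\<ge>1. \<forall>i\<in>I m. \<forall>i'\<in>I m. (\<Prod>j\<in>UNIV. d m i j) = (\<Prod>j\<in>UNIV. d m i' j)) \<and>
        (\<forall>m\<ge>1. \<forall>n\<in>dyadic_block m.
           disjoint_family_on (piece y (d m) (ft m) n) (I m) \<and>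
           property_P y n (\<Union>i\<in>I m. piece y (d m) (ft m) n i)) \<and>
        bump {-1<..<1} \<omega>\<^sub>1 \<and>
        bump {x. 1/2 \<le> \<bar>x\<bar> \<and> \<bar>x\<bar> < 1} \<omega>\<^sub>2 \<and>
        (\<forall>n\<ge>1. f n = system_function y I d ft \<omega>\<^sub>1 \<omega>\<^sub>2 n))"


section \<open>Variances\<close>

definition leb_mean :: "(real ^ 'n \<Rightarrow> real) \<Rightarrow> real" where
  "leb_mean h = (\<integral>x\<in>cbox 0 1. h x \<partial>lborel)"

definition variance_density :: "(nat \<Rightarrow> real ^ 'n \<Rightarrow> real) \<Rightarrow> nat \<Rightarrow> (real ^ 'n \<Rightarrow> real) \<Rightarrow> real" where
  "variance_density f N \<nu> = (\<integral>x. (\<Sum>n=1..N. f n x - leb_mean (f n))\<^sup>2 * \<nu> x \<partial>lborel)"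

definition variance_leb :: "(nat \<Rightarrow> real ^ 'n \<Rightarrow> real) \<Rightarrow> nat \<Rightarrow> real" where
  "variance_leb f N = leb_mean (\<lambda>x. (\<Sum>n=1..N. f n x - leb_mean (f n))\<^sup>2)"

end

theory Submission
  imports Defs "HOL-Probability.Probability_Measure"
begin

text \<open>
  The function \<open>f\<^sub>n\<close> has a Fourier series in the frequencies \<open>n h\<close>, \<open>h \<in> \<int>\<^sup>k\<close>, whose coefficients are \<open>\<lambda>(f\<^sub>n)\<close>
  times a factor that decays rapidly beyond \<open>\<parallel>h\<parallel> > n\<^bsup>1/k+\<tau>\<^esup>\<close>.  The Fourier transform of \<open>\<mu>\<^sub>\<eta>\<close> is bounded
  uniformly in \<open>\<eta>\<close> and decays rapidly away from the line \<open>\<real>\<alpha>\<close>.  Hence the difference of the variances is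
  governed by the number of pairs of non-zero \<open>h\<close>, \<open>h'\<close> in these ranges for which \<open>n h + n' h'\<close> is within
  \<open>(n n')\<^bsup>O(\<tau>)\<^esup>\<close> of the line.

  Suppose that \<open>h\<close>, \<open>h'\<close> are linearly independent and \<open>\<xi> = n h + n' h'\<close> is near the line.  If an integer vector
  \<open>(u, v, w)\<close> is orthogonal to \<open>(\<xi>\<^sub>1, \<xi>\<^sub>i, \<xi>\<^sub>j)\<close>, then \<open>u + v \<alpha>\<^sub>i + w \<alpha>\<^sub>j\<close> is at most \<open>M (n n')\<^bsup>O(\<tau>)\<^esup> / \<bar>\<xi>\<^sub>1\<bar>\<close>, so
  \<open>\<bar>u + v \<alpha>\<^sub>i + w \<alpha>\<^sub>j\<bar> \<ge> c M\<^bsup>-\<omega>\<^esup>\<close>, valid for \<open>\<bar>u\<bar>, \<bar>v\<bar>, \<bar>w\<bar> \<le> M\<close> and every \<open>\<omega> > \<omega>\<^sub>2(\<H>)\<close>, bounds \<open>\<xi>\<close>.  When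
  \<open>g = gcd n n'\<close> is large, Siegel's lemma provides such a vector for \<open>\<xi> / g\<close>; when it is small, the cross product
  of the projections of \<open>h\<close> and \<open>h'\<close> serves.  Parallel pairs are counted directly when \<open>\<omega>\<^sub>2(\<H>)\<close> or \<open>\<tau>\<close> is large;
  otherwise their total contribution over all \<open>n\<close>, \<open>n'\<close> converges.
\<close>

section \<open>Counting pairs of frequencies\<close>

text \<open>With \<open>A\<close>, \<open>A'\<close> near n^(1/k), n'^(1/k), independent pairs are
  bounded by about (A A')^(2 + \<omega>) / sqrt(n n'), and (2 + \<omega>)/k - 1/2 is precisely the
  exponent (2\<omega> + 4 - k)/(2k) of the theorem. Both gcd regimes, split at gcd n n' = n / A',
  are arranged to end in this same bound. The orthogonal integer vector lives on coordinates 1, i, j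
  only, which is why only the exponents of pairs (\<alpha>_i, \<alpha>_j) enter. The obstacle is the
  parallel pairs: for fixed n, n' their bound is about (n n')^(1/k), which exceeds the target when
  \<omega> + 1 < k/2. What helps then is that for h = s p, h' = t p the number n s + n' t must be
  small, which leaves few n for given n', s, t, p. The exponent \<omega> is taken to be the exponent
  of the hyperplane plus \<tau>, so that every loss is a multiple of \<tau> and the o(1) term can be
  chosen as zero. The implied constant may depend on \<tau> and on the function system, but not on
  \<eta> or N.\<close>

lemma card_fibres_le:
  fixes g :: "'b \<Rightarrow> real"
  assumes "finite (f ` S)" and "\<And>y. y \<in> f ` S \<Longrightarrow> finite {x \<in> S. f x = y}"
    and "\<And>y. y \<in> f ` S \<Longrightarrow> card {x \<in> S. f x = y} \<le> g y"
  shows "finite S" "card S \<le> (\<Sum>y\<in>f ` S. g y)"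
proof -
  have S: "S = (\<Union>y\<in>f ` S. {x \<in> S. f x = y})" by auto
  show "finite S" using assms(1,2) by (subst S) blast
  have "card S \<le> (\<Sum>y\<in>f ` S. card {x \<in> S. f x = y})"
    using card_UN_le[OF assms(1), of "\<lambda>y. {x \<in> S. f x = y}"] S by simp
  hence "real (card S) \<le> (\<Sum>y\<in>f ` S. real (card {x \<in> S. f x = y}))"
    by (metis of_nat_mono of_nat_sum)
  also have "\<dots> \<le> (\<Sum>y\<in>f ` S. g y)" by (intro sum_mono assms(3))
  finally show "card S \<le> (\<Sum>y\<in>f ` S. g y)" .
qed

lemma card_fibres_le_const:
  fixes b :: real
  assumes "finite B" "f ` S \<subseteq> B" and "\<And>y. y \<in> B \<Longrightarrow> finite {x \<in> S. f x = y}"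
    and "\<And>y. y \<in> B \<Longrightarrow> card {x \<in> S. f x = y} \<le> b" and "0 \<le> b"
  shows "finite S" "card S \<le> card B * b"
proof -
  have fin: "finite (f ` S)" using assms(1,2) finite_subset by blast
  show "finite S" using card_fibres_le(1)[of f S "\<lambda>_. b"] fin assms by blast
  have "card S \<le> card (f ` S) * b"
    using card_fibres_le(2)[of f S "\<lambda>_. b"] fin assms by (simp add: subset_iff)
  also have "\<dots> \<le> card B * b"
    using card_mono[OF assms(1,2)] assms(5) by (intro mult_right_mono) auto
  finally show "card S \<le> card B * b" .
qed

lemma card_int_interval:
  fixes c L :: real
  assumes "0 \<le> L"
  shows "finite {z :: int. \<bar>of_int z - c\<bar> \<le> L}" "card {z :: int. \<bar>of_int z - c\<bar> \<le> L} \<le> 2 * L + 1"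
proof -
  have eq: "{z :: int. \<bar>of_int z - c\<bar> \<le> L} = {\<lceil>c - L\<rceil>..\<lfloor>c + L\<rfloor>}"
    by (auto simp: abs_le_iff ceiling_le_iff le_floor_iff)
  show "finite {z :: int. \<bar>of_int z - c\<bar> \<le> L}" unfolding eq by simp
  have "real_of_int \<lfloor>c + L\<rfloor> \<le> c + L" "c - L \<le> real_of_int \<lceil>c - L\<rceil>" by linarith+
  thus "card {z :: int. \<bar>of_int z - c\<bar> \<le> L} \<le> 2 * L + 1"
    unfolding eq using assms by (simp add: of_nat_nat) linarith
qed

lemma card_int_multiples:
  fixes c L m :: real
  assumes "0 \<le> L" "0 < m"
  shows "finite {z :: int. \<bar>m * of_int z - c\<bar> \<le> L}"
    "card {z :: int. \<bar>m * of_int z - c\<bar> \<le> L} \<le> 2 * L / m + 1"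
proof -
  have "\<bar>m * of_int z - c\<bar> = m * \<bar>of_int z - c / m\<bar>" for z :: int
    using assms(2) by (simp add: abs_mult_pos' right_diff_distrib)
  hence eq: "{z :: int. \<bar>m * of_int z - c\<bar> \<le> L} = {z. \<bar>of_int z - c / m\<bar> \<le> L / m}"
    using assms(2) by (simp add: pos_le_divide_eq mult.commute)
  show "finite {z :: int. \<bar>m * of_int z - c\<bar> \<le> L}" 
    "card {z :: int. \<bar>m * of_int z - c\<bar> \<le> L} \<le> 2 * L / m + 1"
    unfolding eq using card_int_interval[of "L / m" "c / m"] assms by auto
qed

lemma card_nonzero_int:
  fixes L :: real
  assumes "0 \<le> L"
  shows "finite {z :: int. z \<noteq> 0 \<and> \<bar>of_int z\<bar> \<le> L}" "card {z :: int. z \<noteq> 0 \<and> \<bar>of_int z\<bar> \<le> L} \<le> 2 * L"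
proof -
  have fin: "finite {z :: int. \<bar>of_int z\<bar> \<le> L}" "card {z :: int. \<bar>of_int z\<bar> \<le> L} \<le> 2 * L + 1"
    using card_int_interval[OF assms, of 0] by auto
  have eq: "{z :: int. \<bar>of_int z\<bar> \<le> L} = insert 0 {z. z \<noteq> 0 \<and> \<bar>of_int z\<bar> \<le> L}" using assms by auto
  show f: "finite {z :: int. z \<noteq> 0 \<and> \<bar>of_int z\<bar> \<le> L}" using fin(1) by (rule rev_finite_subset) auto
  show "card {z :: int. z \<noteq> 0 \<and> \<bar>of_int z\<bar> \<le> L} \<le> 2 * L"
    using fin(2) f unfolding eq by simp
qed

text \<open>With n = g \<nu> and n' = g \<nu>', the form takes only values g r. The first factor
  counts the r that can occur, the second the points of one line \<nu> x + \<nu>' y = r, which form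
  a progression with step (-\<nu>', \<nu>). A large gcd helps the first factor and hurts the
  second.\<close>

lemma card_linear_form_pairs:
  fixes n n' :: nat and A' R c :: real
  assumes "0 < n" "0 \<le> A'" "0 \<le> R"
  defines "g \<equiv> gcd n n'"
  defines "P \<equiv> {(x :: int, y :: int). \<bar>of_int y\<bar> \<le> A' \<and> \<bar>of_int (int n * x + int n' * y) - c\<bar> \<le> R}"
  shows "finite P" "card P \<le> (2 * R / g + 1) * (2 * A' * g / n + 1)"
proof -
  have g0: "g > 0" using assms(1) by (simp add: g_def)
  have "\<exists>\<nu> \<nu>'. n = \<nu> * g \<and> n' = \<nu>' * g \<and> coprime \<nu> \<nu>'"
    using g0 unfolding g_def by (intro gcd_coprime_exists) simp
  then obtain \<nu> \<nu>' where nu: "n = g * \<nu>" "n' = g * \<nu>'" "coprime \<nu> \<nu>'"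
    by (metis mult.commute)
  have nu0: "\<nu> > 0" using nu(1) assms(1) by (cases \<nu>) auto
  define f where "f = (\<lambda>(x, y). int \<nu> * x + int \<nu>' * y)"
  define B where "B = {r :: int. \<bar>real g * of_int r - c\<bar> \<le> R}"
  have B: "finite B" "card B \<le> 2 * R / g + 1"
    using card_int_multiples[of R "real g" c] assms(3) g0 by (auto simp: B_def)
  have sub: "f ` P \<subseteq> B"
    by (auto simp: f_def P_def B_def nu(1,2) algebra_simps)
  have fib: "finite {x \<in> P. f x = r} \<and> card {x \<in> P. f x = r} \<le> 2 * A' * g / n + 1" for r
  proof (cases "{x \<in> P. f x = r} = {}")
    case True
    show ?thesis unfolding True using assms(2) by simp
  next
    case False
    then obtain x0 y0 where xy0: "int \<nu> * x0 + int \<nu>' * y0 = r" by (auto simp: f_def)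
    define Tt where "Tt = {t :: int. \<bar>real \<nu> * of_int t - (- of_int y0)\<bar> \<le> A'}"
    have T: "finite Tt" "card Tt \<le> 2 * A' / \<nu> + 1"
      using card_int_multiples[of A' "real \<nu>" "- of_int y0"] assms(2) nu0 by (auto simp: Tt_def)
    have "{x \<in> P. f x = r} \<subseteq> (\<lambda>t. (x0 - int \<nu>' * t, y0 + int \<nu> * t)) ` Tt"
    proof
      fix z assume "z \<in> {x \<in> P. f x = r}"
      then obtain x y where z: "z = (x, y)" "int \<nu> * x + int \<nu>' * y = r" "\<bar>of_int y\<bar> \<le> A'"
        by (auto simp: f_def P_def)
      have eq: "int \<nu> * (x0 - x) = int \<nu>' * (y - y0)" using z(2) xy0 by (simp add: algebra_simps)
      have "int \<nu> dvd int \<nu>' * (y - y0)" by (metis eq dvd_triv_left)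
      hence "int \<nu> dvd y - y0"
        using nu(3) by (simp add: coprime_dvd_mult_right_iff)
      then obtain t where t: "y - y0 = int \<nu> * t" by blast
      have "x0 - x = int \<nu>' * t"
        using eq t nu0 by simp
      hence "z = (x0 - int \<nu>' * t, y0 + int \<nu> * t)" using z(1) t by simp
      moreover have "t \<in> Tt"
      proof -
        have "y = y0 + int \<nu> * t" using t by simp
        thus ?thesis using z(3) by (simp add: Tt_def add.commute)
      qed
      ultimately show "z \<in> (\<lambda>t. (x0 - int \<nu>' * t, y0 + int \<nu> * t)) ` Tt" by blast
    qed
    hence "finite {x \<in> P. f x = r}" "card {x \<in> P. f x = r} \<le> card Tt"
      using T(1) finite_subset finite_imageI apply blast
      using \<open>{x \<in> P. f x = r} \<subseteq> _\<close> T(1) surj_card_le by blast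
    moreover have "2 * A' / \<nu> = 2 * A' * g / n" using nu(1) g0 by simp
    ultimately show ?thesis using T(2) by (smt (verit) of_nat_mono)
  qed
  have "finite P \<and> card P \<le> card B * (2 * A' * g / n + 1)"
    using card_fibres_le_const[OF B(1) sub, of "2 * A' * g / n + 1"] fib assms(2) by simp
  moreover have "card B * (2 * A' * g / n + 1) \<le> (2 * R / g + 1) * (2 * A' * g / n + 1)"
    using B(2) assms(2) by (intro mult_right_mono) auto
  ultimately show "finite P" "card P \<le> (2 * R / g + 1) * (2 * A' * g / n + 1)"
    by (blast intro: order_trans)+
qed

lemma card_pairs_of_functions:
  fixes Q :: "'n::finite \<Rightarrow> ('a \<times> 'b) set"
  assumes "\<And>j. finite (Q j)"
  shows "finite {(h, h'). \<forall>j. (h j, h' j) \<in> Q j}"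
    "card {(h, h'). \<forall>j. (h j, h' j) \<in> Q j} = (\<Prod>j\<in>UNIV. card (Q j))"
proof -
  have bij: "bij_betw (\<lambda>f. (\<lambda>j. fst (f j), \<lambda>j. snd (f j))) (PiE UNIV Q) {(h, h'). \<forall>j. (h j, h' j) \<in> Q j}"
    by (rule bij_betw_byWitness[where f' = "\<lambda>(h, h') j. (h j, h' j)"]) (auto simp: PiE_UNIV_domain)
  have "finite (PiE UNIV Q)" using assms by (intro finite_PiE) auto
  thus "finite {(h, h'). \<forall>j. (h j, h' j) \<in> Q j}" using bij_betw_finite[OF bij] by simp
  show "card {(h, h'). \<forall>j. (h j, h' j) \<in> Q j} = (\<Prod>j\<in>UNIV. card (Q j))"
    using bij_betw_same_card[OF bij] by (simp add: card_PiE)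
qed

lemma card_functions:
  fixes Q :: "'n::finite \<Rightarrow> 'a set"
  assumes "\<And>j. finite (Q j)"
  shows "finite {h. \<forall>j. h j \<in> Q j}" "card {h. \<forall>j. h j \<in> Q j} = (\<Prod>j\<in>UNIV. card (Q j))"
proof -
  have eq: "{h. \<forall>j. h j \<in> Q j} = PiE UNIV Q" by (auto simp: PiE_UNIV_domain)
  show "finite {h. \<forall>j. h j \<in> Q j}" unfolding eq using assms by (intro finite_PiE) auto
  show "card {h. \<forall>j. h j \<in> Q j} = (\<Prod>j\<in>UNIV. card (Q j))" unfolding eq by (simp add: card_PiE)
qed

text \<open>Siegel's lemma in three variables, by the pigeonhole principle: the box {0..m}^3 has (m
  + 1)^3 points and the form takes at most 6 m Z + 1 values on it, so some m of order sqrt Z forces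
  a collision, and the difference of two colliding points is orthogonal to (x, y, z).\<close>

lemma small_orthogonal_integer_vector:
  fixes x y z :: int and Z :: real
  assumes "1 \<le> Z" "\<bar>of_int x\<bar> \<le> Z" "\<bar>of_int y\<bar> \<le> Z" "\<bar>of_int z\<bar> \<le> Z"
  obtains u v w :: int where "(u, v, w) \<noteq> (0, 0, 0)" "u * x + v * y + w * z = 0"
    "\<bar>of_int u\<bar> \<le> 4 * sqrt Z" "\<bar>of_int v\<bar> \<le> 4 * sqrt Z" "\<bar>of_int w\<bar> \<le> 4 * sqrt Z"
proof -
  \<comment> \<open>This makes m^2 \<ge> 6 Z + 1, from which (m + 1)^3 > 6 m Z + 1 follows, while m
    \<le> 4 sqrt Z.\<close>
  define m where "m = nat \<lceil>sqrt (6 * Z + 1)\<rceil>"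
  have sq1: "sqrt (6 * Z + 1) \<ge> 1" using assms(1) by simp
  hence m1: "sqrt (6 * Z + 1) \<le> m" "real m \<le> sqrt (6 * Z + 1) + 1" "m \<ge> 1"
    unfolding m_def by linarith+
  have sZ: "sqrt Z \<ge> 1" using assms(1) by simp
  have "sqrt (6 * Z + 1) \<le> 3 * sqrt Z"
    by (rule real_le_lsqrt) (use assms(1) in \<open>auto simp: power_mult_distrib\<close>)
  hence m4: "real m \<le> 4 * sqrt Z" using m1 sZ by linarith
  have "6 * Z + 1 \<le> (real m)\<^sup>2" using m1(1) assms(1) by (simp add: sqrt_le_D)
  hence big: "(real m + 1) ^ 3 > 6 * real m * Z + 1"
  proof -
    have "(real m + 1) ^ 3 = (real m)\<^sup>2 * real m + 3 * (real m)\<^sup>2 + 3 * real m + 1"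
      by (simp add: power3_eq_cube power2_eq_square algebra_simps)
    moreover have "(6 * Z + 1) * real m \<le> (real m)\<^sup>2 * real m"
      using \<open>6 * Z + 1 \<le> (real m)\<^sup>2\<close> by (intro mult_right_mono) auto
    moreover have "(6 * Z + 1) * real m = 6 * real m * Z + real m" by (simp add: algebra_simps)
    moreover have "(real m)\<^sup>2 \<ge> 0" "real m \<ge> 1" using m1(3) by auto
    ultimately show ?thesis by linarith
  qed
  define D where "D = {0..int m} \<times> {0..int m} \<times> {0..int m}"
  define F where "F = (\<lambda>(u, v, w). u * x + v * y + w * z)"
  define V where "V = {r :: int. \<bar>of_int r - (0::real)\<bar> \<le> 3 * m * Z}"
  have V: "finite V" "card V \<le> 6 * m * Z + 1"
    using card_int_interval[of "3 * m * Z" 0] assms(1) by (auto simp: V_def algebra_simps)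
  have sub: "F ` D \<subseteq> V"
  proof
    fix r assume "r \<in> F ` D"
    then obtain u v w where uvw: "0 \<le> u" "u \<le> int m" "0 \<le> v" "v \<le> int m" "0 \<le> w" "w \<le> int m"
      "r = u * x + v * y + w * z" by (auto simp: D_def F_def)
    have b: "\<bar>of_int (t * s) :: real\<bar> \<le> m * Z" if "0 \<le> t" "t \<le> int m" "\<bar>of_int s\<bar> \<le> Z" for s t :: int
      using that by (simp add: abs_mult) (intro mult_mono, auto)
    have "\<bar>of_int r :: real\<bar> \<le> \<bar>of_int (u * x)\<bar> + \<bar>of_int (v * y)\<bar> + \<bar>of_int (w * z)\<bar>"
      unfolding uvw(7) by simp
    also have "\<dots> \<le> 3 * m * Z" using b[of u x] b[of v y] b[of w z] uvw assms by linarith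
    finally show "r \<in> V" by (simp add: V_def)
  qed
  have "card {0..int m} = m + 1" by simp
  hence "card D = (m + 1) * ((m + 1) * (m + 1))" unfolding D_def card_cartesian_product by presburger
  hence cD: "real (card D) = (real m + 1) ^ 3" by (simp add: power3_eq_cube algebra_simps)
  have "card (F ` D) \<le> card V" using V(1) sub by (rule card_mono)
  hence "real (card (F ` D)) < real (card D)" using V(2) big cD by linarith
  hence "\<not> inj_on F D" using card_image by fastforce
  then obtain a b where ab: "a \<in> D" "b \<in> D" "a \<noteq> b" "F a = F b"
    unfolding inj_on_def by blast
  obtain u v w u' v' w' where e: "a = (u, v, w)" "b = (u', v', w')" by (metis prod_cases3)
  have r: "0 \<le> u" "u \<le> m" "0 \<le> v" "v \<le> m" "0 \<le> w" "w \<le> m"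
    "0 \<le> u'" "u' \<le> m" "0 \<le> v'" "v' \<le> m" "0 \<le> w'" "w' \<le> m"
    using ab(1,2) by (auto simp: D_def e)
  have b: "\<bar>of_int (s - t) :: real\<bar> \<le> 4 * sqrt Z" if "0 \<le> t" "t \<le> int m" "0 \<le> s" "s \<le> int m" for s t :: int
  proof -
    have "\<bar>s - t\<bar> \<le> int m" using that by linarith
    hence "\<bar>of_int (s - t) :: real\<bar> \<le> real m" by linarith
    thus ?thesis using m4 by linarith
  qed
  show thesis
  proof (rule that[of "u - u'" "v - v'" "w - w'"])
    show "(u - u') * x + (v - v') * y + (w - w') * z = 0" using ab(4) by (simp add: e F_def algebra_simps)
  qed (use ab(3) b r in \<open>auto simp: e\<close>)
qed

text \<open>\<open>dioph\<close> is what a dual exponent of (\<alpha>_i, \<alpha>_j) below \<omega>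
  provides, with one constant \<open>c\<close> for all pairs of coordinates and an integer u in
  place of the nearest integer. Any M \<ge> 1 bounding the coefficients is allowed, so that M can be
  chosen freely later.\<close>

locale diophantine_direction =
  fixes \<alpha> :: "'n::finite \<Rightarrow> real" and i\<^sub>0 :: 'n and \<omega> c a :: real
  assumes alpha_i0: "\<alpha> i\<^sub>0 = 1" and alpha_le: "\<bar>\<alpha> j\<bar> \<le> a" and card3: "CARD('n) \<ge> 3"
    and omega_nonneg: "0 \<le> \<omega>" and c_pos: "0 < c"
    and dioph: "\<And>i j (u :: int) (v :: int) (w :: int) M. i \<noteq> i\<^sub>0 \<Longrightarrow> j \<noteq> i\<^sub>0 \<Longrightarrow> i \<noteq> j \<Longrightarrow> 1 \<le> M \<Longrightarrow>
      \<bar>of_int u\<bar> \<le> M \<Longrightarrow> \<bar>of_int v\<bar> \<le> M \<Longrightarrow> \<bar>of_int w\<bar> \<le> M \<Longrightarrow> (u, v, w) \<noteq> (0, 0, 0) \<Longrightarrow>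
      c * M powr (- \<omega>) \<le> \<bar>of_int u + of_int v * \<alpha> i + of_int w * \<alpha> j\<bar>"
begin

text \<open>Distance from the line spanned by \<alpha>, measured against the point of the line with
  the same coordinate \<open>i\<^sub>0\<close>; such a point exists because \<alpha> is 1
  there.\<close>

definition near :: "real \<Rightarrow> ('n \<Rightarrow> int) \<Rightarrow> bool" where
  "near R \<xi> \<longleftrightarrow> (\<forall>j. \<bar>of_int (\<xi> j) - \<alpha> j * of_int (\<xi> i\<^sub>0)\<bar> \<le> R)"

text \<open>Linear dependence in the form that all 2 x 2 minors vanish.\<close>

definition parallel :: "('n \<Rightarrow> int) \<Rightarrow> ('n \<Rightarrow> int) \<Rightarrow> bool" where
  "parallel h h' \<longleftrightarrow> (\<forall>i j. h i * h' j = h j * h' i)"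

text \<open>Requiring n h + n' h' to be non-zero removes the pairs whose product of exponentials is
  constant: these have the same integral against both measures and cancel.\<close>

definition sol :: "nat \<Rightarrow> nat \<Rightarrow> real \<Rightarrow> real \<Rightarrow> real \<Rightarrow> (('n \<Rightarrow> int) \<times> ('n \<Rightarrow> int)) set" where
  "sol n n' A A' R = {(h, h'). (\<forall>j. \<bar>of_int (h j)\<bar> \<le> A) \<and> (\<forall>j. \<bar>of_int (h' j)\<bar> \<le> A') \<and>
     (\<exists>j. h j \<noteq> 0) \<and> (\<exists>j. h' j \<noteq> 0) \<and> (\<exists>j. int n * h j + int n' * h' j \<noteq> 0) \<and>
     near R (\<lambda>j. int n * h j + int n' * h' j)}"

text \<open>Passes from the coordinate \<open>i\<^sub>0\<close> to an arbitrary one: 2 a / c from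
  the bound for \<open>i\<^sub>0\<close> scaled by a, and 1 for the additive term R of
  \<open>near_coordinate_le\<close>.\<close>

definition \<kappa> :: real where "\<kappa> = 2 * a / c + 1"

lemma a_ge_1: "1 \<le> a"
  using alpha_le[of i\<^sub>0] alpha_i0 by simp

lemma kappa_ge_1: "1 \<le> \<kappa>"
  using a_ge_1 c_pos by (simp add: \<kappa>_def)

lemma exists_other: "\<exists>j. j \<noteq> x \<and> j \<noteq> (y :: 'n)"
proof (rule ccontr)
  assume "\<not> ?thesis"
  hence "(UNIV :: 'n set) \<subseteq> {x, y}" by auto
  hence "CARD('n) \<le> card {x, y}" by (intro card_mono) auto
  also have "\<dots> \<le> 2" by (simp add: card_insert_if)
  finally show False using card3 by simp
qed

text \<open>Let L = u + v \<alpha>_i + w \<alpha>_j. Orthogonality turns L times the coordinate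
  \<open>i\<^sub>0\<close> of \<xi> into a combination of the deviations of \<xi> from the line,
  hence into something of size at most 2 M R, and \<open>dioph\<close> bounds |L| from
  below.\<close>

lemma near_orthogonal_bound:
  assumes "near R \<xi>" "i \<noteq> i\<^sub>0" "j \<noteq> i\<^sub>0" "i \<noteq> j" "1 \<le> M"
    and "\<bar>of_int u\<bar> \<le> M" "\<bar>of_int v\<bar> \<le> M" "\<bar>of_int w\<bar> \<le> M" "(u, v, w) \<noteq> (0, 0, 0)"
    and "u * \<xi> i\<^sub>0 + v * \<xi> i + w * \<xi> j = 0"
  shows "\<bar>of_int (\<xi> i\<^sub>0)\<bar> \<le> 2 / c * R * M powr (1 + \<omega>)"
proof -
  define L where "L = of_int u + of_int v * \<alpha> i + of_int w * \<alpha> j"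
  have n: "\<bar>of_int (\<xi> i) - \<alpha> i * of_int (\<xi> i\<^sub>0)\<bar> \<le> R" "\<bar>of_int (\<xi> j) - \<alpha> j * of_int (\<xi> i\<^sub>0)\<bar> \<le> R"
    using assms(1) by (auto simp: near_def)
  have "of_int (u * \<xi> i\<^sub>0 + v * \<xi> i + w * \<xi> j) = (0 :: real)" using assms(10) by simp
  hence "L * of_int (\<xi> i\<^sub>0) = - (of_int v * (of_int (\<xi> i) - \<alpha> i * of_int (\<xi> i\<^sub>0))
      + of_int w * (of_int (\<xi> j) - \<alpha> j * of_int (\<xi> i\<^sub>0)))"
    by (simp add: L_def algebra_simps)
  hence "\<bar>L * of_int (\<xi> i\<^sub>0)\<bar> = \<bar>of_int v * (of_int (\<xi> i) - \<alpha> i * of_int (\<xi> i\<^sub>0))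
      + of_int w * (of_int (\<xi> j) - \<alpha> j * of_int (\<xi> i\<^sub>0))\<bar>"
    by (simp only: abs_minus_cancel)
  hence "\<bar>L\<bar> * \<bar>of_int (\<xi> i\<^sub>0)\<bar> \<le> \<bar>of_int v * (of_int (\<xi> i) - \<alpha> i * of_int (\<xi> i\<^sub>0))\<bar>
      + \<bar>of_int w * (of_int (\<xi> j) - \<alpha> j * of_int (\<xi> i\<^sub>0))\<bar>"
    unfolding abs_mult[of L] by (metis abs_triangle_ineq)
  also have "\<dots> \<le> M * R + M * R"
    unfolding abs_mult using assms(5-8) n by (intro add_mono mult_mono) auto
  finally have 1: "\<bar>L\<bar> * \<bar>of_int (\<xi> i\<^sub>0)\<bar> \<le> 2 * M * R" by simp
  have 2: "c * M powr (- \<omega>) \<le> \<bar>L\<bar>"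
    unfolding L_def using assms by (intro dioph) auto
  have "c * M powr (- \<omega>) * \<bar>of_int (\<xi> i\<^sub>0)\<bar> \<le> 2 * M * R"
    using mult_right_mono[OF 2, of "\<bar>of_int (\<xi> i\<^sub>0)\<bar>"] 1 by simp
  hence "M powr \<omega> * (c * M powr (- \<omega>) * \<bar>of_int (\<xi> i\<^sub>0)\<bar>) \<le> M powr \<omega> * (2 * M * R)"
    by (intro mult_left_mono) auto
  moreover have "M powr \<omega> * (c * M powr (- \<omega>) * \<bar>of_int (\<xi> i\<^sub>0)\<bar>) = c * \<bar>of_int (\<xi> i\<^sub>0)\<bar>"
    using assms(5) by (simp add: powr_minus field_simps)
  moreover have "M powr \<omega> * (2 * M * R) = 2 * R * M powr (1 + \<omega>)"
    using assms(5) by (simp add: powr_add)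
  ultimately have "c * \<bar>of_int (\<xi> i\<^sub>0)\<bar> \<le> 2 * R * M powr (1 + \<omega>)" by simp
  thus ?thesis using c_pos by (simp add: field_simps)
qed

lemma near_coordinate_le: "near R \<xi> \<Longrightarrow> \<bar>of_int (\<xi> j)\<bar> \<le> a * \<bar>of_int (\<xi> i\<^sub>0)\<bar> + R"
proof -
  assume "near R \<xi>"
  hence "\<bar>of_int (\<xi> j) - \<alpha> j * of_int (\<xi> i\<^sub>0)\<bar> \<le> R" by (auto simp: near_def)
  moreover have "\<bar>\<alpha> j * of_int (\<xi> i\<^sub>0)\<bar> \<le> a * \<bar>of_int (\<xi> i\<^sub>0)\<bar>"
    unfolding abs_mult by (intro mult_right_mono alpha_le) auto
  ultimately show ?thesis by linarith
qed

lemma near_orthogonal_bound_all: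
  assumes "near R \<xi>" "0 \<le> R" "i \<noteq> i\<^sub>0" "j \<noteq> i\<^sub>0" "i \<noteq> j" "1 \<le> M"
    and "\<bar>of_int u\<bar> \<le> M" "\<bar>of_int v\<bar> \<le> M" "\<bar>of_int w\<bar> \<le> M" "(u, v, w) \<noteq> (0, 0, 0)"
    and "u * \<xi> i\<^sub>0 + v * \<xi> i + w * \<xi> j = 0"
  shows "\<bar>of_int (\<xi> l)\<bar> \<le> \<kappa> * R * M powr (1 + \<omega>)"
proof -
  have "\<bar>of_int (\<xi> l)\<bar> \<le> a * \<bar>of_int (\<xi> i\<^sub>0)\<bar> + R" by (rule near_coordinate_le) fact
  also have "\<dots> \<le> a * (2 / c * R * M powr (1 + \<omega>)) + R * M powr (1 + \<omega>)"
    using near_orthogonal_bound[OF assms(1,3-)] a_ge_1 assms(2,6) omega_nonneg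
    by (intro add_mono mult_left_mono) (auto intro!: mult_right_le_one_le mult_le_cancel_left1[THEN iffD2] ge_one_powr_ge_zero)
  also have "\<dots> = \<kappa> * R * M powr (1 + \<omega>)" by (simp add: \<kappa>_def algebra_simps)
  finally show ?thesis .
qed

text \<open>Once the coordinates at \<open>i\<^sub>0\<close> are fixed, every other coordinate of n
  h + n' h' lies within R of a prescribed number, so each of the k - 1 remaining coordinate pairs is
  counted by \<open>card_linear_form_pairs\<close>.\<close>

lemma card_near_pairs:
  fixes n n' :: nat
  assumes "0 < n" "0 \<le> A'" "0 \<le> R" "finite B"
  defines "g \<equiv> gcd n n'"
  defines "S \<equiv> {(h, h'). (h i\<^sub>0, h' i\<^sub>0) \<in> B \<and> (\<forall>j. \<bar>of_int (h' j)\<bar> \<le> A') \<and> near R (\<lambda>j. int n * h j + int n' * h' j)}"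
  shows "finite S" "card S \<le> card B * ((2 * R / g + 1) * (2 * A' * g / n + 1)) ^ (CARD('n) - 1)"
proof -
  define b where "b = (2 * R / g + 1) * (2 * A' * g / n + 1)"
  have b0: "0 \<le> b" using assms(2,3) by (simp add: b_def)
  have fib: "finite {z \<in> S. (\<lambda>(h, h'). (h i\<^sub>0, h' i\<^sub>0)) z = y} \<and>
     card {z \<in> S. (\<lambda>(h, h'). (h i\<^sub>0, h' i\<^sub>0)) z = y} \<le> b ^ (CARD('n) - 1)" for y
  proof -
    obtain x\<^sub>0 y\<^sub>0 where y: "y = (x\<^sub>0, y\<^sub>0)" by force
    define P where "P = (\<lambda>c. {(x :: int, y :: int). \<bar>of_int y\<bar> \<le> A' \<and> \<bar>of_int (int n * x + int n' * y) - c\<bar> \<le> R})"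
    define Q where "Q = (\<lambda>j. if j = i\<^sub>0 then {(x\<^sub>0, y\<^sub>0)} else P (\<alpha> j * of_int (int n * x\<^sub>0 + int n' * y\<^sub>0)))"
    have P: "finite (P c)" "card (P c) \<le> b" for c
      using card_linear_form_pairs[OF assms(1-3), of n' c] unfolding P_def b_def g_def by auto
    have Qfin: "finite (Q j)" for j using P by (simp add: Q_def)
    have sub: "{z \<in> S. (\<lambda>(h, h'). (h i\<^sub>0, h' i\<^sub>0)) z = y} \<subseteq> {(h, h'). \<forall>j. (h j, h' j) \<in> Q j}"
      by (auto simp: S_def Q_def P_def y near_def)
    have "real (\<Prod>j\<in>UNIV. card (Q j)) = (\<Prod>j\<in>UNIV. real (card (Q j)))" by simp
    also have "\<dots> \<le> (\<Prod>j\<in>UNIV. if j = i\<^sub>0 then 1 else b)"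
      using P(2) by (intro prod_mono) (auto simp: Q_def)
    also have "\<dots> = (\<Prod>j\<in>UNIV - {i\<^sub>0}. b)"
      by (simp add: prod.remove[of UNIV i\<^sub>0])
    also have "\<dots> = b ^ (CARD('n) - 1)" by simp
    finally have le: "real (\<Prod>j\<in>UNIV. card (Q j)) \<le> b ^ (CARD('n) - 1)" .
    note cp = card_pairs_of_functions[of Q, OF Qfin]
    have "card {z \<in> S. (\<lambda>(h, h'). (h i\<^sub>0, h' i\<^sub>0)) z = y} \<le> (\<Prod>j\<in>UNIV. card (Q j))"
      using card_mono[OF cp(1) sub] cp(2) by simp
    hence "real (card {z \<in> S. (\<lambda>(h, h'). (h i\<^sub>0, h' i\<^sub>0)) z = y}) \<le> b ^ (CARD('n) - 1)"
      using le by (meson of_nat_mono order_trans)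
    thus ?thesis using finite_subset[OF sub cp(1)] by blast
  qed
  have im: "(\<lambda>(h, h'). (h i\<^sub>0, h' i\<^sub>0)) ` S \<subseteq> B" by (auto simp: S_def)
  show "finite S" "card S \<le> card B * ((2 * R / g + 1) * (2 * A' * g / n + 1)) ^ (CARD('n) - 1)"
    using card_fibres_le_const[OF assms(4) im, of "b ^ (CARD('n) - 1)"] fib b0 unfolding b_def by auto
qed

text \<open>Fixing y first and solving for x gives a factor X / n where
  \<open>card_linear_form_pairs\<close> would give X / gcd; this is the better order when the gcd is
  small.\<close>

lemma card_bounded_linear_form:
  fixes n n' :: nat
  assumes "0 < n" "0 \<le> A'" "0 \<le> X"
  defines "B \<equiv> {(x :: int, y :: int). \<bar>of_int y\<bar> \<le> A' \<and> \<bar>of_int (int n * x + int n' * y)\<bar> \<le> X}"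
  shows "finite B" "card B \<le> (2 * A' + 1) * (2 * X / n + 1)"
proof -
  define Y where "Y = {y :: int. \<bar>of_int y - 0\<bar> \<le> A'}"
  have Y: "finite Y" "card Y \<le> 2 * A' + 1" using card_int_interval[OF assms(2), of 0] by (auto simp: Y_def)
  have im: "snd ` B \<subseteq> Y" by (auto simp: B_def Y_def)
  have fib: "finite {z \<in> B. snd z = y} \<and> card {z \<in> B. snd z = y} \<le> 2 * X / n + 1" for y
  proof -
    define F where "F = {x :: int. \<bar>real n * of_int x - (- of_int (int n' * y))\<bar> \<le> X}"
    have F: "finite F" "card F \<le> 2 * X / n + 1"
      using card_int_multiples[OF assms(3), of "real n" "- of_int (int n' * y)"] assms(1) by (auto simp: F_def)
    have "{z \<in> B. snd z = y} \<subseteq> (\<lambda>x. (x, y)) ` F" by (auto simp: B_def F_def)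
    hence "finite {z \<in> B. snd z = y}" "card {z \<in> B. snd z = y} \<le> card F"
      using F(1) finite_subset finite_imageI apply blast
      using \<open>{z \<in> B. snd z = y} \<subseteq> _\<close> F(1) surj_card_le by blast
    thus ?thesis using F(2) by linarith
  qed
  have "finite B \<and> card B \<le> card Y * (2 * X / n + 1)"
    using card_fibres_le_const[OF Y(1) im, of "2 * X / n + 1"] fib assms(2,3) by auto
  moreover have "card Y * (2 * X / n + 1) \<le> (2 * A' + 1) * (2 * X / n + 1)"
    using Y(2) assms(3) by (intro mult_right_mono) auto
  ultimately show "finite B" "card B \<le> (2 * A' + 1) * (2 * X / n + 1)"
    by (blast intro: order_trans)+
qed

text \<open>The frequency divided by g is an integer vector of size Z \<le> 2 A A', because n \<le>
  A' g. Siegel's lemma yields an orthogonal vector of size about sqrt Z instead of Z, and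
  \<open>near_orthogonal_bound_all\<close> for the undivided frequency gives g Z \<le> const R Z^((1
  + \<omega>)/2), which bounds g.\<close>

lemma gcd_le_of_sol:
  fixes n n' :: nat and A A' R :: real
  assumes "(h, h') \<in> sol n n' A A' R" "0 < n'" "n' \<le> n" "1 \<le> A'" "A' \<le> A" "1 \<le> R"
  defines "g \<equiv> gcd n n'"
  assumes "n \<le> A' * g"
  shows "g \<le> \<kappa> * 4 powr (1 + \<omega>) * R * (2 * (A * A')) powr (\<omega> / 2)"
proof -
  define \<xi> where "\<xi> = (\<lambda>j. int n * h j + int n' * h' j)"
  have g0: "0 < g" using assms(2) by (simp add: g_def)
  have "int g dvd \<xi> j" for j unfolding \<xi>_def g_def by (intro dvd_add dvd_mult2) auto
  hence "\<exists>\<zeta>. \<forall>j. \<xi> j = int g * \<zeta> j" by (intro choice) (auto simp: dvd_def)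
  then obtain \<zeta> where \<zeta>: "\<And>j. \<xi> j = int g * \<zeta> j" by blast
  have hb: "\<bar>of_int (h j)\<bar> \<le> A" "\<bar>of_int (h' j)\<bar> \<le> A'" for j using assms(1) by (auto simp: sol_def)
  have nr: "near R \<xi>" and nz: "\<exists>j. \<xi> j \<noteq> 0" using assms(1) by (auto simp: sol_def \<xi>_def)
  have \<zeta>b: "\<bar>of_int (\<zeta> j)\<bar> \<le> 2 * (A * A')" for j
  proof -
    have "real g * \<bar>of_int (\<zeta> j)\<bar> = \<bar>of_int (\<xi> j)\<bar>" by (simp add: \<zeta> abs_mult)
    also have "\<dots> \<le> \<bar>of_int (int n * h j)\<bar> + \<bar>of_int (int n' * h' j)\<bar>" by (simp add: \<xi>_def)
    also have "\<dots> \<le> real n * A + real n * A"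
      using hb[of j] assms by (intro add_mono) (auto simp: abs_mult intro!: mult_mono order_trans[OF hb(2)])
    also have "\<dots> = 2 * A * real n" by simp
    also have "\<dots> \<le> 2 * A * (A' * g)" using assms by (intro mult_left_mono) auto
    finally have "real g * \<bar>of_int (\<zeta> j)\<bar> \<le> real g * (2 * (A * A'))" by (simp add: algebra_simps)
    thus ?thesis using g0 by simp
  qed
  define Z where "Z = Max (range (\<lambda>j. \<bar>real_of_int (\<zeta> j)\<bar>))"
  have Zj: "\<bar>real_of_int (\<zeta> j)\<bar> \<le> Z" for j by (simp add: Z_def)
  obtain l where l: "Z = \<bar>real_of_int (\<zeta> l)\<bar>"
  proof -
    have "Z \<in> range (\<lambda>j. \<bar>real_of_int (\<zeta> j)\<bar>)" unfolding Z_def by (intro Max_in) auto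
    thus ?thesis using that by auto
  qed
  have Z1: "1 \<le> Z"
  proof -
    from nz obtain j where "\<xi> j \<noteq> 0" by blast
    hence "\<zeta> j \<noteq> 0" by (simp add: \<zeta>)
    hence "1 \<le> \<bar>real_of_int (\<zeta> j)\<bar>" by linarith
    thus ?thesis using Zj[of j] by linarith
  qed
  obtain i where i: "i \<noteq> i\<^sub>0" using exists_other by blast
  obtain j where j: "j \<noteq> i\<^sub>0" "i \<noteq> j" using exists_other by metis
  obtain u v w :: int where uvw: "(u, v, w) \<noteq> (0, 0, 0)" "u * \<zeta> i\<^sub>0 + v * \<zeta> i + w * \<zeta> j = 0"
    "\<bar>of_int u\<bar> \<le> 4 * sqrt Z" "\<bar>of_int v\<bar> \<le> 4 * sqrt Z" "\<bar>of_int w\<bar> \<le> 4 * sqrt Z"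
    using small_orthogonal_integer_vector[OF Z1 Zj[of i\<^sub>0] Zj[of i] Zj[of j]] by blast
  have "u * \<xi> i\<^sub>0 + v * \<xi> i + w * \<xi> j = int g * (u * \<zeta> i\<^sub>0 + v * \<zeta> i + w * \<zeta> j)"
    by (simp add: \<zeta> algebra_simps)
  hence orth: "u * \<xi> i\<^sub>0 + v * \<xi> i + w * \<xi> j = 0" using uvw(2) by simp
  have "1 \<le> sqrt Z" using Z1 by simp
  hence sZ: "1 \<le> 4 * sqrt Z" by linarith
  have "real g * Z = \<bar>of_int (\<xi> l)\<bar>" by (simp add: \<zeta> l abs_mult)
  also have "\<dots> \<le> \<kappa> * R * (4 * sqrt Z) powr (1 + \<omega>)"
    by (rule near_orthogonal_bound_all[OF nr _ i j _ uvw(3-5) uvw(1) orth]) (use assms sZ in auto)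
  also have "(4 * sqrt Z) powr (1 + \<omega>) = 4 powr (1 + \<omega>) * Z powr ((1 + \<omega>) / 2)"
    using Z1 by (simp add: powr_mult powr_half_sqrt[symmetric] powr_powr)
  \<comment> \<open>Deliberately wasteful: after one factor Z is cancelled, the remaining exponent
    must be non-negative for the upper bound on Z to apply, and (\<omega> - 1)/2 need not
    be.\<close>
  also have "Z powr ((1 + \<omega>) / 2) \<le> Z powr (1 + \<omega> / 2)"
    using Z1 omega_nonneg by (intro powr_mono) auto
  also have "\<dots> = Z * Z powr (\<omega> / 2)" using Z1 by (simp add: powr_add)
  also have "Z powr (\<omega> / 2) \<le> (2 * (A * A')) powr (\<omega> / 2)"
    using Z1 l \<zeta>b[of l] omega_nonneg by (intro powr_mono2) auto
  finally have "real g * Z \<le> \<kappa> * R * (4 powr (1 + \<omega>) * (Z * (2 * (A * A')) powr (\<omega> / 2)))"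
    using kappa_ge_1 assms(6) Z1 by (simp add: mult_left_mono)
  also have "\<dots> = (\<kappa> * 4 powr (1 + \<omega>) * R * (2 * (A * A')) powr (\<omega> / 2)) * Z" by (simp add: algebra_simps)
  finally show ?thesis using Z1 by simp
qed

end

section \<open>Linearly independent pairs of frequencies\<close>

context diophantine_direction
begin

lemma finite_sol: "finite (sol n n' A A' R)"
proof -
  have f: "finite {h :: 'n \<Rightarrow> int. \<forall>j. h j \<in> {z. \<bar>real_of_int z\<bar> \<le> X}}" for X :: real
  proof (rule card_functions(1))
    show "finite {z. \<bar>real_of_int z\<bar> \<le> X}"
      using card_int_interval(1)[of "max 0 X" 0] by (rule rev_finite_subset) auto
  qed
  have "sol n n' A A' R \<subseteq> {h. \<forall>j. h j \<in> {z. \<bar>real_of_int z\<bar> \<le> A}} \<times> {h. \<forall>j. h j \<in> {z. \<bar>real_of_int z\<bar> \<le> A'}}"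
    by (auto simp: sol_def)
  thus ?thesis using f[of A] f[of A'] finite_subset finite_cartesian_product by blast
qed

text \<open>The minors W of (h, h') on the coordinates \<open>i\<^sub>0\<close>, i, j form the cross
  product of the projections, which is orthogonal to the projection of \<xi> = n h + n' h'. The
  second bound comes from n W_pq = \<xi>_p h'_q - \<xi>_q h'_p for the largest minor M = |W_pq|: one
  factor M cancels, so independent solutions exist only for bounded n.\<close>

lemma nonparallel_bounds:
  fixes A A' R :: real
  assumes "(h, h') \<in> sol n n' A A' R" "\<not> parallel h h'" "0 < n'" "n' \<le> n" "1 \<le> A'" "A' \<le> A" "1 \<le> R"
  shows "\<bar>of_int (int n * h l + int n' * h' l)\<bar> \<le> \<kappa> * R * (2 * (A * A')) powr (1 + \<omega>)"
    and "n \<le> 2 * \<kappa> * R * (2 * (A * A')) powr \<omega> * A'"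
proof -
  define \<xi> where "\<xi> = (\<lambda>j. int n * h j + int n' * h' j)"
  have hb: "\<bar>of_int (h j)\<bar> \<le> A" "\<bar>of_int (h' j)\<bar> \<le> A'" for j using assms(1) by (auto simp: sol_def)
  have nr: "near R \<xi>" using assms(1) by (auto simp: sol_def \<xi>_def)
  define W where "W = (\<lambda>i j. h i * h' j - h j * h' i)"
  \<comment> \<open>A non-zero minor may or may not involve \<open>i\<^sub>0\<close>; in either case
    k \<ge> 3 allows its indices to be completed to a triple of distinct coordinates containing
    \<open>i\<^sub>0\<close>.\<close>
  obtain i j where ij: "i \<noteq> i\<^sub>0" "j \<noteq> i\<^sub>0" "i \<noteq> j" "W i j \<noteq> 0 \<or> W j i\<^sub>0 \<noteq> 0 \<or> W i\<^sub>0 i \<noteq> 0"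
  proof -
    obtain p q where pq: "W p q \<noteq> 0" using assms(2) by (auto simp: parallel_def W_def)
    have anti: "W q p \<noteq> 0" "p \<noteq> q" using pq by (auto simp: W_def algebra_simps)
    show thesis
    proof (cases "p = i\<^sub>0")
      case True
      obtain r where "r \<noteq> i\<^sub>0" "r \<noteq> q" using exists_other by blast
      thus ?thesis using that[of q r] pq anti True by auto
    next
      case False
      show ?thesis
      proof (cases "q = i\<^sub>0")
        case True
        obtain r where "r \<noteq> i\<^sub>0" "r \<noteq> p" using exists_other by blast
        thus ?thesis using that[of p r] pq anti True False by auto
      qed (use that[of p q] pq anti False in auto)
    qed
  qed
  define u v w where "u = W i j" and "v = W j i\<^sub>0" and "w = W i\<^sub>0 i"
  have orth: "u * \<xi> i\<^sub>0 + v * \<xi> i + w * \<xi> j = 0"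
    by (simp add: u_def v_def w_def W_def \<xi>_def algebra_simps)
  have Wn: "int n * W p q = \<xi> p * h' q - \<xi> q * h' p" for p q
    by (simp add: W_def \<xi>_def algebra_simps)
  have WA: "\<bar>real_of_int (W p q)\<bar> \<le> 2 * (A * A')" for p q
  proof -
    have "\<bar>real_of_int (W p q)\<bar> \<le> \<bar>of_int (h p * h' q)\<bar> + \<bar>of_int (h q * h' p)\<bar>"
      by (simp add: W_def)
    also have "\<dots> \<le> A * A' + A * A'"
      using hb assms by (intro add_mono) (auto simp: abs_mult intro!: mult_mono)
    finally show ?thesis by simp
  qed
  define M where "M = Max {\<bar>real_of_int u\<bar>, \<bar>real_of_int v\<bar>, \<bar>real_of_int w\<bar>}"
  have Mle: "\<bar>real_of_int u\<bar> \<le> M" "\<bar>real_of_int v\<bar> \<le> M" "\<bar>real_of_int w\<bar> \<le> M"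
    by (auto simp: M_def)
  have nz: "(u, v, w) \<noteq> (0, 0, 0)" using ij(4) by (auto simp: u_def v_def w_def)
  have M1: "1 \<le> M"
  proof -
    have "u \<noteq> 0 \<or> v \<noteq> 0 \<or> w \<noteq> 0" using nz by auto
    hence "1 \<le> \<bar>real_of_int u\<bar> \<or> 1 \<le> \<bar>real_of_int v\<bar> \<or> 1 \<le> \<bar>real_of_int w\<bar>" by linarith
    thus ?thesis using Mle by linarith
  qed
  have "M \<in> {\<bar>real_of_int u\<bar>, \<bar>real_of_int v\<bar>, \<bar>real_of_int w\<bar>}" unfolding M_def by (rule Max_in) auto
  then obtain p q where pq: "M = \<bar>real_of_int (W p q)\<bar>" by (auto simp: u_def v_def w_def)
  have MA: "M \<le> 2 * (A * A')" using WA pq by simp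
  have xi: "\<bar>of_int (\<xi> l)\<bar> \<le> \<kappa> * R * M powr (1 + \<omega>)" for l
    by (rule near_orthogonal_bound_all[OF nr _ ij(1-3) M1 Mle nz orth]) (use assms in auto)
  have "\<bar>of_int (\<xi> l)\<bar> \<le> \<kappa> * R * (2 * (A * A')) powr (1 + \<omega>)"
    using MA M1 omega_nonneg kappa_ge_1 assms(7)
    by (intro order_trans[OF xi]) (auto intro!: mult_left_mono powr_mono2)
  thus "\<bar>of_int (int n * h l + int n' * h' l)\<bar> \<le> \<kappa> * R * (2 * (A * A')) powr (1 + \<omega>)"
    by (simp add: \<xi>_def)
  have "real n * M = \<bar>of_int (int n * W p q)\<bar>" by (simp add: pq abs_mult)
  also have "\<dots> \<le> \<bar>of_int (\<xi> p * h' q)\<bar> + \<bar>of_int (\<xi> q * h' p)\<bar>" unfolding Wn by simp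
  also have "\<dots> \<le> \<kappa> * R * M powr (1 + \<omega>) * A' + \<kappa> * R * M powr (1 + \<omega>) * A'"
    using hb xi kappa_ge_1 assms(5,7) by (intro add_mono) (auto simp: abs_mult intro!: mult_mono)
  also have "\<dots> = (2 * \<kappa> * R * M powr \<omega> * A') * M" using M1 by (simp add: powr_add)
  finally have "real n \<le> 2 * \<kappa> * R * M powr \<omega> * A'" using M1 by simp
  also have "\<dots> \<le> 2 * \<kappa> * R * (2 * (A * A')) powr \<omega> * A'"
    using MA M1 omega_nonneg kappa_ge_1 assms(5,7)
    by (intro mult_right_mono mult_left_mono powr_mono2) auto
  finally show "n \<le> 2 * \<kappa> * R * (2 * (A * A')) powr \<omega> * A'" .
qed

text \<open>Two bounds are multiplied. Counting coordinate by coordinate gives about A A' n', since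
  (A' g / n)^k \<le> A'^k \<le> n' R^k; and n \<le> A' g together with \<open>gcd_le_of_sol\<close>
  bounds n^2 by about (A A')^(1 + \<omega>). In this regime parallel pairs are counted as
  well.\<close>

lemma card_sol_large_gcd:
  fixes n n' :: nat and A A' R :: real
  assumes "0 < n'" "n' \<le> n" "1 \<le> A'" "A' \<le> A" "1 \<le> R" "A' ^ CARD('n) \<le> n' * R ^ CARD('n)"
    and "n \<le> A' * real (gcd n n')"
  shows "card (sol n n' A A' R) \<le> 5 * 9 ^ CARD('n) * \<kappa>\<^sup>2 * 16 powr (1 + \<omega>) * 2 powr \<omega> *
    R ^ (2 * CARD('n) + 2) * (A * A') powr (2 + \<omega>) * (n' / (real n)\<^sup>2)"
proof (cases "sol n n' A A' R = {}")
  case True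
  show ?thesis unfolding True using kappa_ge_1 assms by simp
next
  case False
  let ?k = "CARD('n)"
  define g where "g = gcd n n'"
  have g: "0 < g" "g \<le> n" "g \<le> n'" using assms(1,2) by (auto simp: g_def intro: gcd_le1_nat gcd_le2_nat)
  have n0: "0 < n" using assms by simp
  have nAg: "real n \<le> A' * g" using assms(7) by (simp add: g_def)
  define B where "B = {(x :: int, y :: int). \<bar>of_int y\<bar> \<le> A' \<and> \<bar>of_int (int n * x + int n' * y) - 0\<bar> \<le> n * A + n' * A'}"
  define r m where "r = 2 * R / g + 1" and "m = 2 * A' * g / n + 1"
  have A0: "0 \<le> n * A + n' * A'" using assms by simp
  have "card B \<le> (2 * (n * A + n' * A') / g + 1) * (2 * A' * g / n + 1)" "finite B"
    using card_linear_form_pairs[OF n0 _ A0, of A' n' 0] assms(3) unfolding B_def g_def by auto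
  hence B: "card B \<le> (2 * (n * A + n' * A') / g + 1) * m" "finite B" by (auto simp: m_def)
  define S where "S = {(h, h'). (h i\<^sub>0, h' i\<^sub>0) \<in> B \<and> (\<forall>j. \<bar>of_int (h' j)\<bar> \<le> A') \<and> near R (\<lambda>j. int n * h j + int n' * h' j)}"
  have S: "finite S" "card S \<le> card B * (r * m) ^ (?k - 1)"
    using card_near_pairs[OF n0 _ _ B(2), of A' R n'] assms(3,5) unfolding S_def r_def m_def g_def by auto
  have sub: "sol n n' A A' R \<subseteq> S"
  proof
    fix z assume z: "z \<in> sol n n' A A' R"
    obtain h h' where zz: "z = (h, h')" by force
    have hb: "\<bar>of_int (h j)\<bar> \<le> A" "\<bar>of_int (h' j)\<bar> \<le> A'" for j using z by (auto simp: sol_def zz)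
    have "\<bar>real_of_int (int n * h i\<^sub>0 + int n' * h' i\<^sub>0)\<bar> \<le> \<bar>of_int (int n * h i\<^sub>0)\<bar> + \<bar>of_int (int n' * h' i\<^sub>0)\<bar>" by simp
    also have "\<dots> \<le> n * A + n' * A'"
      unfolding of_int_mult abs_mult using hb by (intro add_mono mult_mono) auto
    finally show "z \<in> S" using z hb by (auto simp: sol_def zz S_def B_def)
  qed
  have ge1: "1 \<le> A * A'" using assms mult_mono[of 1 A 1 A'] by simp
  have r1: "2 * (n * A + n' * A') / g + 1 \<le> 5 * (A * A')"
  proof -
    have "n' * A' \<le> n * A" using assms by (intro mult_mono) auto
    moreover have "n * A \<le> (A' * g) * A" using nAg assms by (intro mult_right_mono) auto
    ultimately have "2 * (n * A + n' * A') \<le> 4 * (A * A') * g" by (simp add: algebra_simps)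
    hence "2 * (n * A + n' * A') / g \<le> 4 * (A * A')" using g(1) by (simp add: pos_divide_le_eq)
    thus ?thesis using ge1 by linarith
  qed
  have m0: "0 \<le> m" using assms by (simp add: m_def)
  have rR: "0 \<le> r" "r \<le> 3 * R"
  proof -
    have "R / g \<le> R / 1" using g(1) assms(5) by (intro divide_left_mono) auto
    thus "0 \<le> r" "r \<le> 3 * R" using assms(5) by (auto simp: r_def)
  qed
  have m3: "m \<le> 3 * A' * (g / n)"
  proof -
    have "1 \<le> A' * (g / n)" using nAg n0 by simp
    thus ?thesis by (simp add: m_def)
  qed
  have mk: "m ^ ?k \<le> 3 ^ ?k * (n' * R ^ ?k)"
  proof -
    have "m ^ ?k \<le> (3 * A' * (g / n)) ^ ?k" using m3 m0 by (intro power_mono)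
    also have "\<dots> = 3 ^ ?k * A' ^ ?k * (g / n) ^ ?k" by (simp only: power_mult_distrib)
    also have "\<dots> \<le> 3 ^ ?k * A' ^ ?k * 1"
      using g n0 assms(3) by (intro mult_left_mono power_le_one) auto
    also have "\<dots> \<le> 3 ^ ?k * (n' * R ^ ?k)" using assms(6) by simp
    finally show ?thesis .
  qed
  have k1: "m * (r * m) ^ (?k - 1) \<le> (3 * R) ^ ?k * (3 ^ ?k * (n' * R ^ ?k))"
  proof -
    obtain k' where k': "?k = Suc k'" using card3 by (cases "?k") auto
    have "m * (r * m) ^ (?k - 1) = r ^ (?k - 1) * m ^ ?k"
      by (simp add: k' power_mult_distrib)
    also have "\<dots> \<le> (3 * R) ^ (?k - 1) * (3 ^ ?k * (n' * R ^ ?k))"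
      using rR mk m0 assms(5) by (intro mult_mono power_mono) auto
    also have "\<dots> \<le> (3 * R) ^ ?k * (3 ^ ?k * (n' * R ^ ?k))"
      using assms(5) by (intro mult_right_mono power_increasing) auto
    finally show ?thesis .
  qed
  have "real (card (sol n n' A A' R)) \<le> card S" using card_mono[OF S(1) sub] by simp
  also have "\<dots> \<le> card B * (r * m) ^ (?k - 1)" by (rule S(2))
  also have "\<dots> \<le> ((2 * (n * A + n' * A') / g + 1) * m) * (r * m) ^ (?k - 1)"
    using B(1) rR m0 by (intro mult_right_mono) auto
  also have "\<dots> = (2 * (n * A + n' * A') / g + 1) * (m * (r * m) ^ (?k - 1))" by (simp only: mult.assoc)
  also have "\<dots> \<le> 5 * (A * A') * ((3 * R) ^ ?k * (3 ^ ?k * (n' * R ^ ?k)))"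
    by (rule mult_mono[OF r1 k1]) (use m0 rR ge1 in auto)
  also have "\<dots> = 5 * 9 ^ ?k * R ^ (2 * ?k) * (A * A') * n'"
    by (simp add: power_mult_distrib power_add mult_2 flip: power_mult_distrib[of "3::real" 3, simplified])
  finally have c1: "card (sol n n' A A' R) \<le> 5 * 9 ^ ?k * R ^ (2 * ?k) * (A * A') * n'" .
  obtain h h' where "(h, h') \<in> sol n n' A A' R" using False by auto
  from gcd_le_of_sol[OF this assms(1-5) assms(7)]
  have gG: "real g \<le> \<kappa> * 4 powr (1 + \<omega>) * R * (2 * (A * A')) powr (\<omega> / 2)" (is "_ \<le> ?G") by (simp add: g_def)
  have "real n \<le> A' * ?G" using nAg gG assms(3) by (meson mult_left_mono order_trans zero_le_one)
  hence "(real n)\<^sup>2 \<le> (A' * ?G)\<^sup>2" by (intro power_mono) auto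
  also have "\<dots> = A'\<^sup>2 * (\<kappa>\<^sup>2 * (4 powr (1 + \<omega>))\<^sup>2 * R\<^sup>2 * ((2 * (A * A')) powr (\<omega> / 2))\<^sup>2)"
    by (simp add: power_mult_distrib)
  also have "(4 powr (1 + \<omega>))\<^sup>2 = (16 :: real) powr (1 + \<omega>)"
    by (simp add: power2_eq_square flip: powr_mult)
  also have "((2 * (A * A')) powr (\<omega> / 2))\<^sup>2 = 2 powr \<omega> * (A * A') powr \<omega>"
    using ge1 by (simp add: power2_eq_square flip: powr_add powr_mult)
  also have "A'\<^sup>2 * (\<kappa>\<^sup>2 * 16 powr (1 + \<omega>) * R\<^sup>2 * (2 powr \<omega> * (A * A') powr \<omega>)) \<le>
     (A * A') * (\<kappa>\<^sup>2 * 16 powr (1 + \<omega>) * R\<^sup>2 * (2 powr \<omega> * (A * A') powr \<omega>))"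
    using assms by (intro mult_right_mono) (auto simp: power2_eq_square mult_right_mono)
  finally have n2: "(real n)\<^sup>2 \<le> (A * A') * (\<kappa>\<^sup>2 * 16 powr (1 + \<omega>) * R\<^sup>2 * (2 powr \<omega> * (A * A') powr \<omega>))" (is "_ \<le> ?N") .
  have "card (sol n n' A A' R) * (real n)\<^sup>2 \<le> (5 * 9 ^ ?k * R ^ (2 * ?k) * (A * A') * n') * ?N"
    using c1 n2 assms by (intro mult_mono) auto
  also have "\<dots> = (5 * 9 ^ ?k * \<kappa>\<^sup>2 * 16 powr (1 + \<omega>) * 2 powr \<omega> * R ^ (2 * ?k + 2) * (A * A') powr (2 + \<omega>)) * n'"
    using ge1 by (simp add: powr_add power_add power2_eq_square)
  finally show ?thesis using n0 by (simp add: field_simps)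
qed

text \<open>For A' g \<le> n each of the k - 1 free coordinates costs only a factor 9 R. The base
  coordinate is counted through the upper bound X for the frequency itself, and the second part of
  \<open>nonparallel_bounds\<close> makes 2 X / n at least 1, so that the + 1 in its count does no
  harm.\<close>

lemma card_sol_small_gcd:
  fixes n n' :: nat and A A' R :: real
  assumes "0 < n'" "n' \<le> n" "1 \<le> A'" "A' \<le> A" "1 \<le> R" "A' * real (gcd n n') \<le> n"
  shows "card {(h, h') \<in> sol n n' A A' R. \<not> parallel h h'} \<le>
     12 * \<kappa> * 2 powr (1 + \<omega>) * 9 ^ CARD('n) * R ^ (CARD('n) + 1) * (A * A') powr (2 + \<omega>) / n"
proof (cases "{(h, h') \<in> sol n n' A A' R. \<not> parallel h h'} = {}")
  case True
  show ?thesis unfolding True using kappa_ge_1 assms by simp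
next
  case False
  let ?k = "CARD('n)"
  define g where "g = gcd n n'"
  have g: "0 < g" using assms(1,2) by (auto simp: g_def)
  have n0: "0 < n" using assms by simp
  define X where "X = \<kappa> * R * (2 * (A * A')) powr (1 + \<omega>)"
  have X0: "0 \<le> X" using kappa_ge_1 assms by (simp add: X_def)
  have ge1: "1 \<le> A * A'" using assms mult_mono[of 1 A 1 A'] by simp
  have A'le: "A' \<le> A * A'" using assms mult_right_mono[of 1 A A'] by simp
  define B where "B = {(x :: int, y :: int). \<bar>of_int y\<bar> \<le> A' \<and> \<bar>of_int (int n * x + int n' * y)\<bar> \<le> X}"
  have B: "finite B" "card B \<le> (2 * A' + 1) * (2 * X / n + 1)"
    using card_bounded_linear_form[OF n0 _ X0, of A' n'] assms(3) unfolding B_def by auto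
  define b where "b = (2 * R / g + 1) * (2 * A' * g / n + 1)"
  define S where "S = {(h, h'). (h i\<^sub>0, h' i\<^sub>0) \<in> B \<and> (\<forall>j. \<bar>of_int (h' j)\<bar> \<le> A') \<and> near R (\<lambda>j. int n * h j + int n' * h' j)}"
  have S: "finite S" "card S \<le> card B * b ^ (?k - 1)"
    using card_near_pairs[OF n0 _ _ B(1), of A' R n'] assms(3,5) unfolding S_def b_def g_def by auto
  have sub: "{(h, h') \<in> sol n n' A A' R. \<not> parallel h h'} \<subseteq> S"
    using nonparallel_bounds(1)[OF _ _ assms(1-5)] by (auto simp: S_def B_def X_def sol_def)
  have b9: "0 \<le> b" "b \<le> 9 * R"
  proof -
    have "R / g \<le> R / 1" using g(1) assms(5) by (intro divide_left_mono) auto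
    hence 1: "2 * R / g + 1 \<le> 3 * R" using assms(5) by simp
    have "A' * g / n \<le> 1" using assms(6) n0 by (simp add: g_def)
    hence 2: "2 * A' * g / n + 1 \<le> 3" by simp
    have "b \<le> 3 * R * 3" unfolding b_def using 1 2 assms by (intro mult_mono) auto
    thus "b \<le> 9 * R" by simp
    show "0 \<le> b" using assms by (simp add: b_def)
  qed
  have Xn: "1 \<le> 2 * X / n"
  proof -
    obtain h h' where hh: "(h, h') \<in> sol n n' A A' R" "\<not> parallel h h'" using False by auto
    have "n \<le> 2 * \<kappa> * R * (2 * (A * A')) powr \<omega> * A'"
      using nonparallel_bounds(2)[OF hh assms(1-5)] .
    also have "\<dots> \<le> 2 * \<kappa> * R * (2 * (A * A')) powr \<omega> * (2 * (A * A'))"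
      using A'le kappa_ge_1 assms ge1 by (intro mult_left_mono) auto
    also have "\<dots> = 2 * X" using ge1 by (simp add: X_def powr_add)
    finally show ?thesis using n0 by simp
  qed
  have t1: "2 * A' + 1 \<le> 3 * (A * A')" using A'le ge1 by linarith
  have "4 * X / n = 2 * (2 * X / n)" by simp
  hence t2: "2 * X / n + 1 \<le> 4 * X / n" using Xn by linarith
  have "real (card {(h, h') \<in> sol n n' A A' R. \<not> parallel h h'}) \<le> card S"
    using card_mono[OF S(1) sub] by simp
  also have "\<dots> \<le> card B * b ^ (?k - 1)" by (rule S(2))
  also have "\<dots> \<le> ((2 * A' + 1) * (2 * X / n + 1)) * b ^ (?k - 1)"
    using B(2) b9 by (intro mult_right_mono) auto
  also have "\<dots> \<le> ((3 * (A * A')) * (4 * X / n)) * (9 * R) ^ (?k - 1)"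
    using b9 t1 t2 ge1 X0 assms by (intro mult_mono power_mono) auto
  also have "\<dots> \<le> ((3 * (A * A')) * (4 * X / n)) * (9 * R) ^ ?k"
    using ge1 X0 assms by (intro mult_left_mono power_increasing) auto
  also have "\<dots> = 12 * \<kappa> * 2 powr (1 + \<omega>) * 9 ^ ?k * R ^ (?k + 1) * (A * A') powr (2 + \<omega>) / n"
  proof -
    define P where "P = A * A'"
    have P: "1 \<le> P" "X = \<kappa> * R * (2 * P) powr (1 + \<omega>)" using ge1 by (auto simp: P_def X_def)
    show ?thesis unfolding P_def[symmetric] using P(1)
      by (simp add: P(2) powr_mult power_mult_distrib powr_add power_add power2_eq_square)
  qed
  finally show ?thesis .
qed

text \<open>The savings in the two gcd regimes are n' / n^2 and 1 / n; for n' \<le> n both are at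
  most 1 / sqrt(n n'), the form symmetric in n and n'.\<close>

lemma card_nonparallel:
  "\<exists>C\<ge>0. \<forall>n n' A A' R. 0 < n' \<and> n' \<le> n \<and> 1 \<le> A' \<and> A' \<le> A \<and> 1 \<le> R \<and> A' ^ CARD('n) \<le> n' * R ^ CARD('n) \<longrightarrow>
     card {(h, h') \<in> sol n n' A A' R. \<not> parallel h h'} \<le>
       C * R ^ (2 * CARD('n) + 2) * (A * A') powr (2 + \<omega>) / sqrt (real (n * n'))"
proof -
  let ?k = "CARD('n)"
  define C1 where "C1 = 5 * 9 ^ ?k * \<kappa>\<^sup>2 * 16 powr (1 + \<omega>) * 2 powr \<omega>"
  define C2 where "C2 = 12 * \<kappa> * 2 powr (1 + \<omega>) * 9 ^ ?k"
  have C: "0 \<le> C1" "0 \<le> C2" using kappa_ge_1 by (auto simp: C1_def C2_def)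
  show ?thesis
  proof (intro exI[of _ "C1 + C2"] conjI allI impI)
    fix n n' :: nat and A A' R :: real
    assume H: "0 < n' \<and> n' \<le> n \<and> 1 \<le> A' \<and> A' \<le> A \<and> 1 \<le> R \<and> A' ^ ?k \<le> n' * R ^ ?k"
    hence n0: "0 < n" "0 < n'" by auto
    let ?S = "{(h, h') \<in> sol n n' A A' R. \<not> parallel h h'}"
    let ?P = "(A * A') powr (2 + \<omega>)"
    have s: "sqrt (real (n * n')) \<le> n"
      using H by (intro real_le_lsqrt) (auto simp: power2_eq_square)
    have spos: "0 < sqrt (real (n * n'))" using n0 by simp
    have i1: "1 / n \<le> 1 / sqrt (real (n * n'))" using s spos n0 by (intro divide_left_mono) auto
    have i2: "n' / (real n)\<^sup>2 \<le> 1 / sqrt (real (n * n'))"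
    proof -
      have "n' / (real n)\<^sup>2 \<le> n / (real n)\<^sup>2" using H by (intro divide_right_mono) auto
      also have "\<dots> = 1 / n" using n0 by (simp add: power2_eq_square)
      finally show ?thesis using i1 by linarith
    qed
    show "card ?S \<le> (C1 + C2) * R ^ (2 * ?k + 2) * ?P / sqrt (real (n * n'))"
    proof (cases "n \<le> A' * real (gcd n n')")
      case True
      have "card ?S \<le> card (sol n n' A A' R)" by (intro card_mono finite_sol) auto
      hence "real (card ?S) \<le> card (sol n n' A A' R)" by simp
      also have "\<dots> \<le> C1 * R ^ (2 * ?k + 2) * ?P * (n' / (real n)\<^sup>2)"
        unfolding C1_def by (rule card_sol_large_gcd) (use H True in auto)
      also have "\<dots> \<le> (C1 + C2) * R ^ (2 * ?k + 2) * ?P * (1 / sqrt (real (n * n')))"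
        using C H i2 by (intro mult_mono) auto
      finally show ?thesis by simp
    next
      case False
      have "card ?S \<le> C2 * R ^ (?k + 1) * ?P / n"
        unfolding C2_def by (rule card_sol_small_gcd) (use H False in auto)
      also have "\<dots> = C2 * R ^ (?k + 1) * ?P * (1 / n)" by simp
      also have "\<dots> \<le> (C1 + C2) * R ^ (2 * ?k + 2) * ?P * (1 / sqrt (real (n * n')))"
        using C H i1 by (intro mult_mono power_increasing) auto
      finally show ?thesis by simp
    qed
  qed (use C in auto)
qed

end

section \<open>Parallel pairs of frequencies\<close>

lemma sum_inverse_squares_int_le:
  assumes "finite X"
  shows "(\<Sum>x\<in>X. 1 / (max 1 \<bar>real_of_int x\<bar>)\<^sup>2) \<le> 5"
proof -
  let ?f = "\<lambda>x :: int. 1 / (max 1 \<bar>real_of_int x\<bar>)\<^sup>2"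
  \<comment> \<open>The right-hand side starts at 3 and grows by 2 / (N + 1) - 2 / (N + 2), which
    dominates the two new terms 1 / (N + 2)^2.\<close>
  have ind: "(\<Sum>x\<in>{- int (Suc N)..int (Suc N)}. ?f x) \<le> 5 - 2 / real (Suc N)" for N
  proof (induction N)
    case 0
    have "{- int (Suc 0)..int (Suc 0)} = {-1, 0, 1}" by auto
    thus ?case by simp
  next
    case (Suc N)
    have "{- int (Suc (Suc N))..int (Suc (Suc N))} =
      insert (int (Suc (Suc N))) (insert (- int (Suc (Suc N))) {- int (Suc N)..int (Suc N)})" by auto
    hence "(\<Sum>x\<in>{- int (Suc (Suc N))..int (Suc (Suc N))}. ?f x) =
       2 / (real (Suc (Suc N)))\<^sup>2 + (\<Sum>x\<in>{- int (Suc N)..int (Suc N)}. ?f x)"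
      by (simp add: add_ac)
    also have "\<dots> \<le> 2 / (real (Suc (Suc N)))\<^sup>2 + (5 - 2 / real (Suc N))" using Suc by simp
    also have "\<dots> \<le> 5 - 2 / real (Suc (Suc N))"
    proof -
      have "2 / real (Suc N) - 2 / real (Suc (Suc N)) = 2 / (real (Suc N) * real (Suc (Suc N)))"
        by (simp add: field_simps)
      moreover have "2 / (real (Suc (Suc N)))\<^sup>2 \<le> 2 / (real (Suc N) * real (Suc (Suc N)))"
        unfolding power2_eq_square by (intro divide_left_mono mult_right_mono) auto
      ultimately show ?thesis by linarith
    qed
    finally show ?case .
  qed
  obtain N where N: "X \<subseteq> {- int (Suc N)..int (Suc N)}"
  proof
    show "X \<subseteq> {- int (Suc (nat (\<Sum>x\<in>X. \<bar>x\<bar>)))..int (Suc (nat (\<Sum>x\<in>X. \<bar>x\<bar>)))}"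
    proof
      fix x assume "x \<in> X"
      hence "\<bar>x\<bar> \<le> (\<Sum>x\<in>X. \<bar>x\<bar>)" using assms by (intro member_le_sum) auto
      thus "x \<in> {- int (Suc (nat (\<Sum>x\<in>X. \<bar>x\<bar>)))..int (Suc (nat (\<Sum>x\<in>X. \<bar>x\<bar>)))}" by auto
    qed
  qed
  have "(\<Sum>x\<in>X. ?f x) \<le> (\<Sum>x\<in>{- int (Suc N)..int (Suc N)}. ?f x)"
    using N by (intro sum_mono2) auto
  also have "\<dots> \<le> 5 - 2 / real (Suc N)" by (rule ind)
  also have "\<dots> \<le> 5" by simp
  finally show ?thesis .
qed

context diophantine_direction
begin

text \<open>Data of a parallel pair h = s p, h' = t p. Different triples may describe the same pair;
  for upper bounds it is enough that every parallel pair arises.\<close>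

definition trip :: "real \<Rightarrow> real \<Rightarrow> real \<Rightarrow> (int \<times> int \<times> ('n \<Rightarrow> int)) set" where
  "trip A A' R = {(s, t, p). s \<noteq> 0 \<and> t \<noteq> 0 \<and> (\<exists>j. p j \<noteq> 0) \<and> (\<forall>j. \<bar>of_int (s * p j)\<bar> \<le> A) \<and>
     (\<forall>j. \<bar>of_int (t * p j)\<bar> \<le> A') \<and> near R p}"

lemma near_of_multiple:
  assumes "near R (\<lambda>j. m * p j)" "m \<noteq> 0"
  shows "near R p"
  unfolding near_def
proof
  fix j
  have "1 \<le> \<bar>real_of_int m\<bar>" using assms(2) by linarith
  hence "\<bar>of_int (p j) - \<alpha> j * of_int (p i\<^sub>0)\<bar> \<le> \<bar>real_of_int m\<bar> * \<bar>of_int (p j) - \<alpha> j * of_int (p i\<^sub>0)\<bar>"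
    by (simp add: mult_le_cancel_right1)
  also have "\<dots> = \<bar>of_int (m * p j) - \<alpha> j * of_int (m * p i\<^sub>0)\<bar>"
    by (simp add: abs_mult[symmetric] algebra_simps)
  also have "\<dots> \<le> R" using assms(1) by (auto simp: near_def)
  finally show "\<bar>of_int (p j) - \<alpha> j * of_int (p i\<^sub>0)\<bar> \<le> R" .
qed

text \<open>Dividing one coordinate pair (h_l, h'_l) with h_l non-zero by its gcd gives coprime s,
  t; parallelism becomes s h'_j = t h_j, which forces s to divide every h_j.\<close>

lemma sol_parallel_obtain:
  assumes "(h, h') \<in> sol n n' A A' R" "parallel h h'"
  obtains s t p where "(s, t, p) \<in> trip A A' R" "h = (\<lambda>j. s * p j)" "h' = (\<lambda>j. t * p j)"
    "near R (\<lambda>j. (int n * s + int n' * t) * p j)" "int n * s + int n' * t \<noteq> 0"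
proof -
  have hb: "\<bar>of_int (h j)\<bar> \<le> A" "\<bar>of_int (h' j)\<bar> \<le> A'" for j using assms(1) by (auto simp: sol_def)
  have nr: "near R (\<lambda>j. int n * h j + int n' * h' j)" and nz: "\<exists>j. int n * h j + int n' * h' j \<noteq> 0"
    using assms(1) by (auto simp: sol_def)
  have nz': "\<exists>j. h' j \<noteq> 0" using assms(1) by (auto simp: sol_def)
  obtain l where l: "h l \<noteq> 0" using assms(1) by (auto simp: sol_def)
  define d where "d = gcd (h l) (h' l)"
  have d0: "d \<noteq> 0" using l by (simp add: d_def)
  have "\<exists>s t. h l = s * d \<and> h' l = t * d \<and> coprime s t"
    using d0 unfolding d_def by (intro gcd_coprime_exists)
  then obtain s t where st: "h l = s * d" "h' l = t * d" "coprime s t" by blast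
  have s0: "s \<noteq> 0" using l st by auto
  have eq: "s * h' j = h j * t" for j
  proof -
    have "h l * h' j = h j * h' l" using assms(2) by (auto simp: parallel_def)
    hence "d * (s * h' j) = d * (h j * t)" using st by (simp add: algebra_simps)
    thus ?thesis using d0 by simp
  qed
  have "s dvd h j" for j
  proof -
    have "s dvd h j * t" by (metis eq dvd_triv_left)
    thus ?thesis using st(3) by (simp add: coprime_dvd_mult_left_iff)
  qed
  hence "\<exists>p. \<forall>j. h j = s * p j" by (intro choice) (auto simp: dvd_def)
  then obtain p where p: "\<And>j. h j = s * p j" by blast
  have p': "h' j = t * p j" for j
  proof -
    have "s * h' j = s * (t * p j)" using eq[of j] p[of j] by (simp add: algebra_simps)
    thus ?thesis using s0 by simp
  qed
  have t0: "t \<noteq> 0" using nz' p' by auto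
  have xi: "int n * h j + int n' * h' j = (int n * s + int n' * t) * p j" for j
    by (simp add: p p' algebra_simps)
  have m0: "int n * s + int n' * t \<noteq> 0" using nz unfolding xi by auto
  have nr': "near R (\<lambda>j. (int n * s + int n' * t) * p j)" using nr unfolding xi .
  have "\<exists>j. p j \<noteq> 0" using l p by (metis mult_zero_right)
  hence "(s, t, p) \<in> trip A A' R"
    using s0 t0 hb near_of_multiple[OF nr' m0] unfolding trip_def by (auto simp: p p' simp del: of_int_mult)
  thus thesis using that nr' m0 p p' by blast
qed

text \<open>Sort by the coordinate x of p at \<open>i\<^sub>0\<close>. There are at most 2 A / |x|
  values of s and 2 A' / |x| of t, while every p_j lies in a window of length 2 R around \<alpha>_j
  x; the weight 1 / x^2 is summable. For x = 0 another non-zero coordinate of p gives the same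
  bounds with 1 in place of |x|.\<close>

lemma card_trip:
  fixes A A' R :: real
  assumes "1 \<le> A" "1 \<le> A'" "1 \<le> R"
  shows "finite (trip A A' R)" "card (trip A A' R) \<le> 20 * (A * A') * (3 * R) ^ CARD('n)"
proof -
  let ?k = "CARD('n)"
  define f where "f = (\<lambda>(s :: int, t :: int, p :: 'n \<Rightarrow> int). p i\<^sub>0)"
  define q where "q = (\<lambda>x :: int. max 1 \<bar>real_of_int x\<bar>)"
  have q1: "1 \<le> q x" for x by (simp add: q_def)
  define N where "N = (\<lambda>L :: real. {z :: int. z \<noteq> 0 \<and> \<bar>of_int z\<bar> \<le> L})"
  have N: "finite (N L)" "card (N L) \<le> 2 * L" if "0 \<le> L" for L :: real
    using card_nonzero_int[OF that] by (auto simp: N_def)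
  define Q where "Q = (\<lambda>x j. {z :: int. \<bar>of_int z - \<alpha> j * of_int (x :: int)\<bar> \<le> R})"
  have Q: "finite (Q x j)" "card (Q x j) \<le> 3 * R" for x j
    using card_int_interval[of R "\<alpha> j * of_int x"] assms(3) by (auto simp: Q_def)
  have bound: "\<bar>real_of_int s\<bar> \<le> L / q (p i\<^sub>0)"
    if pnz: "\<exists>j. p j \<noteq> 0" and pL: "\<forall>j. \<bar>of_int (s * p j)\<bar> \<le> L" for s :: int and p :: "'n \<Rightarrow> int" and L
  proof (cases "p i\<^sub>0 = 0")
    case True
    obtain j where "p j \<noteq> 0" using pnz by blast
    hence "1 \<le> \<bar>real_of_int (p j)\<bar>" by linarith
    hence "\<bar>real_of_int s\<bar> * 1 \<le> \<bar>real_of_int s\<bar> * \<bar>real_of_int (p j)\<bar>" by (intro mult_left_mono) auto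
    also have "\<dots> \<le> L" using pL[rule_format, of j] by (simp add: abs_mult)
    finally show ?thesis using True by (simp add: q_def)
  next
    case False
    hence "1 \<le> \<bar>real_of_int (p i\<^sub>0)\<bar>" by linarith
    hence "q (p i\<^sub>0) = \<bar>real_of_int (p i\<^sub>0)\<bar>" by (simp add: q_def)
    thus ?thesis using pL[rule_format, of "i\<^sub>0"] q1[of "p i\<^sub>0"] by (simp add: pos_le_divide_eq abs_mult)
  qed
  have fibsub: "{z \<in> trip A A' R. f z = x} \<subseteq> N (A / q x) \<times> N (A' / q x) \<times> {p. \<forall>j. p j \<in> Q x j}" for x
  proof
    fix z assume "z \<in> {z \<in> trip A A' R. f z = x}"
    then obtain s t p where z: "z = (s, t, p)" "(s, t, p) \<in> trip A A' R" "p i\<^sub>0 = x" by (cases z) (auto simp: f_def)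
    have "\<bar>real_of_int s\<bar> \<le> A / q x" "\<bar>real_of_int t\<bar> \<le> A' / q x"
      using bound[of p s A] bound[of p t A'] z(2,3) unfolding trip_def by blast+
    thus "z \<in> N (A / q x) \<times> N (A' / q x) \<times> {p. \<forall>j. p j \<in> Q x j}"
      using z by (auto simp: trip_def N_def Q_def near_def)
  qed
  have fib: "finite {z \<in> trip A A' R. f z = x} \<and>
     card {z \<in> trip A A' R. f z = x} \<le> 4 * (A * A') * (3 * R) ^ ?k * (1 / (q x)\<^sup>2)" for x
  proof -
    have Aq: "0 \<le> A / q x" "0 \<le> A' / q x" using assms q1[of x] by auto
    note cf = card_functions[of "Q x", OF Q(1)]
    let ?W = "N (A / q x) \<times> N (A' / q x) \<times> {p. \<forall>j. p j \<in> Q x j}"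
    have fin: "finite ?W" using N(1)[OF Aq(1)] N(1)[OF Aq(2)] cf(1) by blast
    have "real (card {z \<in> trip A A' R. f z = x}) \<le> card ?W"
      using card_mono[OF fin fibsub] by simp
    also have "\<dots> = real (card (N (A / q x))) * (real (card (N (A' / q x))) * (\<Prod>j\<in>UNIV. real (card (Q x j))))"
      by (simp add: card_cartesian_product cf(2))
    also have "\<dots> \<le> (2 * (A / q x)) * ((2 * (A' / q x)) * (\<Prod>j\<in>(UNIV :: 'n set). 3 * R))"
      using N(2)[OF Aq(1)] N(2)[OF Aq(2)] Q(2) Aq
      by (intro mult_mono prod_mono mult_nonneg_nonneg prod_nonneg) auto
    also have "\<dots> = 4 * (A * A') * (3 * R) ^ ?k * (1 / (q x)\<^sup>2)"
      by (simp add: power2_eq_square)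
    finally show ?thesis using finite_subset[OF fibsub fin] by blast
  qed
  have img: "f ` trip A A' R \<subseteq> {x. \<bar>of_int x - 0\<bar> \<le> A}"
  proof
    fix x assume "x \<in> f ` trip A A' R"
    then obtain s t p where stp: "(s, t, p) \<in> trip A A' R" "x = p i\<^sub>0" by (auto simp: f_def)
    hence "s \<noteq> 0" "\<bar>real_of_int (s * x)\<bar> \<le> A" unfolding trip_def by auto
    moreover from this(1) have "1 \<le> \<bar>real_of_int s\<bar>" by linarith
    hence "1 * \<bar>real_of_int x\<bar> \<le> \<bar>real_of_int s\<bar> * \<bar>real_of_int x\<bar>" by (intro mult_right_mono) auto
    ultimately show "x \<in> {x. \<bar>of_int x - 0\<bar> \<le> A}" by (simp add: abs_mult)
  qed
  have fin: "finite (f ` trip A A' R)"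
    using finite_subset[OF img] card_int_interval(1)[of A 0] assms(1) by simp
  show "finite (trip A A' R)"
    by (rule card_fibres_le(1)[OF fin, where g = "\<lambda>x. 4 * (A * A') * (3 * R) ^ ?k * (1 / (q x)\<^sup>2)"]) (use fib in auto)
  have "card (trip A A' R) \<le> (\<Sum>x\<in>f ` trip A A' R. 4 * (A * A') * (3 * R) ^ ?k * (1 / (q x)\<^sup>2))"
    by (rule card_fibres_le(2)[OF fin]) (use fib in auto)
  also have "\<dots> = 4 * (A * A') * (3 * R) ^ ?k * (\<Sum>x\<in>f ` trip A A' R. 1 / (q x)\<^sup>2)"
    by (simp add: sum_distrib_left)
  also have "\<dots> \<le> 4 * (A * A') * (3 * R) ^ ?k * 5"
    unfolding q_def using assms fin by (intro mult_left_mono sum_inverse_squares_int_le) auto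
  finally show "card (trip A A' R) \<le> 20 * (A * A') * (3 * R) ^ ?k" by simp
qed

lemma card_parallel:
  fixes A A' R :: real
  assumes "1 \<le> A" "1 \<le> A'" "1 \<le> R"
  shows "card {(h, h') \<in> sol n n' A A' R. parallel h h'} \<le> 20 * (A * A') * (3 * R) ^ CARD('n)"
proof -
  have "{(h, h') \<in> sol n n' A A' R. parallel h h'} \<subseteq> (\<lambda>(s, t, p). (\<lambda>j. s * p j, \<lambda>j. t * p j)) ` trip A A' R"
  proof
    fix z assume "z \<in> {(h, h') \<in> sol n n' A A' R. parallel h h'}"
    then obtain h h' where z: "z = (h, h')" "(h, h') \<in> sol n n' A A' R" "parallel h h'" by auto
    obtain s t p where "(s, t, p) \<in> trip A A' R" "h = (\<lambda>j. s * p j)" "h' = (\<lambda>j. t * p j)"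
      by (rule sol_parallel_obtain[OF z(2,3)])
    thus "z \<in> (\<lambda>(s, t, p). (\<lambda>j. s * p j, \<lambda>j. t * p j)) ` trip A A' R" unfolding z(1) by force
  qed
  hence "card {(h, h') \<in> sol n n' A A' R. parallel h h'} \<le> card (trip A A' R)"
    using card_trip(1)[OF assms] surj_card_le by blast
  thus ?thesis using card_trip(2)[OF assms] by (meson of_nat_mono order_trans)
qed

text \<open>Constant of \<open>near_multiple_bound\<close>; the summand 1 covers vectors whose
  coordinate at \<open>i\<^sub>0\<close> vanishes.\<close>

definition \<mu>\<^sub>0 :: real where "\<mu>\<^sub>0 = 2 / c * (a + 1) powr (1 + \<omega>) + 1"

lemma mu0_ge_1: "1 \<le> \<mu>\<^sub>0"
  using c_pos by (simp add: \<mu>\<^sub>0_def)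

text \<open>The vector (p_i, -x, 0), with x the coordinate of p at \<open>i\<^sub>0\<close>, is
  orthogonal to the projection of p and has size about |x|. Applied to m p,
  \<open>near_orthogonal_bound\<close> therefore bounds |m| |x| by about |x|^(1 + \<omega>).\<close>

lemma near_multiple_bound:
  assumes "near R (\<lambda>j. m * p j)" "\<exists>j. p j \<noteq> 0" "\<forall>j. \<bar>of_int (p j)\<bar> \<le> P" "1 \<le> P" "1 \<le> R"
  shows "\<bar>of_int m\<bar> \<le> \<mu>\<^sub>0 * R powr (2 + \<omega>) * P powr \<omega>"
proof (cases "m = 0")
  case True
  thus ?thesis using mu0_ge_1 by simp
next
  case m0: False
  have np: "near R p" using near_of_multiple[OF assms(1) m0] .
  have P1: "1 \<le> P powr \<omega>" using assms(4) omega_nonneg by (simp add: ge_one_powr_ge_zero)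
  show ?thesis
  proof (cases "p i\<^sub>0 = 0")
    case True
    obtain j where "p j \<noteq> 0" using assms(2) by blast
    hence "1 \<le> \<bar>real_of_int (p j)\<bar>" by linarith
    hence "\<bar>real_of_int m\<bar> * 1 \<le> \<bar>real_of_int m\<bar> * \<bar>real_of_int (p j)\<bar>" by (intro mult_left_mono) auto
    also have "\<dots> \<le> R" using assms(1) True by (auto simp: near_def abs_mult dest: spec[of _ j])
    also have "\<dots> = R powr 1" using assms(5) by simp
    also have "\<dots> \<le> R powr (2 + \<omega>)" using assms(5) omega_nonneg by (intro powr_mono) auto
    also have "\<dots> \<le> \<mu>\<^sub>0 * R powr (2 + \<omega>) * P powr \<omega>"
    proof -
      have "1 * R powr (2 + \<omega>) * 1 \<le> \<mu>\<^sub>0 * R powr (2 + \<omega>) * P powr \<omega>"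
        using mu0_ge_1 P1 by (intro mult_mono) auto
      thus ?thesis by simp
    qed
    finally show ?thesis by simp
  next
    case False
    define x where "x = \<bar>real_of_int (p i\<^sub>0)\<bar>"
    have x1: "1 \<le> x" using False unfolding x_def by linarith
    have xP: "x \<le> P" using assms(3) by (simp add: x_def)
    \<comment> \<open>Bounds both entries of the orthogonal vector: |p_i| \<le> a x + R \<le> (a +
      R) x because x \<ge> 1.\<close>
    define M where "M = (a + R) * x"
    have aR: "1 \<le> a + R" using a_ge_1 assms(5) by simp
    have M1: "1 \<le> M" "x \<le> M" unfolding M_def using aR x1 mult_mono[of 1 "a + R" 1 x] mult_right_mono[of 1 "a + R" x] by auto
    obtain i where i: "i \<noteq> i\<^sub>0" using exists_other by blast
    obtain j where j: "j \<noteq> i\<^sub>0" "i \<noteq> j" using exists_other by metis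
    have piM: "\<bar>of_int (p i)\<bar> \<le> M"
    proof -
      have "\<bar>of_int (p i)\<bar> \<le> a * x + R" using near_coordinate_le[OF np, of i] by (simp add: x_def)
      also have "\<dots> \<le> a * x + R * x" using x1 assms(5) by (simp add: mult_le_cancel_left1)
      finally show ?thesis by (simp add: M_def algebra_simps)
    qed
    have "\<bar>of_int (m * p i\<^sub>0)\<bar> \<le> 2 / c * R * M powr (1 + \<omega>)"
      by (rule near_orthogonal_bound[OF assms(1) i j M1(1), where u = "p i" and v = "- p i\<^sub>0" and w = 0])
        (use piM M1 False in \<open>auto simp: x_def\<close>)
    also have "M powr (1 + \<omega>) = (a + R) powr (1 + \<omega>) * x powr \<omega> * x"
      using x1 aR by (simp add: M_def powr_mult powr_add)
    finally have "\<bar>real_of_int m\<bar> * x \<le> (2 / c * R * ((a + R) powr (1 + \<omega>) * x powr \<omega>)) * x"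
      by (simp add: x_def abs_mult algebra_simps)
    hence "\<bar>real_of_int m\<bar> \<le> 2 / c * R * ((a + R) powr (1 + \<omega>) * x powr \<omega>)"
      by (rule mult_right_le_imp_le) (use x1 in auto)
    also have "\<dots> \<le> 2 / c * R * (((a + 1) * R) powr (1 + \<omega>) * P powr \<omega>)"
    proof -
      have "a + R \<le> (a + 1) * R" using a_ge_1 assms(5) by (simp add: algebra_simps mult_le_cancel_left1)
      thus ?thesis using aR x1 xP c_pos assms(5) omega_nonneg
        by (intro mult_left_mono mult_mono powr_mono2) auto
    qed
    also have "\<dots> = 2 / c * (a + 1) powr (1 + \<omega>) * R powr (2 + \<omega>) * P powr \<omega>"
      using a_ge_1 assms(5) by (simp add: powr_mult powr_add power2_eq_square)
    also have "\<dots> \<le> \<mu>\<^sub>0 * R powr (2 + \<omega>) * P powr \<omega>"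
      by (intro mult_right_mono) (auto simp: \<mu>\<^sub>0_def)
    finally show ?thesis .
  qed
qed

lemma sol_mono: "A' \<le> B' \<Longrightarrow> R \<le> \<rho> \<Longrightarrow> sol n n' A A' R \<subseteq> sol n n' A B' \<rho>"
  unfolding sol_def near_def by (auto intro: order_trans)

text \<open>Here n' is fixed and n varies. For given (s, t, p) the condition |n s + n' t| \<le> M
  leaves at most 2 M + 1 values of n. The bound M \<le> L n' forces |s| \<le> (1 + L) |t|, so the
  size of h = s p is controlled by that of h', and the range \<open>A\<close> of h, which will
  depend on n, can be left existential.\<close>

lemma card_parallel_fibre:
  fixes A' \<rho> L :: real
  assumes "0 < n'" "1 \<le> A'" "1 \<le> \<rho>" "0 \<le> L"
  defines "M \<equiv> \<mu>\<^sub>0 * \<rho> powr (2 + \<omega>) * A' powr \<omega>"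
  defines "U \<equiv> {(n, h, h'). n' \<le> n \<and> (\<exists>A. (h, h') \<in> sol n n' A A' \<rho>) \<and> parallel h h'}"
  assumes "M \<le> L * n'"
  shows "finite U" "card U \<le> (2 * M + 1) * (20 * (1 + L) * A'\<^sup>2 * (3 * \<rho>) ^ CARD('n))"
proof -
  let ?T = "trip ((1 + L) * A') A' \<rho>"
  have M0: "0 \<le> M" using mu0_ge_1 by (simp add: M_def)
  define E where "E = (\<lambda>(s, t, p :: 'n \<Rightarrow> int). {n :: nat. \<bar>of_int (int n * s + int n' * t)\<bar> \<le> M})"
  have E: "finite (E z) \<and> card (E z) \<le> 2 * M + 1" if "z \<in> ?T" for z
  proof -
    obtain s t p where z: "z = (s, t, p)" by (metis prod_cases3)
    have s0: "s \<noteq> 0" using that by (auto simp: z trip_def)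
    hence s1: "1 \<le> \<bar>real_of_int s\<bar>" by linarith
    \<comment> \<open>Multiplication by the sign of s makes the leading coefficient positive, as
      \<open>card_int_multiples\<close> requires.\<close>
    define F where "F = {x :: int. \<bar>\<bar>of_int s\<bar> * of_int x - (- (sgn (of_int s) * of_int (int n' * t)))\<bar> \<le> M}"
    have F: "finite F" "card F \<le> 2 * M / \<bar>real_of_int s\<bar> + 1"
      unfolding F_def using card_int_multiples[OF M0, of "\<bar>real_of_int s\<bar>"] s1 by (blast intro: less_le_trans[OF zero_less_one])+
    have sub: "int ` E z \<subseteq> F"
    proof
      fix x assume "x \<in> int ` E z"
      then obtain n where n: "x = int n" "\<bar>real_of_int (int n * s + int n' * t)\<bar> \<le> M" by (auto simp: E_def z)
      have "\<bar>real_of_int s\<bar> * of_int x - (- (sgn (of_int s) * of_int (int n' * t))) = sgn (of_int s) * real_of_int (int n * s + int n' * t)"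
        by (simp add: n(1) algebra_simps sgn_mult_abs abs_mult_sgn mult_sgn_abs) (simp add: sgn_if)
      hence "\<bar>\<bar>real_of_int s\<bar> * of_int x - (- (sgn (of_int s) * of_int (int n' * t)))\<bar> = \<bar>real_of_int (int n * s + int n' * t)\<bar>"
        using s0 by (simp add: abs_mult abs_sgn_eq)
      thus "x \<in> F" using n(2) by (simp add: F_def)
    qed
    have fE: "finite (E z)" using finite_subset[OF sub F(1)] by (simp add: finite_image_iff)
    have "card (E z) = card (int ` E z)" by (simp add: card_image)
    also have "\<dots> \<le> card F" using card_mono[OF F(1) sub] .
    finally have "card (E z) \<le> 2 * M / \<bar>real_of_int s\<bar> + 1" using F(2) by (meson of_nat_mono order_trans)
    also have "2 * M / \<bar>real_of_int s\<bar> \<le> 2 * M / 1" using s1 M0 by (intro divide_left_mono) auto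
    finally show ?thesis using fE by simp
  qed
  have LA: "1 \<le> (1 + L) * A'" using assms(2,4) mult_mono[of 1 "1 + L" 1 A'] by simp
  note T = card_trip[OF LA assms(2,3)]
  have sub: "U \<subseteq> (\<lambda>((s, t, p), n). (n, \<lambda>j. s * p j, \<lambda>j. t * p j)) ` Sigma ?T E"
  proof
    fix z assume "z \<in> U"
    then obtain n h h' A where z: "z = (n, h, h')" "n' \<le> n" "(h, h') \<in> sol n n' A A' \<rho>" "parallel h h'"
      by (auto simp: U_def)
    obtain s t p where stp: "(s, t, p) \<in> trip A A' \<rho>" "h = (\<lambda>j. s * p j)" "h' = (\<lambda>j. t * p j)"
      "near \<rho> (\<lambda>j. (int n * s + int n' * t) * p j)" "int n * s + int n' * t \<noteq> 0"
      by (rule sol_parallel_obtain[OF z(3,4)])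
    have n0: "0 < n" using z(2) assms(1) by simp
    have t: "s \<noteq> 0" "t \<noteq> 0" "\<exists>j. p j \<noteq> 0" "\<And>j. \<bar>of_int (t * p j)\<bar> \<le> A'" "near \<rho> p"
      using stp(1) unfolding trip_def by auto
    have t1: "1 \<le> \<bar>real_of_int t\<bar>" using t(2) by linarith
    have "\<bar>of_int (p j)\<bar> \<le> A'" for j
    proof -
      have "1 * \<bar>of_int (p j)\<bar> \<le> \<bar>real_of_int t\<bar> * \<bar>of_int (p j)\<bar>" using t1 by (intro mult_right_mono) auto
      also have "\<dots> \<le> A'" using t(4)[of j] by (simp add: abs_mult)
      finally show ?thesis by simp
    qed
    hence mM: "\<bar>of_int (int n * s + int n' * t)\<bar> \<le> M"
      unfolding M_def using near_multiple_bound[OF stp(4) t(3) _ assms(2,3)] by blast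
    have s_le: "\<bar>real_of_int s\<bar> \<le> (1 + L) * \<bar>real_of_int t\<bar>"
    proof -
      have "real n * \<bar>real_of_int s\<bar> = \<bar>of_int (int n * s + int n' * t) - of_int (int n' * t)\<bar>"
        by (simp add: abs_mult)
      also have "\<dots> \<le> \<bar>of_int (int n * s + int n' * t)\<bar> + \<bar>of_int (int n' * t)\<bar>" by linarith
      also have "\<dots> \<le> L * n' + real n' * \<bar>real_of_int t\<bar>" using mM assms(7) by (simp add: abs_mult)
      also have "\<dots> \<le> L * n * \<bar>real_of_int t\<bar> + real n * \<bar>real_of_int t\<bar>"
      proof (intro add_mono mult_right_mono)
        have "L * n' * 1 \<le> L * n * \<bar>real_of_int t\<bar>" using t1 z(2) assms(4) by (intro mult_mono) auto
        thus "L * n' \<le> L * n * \<bar>real_of_int t\<bar>" by simp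
      qed (use z(2) in auto)
      also have "\<dots> = real n * ((1 + L) * \<bar>real_of_int t\<bar>)" by (simp add: algebra_simps)
      finally show ?thesis using n0 by simp
    qed
    have "\<bar>of_int (s * p j)\<bar> \<le> (1 + L) * A'" for j
    proof -
      have "\<bar>real_of_int (s * p j)\<bar> \<le> (1 + L) * \<bar>real_of_int t\<bar> * \<bar>of_int (p j)\<bar>"
        using s_le by (auto simp: abs_mult intro: mult_right_mono)
      also have "\<dots> = (1 + L) * \<bar>of_int (t * p j)\<bar>" by (simp add: abs_mult)
      also have "\<dots> \<le> (1 + L) * A'" using t(4)[of j] assms(4) by (intro mult_left_mono) auto
      finally show ?thesis .
    qed
    hence "(s, t, p) \<in> ?T" using t unfolding trip_def by auto
    moreover have "n \<in> E (s, t, p)" using mM by (simp add: E_def)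
    ultimately show "z \<in> (\<lambda>((s, t, p), n). (n, \<lambda>j. s * p j, \<lambda>j. t * p j)) ` Sigma ?T E"
      unfolding z(1) stp(2,3) by force
  qed
  have fin: "finite (Sigma ?T E)" using T(1) E by (intro finite_SigmaI) auto
  show "finite U" using finite_subset[OF sub] fin by blast
  have "card U \<le> card (Sigma ?T E)" using surj_card_le[OF fin sub] .
  also have "\<dots> = (\<Sum>z\<in>?T. card (E z))" using T(1) E by (simp add: card_SigmaI)
  finally have "real (card U) \<le> (\<Sum>z\<in>?T. real (card (E z)))" by (metis of_nat_mono of_nat_sum)
  also have "\<dots> \<le> (\<Sum>z\<in>?T. 2 * M + 1)" using E by (intro sum_mono) auto
  also have "\<dots> = (2 * M + 1) * card ?T" by simp
  also have "\<dots> \<le> (2 * M + 1) * (20 * ((1 + L) * A' * A') * (3 * \<rho>) ^ CARD('n))"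
    using T(2) M0 by (intro mult_left_mono) auto
  finally show "card U \<le> (2 * M + 1) * (20 * (1 + L) * A'\<^sup>2 * (3 * \<rho>) ^ CARD('n))"
    by (simp only: power2_eq_square mult.assoc)
qed

end

section \<open>Parallel pairs summed over all \<open>n\<close> and \<open>n'\<close>\<close>

context diophantine_direction
begin

text \<open>\<open>card_parallel_fibre\<close> wants ranges that depend on n' alone, but R grows
  with n. The remedy is that a parallel solution with n' \<le> n forces n \<le> const n'^3, so that
  R is at most a constant times n'^(8 \<tau>). The sum over n is then at most a constant times
  n'^(-13/12), where -13/12 = -2 + 11/12 explains the last hypothesis.\<close>

lemma sum_parallel_bounded:
  fixes a\<^sub>0 \<tau> :: real
  defines "k \<equiv> real CARD('n)"
  defines "R \<equiv> \<lambda>n n' :: nat. a\<^sub>0 * real (n * n') powr (2 * \<tau>)"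
  defines "P \<equiv> \<lambda>n n' :: nat. {(h, h') \<in> sol n n' (n powr (1 / k) * R n n') (n' powr (1 / k) * R n n') (R n n'). parallel h h'}"
  assumes "1 \<le> a\<^sub>0" "0 < \<tau>" "(2 + \<omega>) / k + \<tau> * (2 * k + 8 * (4 + 2 * \<omega> + k)) \<le> 11 / 12"
  shows "\<exists>C\<ge>0. \<forall>N. (\<Sum>n'=1..N. \<Sum>n=n'..N. real (n * n') powr (- 1 + k * \<tau>) * card (P n n')) \<le> C"
proof -
  have k3: "3 \<le> k" using card3 by (simp add: k_def)
  have H: "(2 + \<omega>) / k + (2 * k * \<tau> + 8 * \<tau> * (2 + 2 * \<omega>) + 8 * \<tau> * (2 + k)) \<le> 11 / 12"
    using assms(6) by (simp add: algebra_simps)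
  have p1: "0 \<le> \<omega> / k" "\<omega> / k \<le> (2 + \<omega>) / k" using k3 omega_nonneg by (auto simp: divide_right_mono)
  have p2: "0 \<le> 2 * k * \<tau>" "0 \<le> 8 * \<tau> * (2 + 2 * \<omega>)" "0 \<le> 8 * \<tau> * (2 + k)"
    using k3 omega_nonneg assms(5) by auto
  have e1: "\<omega> / k + 8 * \<tau> * (2 + 2 * \<omega>) \<le> 1" "2 * \<tau> * (2 + 2 * \<omega>) \<le> 1 / 4" "k * \<tau> \<le> 1"
    using H p1 p2 by linarith+
  have R1: "1 \<le> R n n'" if "0 < n" "0 < n'" for n n'
  proof -
    have "1 \<le> real (n * n')" using that by (simp flip: of_nat_mult add: Suc_leI)
    hence "1 \<le> real (n * n') powr (2 * \<tau>)" using assms(5) by (intro ge_one_powr_ge_zero) auto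
    thus ?thesis using assms(4) mult_mono[of 1 a\<^sub>0 1 "real (n * n') powr (2 * \<tau>)"] by (simp add: R_def)
  qed
  define C3 where "C3 = (1 + \<mu>\<^sub>0) * a\<^sub>0 powr (2 + 2 * \<omega>)"
  define C4 where "C4 = C3 powr (4 / 3)"
  define C5 where "C5 = a\<^sub>0 * C4 powr (2 * \<tau>)"
  have C3: "1 \<le> C3" unfolding C3_def
    using mu0_ge_1 assms(4) omega_nonneg mult_mono[of 1 "1 + \<mu>\<^sub>0" 1 "a\<^sub>0 powr (2 + 2 * \<omega>)"]
    by (simp add: ge_one_powr_ge_zero)
  hence C4: "1 \<le> C4" by (simp add: C4_def ge_one_powr_ge_zero)
  hence C5: "1 \<le> C5" unfolding C5_def
    using assms(4,5) mult_mono[of 1 a\<^sub>0 1 "C4 powr (2 * \<tau>)"] by (simp add: ge_one_powr_ge_zero)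
  \<comment> \<open>From n \<le> |n s + n' t| + n' |t| one gets n \<le> const n'^2 R^(2 + 2
    \<omega>), and for small \<tau> the last factor is at most const (n n')^(1/4). Solving for n
    gives the cube of n', hence (n n')^(2 \<tau>) \<le> const (n'^4)^(2 \<tau>).\<close>
  have growth: "R n n' \<le> C5 * n' powr (8 * \<tau>)"
    if "(h, h') \<in> P n n'" "0 < n'" "n' \<le> n" for n n' h h'
  proof -
    have n0: "0 < n" using that by simp
    define A' where "A' = n' powr (1 / k) * R n n'"
    have r1: "1 \<le> R n n'" using R1 n0 that by simp
    have n'1: "1 \<le> real n'" "1 \<le> real n" using that n0 by auto
    have "1 \<le> n' powr (1 / k)" using n'1 k3 by (intro ge_one_powr_ge_zero) auto
    hence A'1: "1 \<le> A'" using r1 mult_mono[of 1 "n' powr (1 / k)" 1 "R n n'"] by (simp add: A'_def)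
    have hs: "(h, h') \<in> sol n n' (n powr (1 / k) * R n n') A' (R n n')" "parallel h h'"
      using that(1) by (auto simp: P_def A'_def)
    obtain s t p where stp: "(s, t, p) \<in> trip (n powr (1 / k) * R n n') A' (R n n')"
      "near (R n n') (\<lambda>j. (int n * s + int n' * t) * p j)"
      by (rule sol_parallel_obtain[OF hs])
    have t: "s \<noteq> 0" "t \<noteq> 0" "\<exists>j. p j \<noteq> 0" "\<And>j. \<bar>of_int (t * p j)\<bar> \<le> A'"
      using stp(1) unfolding trip_def by auto
    have t1: "1 \<le> \<bar>real_of_int t\<bar>" "1 \<le> \<bar>real_of_int s\<bar>" using t(1,2) by linarith+
    have pA: "\<bar>of_int (p j)\<bar> \<le> A'" for j
    proof -
      have "1 * \<bar>of_int (p j)\<bar> \<le> \<bar>real_of_int t\<bar> * \<bar>of_int (p j)\<bar>" using t1 by (intro mult_right_mono) auto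
      also have "\<dots> \<le> A'" using t(4)[of j] by (simp add: abs_mult)
      finally show ?thesis by simp
    qed
    have tA: "\<bar>of_int t\<bar> \<le> A'"
    proof -
      obtain j where "p j \<noteq> 0" using t(3) by blast
      hence "1 \<le> \<bar>real_of_int (p j)\<bar>" by linarith
      hence "\<bar>of_int t\<bar> * 1 \<le> \<bar>real_of_int t\<bar> * \<bar>of_int (p j)\<bar>" by (intro mult_left_mono) auto
      also have "\<dots> \<le> A'" using t(4)[of j] by (simp add: abs_mult)
      finally show ?thesis by simp
    qed
    have mM: "\<bar>of_int (int n * s + int n' * t)\<bar> \<le> \<mu>\<^sub>0 * R n n' powr (2 + \<omega>) * A' powr \<omega>"
      using near_multiple_bound[OF stp(2) t(3) _ A'1 r1] pA by blast
    have "real n * 1 \<le> real n * \<bar>of_int s\<bar>" using t1 by (intro mult_left_mono) auto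
    also have "\<dots> = \<bar>of_int (int n * s + int n' * t) - of_int (int n' * t)\<bar>" by (simp add: abs_mult)
    also have "\<dots> \<le> \<bar>of_int (int n * s + int n' * t)\<bar> + \<bar>of_int (int n' * t)\<bar>" by linarith
    also have "\<dots> \<le> \<mu>\<^sub>0 * R n n' powr (2 + \<omega>) * A' powr \<omega> + real n' * A'"
      using mM tA by (intro add_mono) (auto simp: abs_mult intro: mult_left_mono)
    also have "real n' * A' = n' powr (1 + 1 / k) * R n n' powr 1"
      using n'1 r1 by (simp add: A'_def powr_add)
    also have "\<dots> \<le> n' powr 2 * R n n' powr (2 + 2 * \<omega>)"
      using n'1 r1 k3 omega_nonneg by (intro mult_mono powr_mono) (auto simp: field_simps)
    also have "\<mu>\<^sub>0 * R n n' powr (2 + \<omega>) * A' powr \<omega> = \<mu>\<^sub>0 * (n' powr (\<omega> / k) * R n n' powr (2 + 2 * \<omega>))"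
    proof -
      have "R n n' powr (2 + 2 * \<omega>) = R n n' powr (2 + \<omega>) * R n n' powr \<omega>" by (simp add: add.commute flip: powr_add)
      moreover have "A' powr \<omega> = n' powr (\<omega> / k) * R n n' powr \<omega>"
        using r1 by (simp add: A'_def powr_mult powr_powr)
      ultimately show ?thesis by (simp only: mult_ac)
    qed
    also have "\<dots> \<le> \<mu>\<^sub>0 * (n' powr 2 * R n n' powr (2 + 2 * \<omega>))"
      using mu0_ge_1 n'1 e1(1) p2(2) by (intro mult_left_mono mult_right_mono powr_mono) auto
    finally have "real n \<le> (1 + \<mu>\<^sub>0) * n' powr 2 * R n n' powr (2 + 2 * \<omega>)" by (simp add: algebra_simps)
    also have "R n n' powr (2 + 2 * \<omega>) = a\<^sub>0 powr (2 + 2 * \<omega>) * real (n * n') powr (2 * \<tau> * (2 + 2 * \<omega>))"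
      using assms(4) by (simp add: R_def powr_mult powr_powr)
    also have "real (n * n') powr (2 * \<tau> * (2 + 2 * \<omega>)) \<le> real (n * n') powr (1 / 4)"
    proof -
      have "1 \<le> real (n * n')" using that n0 by (simp flip: of_nat_mult add: Suc_leI)
      thus ?thesis using e1(2) by (intro powr_mono) auto
    qed
    finally have "real n \<le> (1 + \<mu>\<^sub>0) * n' powr 2 * (a\<^sub>0 powr (2 + 2 * \<omega>) * real (n * n') powr (1 / 4))"
      using mu0_ge_1 assms(4) by (simp add: mult_left_mono)
    also have "\<dots> = C3 * n' powr (9 / 4) * n powr (1 / 4)"
    proof -
      have "n' powr (9 / 4) = n' powr 2 * n' powr (1 / 4)" using powr_add[of "real n'" 2 "1/4"] by simp
      thus ?thesis by (simp add: C3_def powr_mult)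
    qed
    finally have "n powr (3 / 4) * n powr (1 / 4) \<le> C3 * n' powr (9 / 4) * n powr (1 / 4)"
      using n0 by (simp flip: powr_add)
    hence "n powr (3 / 4) \<le> C3 * n' powr (9 / 4)" by (rule mult_right_le_imp_le) (use n0 in auto)
    hence "(n powr (3 / 4)) powr (4 / 3) \<le> (C3 * n' powr (9 / 4)) powr (4 / 3)" by (intro powr_mono2) auto
    hence n3: "real n \<le> C4 * n' powr 3" using C3 n0 by (simp add: powr_powr powr_mult C4_def)
    have "real (n * n') \<le> C4 * n' powr 3 * n' powr 1" using n3 n'1 by (simp add: mult_right_mono)
    also have "\<dots> = C4 * n' powr (3 + 1)" by (simp only: powr_add mult.assoc)
    also have "\<dots> = C4 * n' powr 4" by simp
    finally have "real (n * n') powr (2 * \<tau>) \<le> (C4 * n' powr 4) powr (2 * \<tau>)"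
      using assms(5) by (intro powr_mono2) auto
    also have "\<dots> = C4 powr (2 * \<tau>) * n' powr (4 * (2 * \<tau>))"
      using C4 by (simp only: powr_mult powr_powr)
    also have "4 * (2 * \<tau>) = 8 * \<tau>" by simp
    finally show ?thesis using assms(4) by (simp add: R_def C5_def mult_left_mono)
  qed
  define L where "L = \<mu>\<^sub>0 * C5 powr (2 + 2 * \<omega>)"
  have L0: "0 \<le> L" using mu0_ge_1 by (simp add: L_def)
  define C6 where "C6 = (2 * L + 1) * (20 * (1 + L) * C5\<^sup>2 * (3 * C5) ^ CARD('n))"
  have C6: "0 \<le> C6" using L0 C5 by (simp add: C6_def)
  have inner: "(\<Sum>n=n'..N. real (n * n') powr (- 1 + k * \<tau>) * card (P n n')) \<le> C6 * n' powr (- 13 / 12)"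
    if n': "0 < n'" for n' N :: nat
  proof -
    have n'1: "1 \<le> real n'" using that by simp
    define \<rho> where "\<rho> = C5 * n' powr (8 * \<tau>)"
    define A' where "A' = n' powr (1 / k) * \<rho>"
    have "1 \<le> n' powr (8 * \<tau>)" using n'1 assms(5) by (intro ge_one_powr_ge_zero) auto
    hence \<rho>1: "1 \<le> \<rho>" using C5 mult_mono[of 1 C5 1 "n' powr (8 * \<tau>)"] by (simp add: \<rho>_def)
    have "1 \<le> n' powr (1 / k)" using n'1 k3 by (intro ge_one_powr_ge_zero) auto
    hence A'1: "1 \<le> A'" using \<rho>1 mult_mono[of 1 "n' powr (1 / k)" 1 \<rho>] by (simp add: A'_def)
    define M where "M = \<mu>\<^sub>0 * \<rho> powr (2 + \<omega>) * A' powr \<omega>"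
    have M: "M = L * n' powr (\<omega> / k + 8 * \<tau> * (2 + 2 * \<omega>))"
    proof -
      have "M = \<mu>\<^sub>0 * \<rho> powr (2 + 2 * \<omega>) * n' powr (\<omega> / k)"
      proof -
        have "\<rho> powr (2 + 2 * \<omega>) = \<rho> powr (2 + \<omega>) * \<rho> powr \<omega>" by (simp add: add.commute flip: powr_add)
        moreover have "A' powr \<omega> = n' powr (\<omega> / k) * \<rho> powr \<omega>"
          using \<rho>1 by (simp add: A'_def powr_mult powr_powr)
        ultimately show ?thesis by (simp only: M_def mult_ac)
      qed
      also have "\<rho> powr (2 + 2 * \<omega>) = C5 powr (2 + 2 * \<omega>) * n' powr (8 * \<tau> * (2 + 2 * \<omega>))"
        using C5 by (simp add: \<rho>_def powr_mult powr_powr)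
      finally show ?thesis by (simp add: L_def powr_add)
    qed
    have "n' powr (\<omega> / k + 8 * \<tau> * (2 + 2 * \<omega>)) \<le> n' powr 1"
      using n'1 e1(1) by (intro powr_mono) auto
    hence M_le: "M \<le> L * n'" using L0 n'1 by (simp add: M mult_left_mono)
    define U where "U = {(n, h, h'). n' \<le> n \<and> (\<exists>A. (h, h') \<in> sol n n' A A' \<rho>) \<and> parallel h h'}"
    have U: "finite U" "card U \<le> (2 * M + 1) * (20 * (1 + L) * A'\<^sup>2 * (3 * \<rho>) ^ CARD('n))"
      using card_parallel_fibre[OF n' A'1 \<rho>1 L0 M_le[unfolded M_def]] unfolding U_def M_def by auto
    have sub: "Sigma {n'..N} (\<lambda>n. P n n') \<subseteq> U"
    proof
      fix z assume "z \<in> Sigma {n'..N} (\<lambda>n. P n n')"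
      then obtain n h h' where z: "z = (n, h, h')" "n' \<le> n" "(h, h') \<in> P n n'" by auto
      have r: "R n n' \<le> \<rho>" unfolding \<rho>_def by (rule growth[OF z(3) n' z(2)])
      hence "n' powr (1 / k) * R n n' \<le> A'" by (simp add: A'_def mult_left_mono)
      from sol_mono[OF this r] have "(h, h') \<in> sol n n' (n powr (1 / k) * R n n') A' \<rho>"
        using z(3) by (auto simp: P_def)
      thus "z \<in> U" using z by (auto simp: P_def U_def)
    qed
    have fP: "finite (P n n')" for n unfolding P_def
      by (rule finite_subset[OF _ finite_sol]) auto
    have "(\<Sum>n=n'..N. card (P n n')) = card (Sigma {n'..N} (\<lambda>n. P n n'))"
      using fP by (simp add: card_SigmaI)
    also have "\<dots> \<le> card U" using card_mono[OF U(1) sub] .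
    finally have cs: "(\<Sum>n=n'..N. real (card (P n n'))) \<le> card U" by (metis of_nat_mono of_nat_sum)
    have "2 * M + 1 \<le> (2 * L + 1) * n' powr (\<omega> / k + 8 * \<tau> * (2 + 2 * \<omega>))"
    proof -
      have "1 \<le> n' powr (\<omega> / k + 8 * \<tau> * (2 + 2 * \<omega>))" using n'1 p1 p2 by (intro ge_one_powr_ge_zero) auto
      thus ?thesis unfolding M by (simp add: algebra_simps)
    qed
    hence le: "(2 * M + 1) * (20 * (1 + L) * A'\<^sup>2 * (3 * \<rho>) ^ CARD('n)) \<le>
      ((2 * L + 1) * n' powr (\<omega> / k + 8 * \<tau> * (2 + 2 * \<omega>))) * (20 * (1 + L) * A'\<^sup>2 * (3 * \<rho>) ^ CARD('n))"
      using L0 A'1 \<rho>1 by (intro mult_right_mono) auto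
    have Asq: "A'\<^sup>2 = C5\<^sup>2 * n' powr (2 / k + 16 * \<tau>)"
      by (simp add: A'_def \<rho>_def power_mult_distrib powr_add power2_eq_square flip: powr_add)
    have \<rho>k: "(3 * \<rho>) ^ CARD('n) = (3 * C5) ^ CARD('n) * n' powr (8 * \<tau> * k)"
      using n' by (simp add: \<rho>_def power_mult_distrib k_def powr_powr flip: powr_realpow)
    have eq: "((2 * L + 1) * n' powr (\<omega> / k + 8 * \<tau> * (2 + 2 * \<omega>))) * (20 * (1 + L) * A'\<^sup>2 * (3 * \<rho>) ^ CARD('n)) =
      C6 * (n' powr (\<omega> / k + 8 * \<tau> * (2 + 2 * \<omega>)) * n' powr (2 / k + 16 * \<tau>) * n' powr (8 * \<tau> * k))"
      unfolding Asq \<rho>k C6_def by (simp only: mult_ac)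
    have "card U \<le> C6 * (n' powr (\<omega> / k + 8 * \<tau> * (2 + 2 * \<omega>)) * n' powr (2 / k + 16 * \<tau>) * n' powr (8 * \<tau> * k))"
      using U(2) le unfolding eq by (rule order_trans)
    hence cU: "card U \<le> C6 * n' powr (\<omega> / k + 8 * \<tau> * (2 + 2 * \<omega>) + (2 / k + 16 * \<tau>) + 8 * \<tau> * k)"
      by (simp only: powr_add)
    \<comment> \<open>The exponent -1 + k \<tau> is non-positive, so n may be replaced by its least
      value n' in the weight.\<close>
    have "(\<Sum>n=n'..N. real (n * n') powr (- 1 + k * \<tau>) * card (P n n')) \<le>
      (\<Sum>n=n'..N. real (n' * n') powr (- 1 + k * \<tau>) * card (P n n'))"
      using e1(3) n' by (intro sum_mono mult_right_mono powr_mono2') auto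
    also have "\<dots> = real (n' * n') powr (- 1 + k * \<tau>) * (\<Sum>n=n'..N. real (card (P n n')))"
      by (simp add: sum_distrib_left)
    also have "\<dots> \<le> real (n' * n') powr (- 1 + k * \<tau>) * card U"
      using cs by (intro mult_left_mono) auto
    also have "real (n' * n') powr (- 1 + k * \<tau>) = n' powr (- 2 + 2 * k * \<tau>)"
      by (simp add: powr_mult mult_ac flip: powr_add)
    also have "n' powr (- 2 + 2 * k * \<tau>) * card U \<le> n' powr (- 2 + 2 * k * \<tau>) *
        (C6 * n' powr (\<omega> / k + 8 * \<tau> * (2 + 2 * \<omega>) + (2 / k + 16 * \<tau>) + 8 * \<tau> * k))"
      using cU by (intro mult_left_mono) auto
    also have "\<dots> = C6 * n' powr (- 2 + 2 * k * \<tau> + (\<omega> / k + 8 * \<tau> * (2 + 2 * \<omega>) + (2 / k + 16 * \<tau>) + 8 * \<tau> * k))"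
      by (simp only: powr_add mult_ac)
    also have "\<dots> \<le> C6 * n' powr (- 13 / 12)"
    proof -
      have "(2 + \<omega>) / k = 2 / k + \<omega> / k" by (simp add: add_divide_distrib)
      hence "- 2 + 2 * k * \<tau> + (\<omega> / k + 8 * \<tau> * (2 + 2 * \<omega>) + (2 / k + 16 * \<tau>) + 8 * \<tau> * k) \<le> - 13 / 12"
        using H by (simp add: algebra_simps)
      thus ?thesis using n'1 C6 by (intro mult_left_mono powr_mono) auto
    qed
    finally show ?thesis .
  qed
  have sm: "summable (\<lambda>n. real n powr (- 13 / 12))" by (subst summable_real_powr_iff) auto
  show ?thesis
  proof (intro exI[of _ "C6 * (\<Sum>n. real n powr (- 13 / 12))"] conjI allI)
    show "0 \<le> C6 * (\<Sum>n. real n powr (- 13 / 12))" using C6 by (intro mult_nonneg_nonneg suminf_nonneg sm) auto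
    fix N
    have "(\<Sum>n'=1..N. \<Sum>n=n'..N. real (n * n') powr (- 1 + k * \<tau>) * card (P n n')) \<le>
      (\<Sum>n'=1..N. C6 * real n' powr (- 13 / 12))"
      using inner by (intro sum_mono) auto
    also have "\<dots> = C6 * (\<Sum>n'=1..N. real n' powr (- 13 / 12))" by (simp add: sum_distrib_left)
    also have "\<dots> \<le> C6 * (\<Sum>n. real n powr (- 13 / 12))"
      using C6 sm by (intro mult_left_mono sum_le_suminf) auto
    finally show "(\<Sum>n'=1..N. \<Sum>n=n'..N. real (n * n') powr (- 1 + k * \<tau>) * card (P n n')) \<le>
      C6 * (\<Sum>n. real n powr (- 13 / 12))" .
  qed
qed

end

section \<open>Additive characters and a lattice sum with quadratic decay\<close>

definition char1 :: "real \<Rightarrow> complex" where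
  "char1 t = cis (2 * pi * t)"

lemma norm_char1 [simp]: "norm (char1 t) = 1"
  by (simp add: char1_def)

lemma char1_0 [simp]: "char1 0 = 1"
  by (simp add: char1_def)

lemma char1_add: "char1 (s + t) = char1 s * char1 t"
  by (simp add: char1_def cis_mult distrib_left)

lemma cnj_char1 [simp]: "cnj (char1 t) = char1 (- t)"
  by (simp add: char1_def cis_cnj)

lemma char1_int [simp]: "char1 (of_int m) = 1"
  unfolding char1_def by (metis cis_multiple_2pi Ints_of_int mult.commute mult.assoc)

lemma continuous_on_char1 [continuous_intros]: "continuous_on A f \<Longrightarrow> continuous_on A (\<lambda>x. char1 (f x))"
  unfolding char1_def by (intro continuous_intros)

lemma measurable_char1 [measurable]: "char1 \<in> borel_measurable borel"
  by (intro borel_measurable_continuous_onI continuous_intros)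

lemma char1_sum: "finite A \<Longrightarrow> char1 (\<Sum>j\<in>A. f j) = (\<Prod>j\<in>A. char1 (f j))"
  by (induction A rule: finite_induct) (auto simp: char1_add)

lemma has_vector_derivative_char1:
  "((\<lambda>t. char1 (s * t)) has_vector_derivative (2 * pi * s * \<i>) * char1 (s * t)) (at t within X)"
proof -
  have "((\<lambda>z. exp (of_real (2 * pi * s) * \<i> * z)) has_field_derivative
      (of_real (2 * pi * s) * \<i>) * exp (of_real (2 * pi * s) * \<i> * of_real t)) (at (of_real t))"
    by (auto intro!: derivative_eq_intros)
  from has_vector_derivative_real_field[OF this]
  show ?thesis by (simp add: char1_def cis_conv_exp algebra_simps)
qed

text \<open>The summand is H^2 / (H + |x|)^2 and is compared with differences of H^2 / (H + N). What
  matters is the linear growth in H, the effective number of frequencies.\<close>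

lemma sum_quadratic_decay_int_le:
  fixes H :: real
  assumes "0 < H" "finite X"
  shows "(\<Sum>x\<in>X. 1 / (1 + \<bar>real_of_int x\<bar> / H)\<^sup>2) \<le> 1 + 2 * H"
proof -
  let ?f = "\<lambda>x :: int. 1 / (1 + \<bar>real_of_int x\<bar> / H)\<^sup>2"
  have ind: "(\<Sum>x\<in>{- int N..int N}. ?f x) \<le> 1 + 2 * H - 2 * H\<^sup>2 / (H + N)" for N
  proof (induction N)
    case 0
    show ?case using assms(1) by (simp add: power2_eq_square)
  next
    case (Suc N)
    define u where "u = H + real N"
    have u: "0 < u" "0 < u + 1" using assms(1) by (auto simp: u_def)
    have set: "{- int (Suc N)..int (Suc N)} = insert (int (Suc N)) (insert (- int (Suc N)) {- int N..int N})" by auto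
    have fS: "?f (int (Suc N)) = H\<^sup>2 / (u + 1)\<^sup>2" "?f (- int (Suc N)) = H\<^sup>2 / (u + 1)\<^sup>2"
    proof -
      have 1: "1 + \<bar>real_of_int (int (Suc N))\<bar> / H = (u + 1) / H" "1 + \<bar>real_of_int (- int (Suc N))\<bar> / H = (u + 1) / H"
        using assms(1) by (auto simp: u_def field_simps)
      show "?f (int (Suc N)) = H\<^sup>2 / (u + 1)\<^sup>2" "?f (- int (Suc N)) = H\<^sup>2 / (u + 1)\<^sup>2"
        unfolding 1 power_divide by simp_all
    qed
    have "(\<Sum>x\<in>{- int (Suc N)..int (Suc N)}. ?f x) = ?f (int (Suc N)) + (?f (- int (Suc N)) + (\<Sum>x\<in>{- int N..int N}. ?f x))"
      unfolding set by (subst sum.insert, simp, simp, subst sum.insert, simp, simp, simp)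
    hence "(\<Sum>x\<in>{- int (Suc N)..int (Suc N)}. ?f x) = 2 * (H\<^sup>2 / (u + 1)\<^sup>2) + (\<Sum>x\<in>{- int N..int N}. ?f x)"
      unfolding fS by simp
    also have "\<dots> \<le> 2 * (H\<^sup>2 / (u + 1)\<^sup>2) + (1 + 2 * H - 2 * H\<^sup>2 / u)" using Suc by (simp add: u_def)
    also have "\<dots> \<le> 1 + 2 * H - 2 * H\<^sup>2 / (u + 1)"
    proof -
      have "H\<^sup>2 / u - H\<^sup>2 / (u + 1) = H\<^sup>2 / (u * (u + 1))" using u by (simp add: field_simps)
      moreover have "H\<^sup>2 / (u + 1)\<^sup>2 \<le> H\<^sup>2 / (u * (u + 1))"
        unfolding power2_eq_square[of "u + 1"] using u by (intro divide_left_mono mult_right_mono) auto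
      ultimately show ?thesis by linarith
    qed
    finally show ?case by (simp add: u_def add_ac)
  qed
  obtain N where N: "X \<subseteq> {- int N..int N}"
  proof
    show "X \<subseteq> {- int (nat (\<Sum>x\<in>X. \<bar>x\<bar>))..int (nat (\<Sum>x\<in>X. \<bar>x\<bar>))}"
    proof
      fix x assume "x \<in> X"
      hence "\<bar>x\<bar> \<le> (\<Sum>x\<in>X. \<bar>x\<bar>)" using assms by (intro member_le_sum) auto
      thus "x \<in> {- int (nat (\<Sum>x\<in>X. \<bar>x\<bar>))..int (nat (\<Sum>x\<in>X. \<bar>x\<bar>))}" by auto
    qed
  qed
  have "(\<Sum>x\<in>X. ?f x) \<le> (\<Sum>x\<in>{- int N..int N}. ?f x)"
    using N by (intro sum_mono2) auto
  also have "\<dots> \<le> 1 + 2 * H - 2 * H\<^sup>2 / (H + N)" by (rule ind)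
  also have "\<dots> \<le> 1 + 2 * H" using assms(1) by simp
  finally show ?thesis .
qed

section \<open>Fourier transforms of bump functions\<close>

definition ft :: "(real \<Rightarrow> real) \<Rightarrow> real \<Rightarrow> complex" where
  "ft g s = (LINT v|lborel. of_real (g v) * char1 (- s * v))"

lemma integrable_compact_support:
  fixes g :: "real \<Rightarrow> 'a :: {banach, second_countable_topology}"
  assumes "continuous_on UNIV g" "\<And>x. \<bar>x\<bar> > D \<Longrightarrow> g x = 0"
  shows "integrable lborel g"
proof -
  have "set_integrable lborel {- D..D} g"
    using assms(1) by (intro borel_integrable_atLeastAtMost' continuous_on_subset[OF assms(1)]) auto
  moreover have "(\<lambda>x. indicator {- D..D} x *\<^sub>R g x) = g"
    using assms(2) by (auto simp: fun_eq_iff indicator_def abs_if)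
  ultimately show ?thesis by (simp add: set_integrable_def)
qed

lemma norm_ft_le: "norm (ft g s) \<le> (LINT v|lborel. \<bar>g v\<bar>)"
  unfolding ft_def by (rule integral_norm_bound[THEN order_trans]) (simp add: norm_mult)

text \<open>Integration by parts: the derivative of g(v) e(-s v) has compact support, hence integral
  zero.\<close>

lemma ft_derivative:
  assumes g: "\<And>x. (g has_real_derivative g' x) (at x)" and g': "continuous_on UNIV g'"
    and "\<And>x. \<bar>x\<bar> > D \<Longrightarrow> g x = 0" "\<And>x. \<bar>x\<bar> > D \<Longrightarrow> g' x = 0"
  shows "ft g' s = (2 * pi * s * \<i>) * ft g s"
proof -
  define F where "F = (\<lambda>v. of_real (g v) * char1 (- s * v))"
  define F' where "F' = (\<lambda>v. of_real (g' v) * char1 (- s * v) - (2 * pi * s * \<i>) * (of_real (g v) * char1 (- s * v)))"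
  define E where "E = \<bar>D\<bar> + 1"
  have gc: "continuous_on UNIV g" using g by (meson DERIV_continuous_on has_field_derivative_at_within)
  have int: "integrable lborel (\<lambda>v. of_real (g v) * char1 (- s * v))" "integrable lborel (\<lambda>v. of_real (g' v) * char1 (- s * v))"
    using assms gc by (auto intro!: integrable_compact_support[where D = D] continuous_intros)
  have dF: "(F has_vector_derivative F' v) (at v within X)" for v X
  proof -
    have "((\<lambda>v. of_real (g v) :: complex) has_vector_derivative of_real (g' v)) (at v within X)"
      using g[of v] by (intro has_vector_derivative_of_real)
         (simp add: has_real_derivative_iff_has_vector_derivative[symmetric] has_field_derivative_at_within)
    from has_vector_derivative_mult[OF this has_vector_derivative_char1[of "- s" v X]]
    show ?thesis unfolding F_def F'_def by (simp add: algebra_simps)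
  qed
  have "has_bochner_integral lborel (\<lambda>x. indicator {- E..E} x *\<^sub>R F' x) (F E - F (- E))"
  proof (rule has_bochner_integral_FTC_Icc)
    show "continuous_on {- E..E} F'" unfolding F'_def
      by (intro continuous_intros continuous_on_subset[OF gc] continuous_on_subset[OF g']) auto
  qed (use dF in \<open>auto simp: E_def\<close>)
  moreover have "(\<lambda>x. indicator {- E..E} x *\<^sub>R F' x) = F'"
    using assms(3,4) by (auto simp: fun_eq_iff indicator_def F'_def E_def abs_if)
  moreover have "F E = 0" "F (- E) = 0" using assms(3) by (auto simp: F_def E_def)
  ultimately have "(LINT v|lborel. F' v) = 0" by (simp add: has_bochner_integral_iff)
  thus ?thesis unfolding F'_def ft_def using int by (simp add: integral_mult_right_zero)
qed

lemma smooth_derivatives: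
  assumes "smooth b" "\<And>x. \<bar>x\<bar> > D \<Longrightarrow> b x = 0"
  shows "((deriv ^^ m) b has_real_derivative (deriv ^^ Suc m) b x) (at x)"
    "continuous_on UNIV ((deriv ^^ m) b)" "\<bar>x\<bar> > D \<Longrightarrow> (deriv ^^ m) b x = 0"
proof -
  have d: "((deriv ^^ m) b has_real_derivative (deriv ^^ Suc m) b x) (at x)" for m x
    using assms(1) by (simp add: smooth_def DERIV_deriv_iff_field_differentiable)
  show "((deriv ^^ m) b has_real_derivative (deriv ^^ Suc m) b x) (at x)" by (rule d)
  show "continuous_on UNIV ((deriv ^^ m) b)"
    by (rule DERIV_continuous_on) (use d in \<open>auto intro: has_field_derivative_at_within\<close>)
  show "\<bar>x\<bar> > D \<Longrightarrow> (deriv ^^ m) b x = 0"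
  proof (induction m arbitrary: x)
    case 0
    thus ?case using assms(2) by simp
  next
    case (Suc m)
    have op: "open {x :: real. \<bar>x\<bar> > D}" by (intro open_Collect_less continuous_intros)
    have "((\<lambda>x. 0) has_real_derivative 0) (at x)" by simp
    hence "((deriv ^^ m) b has_real_derivative 0) (at x)"
      by (rule has_field_derivative_transform_within_open[OF _ op]) (use Suc in auto)
    from DERIV_unique[OF this d] show ?case by simp
  qed
qed

text \<open>Differentiating L times multiplies the transform by (2 \<pi> i s)^L while the L^1 norm
  stays finite; the trivial bound \<open>K 0\<close> takes care of small s.\<close>

lemma ft_rapid_decay:
  assumes "smooth b" "\<And>x. \<bar>x\<bar> > D \<Longrightarrow> b x = 0"
  shows "\<exists>C\<ge>0. \<forall>s. norm (ft b s) \<le> C / (1 + \<bar>s\<bar>) ^ L"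
proof -
  note sd = smooth_derivatives[where D = D, OF assms]
  have ftm: "ft ((deriv ^^ m) b) s = (2 * pi * s * \<i>) ^ m * ft b s" for m s
  proof (induction m)
    case (Suc m)
    have "ft ((deriv ^^ Suc m) b) s = (2 * pi * s * \<i>) * ft ((deriv ^^ m) b) s"
      by (rule ft_derivative[where D = D, OF sd(1) sd(2) sd(3) sd(3)])
    thus ?case using Suc by simp
  qed auto
  define K where "K = (\<lambda>m. LINT v|lborel. \<bar>(deriv ^^ m) b v\<bar>)"
  have K0: "0 \<le> K m" for m by (simp add: K_def)
  have KL: "\<bar>s\<bar> ^ L * norm (ft b s) \<le> K L" for s
  proof -
    have "\<bar>s\<bar> \<le> 2 * pi * \<bar>s\<bar>" using pi_ge_two by (simp add: mult_le_cancel_right1)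
    hence "\<bar>s\<bar> ^ L * norm (ft b s) \<le> (2 * pi * \<bar>s\<bar>) ^ L * norm (ft b s)"
      by (intro mult_right_mono power_mono) auto
    also have "\<dots> = norm (ft ((deriv ^^ L) b) s)"
      by (simp add: ftm norm_mult norm_power)
    also have "\<dots> \<le> K L" unfolding K_def by (rule norm_ft_le)
    finally show ?thesis .
  qed
  have "(1 + \<bar>s\<bar>) ^ L * norm (ft b s) \<le> 2 ^ L * (K 0 + K L)" for s
  proof -
    have "(1 + \<bar>s\<bar>) ^ L \<le> 2 ^ L * (1 + \<bar>s\<bar> ^ L)"
    proof (cases "\<bar>s\<bar> \<le> 1")
      case True
      have "(1 + \<bar>s\<bar>) ^ L \<le> 2 ^ L" using True by (intro power_mono) auto
      also have "\<dots> \<le> 2 ^ L * (1 + \<bar>s\<bar> ^ L)" by simp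
      finally show ?thesis .
    next
      case False
      have "(1 + \<bar>s\<bar>) ^ L \<le> (2 * \<bar>s\<bar>) ^ L" using False by (intro power_mono) auto
      also have "\<dots> \<le> 2 ^ L * (1 + \<bar>s\<bar> ^ L)" by (simp add: power_mult_distrib)
      finally show ?thesis .
    qed
    hence "(1 + \<bar>s\<bar>) ^ L * norm (ft b s) \<le> 2 ^ L * (1 + \<bar>s\<bar> ^ L) * norm (ft b s)"
      by (intro mult_right_mono) auto
    also have "\<dots> = 2 ^ L * (norm (ft b s) + \<bar>s\<bar> ^ L * norm (ft b s))" by (simp add: algebra_simps)
    also have "\<dots> \<le> 2 ^ L * (K 0 + K L)"
      using KL[of s] norm_ft_le[of b s] by (intro mult_left_mono add_mono) (auto simp: K_def)
    finally show ?thesis .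
  qed
  hence "norm (ft b s) \<le> 2 ^ L * (K 0 + K L) / (1 + \<bar>s\<bar>) ^ L" for s
    by (simp add: pos_le_divide_eq mult.commute)
  moreover have "0 \<le> 2 ^ L * (K 0 + K L)" using K0 by simp
  ultimately show ?thesis by blast
qed

section \<open>Fourier series\<close>

text \<open>The period is centred at 0 because the functions to be expanded are supported in
  [-1/2, 1/2], so that their Fourier coefficients are values of \<open>ft\<close>.\<close>

abbreviation (input) period_measure :: "real measure" where
  "period_measure \<equiv> restrict_space lborel {-1/2..1/2}"

lemma finite_measure_period: "finite_measure period_measure"
  by (intro finite_measureI) (simp add: emeasure_restrict_space space_restrict_space)

lemma integrable_period_bounded:
  fixes f :: "real \<Rightarrow> complex"
  assumes "f \<in> borel_measurable borel" "\<And>t. t \<in> {-1/2..1/2} \<Longrightarrow> norm (f t) \<le> B"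
  shows "integrable period_measure f"
proof (rule finite_measure.integrable_const_bound[OF finite_measure_period, where B = B])
  show "f \<in> borel_measurable period_measure" using assms(1) by (simp add: measurable_restrict_space1)
qed (use assms(2) in \<open>auto simp: space_restrict_space\<close>)

lemma integral_period_char1:
  "(LINT t|period_measure. char1 (of_int m * t)) = (if m = 0 then 1 else 0)"
proof (cases "m = 0")
  case True
  thus ?thesis by (simp add: measure_restrict_space space_restrict_space)
next
  case False
  define F where "F = (\<lambda>t. char1 (of_int m * t) / (2 * pi * real_of_int m * \<i>))"
  have dF: "(F has_vector_derivative char1 (of_int m * t)) (at t within X)" for t X
  proof -
    have "(F has_vector_derivative ((2 * pi * real_of_int m * \<i>) * char1 (of_int m * t)) / (2 * pi * real_of_int m * \<i>)) (at t within X)"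
      unfolding F_def by (intro has_vector_derivative_divide has_vector_derivative_char1)
    thus ?thesis using False by simp
  qed
  have hb: "has_bochner_integral lborel (\<lambda>x. indicator {-1/2..1/2} x *\<^sub>R char1 (of_int m * x)) (F (1/2) - F (-1/2))"
    by (rule has_bochner_integral_FTC_Icc) (use dF in \<open>auto intro!: continuous_intros\<close>)
  have "char1 (of_int m * (1/2)) = char1 (of_int m * (-1/2)) * char1 (of_int m)"
    by (simp only: char1_add[symmetric]) simp
  hence "F (1/2) = F (-1/2)" by (simp add: F_def)
  hence "(LINT x|lborel. indicator {-1/2..1/2} x *\<^sub>R char1 (of_int m * x)) = 0"
    using hb by (simp add: has_bochner_integral_iff)
  thus ?thesis using False by (simp add: integral_restrict_space)
qed

lemma borel_measurable_cnj [measurable]: "cnj \<in> borel_measurable borel"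
  by (intro borel_measurable_continuous_onI continuous_intros)

text \<open>Bessel's inequality: in the non-negative integral of |G - S|^2, with S the partial sum,
  all three integrals involving S equal the sum of the |c h|^2.\<close>

lemma bessel_period:
  fixes G :: "real \<Rightarrow> complex"
  assumes G: "G \<in> borel_measurable borel" and B: "\<And>t. t \<in> {-1/2..1/2} \<Longrightarrow> norm (G t) \<le> B" and "finite A"
  defines "c \<equiv> \<lambda>h :: int. LINT t|period_measure. G t * char1 (- of_int h * t)"
  shows "(\<Sum>h\<in>A. (norm (c h))\<^sup>2) \<le> B\<^sup>2"
proof -
  have B0: "0 \<le> B" using order_trans[OF norm_ge_zero B[of 0]] by simp
  have [measurable]: "G \<in> borel_measurable borel" by fact
  define S where "S = (\<lambda>t. \<Sum>h\<in>A. c h * char1 (of_int h * t))"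
  have [measurable]: "S \<in> borel_measurable borel" unfolding S_def by measurable
  have Sb: "norm (S t) \<le> (\<Sum>h\<in>A. norm (c h))" for t
    unfolding S_def by (rule order_trans[OF norm_sum]) (simp add: norm_mult)
  note ipb = integrable_period_bounded
  have i1: "integrable period_measure (\<lambda>t. G t * cnj (G t))"
    by (rule ipb[where B = "B * B"]) (use B B0 in \<open>auto simp: norm_mult intro!: mult_mono\<close>)
  have i2: "integrable period_measure (\<lambda>t. G t * cnj (S t))"
    by (rule ipb[where B = "B * (\<Sum>h\<in>A. norm (c h))"]) (use B B0 Sb in \<open>auto simp: norm_mult intro!: mult_mono\<close>)
  have i3: "integrable period_measure (\<lambda>t. S t * cnj (G t))"
    by (rule ipb[where B = "(\<Sum>h\<in>A. norm (c h)) * B"])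
      (use B B0 Sb in \<open>auto simp: norm_mult intro!: mult_mono sum_nonneg\<close>)
  have i4: "integrable period_measure (\<lambda>t. S t * cnj (S t))"
    by (rule ipb[where B = "(\<Sum>h\<in>A. norm (c h)) * (\<Sum>h\<in>A. norm (c h))"])
      (use Sb in \<open>auto simp: norm_mult intro!: mult_mono sum_nonneg\<close>)
  have iG: "integrable period_measure (\<lambda>t. G t * char1 (- of_int h * t))" for h :: int
    by (rule ipb[where B = B]) (use B in \<open>auto simp: norm_mult\<close>)
  have ie: "integrable period_measure (\<lambda>t. char1 (of_int h * t))" for h :: int
    by (rule ipb[where B = 1]) auto
  define N where "N = (\<Sum>h\<in>A. (norm (c h))\<^sup>2)"
  have GS: "(LINT t|period_measure. G t * cnj (S t)) = of_real N"
  proof -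
    have "(\<lambda>t. G t * cnj (S t)) = (\<lambda>t. \<Sum>h\<in>A. cnj (c h) * (G t * char1 (- of_int h * t)))"
      by (auto simp: S_def sum_distrib_left fun_eq_iff intro!: sum.cong)
    hence "(LINT t|period_measure. G t * cnj (S t)) = (\<Sum>h\<in>A. cnj (c h) * c h)"
      using iG by (simp add: c_def)
    also have "\<dots> = of_real N" unfolding N_def of_real_sum
      by (intro sum.cong refl) (metis complex_norm_square mult.commute of_real_power)
    finally show ?thesis .
  qed
  have SG: "(LINT t|period_measure. S t * cnj (G t)) = of_real N"
  proof -
    have "(LINT t|period_measure. S t * cnj (G t)) = (LINT t|period_measure. cnj (G t * cnj (S t)))"
      by (simp add: mult.commute)
    also have "\<dots> = cnj (LINT t|period_measure. G t * cnj (S t))" by (rule Bochner_Integration.integral_cnj)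
    finally show ?thesis unfolding GS by simp
  qed
  have SS: "(LINT t|period_measure. S t * cnj (S t)) = of_real N"
  proof -
    have "(\<lambda>t. S t * cnj (S t)) = (\<lambda>t. \<Sum>h\<in>A. \<Sum>h'\<in>A. (c h * cnj (c h')) * char1 (of_int (h - h') * t))"
    proof
      fix t
      have e: "char1 (of_int h * t) * char1 (- (of_int h' * t)) = char1 (of_int (h - h') * t)" for h h' :: int
        by (simp add: char1_add[symmetric] left_diff_distrib)
      have "S t * cnj (S t) = (\<Sum>h\<in>A. \<Sum>h'\<in>A. (c h * char1 (of_int h * t)) * (cnj (c h') * char1 (- (of_int h' * t))))"
        by (simp add: S_def sum_product)
      also have "\<dots> = (\<Sum>h\<in>A. \<Sum>h'\<in>A. (c h * cnj (c h')) * (char1 (of_int h * t) * char1 (- (of_int h' * t))))"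
        by (simp only: mult_ac)
      finally show "S t * cnj (S t) = (\<Sum>h\<in>A. \<Sum>h'\<in>A. (c h * cnj (c h')) * char1 (of_int (h - h') * t))"
        unfolding e .
    qed
    hence "(LINT t|period_measure. S t * cnj (S t)) =
        (\<Sum>h\<in>A. \<Sum>h'\<in>A. (c h * cnj (c h')) * (LINT t|period_measure. char1 (of_int (h - h') * t)))"
      using ie by (simp del: of_int_diff)
    also have "\<dots> = (\<Sum>h\<in>A. \<Sum>h'\<in>A. if h' = h then c h * cnj (c h') else 0)"
      unfolding integral_period_char1 by (intro sum.cong) auto
    also have "\<dots> = (\<Sum>h\<in>A. c h * cnj (c h))" using assms(3) by simp
    also have "\<dots> = of_real N" unfolding N_def of_real_sum
      by (intro sum.cong refl) (metis complex_norm_square of_real_power)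
    finally show ?thesis .
  qed
  have diff: "(LINT t|period_measure. (G t - S t) * cnj (G t - S t)) =
      (LINT t|period_measure. G t * cnj (G t)) - of_real N"
  proof -
    have "(\<lambda>t. (G t - S t) * cnj (G t - S t)) =
       (\<lambda>t. (G t * cnj (G t) - G t * cnj (S t)) - (S t * cnj (G t) - S t * cnj (S t)))"
      by (auto simp: algebra_simps)
    hence "(LINT t|period_measure. (G t - S t) * cnj (G t - S t)) = 
       ((LINT t|period_measure. G t * cnj (G t)) - (LINT t|period_measure. G t * cnj (S t)))
       - ((LINT t|period_measure. S t * cnj (G t)) - (LINT t|period_measure. S t * cnj (S t)))"
      using i1 i2 i3 i4 by (simp only: Bochner_Integration.integral_diff Bochner_Integration.integrable_diff)
    thus ?thesis unfolding GS SG SS by simp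
  qed
  have n1: "(\<lambda>t. (G t - S t) * cnj (G t - S t)) = (\<lambda>t. of_real ((norm (G t - S t))\<^sup>2))"
    by (rule ext) (metis complex_norm_square of_real_power)
  have n2: "(\<lambda>t. G t * cnj (G t)) = (\<lambda>t. of_real ((norm (G t))\<^sup>2))"
    by (rule ext) (metis complex_norm_square of_real_power)
  have "complex_of_real (LINT t|period_measure. (norm (G t - S t))\<^sup>2) = of_real ((LINT t|period_measure. (norm (G t))\<^sup>2) - N)"
    using diff unfolding n1 n2 integral_complex_of_real by simp
  hence eq: "(LINT t|period_measure. (norm (G t - S t))\<^sup>2) = (LINT t|period_measure. (norm (G t))\<^sup>2) - N"
    by (simp only: of_real_eq_iff)
  have "0 \<le> (LINT t|period_measure. (norm (G t - S t))\<^sup>2)" by simp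
  moreover have "(LINT t|period_measure. (norm (G t))\<^sup>2) \<le> B\<^sup>2"
  proof -
    have ig: "integrable period_measure (\<lambda>t. (norm (G t))\<^sup>2)"
      by (rule finite_measure.integrable_const_bound[OF finite_measure_period, where B = "B\<^sup>2"])
        (use B in \<open>auto simp: space_restrict_space power_mono measurable_restrict_space1\<close>)
    have ic: "integrable period_measure (\<lambda>t. B\<^sup>2)"
      by (rule finite_measure.integrable_const[OF finite_measure_period])
    have "(LINT t|period_measure. (norm (G t))\<^sup>2) \<le> (LINT t|period_measure. B\<^sup>2)"
      by (rule integral_mono[OF ig ic]) (use B in \<open>auto simp: space_restrict_space power_mono\<close>)
    also have "\<dots> = B\<^sup>2" by (simp add: measure_restrict_space space_restrict_space)
    finally show ?thesis .
  qed
  ultimately show ?thesis using eq unfolding N_def by linarith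
qed

lemma third_le_sin:
  fixes x :: real
  assumes "0 \<le> x" "x \<le> 2"
  shows "x / 3 \<le> sin x"
proof -
  have "\<bar>sin x - (\<Sum>m<3. sin_coeff m * x ^ m)\<bar> \<le> inverse (fact 3) * \<bar>x\<bar> ^ 3"
    by (rule Maclaurin_sin_bound)
  moreover have "(\<Sum>m<3. sin_coeff m * x ^ m) = x"
    by (simp add: numeral_3_eq_3 sin_coeff_def)
  ultimately have "\<bar>sin x - x\<bar> \<le> x ^ 3 / 6" using assms(1) by (simp add: fact_numeral divide_simps)
  hence 1: "x - sin x \<le> x ^ 3 / 6" by linarith
  have "x\<^sup>2 \<le> 2\<^sup>2" using assms by (intro power_mono) auto
  hence "x * x\<^sup>2 \<le> x * 4" using assms by (intro mult_left_mono) auto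
  hence "x ^ 3 \<le> 4 * x" by (simp add: power3_eq_cube power2_eq_square mult.commute)
  thus ?thesis using 1 by simp
qed

lemma norm_char1_minus_1: "norm (char1 u - 1) = 2 * \<bar>sin (pi * u)\<bar>"
proof -
  have "(norm (char1 u - 1))\<^sup>2 = (cos (2 * (pi * u)) - 1)\<^sup>2 + (sin (2 * (pi * u)))\<^sup>2"
    by (simp add: char1_def cmod_power2 mult.assoc)
  also have "\<dots> = ((cos (2 * (pi * u)))\<^sup>2 + (sin (2 * (pi * u)))\<^sup>2) + 1 - 2 * cos (2 * (pi * u))"
    by (simp add: power2_eq_square algebra_simps)
  also have "\<dots> = 2 - 2 * cos (2 * (pi * u))" by simp
  also have "\<dots> = (2 * \<bar>sin (pi * u)\<bar>)\<^sup>2"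
    unfolding cos_double_sin by (simp add: power_mult_distrib)
  finally show ?thesis by (rule power2_eq_imp_eq) auto
qed

lemma abs_le_norm_char1_minus_1:
  assumes "\<bar>u\<bar> \<le> 1 / 2"
  shows "\<bar>u\<bar> \<le> norm (char1 u - 1)"
proof -
  have "pi * \<bar>u\<bar> \<le> pi * (1 / 2)" using assms by (intro mult_left_mono) auto
  hence 1: "pi * \<bar>u\<bar> \<le> 2" using pi_less_4 by linarith
  have "pi * \<bar>u\<bar> / 3 \<le> sin (pi * \<bar>u\<bar>)" by (rule third_le_sin) (use 1 in auto)
  also have "\<dots> \<le> \<bar>sin (pi * u)\<bar>" by (cases "u \<ge> 0") auto
  finally have "2 * (pi * \<bar>u\<bar> / 3) \<le> norm (char1 u - 1)" by (simp add: norm_char1_minus_1)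
  moreover have "\<bar>u\<bar> * 2 \<le> \<bar>u\<bar> * pi" using pi_ge_two by (intro mult_left_mono) auto
  ultimately show ?thesis by (simp add: mult.commute)
qed

text \<open>The quotient G of g(t) - g(x) by e(t - x) - 1 is bounded by the Lipschitz condition.
  Multiplying back shows that the term with index h equals b(h - 1) - b(h), plus g(x) when h = 0.
  Symmetric partial sums telescope, and Bessel's inequality for G sends b to 0. Absolute summability
  then turns the symmetric limit into an unordered sum.\<close>

lemma fourier_series_has_sum:
  fixes g :: "real \<Rightarrow> real"
  assumes lip: "\<And>s t. \<bar>g s - g t\<bar> \<le> \<Lambda> * \<bar>s - t\<bar>" and supp: "\<And>t. 1 / 2 \<le> \<bar>t\<bar> \<Longrightarrow> g t = 0"
    and summ: "(\<lambda>h :: int. norm (ft g (of_int h))) summable_on UNIV"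
    and x: "x \<in> {-1/2..1/2}"
  shows "((\<lambda>h :: int. ft g (of_int h) * char1 (of_int h * x)) has_sum of_real (g x)) UNIV"
proof -
  have L0: "0 \<le> \<Lambda>" using lip[of 1 0] abs_ge_zero order_trans by fastforce
  have gc: "continuous_on UNIV g"
  proof (rule lipschitz_on_continuous_on)
    show "\<Lambda>-lipschitz_on UNIV g" using lip L0 by (intro lipschitz_onI) (auto simp: dist_real_def)
  qed
  have [measurable]: "g \<in> borel_measurable borel" using gc by (rule borel_measurable_continuous_onI)
  \<comment> \<open>Where e(t - x) = 1 the quotient is 0 by the convention for division; there g(t)
    = g(x) by \<open>key\<close>, so that g(t) - g(x) = G(t) (e(t - x) - 1) still holds.\<close>
  define G where "G = (\<lambda>t. of_real (g t - g x) / (char1 (t - x) - 1))"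
  have [measurable]: "G \<in> borel_measurable borel" unfolding G_def by measurable
  have key: "\<bar>g t - g x\<bar> \<le> \<Lambda> * norm (char1 (t - x) - 1)" if t: "t \<in> {-1/2..1/2}" for t
  proof -
    consider "\<bar>t - x\<bar> \<le> 1 / 2" | "1 / 2 < t - x" | "1 / 2 < x - t" by linarith
    thus ?thesis
    proof cases
      case 1
      thus ?thesis using lip[of t x] abs_le_norm_char1_minus_1[OF 1] L0
        by (meson mult_left_mono order_trans)
    next
      case 2
      \<comment> \<open>The points t and x lie near opposite ends of the period; the comparison
        wraps around through 1/2 and -1/2, where g vanishes.\<close>
      have z: "g (1/2) = 0" "g (-1/2) = 0" using supp by auto
      have "\<bar>g t - g x\<bar> \<le> \<bar>g t - g (1/2)\<bar> + \<bar>g (-1/2) - g x\<bar>" unfolding z by linarith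
      also have "\<dots> \<le> \<Lambda> * \<bar>t - 1/2\<bar> + \<Lambda> * \<bar>-1/2 - x\<bar>" using lip by (intro add_mono) auto
      also have "\<dots> = \<Lambda> * (\<bar>t - 1/2\<bar> + \<bar>-1/2 - x\<bar>)" by (simp add: distrib_left)
      also have "\<dots> = \<Lambda> * \<bar>t - x - 1\<bar>" using t x by auto
      also have "\<dots> \<le> \<Lambda> * norm (char1 (t - x - 1) - 1)"
        using t x 2 by (intro mult_left_mono abs_le_norm_char1_minus_1 L0) auto
      also have "char1 (t - x - 1) = char1 (t - x)" using char1_add[of "t - x" "-1"] char1_int[of "-1"] by simp
      finally show ?thesis .
    next
      case 3
      have z: "g (1/2) = 0" "g (-1/2) = 0" using supp by auto
      have "\<bar>g t - g x\<bar> \<le> \<bar>g t - g (-1/2)\<bar> + \<bar>g (1/2) - g x\<bar>" unfolding z by linarith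
      also have "\<dots> \<le> \<Lambda> * \<bar>t - -1/2\<bar> + \<Lambda> * \<bar>1/2 - x\<bar>" using lip[of t "-1/2"] lip[of "1/2" x] by (intro add_mono) auto
      also have "\<dots> = \<Lambda> * (\<bar>t - -1/2\<bar> + \<bar>1/2 - x\<bar>)" by (simp add: distrib_left)
      also have "\<dots> = \<Lambda> * \<bar>t - x + 1\<bar>" using t x by auto
      also have "\<dots> \<le> \<Lambda> * norm (char1 (t - x + 1) - 1)"
        using t x 3 by (intro mult_left_mono abs_le_norm_char1_minus_1 L0) auto
      also have "char1 (t - x + 1) = char1 (t - x)" using char1_add[of "t - x" 1] char1_int[of 1] by simp
      finally show ?thesis .
    qed
  qed
  have Gb: "norm (G t) \<le> \<Lambda>" if "t \<in> {-1/2..1/2}" for t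
  proof (cases "char1 (t - x) = 1")
    case True
    thus ?thesis using L0 by (simp add: G_def)
  next
    case False
    hence "0 < norm (char1 (t - x) - 1)" by simp
    moreover have "norm (G t) = \<bar>g t - g x\<bar> / norm (char1 (t - x) - 1)"
      unfolding G_def norm_divide by (simp only: norm_of_real)
    ultimately show ?thesis using key[OF that] by (simp add: pos_divide_le_eq)
  qed
  define c where "c = (\<lambda>h :: int. LINT t|period_measure. G t * char1 (- of_int h * t))"
  define b where "b = (\<lambda>h :: int. char1 (of_int h * x) * c h)"
  note ipb = integrable_period_bounded
  have iG: "integrable period_measure (\<lambda>t. G t * char1 (- of_int h * t))" for h :: int
    by (rule ipb[where B = \<Lambda>]) (use Gb in \<open>auto simp: norm_mult\<close>)
  have g_le: "\<bar>g t\<bar> \<le> \<bar>g 0\<bar> + \<Lambda>" if "t \<in> {-1/2..1/2}" for t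
  proof -
    have "\<Lambda> * \<bar>t - 0\<bar> \<le> \<Lambda> * 1" using that L0 by (intro mult_left_mono) auto
    thus ?thesis using lip[of t 0] by auto
  qed
  have ig: "integrable period_measure (\<lambda>t. of_real (g t) * char1 (- of_int h * t))" for h :: int
    by (rule ipb[where B = "\<bar>g 0\<bar> + \<Lambda>"]) (use g_le in \<open>auto simp: norm_mult\<close>)
  have ie: "integrable period_measure (\<lambda>t. of_real (g x) * char1 (- of_int h * t))" for h :: int
    by (rule ipb[where B = "\<bar>g x\<bar>"]) (auto simp: norm_mult)
  have ftg: "(LINT t|period_measure. of_real (g t) * char1 (- of_int h * t)) = ft g (of_int h)" for h :: int
  proof -
    have "(\<lambda>t. indicator {-1/2..1/2} t *\<^sub>R (of_real (g t) * char1 (- of_int h * t))) = (\<lambda>t. of_real (g t) * char1 (- of_int h * t))"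
    proof
      fix t :: real
      show "indicator {-1/2..1/2} t *\<^sub>R (of_real (g t) * char1 (- of_int h * t)) = of_real (g t) * char1 (- of_int h * t)"
      proof (cases "t \<in> {-1/2..1/2}")
        case False
        hence "1 / 2 \<le> \<bar>t\<bar>" by auto
        thus ?thesis using supp by simp
      qed simp
    qed
    thus ?thesis by (simp add: integral_restrict_space ft_def)
  qed
  have ident: "ft g (of_int h) * char1 (of_int h * x) = (if h = 0 then of_real (g x) else 0) + b (h - 1) - b h" for h
  proof -
    have pt: "of_real (g t) * char1 (- of_int h * t) - of_real (g x) * char1 (- of_int h * t) =
        char1 (- x) * (G t * char1 (- of_int (h - 1) * t)) - G t * char1 (- of_int h * t)"
      if "t \<in> {-1/2..1/2}" for t
    proof -
      have "of_real (g t - g x) = G t * (char1 (t - x) - 1)"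
      proof (cases "char1 (t - x) = 1")
        case True
        thus ?thesis using key[OF that] by simp
      qed (simp add: G_def)
      hence "of_real (g t - g x) * char1 (- of_int h * t) = G t * char1 (t - x) * char1 (- of_int h * t) - G t * char1 (- of_int h * t)"
        by (simp only: left_diff_distrib right_diff_distrib mult_1_right)
      moreover have "char1 (t - x) * char1 (- of_int h * t) = char1 (- x) * char1 (- of_int (h - 1) * t)"
        by (simp add: char1_add[symmetric] algebra_simps)
      ultimately show ?thesis by (simp add: algebra_simps)
    qed
    have "ft g (of_int h) - of_real (g x) * (LINT t|period_measure. char1 (of_int (- h) * t)) =
       (LINT t|period_measure. of_real (g t) * char1 (- of_int h * t) - of_real (g x) * char1 (- of_int h * t))"
      unfolding Bochner_Integration.integral_diff[OF ig ie] ftg by simp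
    also have "\<dots> = (LINT t|period_measure. char1 (- x) * (G t * char1 (- of_int (h - 1) * t)) - G t * char1 (- of_int h * t))"
      by (intro Bochner_Integration.integral_cong refl pt) (simp add: space_restrict_space)
    also have "\<dots> = char1 (- x) * c (h - 1) - c h"
      using iG[of h] iG[of "h - 1"] unfolding c_def by (simp del: of_int_diff)
    finally have "ft g (of_int h) = (if h = 0 then of_real (g x) else 0) + char1 (- x) * c (h - 1) - c h"
      unfolding integral_period_char1 by (auto simp: algebra_simps)
    hence "ft g (of_int h) * char1 (of_int h * x) =
        ((if h = 0 then of_real (g x) else 0) + char1 (- x) * c (h - 1) - c h) * char1 (of_int h * x)" by simp
    also have "\<dots> = (if h = 0 then of_real (g x) else 0) * char1 (of_int h * x) +
        (char1 (of_int h * x) * char1 (- x)) * c (h - 1) - char1 (of_int h * x) * c h"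
      by (simp only: algebra_simps)
    also have "(if h = 0 then of_real (g x) else 0) * char1 (of_int h * x) = (if h = 0 then of_real (g x) else 0)" by simp
    also have "char1 (of_int h * x) * char1 (- x) = char1 (of_int (h - 1) * x)"
      by (simp add: char1_add[symmetric] algebra_simps)
    finally show ?thesis by (simp add: b_def)
  qed
  have part: "(\<Sum>h\<in>{- int M..int M}. ft g (of_int h) * char1 (of_int h * x)) = of_real (g x) + b (- int M - 1) - b (int M)" for M
  proof (induction M)
    case 0
    thus ?case using ident[of 0] by simp
  next
    case (Suc M)
    have set: "{- int (Suc M)..int (Suc M)} = insert (int (Suc M)) (insert (- int (Suc M)) {- int M..int M})" by auto
    have "(\<Sum>h\<in>{- int (Suc M)..int (Suc M)}. ft g (of_int h) * char1 (of_int h * x)) =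
       ft g (of_int (int (Suc M))) * char1 (of_int (int (Suc M)) * x) +
       (ft g (of_int (- int (Suc M))) * char1 (of_int (- int (Suc M)) * x) +
       (\<Sum>h\<in>{- int M..int M}. ft g (of_int h) * char1 (of_int h * x)))"
      unfolding set by (subst sum.insert, simp, simp, subst sum.insert, simp, simp, simp)
    also have "\<dots> = of_real (g x) + b (- int (Suc M) - 1) - b (int (Suc M))"
    proof -
      have e: "b (int (Suc M) - 1) = b (int M)" "b (- int M - 1) = b (- int (Suc M))"
        by (rule arg_cong[where f = b], simp)+
      have z: "int (Suc M) \<noteq> 0" "- int (Suc M) \<noteq> 0" by auto
      show ?thesis unfolding Suc unfolding ident e if_not_P[OF z(1)] if_not_P[OF z(2)] by (simp del: of_nat_Suc)
    qed
    finally show ?case .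
  qed
  have c_lim: "(\<lambda>M. b (f M)) \<longlonglongrightarrow> 0" if "inj f" for f :: "nat \<Rightarrow> int"
  proof -
    have "summable (\<lambda>M. (norm (c (f M)))\<^sup>2)"
    proof (rule bounded_imp_summable)
      fix N
      have "(\<Sum>M\<le>N. (norm (c (f M)))\<^sup>2) = (\<Sum>h\<in>f ` {..N}. (norm (c h))\<^sup>2)"
        using that by (subst sum.reindex) (auto intro: inj_on_subset)
      also have "\<dots> \<le> \<Lambda>\<^sup>2" unfolding c_def by (rule bessel_period) (use Gb in auto)
      finally show "(\<Sum>M\<le>N. (norm (c (f M)))\<^sup>2) \<le> \<Lambda>\<^sup>2" .
    qed auto
    hence "(\<lambda>M. (norm (c (f M)))\<^sup>2) \<longlonglongrightarrow> 0" by (rule summable_LIMSEQ_zero)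
    hence "(\<lambda>M. sqrt ((norm (c (f M)))\<^sup>2)) \<longlonglongrightarrow> sqrt 0" by (rule tendsto_real_sqrt)
    hence "(\<lambda>M. norm (b (f M))) \<longlonglongrightarrow> 0" by (simp add: b_def norm_mult)
    thus ?thesis by (rule tendsto_norm_zero_cancel)
  qed
  have lim1: "(\<lambda>M. \<Sum>h\<in>{- int M..int M}. ft g (of_int h) * char1 (of_int h * x)) \<longlonglongrightarrow> of_real (g x) + 0 - 0"
    unfolding part by (intro tendsto_intros c_lim) (auto simp: inj_def)
  have "(\<lambda>h :: int. norm (ft g (of_int h) * char1 (of_int h * x))) summable_on UNIV"
    using summ by (simp add: norm_mult)
  hence "(\<lambda>h :: int. ft g (of_int h) * char1 (of_int h * x)) summable_on UNIV"
    by (rule abs_summable_summable)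
  then obtain S where S: "((\<lambda>h :: int. ft g (of_int h) * char1 (of_int h * x)) has_sum S) UNIV"
    by (auto simp: summable_on_def)
  have "filterlim (\<lambda>M. {- int M..int M}) (finite_subsets_at_top UNIV) sequentially"
    unfolding filterlim_finite_subsets_at_top
  proof (intro allI impI)
    fix X :: "int set" assume "finite X \<and> X \<subseteq> UNIV"
    hence X: "finite X" by simp
    have "X \<subseteq> {- int M..int M}" if "nat (\<Sum>x\<in>X. \<bar>x\<bar>) \<le> M" for M
    proof
      fix y assume "y \<in> X"
      hence "\<bar>y\<bar> \<le> (\<Sum>x\<in>X. \<bar>x\<bar>)" using X by (intro member_le_sum) auto
      thus "y \<in> {- int M..int M}" using that by auto
    qed
    thus "\<forall>\<^sub>F M in sequentially. finite {- int M..int M} \<and> X \<subseteq> {- int M..int M} \<and> {- int M..int M} \<subseteq> UNIV"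
      unfolding eventually_sequentially by (intro exI[of _ "nat (\<Sum>x\<in>X. \<bar>x\<bar>)"]) auto
  qed
  from filterlim_compose[OF S[unfolded has_sum_def] this]
  have "(\<lambda>M. \<Sum>h\<in>{- int M..int M}. ft g (of_int h) * char1 (of_int h * x)) \<longlonglongrightarrow> S" .
  from LIMSEQ_unique[OF this lim1] S show ?thesis by simp
qed

section \<open>Integrals of products over coordinates\<close>

text \<open>By \<open>lborel_eq\<close> the measure on vectors is the image of a product measure
  indexed by basis vectors; \<open>ix\<close> translates these back into coordinates, after which
  the product theorems for finite families apply.\<close>

lemma
  fixes f :: "'n::finite \<Rightarrow> real \<Rightarrow> 'a::{real_normed_field, banach, second_countable_topology}"
  assumes "\<And>j. integrable lborel (f j)"
  shows integrable_prod_coordinates: "integrable lborel (\<lambda>x :: real ^ 'n. \<Prod>j\<in>UNIV. f j (x $ j))"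
    and integral_prod_coordinates: "(LINT x|lborel. (\<Prod>j\<in>UNIV. f j ((x :: real ^ 'n) $ j))) = (\<Prod>j\<in>UNIV. (LINT t|lborel. f j t))"
proof -
  interpret product_sigma_finite "\<lambda>_ :: real ^ 'n. lborel :: real measure" ..
  define ix where "ix = (\<lambda>b :: real ^ 'n. THE j. b = axis j 1)"
  have ix: "ix (axis j 1) = j" for j :: 'n
    unfolding ix_def by (rule the_equality) (auto simp: axis_eq_axis)
  have B: "(Basis :: (real ^ 'n) set) = (\<lambda>j. axis j 1) ` UNIV" by (auto simp: Basis_vec_def)
  have inj: "inj (\<lambda>j :: 'n. axis j (1 :: real))" by (auto simp: inj_def axis_eq_axis)
  define T where "T = (\<lambda>g :: real ^ 'n \<Rightarrow> real. \<Sum>b\<in>Basis. g b *\<^sub>R b)"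
  define F where "F = (\<lambda>x :: real ^ 'n. \<Prod>j\<in>UNIV. f j (x $ j))"
  have [measurable]: "f j \<in> borel_measurable borel" for j
    using borel_measurable_integrable[OF assms] by simp
  have [measurable]: "F \<in> borel_measurable borel" unfolding F_def by measurable
  have [measurable]: "T \<in> measurable (\<Pi>\<^sub>M b\<in>Basis. lborel) borel" unfolding T_def by measurable
  have FT: "F (T g) = (\<Prod>b\<in>Basis. f (ix b) (g b))" for g
  proof -
    have "T g $ j = g (axis j 1)" for j
    proof -
      have "T g \<bullet> axis j 1 = g (axis j 1)" unfolding T_def by (rule inner_sum_left_Basis) simp
      thus ?thesis by (simp add: inner_axis)
    qed
    thus ?thesis unfolding F_def B by (subst prod.reindex[OF inj]) (simp add: ix)
  qed
  have int: "integrable (\<Pi>\<^sub>M b\<in>Basis. lborel) (\<lambda>g. \<Prod>b\<in>Basis. f (ix b) (g b))"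
    by (intro product_integrable_prod assms) auto
  have leq: "lborel = distr (\<Pi>\<^sub>M b\<in>(Basis :: (real ^ 'n) set). lborel) borel T" unfolding T_def by (rule lborel_eq)
  have "integrable lborel F"
    by (subst leq, subst integrable_distr_eq) (auto simp: FT int)
  thus "integrable lborel (\<lambda>x :: real ^ 'n. \<Prod>j\<in>UNIV. f j (x $ j))" by (simp add: F_def)
  have "(LINT x|lborel. F x) = (LINT g|(\<Pi>\<^sub>M b\<in>Basis. lborel). F (T g))"
    by (subst leq, subst integral_distr) auto
  also have "\<dots> = (\<Prod>b\<in>Basis. (LINT t|lborel. f (ix b) t))"
    unfolding FT by (intro product_integral_prod assms) auto
  also have "\<dots> = (\<Prod>j\<in>UNIV. (LINT t|lborel. f j t))"
    unfolding B by (subst prod.reindex[OF inj]) (simp add: ix)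
  finally show "(LINT x|lborel. (\<Prod>j\<in>UNIV. f j ((x :: real ^ 'n) $ j))) = (\<Prod>j\<in>UNIV. (LINT t|lborel. f j t))"
    by (simp add: F_def)
qed

definition dotp :: "('n::finite \<Rightarrow> int) \<Rightarrow> real ^ 'n \<Rightarrow> real" where
  "dotp h x = (\<Sum>j\<in>UNIV. of_int (h j) * x $ j)"

lemma dotp_add: "dotp (\<lambda>j. h j + h' j) x = dotp h x + dotp h' x"
  by (simp add: dotp_def distrib_right sum.distrib)

lemma dotp_measurable [measurable]: "dotp h \<in> borel_measurable borel"
  unfolding dotp_def by measurable

lemma char1_dotp: "char1 (dotp h x) = (\<Prod>j\<in>UNIV. char1 (of_int (h j) * x $ j))"
  unfolding dotp_def by (rule char1_sum) simp

lemma indicator_unit_cube: "indicator (cbox 0 1) (x :: real ^ 'n) = (\<Prod>j\<in>UNIV. indicator {0..1} (x $ j) :: real)"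
  by (simp add: indicator_def cbox_interval prod_zero_iff split: if_splits) (auto simp: mem_box_cart less_eq_vec_def intro!: prod.neutral[symmetric])

lemma integral_unit_interval_char1:
  "(LINT t|lborel. indicator {0..1} t *\<^sub>R char1 (of_int m * t)) = (if m = 0 then 1 else 0)"
proof (cases "m = 0")
  case True
  thus ?thesis by simp
next
  case False
  define F where "F = (\<lambda>t. char1 (of_int m * t) / (2 * pi * real_of_int m * \<i>))"
  have dF: "(F has_vector_derivative char1 (of_int m * t)) (at t within X)" for t X
  proof -
    have "(F has_vector_derivative ((2 * pi * real_of_int m * \<i>) * char1 (of_int m * t)) / (2 * pi * real_of_int m * \<i>)) (at t within X)"
      unfolding F_def by (intro has_vector_derivative_divide has_vector_derivative_char1)
    thus ?thesis using False by simp
  qed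
  have hb: "has_bochner_integral lborel (\<lambda>x. indicator {0..1} x *\<^sub>R char1 (of_int m * x)) (F 1 - F 0)"
    by (rule has_bochner_integral_FTC_Icc) (use dF in \<open>auto intro!: continuous_intros\<close>)
  have "F 1 = F 0" by (simp add: F_def)
  thus ?thesis using hb False by (simp add: has_bochner_integral_iff)
qed

lemma integral_cube_char1:
  fixes h :: "'n::finite \<Rightarrow> int"
  shows "(LINT x:cbox 0 1|lborel. char1 (dotp h x)) = (if h = (\<lambda>_. 0) then 1 else 0)"
proof -
  have "indicator (cbox 0 1) x *\<^sub>R char1 (dotp h x) = (\<Prod>j\<in>UNIV. indicator {0..1} (x $ j) *\<^sub>R char1 (of_int (h j) * x $ j))" for x :: "real ^ 'n"
    by (simp add: indicator_unit_cube char1_dotp scaleR_conv_of_real prod.distrib)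
  hence "(LINT x:cbox 0 1|lborel. char1 (dotp h x)) =
     (LINT x|lborel. (\<Prod>j\<in>UNIV. indicator {0..1} ((x :: real ^ 'n) $ j) *\<^sub>R char1 (of_int (h j) * x $ j)))"
    by (simp add: set_lebesgue_integral_def)
  also have "\<dots> = (\<Prod>j\<in>UNIV. (LINT t|lborel. indicator {0..1} t *\<^sub>R char1 (of_int (h j) * t)))"
  proof (rule integral_prod_coordinates)
    fix j
    have "set_integrable lborel {0..1} (\<lambda>t. char1 (of_int (h j) * t))"
      by (intro borel_integrable_atLeastAtMost' continuous_intros)
    thus "integrable lborel (\<lambda>t. indicator {0..1} t *\<^sub>R char1 (of_int (h j) * t))"
      by (simp add: set_integrable_def)
  qed
  also have "\<dots> = (\<Prod>j\<in>UNIV. if h j = 0 then 1 else 0)"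
    unfolding integral_unit_interval_char1 ..
  also have "\<dots> = (if h = (\<lambda>_. 0) then 1 else 0)" by (auto simp: fun_eq_iff)
  finally show ?thesis .
qed

text \<open>Enlarging P to the product of its coordinate projections turns the sum of products into
  a product of sums.\<close>

lemma sum_prod_functions_le:
  fixes f :: "'n::finite \<Rightarrow> 'b \<Rightarrow> real"
  assumes "finite P" and nn: "\<And>j y. 0 \<le> f j y" and le: "\<And>j Y. finite Y \<Longrightarrow> (\<Sum>y\<in>Y. f j y) \<le> c j"
  shows "(\<Sum>g\<in>P. \<Prod>j\<in>UNIV. f j (g j)) \<le> (\<Prod>j\<in>UNIV. c j)"
proof -
  define Y where "Y = (\<lambda>j. (\<lambda>g. g j) ` P)"
  have fY: "finite (Y j)" for j using assms(1) by (simp add: Y_def)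
  have "(\<Sum>g\<in>P. \<Prod>j\<in>UNIV. f j (g j)) \<le> (\<Sum>g\<in>PiE UNIV Y. \<Prod>j\<in>UNIV. f j (g j))"
    using fY by (intro sum_mono2 finite_PiE prod_nonneg nn ballI) (auto simp: Y_def PiE_UNIV_domain)
  also have "\<dots> = (\<Prod>j\<in>UNIV. \<Sum>y\<in>Y j. f j y)"
    using fY by (intro prod_sum_PiE[symmetric]) auto
  also have "\<dots> \<le> (\<Prod>j\<in>UNIV. c j)"
    using fY by (intro prod_mono conjI sum_nonneg nn le)
  finally show ?thesis .
qed

lemma has_sum_prod_functions:
  fixes f :: "'n::finite \<Rightarrow> 'b \<Rightarrow> complex"
  assumes "\<And>j. (\<lambda>y. norm (f j y)) summable_on UNIV" "\<And>j. (f j has_sum S j) UNIV"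
  shows "(\<lambda>g. norm (\<Prod>j\<in>UNIV. f j (g j))) summable_on UNIV"
    "((\<lambda>g. \<Prod>j\<in>UNIV. f j (g j)) has_sum (\<Prod>j\<in>UNIV. S j)) UNIV"
proof -
  have U: "PiE UNIV (\<lambda>_ :: 'n. UNIV :: 'b set) = UNIV" by (auto simp: PiE_UNIV_domain)
  show 1: "(\<lambda>g. norm (\<Prod>j\<in>UNIV. f j (g j))) summable_on UNIV"
  proof (rule nonneg_bdd_above_summable_on)
    show "bdd_above (sum (\<lambda>g. norm (\<Prod>j\<in>UNIV. f j (g j))) ` {F. F \<subseteq> UNIV \<and> finite F})"
    proof (rule bdd_aboveI2)
      fix P :: "('n \<Rightarrow> 'b) set" assume "P \<in> {F. F \<subseteq> UNIV \<and> finite F}"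
      hence "finite P" by simp
      hence "(\<Sum>g\<in>P. \<Prod>j\<in>UNIV. norm (f j (g j))) \<le> (\<Prod>j\<in>UNIV. infsum (\<lambda>y. norm (f j y)) UNIV)"
        by (rule sum_prod_functions_le) (auto intro!: finite_sum_le_infsum assms(1))
      thus "(\<Sum>g\<in>P. norm (\<Prod>j\<in>UNIV. f j (g j))) \<le> (\<Prod>j\<in>UNIV. infsum (\<lambda>y. norm (f j y)) UNIV)"
        by (simp add: prod_norm)
    qed
  qed auto
  have "infsum (\<lambda>g. \<Prod>j\<in>UNIV. f j (g j)) (PiE UNIV (\<lambda>_. UNIV)) = (\<Prod>j\<in>UNIV. infsum (f j) UNIV)"
    by (rule infsum_prod_PiE_abs) (use assms(1) in auto)
  also have "\<dots> = (\<Prod>j\<in>UNIV. S j)" using infsumI[OF assms(2)] by simp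
  finally have "infsum (\<lambda>g. \<Prod>j\<in>UNIV. f j (g j)) UNIV = (\<Prod>j\<in>UNIV. S j)" unfolding U .
  thus "((\<lambda>g. \<Prod>j\<in>UNIV. f j (g j)) has_sum (\<Prod>j\<in>UNIV. S j)) UNIV"
    using abs_summable_summable[OF 1] by (simp add: has_sum_iff)
qed

section \<open>Absolutely convergent trigonometric series\<close>

text \<open>The error is uniform in x because every exponential has modulus 1, so the tail is that
  of the coefficients. A chosen index is forced into X so that the constant term can be split off
  later.\<close>

lemma trig_series_approx:
  fixes C :: "'i \<Rightarrow> complex" and e :: "'i \<Rightarrow> 'x \<Rightarrow> complex"
  assumes "(\<lambda>h. norm (C h)) summable_on UNIV" "\<And>h x. norm (e h x) = 1"
    and "\<And>x. ((\<lambda>h. C h * e h x) has_sum f x) UNIV" and "0 < \<epsilon>"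
  shows "\<exists>X. finite X \<and> h\<^sub>0 \<in> X \<and> (\<forall>x. norm (f x - (\<Sum>h\<in>X. C h * e h x)) \<le> \<epsilon>)"
proof -
  obtain F where F: "finite F" "dist (\<Sum>h\<in>F. norm (C h)) (infsum (\<lambda>h. norm (C h)) UNIV) \<le> \<epsilon>"
    using infsum_finite_approximation[OF assms(1,4)] by auto
  define X where "X = insert h\<^sub>0 F"
  have X: "finite X" using F by (simp add: X_def)
  have tail: "infsum (\<lambda>h. norm (C h)) (UNIV - X) \<le> \<epsilon>"
  proof -
    have "infsum (\<lambda>h. norm (C h)) (UNIV - X) = infsum (\<lambda>h. norm (C h)) UNIV - (\<Sum>h\<in>X. norm (C h))"
      using X by (subst infsum_Diff) (use assms(1) in auto)
    also have "\<dots> \<le> infsum (\<lambda>h. norm (C h)) UNIV - (\<Sum>h\<in>F. norm (C h))"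
      using X by (intro diff_left_mono sum_mono2) (auto simp: X_def)
    also have "\<dots> \<le> \<epsilon>" using F(2) by (simp add: dist_real_def)
    finally show ?thesis .
  qed
  show ?thesis
  proof (intro exI[of _ X] conjI allI X)
    show "h\<^sub>0 \<in> X" by (simp add: X_def)
    fix x
    have abs: "(\<lambda>h. norm (C h * e h x)) summable_on UNIV" using assms(1) by (simp add: norm_mult assms(2))
    have "f x - (\<Sum>h\<in>X. C h * e h x) = infsum (\<lambda>h. C h * e h x) (UNIV - X)"
      using X abs_summable_summable[OF abs] infsumI[OF assms(3)[of x]] by (subst infsum_Diff) auto
    also have "norm \<dots> \<le> infsum (\<lambda>h. norm (C h * e h x)) (UNIV - X)"
      by (rule norm_infsum_bound) (rule summable_on_subset[OF abs], simp)
    also have "\<dots> \<le> \<epsilon>" using tail by (simp add: norm_mult assms(2))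
    finally show "norm (f x - (\<Sum>h\<in>X. C h * e h x)) \<le> \<epsilon>" .
  qed
qed

lemma trig_series_measurable:
  fixes C :: "'i \<Rightarrow> complex" and e :: "'i \<Rightarrow> 'x \<Rightarrow> complex"
  assumes "(\<lambda>h. norm (C h)) summable_on UNIV" "\<And>h x. norm (e h x) = 1"
    and "\<And>x. ((\<lambda>h. C h * e h x) has_sum f x) UNIV" and [measurable]: "\<And>h. e h \<in> borel_measurable M"
  shows "f \<in> borel_measurable M"
proof -
  have "\<forall>m. \<exists>X. \<forall>x. norm (f x - (\<Sum>h\<in>X. C h * e h x)) \<le> 1 / Suc m"
  proof
    fix m
    have "0 < 1 / real (Suc m)" by simp
    from trig_series_approx[of C e f "1 / real (Suc m)" undefined, OF assms(1-3) this]
    show "\<exists>X. \<forall>x. norm (f x - (\<Sum>h\<in>X. C h * e h x)) \<le> 1 / Suc m" by blast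
  qed
  from choice[OF this] obtain X where X: "\<forall>m x. norm (f x - (\<Sum>h\<in>X m. C h * e h x)) \<le> 1 / Suc m" ..
  have lim: "(\<lambda>m. \<Sum>h\<in>X m. C h * e h x) \<longlonglongrightarrow> f x" for x
  proof (rule LIM_zero_cancel, rule Lim_null_comparison)
    show "\<forall>\<^sub>F m in sequentially. norm ((\<Sum>h\<in>X m. C h * e h x) - f x) \<le> 1 / Suc m"
      using X by (simp add: norm_minus_commute)
    show "(\<lambda>m. 1 / real (Suc m)) \<longlonglongrightarrow> 0" using LIMSEQ_inverse_real_of_nat by (simp add: inverse_eq_divide)
  qed
  show ?thesis
  proof (rule borel_measurable_LIMSEQ_metric[where f = "\<lambda>m x. \<Sum>h\<in>X m. C h * e h x"])
    show "(\<lambda>x. \<Sum>h\<in>X m. C h * e h x) \<in> borel_measurable M" for m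
      by (intro borel_measurable_sum borel_measurable_times borel_measurable_const assms(4))
  qed (rule lim)
qed

lemma (in prob_space) norm_expectation_diff_le:
  fixes f g :: "'a \<Rightarrow> complex"
  assumes [measurable]: "f \<in> borel_measurable M" "g \<in> borel_measurable M"
    and "\<And>x. norm (f x) \<le> B" "\<And>x. norm (g x) \<le> B'" "\<And>x. norm (f x - g x) \<le> D"
  shows "norm (expectation f - expectation g) \<le> D"
proof -
  have i1: "integrable M f" by (rule integrable_const_bound[where B = B]) (use assms in auto)
  have i2: "integrable M g" by (rule integrable_const_bound[where B = B']) (use assms in auto)
  note i = i1 i2
  have "norm (expectation f - expectation g) = norm (expectation (\<lambda>x. f x - g x))" using i by simp
  also have "\<dots> \<le> expectation (\<lambda>x. norm (f x - g x))" by (rule integral_norm_bound)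
  also have "\<dots> \<le> expectation (\<lambda>x. D)"
    using i assms by (intro integral_mono) auto
  finally show ?thesis by (simp add: prob_space)
qed

text \<open>Reduces the comparison of two expectations of a product of centred series to finite
  double sums over non-constant frequencies. As \<open>bound\<close> speaks of finite sets only, no
  convergence of the double series has to be discussed; truncation costs an arbitrary
  \<delta>.\<close>

lemma product_expectation_diff_le:
  fixes M M0 :: "'x measure" and C C' :: "'i \<Rightarrow> complex" and e e' :: "'i \<Rightarrow> 'x \<Rightarrow> complex"
  assumes "prob_space M" "prob_space M0"
    and C: "(\<lambda>h. norm (C h)) summable_on UNIV" "\<And>x. ((\<lambda>h. C h * e h x) has_sum f x) UNIV"
    and C': "(\<lambda>h. norm (C' h)) summable_on UNIV" "\<And>x. ((\<lambda>h. C' h * e' h x) has_sum f' x) UNIV"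
    and e: "\<And>h x. norm (e h x) = 1" "\<And>x. e h\<^sub>0 x = 1" "\<And>h. e h \<in> borel_measurable M" "\<And>h. e h \<in> borel_measurable M0"
    and e': "\<And>h x. norm (e' h x) = 1" "\<And>x. e' h\<^sub>0 x = 1" "\<And>h. e' h \<in> borel_measurable M" "\<And>h. e' h \<in> borel_measurable M0"
    and bound: "\<And>X Y. finite X \<Longrightarrow> finite Y \<Longrightarrow> h\<^sub>0 \<notin> X \<Longrightarrow> h\<^sub>0 \<notin> Y \<Longrightarrow>
      (\<Sum>h\<in>X. \<Sum>h'\<in>Y. norm (C h) * norm (C' h') * norm ((LINT x|M. e h x * e' h' x) - (LINT x|M0. e h x * e' h' x))) \<le> B"
  shows "norm ((LINT x|M. (f x - C h\<^sub>0) * (f' x - C' h\<^sub>0)) - (LINT x|M0. (f x - C h\<^sub>0) * (f' x - C' h\<^sub>0))) \<le> B"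
proof (rule field_le_epsilon)
  fix \<delta> :: real assume \<delta>: "0 < \<delta>"
  interpret M: prob_space M by fact
  interpret M0: prob_space M0 by fact
  note [measurable] = e(3,4) e'(3,4)
  define S S' where "S = infsum (\<lambda>h. norm (C h)) UNIV" and "S' = infsum (\<lambda>h. norm (C' h)) UNIV"
  have S0: "0 \<le> S" "0 \<le> S'" by (auto simp: S_def S'_def intro!: infsum_nonneg)
  \<comment> \<open>Truncating both series changes each of the two expectations by at most
    \<epsilon> (S + S' + 1), hence the factor 2.\<close>
  define \<epsilon> where "\<epsilon> = min 1 (\<delta> / (2 * (S + S' + 1)))"
  have \<epsilon>: "0 < \<epsilon>" "\<epsilon> \<le> 1" using \<delta> S0 by (auto simp: \<epsilon>_def)
  have \<epsilon>\<delta>: "2 * (\<epsilon> * (S + S' + 1)) \<le> \<delta>"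
  proof -
    have "\<epsilon> * (2 * (S + S' + 1)) \<le> (\<delta> / (2 * (S + S' + 1))) * (2 * (S + S' + 1))"
      using S0 by (intro mult_right_mono) (auto simp: \<epsilon>_def)
    thus ?thesis using S0 by (simp add: mult_ac)
  qed
  obtain X where X: "finite X" "h\<^sub>0 \<in> X" "\<forall>x. norm (f x - (\<Sum>h\<in>X. C h * e h x)) \<le> \<epsilon>"
    using trig_series_approx[of C e f \<epsilon> h\<^sub>0, OF C(1) e(1) C(2) \<epsilon>(1)] by blast
  obtain Y where Y: "finite Y" "h\<^sub>0 \<in> Y" "\<forall>x. norm (f' x - (\<Sum>h\<in>Y. C' h * e' h x)) \<le> \<epsilon>"
    using trig_series_approx[of C' e' f' \<epsilon> h\<^sub>0, OF C'(1) e'(1) C'(2) \<epsilon>(1)] by blast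
  define P where "P = (\<lambda>x. \<Sum>h\<in>X - {h\<^sub>0}. C h * e h x)"
  define P' where "P' = (\<lambda>x. \<Sum>h\<in>Y - {h\<^sub>0}. C' h * e' h x)"
  define u u' where "u = (\<lambda>x. f x - C h\<^sub>0)" and "u' = (\<lambda>x. f' x - C' h\<^sub>0)"
  have fm: "f \<in> borel_measurable M" "f \<in> borel_measurable M0" "f' \<in> borel_measurable M" "f' \<in> borel_measurable M0"
    using trig_series_measurable[of C e f M, OF C(1) e(1) C(2) e(3)] trig_series_measurable[of C e f M0, OF C(1) e(1) C(2) e(4)]
      trig_series_measurable[of C' e' f' M, OF C'(1) e'(1) C'(2) e'(3)] trig_series_measurable[of C' e' f' M0, OF C'(1) e'(1) C'(2) e'(4)]
    by auto
  have m: "(\<lambda>x. u x * u' x) \<in> borel_measurable M" "(\<lambda>x. u x * u' x) \<in> borel_measurable M0"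
    using fm unfolding u_def u'_def by (auto intro!: borel_measurable_times borel_measurable_diff)
  have mP: "(\<lambda>x. P x * P' x) \<in> borel_measurable M" "(\<lambda>x. P x * P' x) \<in> borel_measurable M0"
    unfolding P_def P'_def by measurable
  have uP: "norm (u x - P x) \<le> \<epsilon>" "norm (u' x - P' x) \<le> \<epsilon>" for x
    using spec[OF X(3), of x] spec[OF Y(3), of x] X(1,2) Y(1,2) e(2) e'(2)
    by (auto simp: u_def u'_def P_def P'_def sum.remove[of X h\<^sub>0] sum.remove[of Y h\<^sub>0] diff_diff_eq)
  have Pb: "norm (P x) \<le> S" "norm (P' x) \<le> S'" for x
  proof -
    have "norm (P x) \<le> (\<Sum>h\<in>X - {h\<^sub>0}. norm (C h))"
      unfolding P_def by (rule order_trans[OF norm_sum]) (simp add: norm_mult e(1))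
    also have "\<dots> \<le> S" unfolding S_def using X(1) by (intro finite_sum_le_infsum C(1)) auto
    finally show "norm (P x) \<le> S" .
    have "norm (P' x) \<le> (\<Sum>h\<in>Y - {h\<^sub>0}. norm (C' h))"
      unfolding P'_def by (rule order_trans[OF norm_sum]) (simp add: norm_mult e'(1))
    also have "\<dots> \<le> S'" unfolding S'_def using Y(1) by (intro finite_sum_le_infsum C'(1)) auto
    finally show "norm (P' x) \<le> S'" .
  qed
  have ub: "norm (u x) \<le> S + 1" "norm (u' x) \<le> S' + 1" for x
    using Pb[of x] uP[of x] \<epsilon>(2) norm_triangle_sub[of "u x" "P x"] norm_triangle_sub[of "u' x" "P' x"] by linarith+
  have b1: "norm (u x * u' x) \<le> (S + 1) * (S' + 1)" for x
    unfolding norm_mult using ub[of x] S0 by (intro mult_mono) auto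
  have b2: "norm (P x * P' x) \<le> S * S'" for x
    unfolding norm_mult using Pb[of x] S0 by (intro mult_mono) auto
  have close: "norm (u x * u' x - P x * P' x) \<le> \<epsilon> * (S + S' + 1)" for x
  proof -
    have "u x * u' x - P x * P' x = u x * (u' x - P' x) + (u x - P x) * P' x" by (simp add: algebra_simps)
    also have "norm \<dots> \<le> norm (u x) * norm (u' x - P' x) + norm (u x - P x) * norm (P' x)"
      by (metis norm_mult norm_triangle_ineq)
    also have "\<dots> \<le> (S + 1) * \<epsilon> + \<epsilon> * S'"
      using ub[of x] uP[of x] Pb[of x] S0 \<epsilon> by (intro add_mono mult_mono) auto
    finally show ?thesis by (simp add: algebra_simps)
  qed
  have d1: "norm ((LINT x|M. u x * u' x) - (LINT x|M. P x * P' x)) \<le> \<epsilon> * (S + S' + 1)"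
    by (rule M.norm_expectation_diff_le[OF m(1) mP(1) b1 b2 close])
  have d2: "norm ((LINT x|M0. u x * u' x) - (LINT x|M0. P x * P' x)) \<le> \<epsilon> * (S + S' + 1)"
    by (rule M0.norm_expectation_diff_le[OF m(2) mP(2) b1 b2 close])
  have PP: "P x * P' x = (\<Sum>h\<in>X - {h\<^sub>0}. \<Sum>h'\<in>Y - {h\<^sub>0}. (C h * C' h') * (e h x * e' h' x))" for x
    unfolding P_def P'_def sum_product by (simp only: mult_ac)
  have ie: "integrable M (\<lambda>x. e h x * e' h' x)" "integrable M0 (\<lambda>x. e h x * e' h' x)" for h h'
    by (rule M.integrable_const_bound[where B = 1] M0.integrable_const_bound[where B = 1], simp add: norm_mult e(1) e'(1), measurable)+
  have "(LINT x|M. P x * P' x) - (LINT x|M0. P x * P' x) =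
     (\<Sum>h\<in>X - {h\<^sub>0}. \<Sum>h'\<in>Y - {h\<^sub>0}. (C h * C' h') * ((LINT x|M. e h x * e' h' x) - (LINT x|M0. e h x * e' h' x)))"
    unfolding PP using ie by (simp add: sum_subtractf right_diff_distrib)
  also have "norm \<dots> \<le> (\<Sum>h\<in>X - {h\<^sub>0}. \<Sum>h'\<in>Y - {h\<^sub>0}. norm (C h) * norm (C' h') * norm ((LINT x|M. e h x * e' h' x) - (LINT x|M0. e h x * e' h' x)))"
    by (intro order_trans[OF norm_sum] sum_mono order_trans[OF norm_sum]) (simp add: norm_mult)
  also have "\<dots> \<le> B" using X(1) Y(1) by (intro bound) auto
  finally have d3: "norm ((LINT x|M. P x * P' x) - (LINT x|M0. P x * P' x)) \<le> B" .
  have "(LINT x|M. u x * u' x) - (LINT x|M0. u x * u' x) =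
     ((LINT x|M. u x * u' x) - (LINT x|M. P x * P' x)) + (((LINT x|M. P x * P' x) - (LINT x|M0. P x * P' x))
     - ((LINT x|M0. u x * u' x) - (LINT x|M0. P x * P' x)))" by simp
  also have "norm \<dots> \<le> \<epsilon> * (S + S' + 1) + (B + \<epsilon> * (S + S' + 1))"
    by (intro order_trans[OF norm_triangle_ineq] add_mono d1 order_trans[OF norm_triangle_ineq4] d2 d3)
  also have "\<dots> \<le> B + \<delta>" using \<epsilon>\<delta> by linarith
  finally show "norm ((LINT x|M. (f x - C h\<^sub>0) * (f' x - C' h\<^sub>0)) - (LINT x|M0. (f x - C h\<^sub>0) * (f' x - C' h\<^sub>0))) \<le> B + \<delta>"
    by (simp add: u_def u'_def)
qed

text \<open>Term by term integration, justified by uniform approximation; it will identify the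
  constant coefficient with the mean over the cube.\<close>

lemma expectation_trig_series:
  fixes M :: "'x measure" and C :: "'i \<Rightarrow> complex" and e :: "'i \<Rightarrow> 'x \<Rightarrow> complex"
  assumes "prob_space M"
    and C: "(\<lambda>h. norm (C h)) summable_on UNIV" "\<And>x. ((\<lambda>h. C h * e h x) has_sum f x) UNIV"
    and e: "\<And>h x. norm (e h x) = 1" "\<And>h. e h \<in> borel_measurable M"
    and orth: "\<And>h. (LINT x|M. e h x) = (if h = h\<^sub>0 then 1 else 0)"
  shows "(LINT x|M. f x) = C h\<^sub>0"
proof -
  interpret M: prob_space M by fact
  note [measurable] = e(2)
  define S where "S = infsum (\<lambda>h. norm (C h)) UNIV"
  have fm: "f \<in> borel_measurable M"
    by (rule trig_series_measurable[of C e f M, OF C(1) e(1) C(2) e(2)])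
  have "norm ((LINT x|M. f x) - C h\<^sub>0) \<le> 0 + \<epsilon>" if \<epsilon>: "0 < \<epsilon>" for \<epsilon>
  proof -
    obtain X where X: "finite X" "h\<^sub>0 \<in> X" "\<forall>x. norm (f x - (\<Sum>h\<in>X. C h * e h x)) \<le> \<epsilon>"
      using trig_series_approx[of C e f \<epsilon> h\<^sub>0, OF C(1) e(1) C(2) \<epsilon>] by blast
    define P where "P = (\<lambda>x. \<Sum>h\<in>X. C h * e h x)"
    have [measurable]: "P \<in> borel_measurable M" unfolding P_def by measurable
    have Pb: "norm (P x) \<le> (\<Sum>h\<in>X. norm (C h))" for x
      unfolding P_def by (rule order_trans[OF norm_sum]) (simp add: norm_mult e(1))
    have fb: "norm (f x) \<le> (\<Sum>h\<in>X. norm (C h)) + \<epsilon>" for x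
      using Pb[of x] spec[OF X(3), of x] norm_triangle_sub[of "f x" "P x"] by (simp add: P_def)
    have ie: "integrable M (e h)" for h
      by (rule M.integrable_const_bound[where B = 1], simp add: e(1), measurable)
    have "(LINT x|M. P x) = (\<Sum>h\<in>X. C h * (LINT x|M. e h x))" unfolding P_def using ie by simp
    also have "\<dots> = (\<Sum>h\<in>X. if h = h\<^sub>0 then C h else 0)" unfolding orth by (intro sum.cong) auto
    also have "\<dots> = C h\<^sub>0" using X(1,2) by simp
    finally have eq: "(LINT x|M. P x) = C h\<^sub>0" .
    have "norm ((LINT x|M. f x) - (LINT x|M. P x)) \<le> \<epsilon>"
      by (rule M.norm_expectation_diff_le[OF fm _ fb Pb]) (use X(3) in \<open>auto simp: P_def\<close>)
    thus ?thesis by (simp add: eq)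
  qed
  hence "norm ((LINT x|M. f x) - C h\<^sub>0) \<le> 0" by (rule field_le_epsilon)
  thus ?thesis by simp
qed

section \<open>The Fourier series of an admissible system\<close>

lemma lipschitz_of_smooth_compact_support:
  assumes "smooth b" "\<And>x. \<bar>x\<bar> > D \<Longrightarrow> b x = 0"
  shows "\<exists>K\<ge>0. \<forall>x y. \<bar>b x - b y\<bar> \<le> K * \<bar>x - y\<bar>"
proof -
  have d: "(b has_real_derivative deriv b x) (at x)" for x
    using smooth_derivatives(1)[where D = D and m = 0, OF assms] by simp
  have c: "continuous_on UNIV (deriv b)"
    using smooth_derivatives(2)[where D = D and m = 1, OF assms] by simp
  have z: "deriv b x = 0" if "\<bar>x\<bar> > D" for x
    using smooth_derivatives(3)[where D = D and m = 1, OF assms that] by simp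
  have "bounded (deriv b ` {- D..D})"
    by (intro compact_imp_bounded compact_continuous_image continuous_on_subset[OF c]) auto
  then obtain K where "\<forall>z\<in>deriv b ` {- D..D}. norm z \<le> K" unfolding bounded_iff by blast
  hence K: "\<bar>deriv b x\<bar> \<le> K" if "x \<in> {- D..D}" for x using that by simp
  have K': "norm (deriv b x) \<le> max K 0" for x
  proof (cases "\<bar>x\<bar> > D")
    case False
    hence "x \<in> {- D..D}" by auto
    from K[OF this] show ?thesis by simp
  qed (simp add: z)
  have "norm (b x - b y) \<le> max K 0 * norm (x - y)" for x y
    by (rule field_differentiable_bound[of UNIV b "deriv b"]) (use d K' in \<open>auto intro: has_field_derivative_at_within\<close>)
  thus ?thesis by (intro exI[of _ "max K 0"]) auto
qed

lemma ft_scale: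
  assumes "0 < s"
  shows "ft (\<lambda>u. b (u / s)) x = of_real s * ft b (s * x)"
proof -
  have "ft (\<lambda>u. b (u / s)) x = \<bar>s\<bar> *\<^sub>R (LINT v|lborel. of_real (b ((0 + s * v) / s)) * char1 (- x * (0 + s * v)))"
    unfolding ft_def by (rule lborel_integral_real_affine) (use assms in auto)
  thus ?thesis using assms by (simp add: ft_def scaleR_conv_of_real mult_ac)
qed

lemma summable_quadratic_decay_int:
  fixes H :: real
  assumes "0 < H" "\<And>x. norm (f x) \<le> K / (1 + \<bar>real_of_int x\<bar> / H)\<^sup>2" "0 \<le> K"
  shows "(\<lambda>x. norm (f x :: complex)) summable_on UNIV"
proof (rule nonneg_bdd_above_summable_on)
  show "bdd_above (sum (\<lambda>x. norm (f x)) ` {F. F \<subseteq> UNIV \<and> finite F})"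
  proof (rule bdd_aboveI2)
    fix F :: "int set" assume "F \<in> {F. F \<subseteq> UNIV \<and> finite F}"
    hence F: "finite F" by simp
    have "(\<Sum>x\<in>F. norm (f x)) \<le> (\<Sum>x\<in>F. K * (1 / (1 + \<bar>real_of_int x\<bar> / H)\<^sup>2))"
      using assms(2) by (intro sum_mono) auto
    also have "\<dots> = K * (\<Sum>x\<in>F. 1 / (1 + \<bar>real_of_int x\<bar> / H)\<^sup>2)" by (simp add: sum_distrib_left)
    also have "\<dots> \<le> K * (1 + 2 * H)"
      using assms F by (intro mult_left_mono sum_quadratic_decay_int_le)
    finally show "(\<Sum>x\<in>F. norm (f x)) \<le> K * (1 + 2 * H)" .
  qed
qed auto

text \<open>Because s \<le> 1/2, the scaled bump fits into one period, and evaluating it at t minus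
  the nearest integer is its periodisation; characters with integer frequency do not see the
  subtracted integer.\<close>

lemma periodized_bump:
  assumes "smooth b" and supp: "\<And>x. 1 \<le> \<bar>x\<bar> \<Longrightarrow> b x = 0" and s: "0 < s" "s \<le> 1 / 2"
  shows "(\<lambda>h :: int. norm (of_real s * ft b (s * of_int h))) summable_on UNIV"
    "((\<lambda>h :: int. of_real s * ft b (s * of_int h) * char1 (of_int h * t)) has_sum of_real (b ((t - of_int (round t)) / s))) UNIV"
proof -
  have supp1: "\<And>x. \<bar>x\<bar> > 1 \<Longrightarrow> b x = 0" using supp by simp
  obtain K where K: "0 \<le> K" "\<And>x. norm (ft b x) \<le> K / (1 + \<bar>x\<bar>)\<^sup>2"
    using ft_rapid_decay[where D = 1, OF assms(1) supp1, of 2] by auto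
  show 1: "(\<lambda>h :: int. norm (of_real s * ft b (s * of_int h))) summable_on UNIV"
  proof (rule summable_quadratic_decay_int[where H = "1 / s" and K = "s * K"])
    fix h :: int
    show "norm (of_real s * ft b (s * of_int h)) \<le> s * K / (1 + \<bar>real_of_int h\<bar> / (1 / s))\<^sup>2"
      using mult_left_mono[OF K(2)[of "s * of_int h"], of s] s(1) by (simp add: norm_mult abs_mult mult_ac)
  qed (use s K in auto)
  obtain \<Lambda> where L: "0 \<le> \<Lambda>" "\<And>x y. \<bar>b x - b y\<bar> \<le> \<Lambda> * \<bar>x - y\<bar>"
    using lipschitz_of_smooth_compact_support[where D = 1, OF assms(1) supp1] by auto
  define x where "x = t - of_int (round t)"
  have x: "x \<in> {-1/2..1/2}" using of_int_round_abs_le[of t] unfolding x_def atLeastAtMost_iff by linarith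
  have "((\<lambda>h :: int. ft (\<lambda>u. b (u / s)) (of_int h) * char1 (of_int h * x)) has_sum of_real (b (x / s))) UNIV"
  proof (rule fourier_series_has_sum[where \<Lambda> = "\<Lambda> / s"])
    fix u v
    have "\<bar>b (u / s) - b (v / s)\<bar> \<le> \<Lambda> * \<bar>u / s - v / s\<bar>" by (rule L(2))
    also have "\<dots> = \<Lambda> / s * \<bar>u - v\<bar>" using s(1) by (simp add: diff_divide_distrib[symmetric])
    finally show "\<bar>b (u / s) - b (v / s)\<bar> \<le> \<Lambda> / s * \<bar>u - v\<bar>" .
  next
    fix u :: real assume u: "1 / 2 \<le> \<bar>u\<bar>"
    have "1 \<le> \<bar>u / s\<bar>" using u s by (simp add: pos_le_divide_eq)
    thus "b (u / s) = 0" by (rule supp)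
  qed (use 1 x s in \<open>simp_all add: ft_scale\<close>)
  moreover have "char1 (of_int h * x) = char1 (of_int h * t)" for h :: int
  proof -
    have "char1 (of_int h * t) = char1 (of_int h * x + of_int (h * round t))" by (simp add: x_def algebra_simps)
    thus ?thesis by (simp only: char1_add char1_int mult_1_right)
  qed
  ultimately show "((\<lambda>h :: int. of_real s * ft b (s * of_int h) * char1 (of_int h * t)) has_sum of_real (b ((t - of_int (round t)) / s))) UNIV"
    using s(1) by (simp add: ft_scale x_def)
qed

text \<open>The description operator ranges over all m, including 0. Truncated subtraction makes
  block 0 the empty set {1..<1}, so membership determines m.\<close>

lemma dyadic_index_eqI:
  assumes "n \<in> dyadic_block m"
  shows "dyadic_index n = m"
  unfolding dyadic_index_def
proof (rule the_equality)
  show "n \<in> dyadic_block m" by fact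
  have *: "m' \<le> m''" if "n \<in> dyadic_block m'" "n \<in> dyadic_block m''" for m' m''
  proof (rule ccontr)
    assume "\<not> m' \<le> m''"
    hence "(2 :: nat) ^ m'' \<le> 2 ^ (m' - 1)" by (intro power_increasing) auto
    moreover have "n < 2 ^ m''" "2 ^ (m' - 1) \<le> n" using that by (auto simp: dyadic_block_def)
    ultimately show False by linarith
  qed
  show "m' = m" if "n \<in> dyadic_block m'" for m' using *[OF assms that] *[OF that assms] by simp
qed

lemma dyadic_index_block:
  assumes "1 \<le> n"
  shows "n \<in> dyadic_block (dyadic_index n)" "1 \<le> dyadic_index n"
proof -
  obtain k where k: "2 ^ k \<le> n" "n < 2 ^ (k + 1)" using ex_power_ivl1[of 2 n] assms by auto
  hence *: "n \<in> dyadic_block (k + 1)" by (simp add: dyadic_block_def)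
  show "n \<in> dyadic_block (dyadic_index n)" "1 \<le> dyadic_index n"
    using * unfolding dyadic_index_eqI[OF *] by simp_all
qed

text \<open>At most n + 2 integers can be nearest to some n t - y with t in [0, 1], each
  contributing an interval of length 2 \<delta> / n, and n + 2 \<le> 3 n.\<close>

lemma measure_near_integers_le:
  fixes y \<delta> :: real
  assumes "1 \<le> n" "0 \<le> \<delta>"
  defines "A \<equiv> {t \<in> {0..1}. \<bar>real n * t - y - of_int (round (real n * t - y))\<bar> < \<delta>}"
  shows "(LINT t|lborel. indicator A t) \<le> 6 * \<delta>" "integrable lborel (indicator A :: real \<Rightarrow> real)"
proof -
  have [measurable]: "A \<in> sets borel" unfolding A_def round_def by measurable
  define Z where "Z = {z :: int. \<bar>of_int z - (real n / 2 - y)\<bar> \<le> real n / 2 + 1 / 2}"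
  have Z: "finite Z" "card Z \<le> real n + 2"
    using card_int_interval[of "real n / 2 + 1 / 2" "real n / 2 - y"] unfolding Z_def by (auto simp: field_simps)
  define J where "J = (\<lambda>z :: int. {(y + of_int z - \<delta>) / n..(y + of_int z + \<delta>) / n})"
  have sub: "A \<subseteq> (\<Union>z\<in>Z. J z)"
  proof
    fix t assume t: "t \<in> A"
    define z where "z = round (real n * t - y)"
    have rz: "\<bar>of_int z - (real n * t - y)\<bar> \<le> 1 / 2" unfolding z_def by (rule of_int_round_abs_le)
    have t01: "0 \<le> t" "t \<le> 1" and d: "\<bar>real n * t - y - of_int z\<bar> < \<delta>" using t by (auto simp: A_def z_def)
    have "0 \<le> real n * t" "real n * t \<le> real n" using t01 by (auto simp: mult_left_le)
    hence "z \<in> Z" using rz unfolding Z_def mem_Collect_eq by linarith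
    moreover have "t \<in> J z" using d assms(1) by (simp add: J_def field_simps abs_less_iff)
    ultimately show "t \<in> (\<Union>z\<in>Z. J z)" by blast
  qed
  have J: "emeasure lborel (J z) = ennreal (2 * \<delta> / n)" for z
  proof -
    have "(y + of_int z - \<delta>) / n \<le> (y + of_int z + \<delta>) / n" using assms by (intro divide_right_mono) auto
    moreover have "(y + of_int z + \<delta>) / n - (y + of_int z - \<delta>) / n = 2 * \<delta> / n"
      by (simp add: diff_divide_distrib[symmetric])
    ultimately show ?thesis by (simp add: J_def)
  qed
  have "emeasure lborel A \<le> emeasure lborel (\<Union>z\<in>Z. J z)" using Z(1) by (intro emeasure_mono sub) (auto simp: J_def)
  also have "\<dots> \<le> (\<Sum>z\<in>Z. emeasure lborel (J z))"
    using Z(1) by (intro emeasure_subadditive_finite) (auto simp: J_def)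
  also have "\<dots> = of_nat (card Z) * ennreal (2 * \<delta> / n)" by (simp add: J)
  also have "\<dots> = ennreal (card Z * (2 * \<delta> / n))"
    using assms(2) by (subst ennreal_mult) (auto simp: ennreal_of_nat_eq_real_of_nat)
  finally have le: "emeasure lborel A \<le> ennreal (card Z * (2 * \<delta> / n))" .
  hence fin: "emeasure lborel A < \<infinity>" using le_less_trans by fastforce
  thus "integrable lborel (indicator A :: real \<Rightarrow> real)" by simp
  have "(LINT t|lborel. indicator A t) = measure lborel A" by simp
  also have "\<dots> \<le> card Z * (2 * \<delta> / n)"
    unfolding measure_def using le assms by (intro enn2real_leI) auto
  also have "\<dots> \<le> (real n + 2) * (2 * \<delta> / n)"
    using Z(2) assms by (intro mult_right_mono) auto
  also have "\<dots> \<le> (3 * real n) * (2 * \<delta> / n)" using assms by (intro mult_right_mono) auto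
  also have "\<dots> = 6 * \<delta>" using assms by simp
  finally show "(LINT t|lborel. indicator A t) \<le> 6 * \<delta>" .
qed

lemma has_sum_finite_sum:
  fixes f :: "'i \<Rightarrow> 'b \<Rightarrow> 'c::topological_comm_monoid_add"
  assumes "finite A" "\<And>i. i \<in> A \<Longrightarrow> (f i has_sum s i) B"
  shows "((\<lambda>x. \<Sum>i\<in>A. f i x) has_sum (\<Sum>i\<in>A. s i)) B"
  using assms by (induction rule: finite_induct) (auto intro!: has_sum_add has_sum_0)

text \<open>Witnesses of \<open>admissible_system\<close>. The type flags are called
  \<open>tp\<close> because \<open>ft\<close> is now the Fourier transform. The normalisation
  \<open>c1 \<le> 1\<close> lets c1 (1 + |h| / H) be compared with 1 + s |h| in
  \<open>norm_coef_le\<close>.\<close>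

locale admissible_data =
  fixes y :: "real ^ 'n" and I :: "nat \<Rightarrow> nat set" and d :: "nat \<Rightarrow> nat \<Rightarrow> 'n \<Rightarrow> real"
    and tp :: "nat \<Rightarrow> nat \<Rightarrow> 'n \<Rightarrow> bool" and w1 w2 :: "real \<Rightarrow> real" and c1 c2 \<tau> :: real
  assumes finI: "\<And>m. 1 \<le> m \<Longrightarrow> finite (I m)"
    and dpos: "\<And>m i j. 1 \<le> m \<Longrightarrow> i \<in> I m \<Longrightarrow> 0 < d m i j"
    and d_le: "\<And>m i j n. 1 \<le> m \<Longrightarrow> i \<in> I m \<Longrightarrow> n \<in> dyadic_block m \<Longrightarrow> d m i j \<le> 1 / (2 * real n)"
    and c1: "0 < c1" "c1 \<le> 1" and c2: "0 < c2"
    and d_lower: "\<And>m i j n. 1 \<le> m \<Longrightarrow> i \<in> I m \<Longrightarrow> n \<in> dyadic_block m \<Longrightarrow>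
      c1 * real n powr (- (1 + 1 / real CARD('n) + \<tau>)) \<le> d m i j"
    and d_upper: "\<And>m i j n. 1 \<le> m \<Longrightarrow> i \<in> I m \<Longrightarrow> n \<in> dyadic_block m \<Longrightarrow>
      d m i j \<le> c2 * real n powr (- (1 + 1 / real CARD('n) - \<tau>))"
    and disj: "\<And>m n. 1 \<le> m \<Longrightarrow> n \<in> dyadic_block m \<Longrightarrow> disjoint_family_on (piece y (d m) (tp m) n) (I m)"
    and w1: "bump {-1<..<1} w1" and w2: "bump {x. 1 / 2 \<le> \<bar>x\<bar> \<and> \<bar>x\<bar> < 1} w2"
begin

abbreviation ix :: "nat \<Rightarrow> nat" where "ix \<equiv> dyadic_index"

definition bb :: "nat \<Rightarrow> nat \<Rightarrow> 'n \<Rightarrow> real \<Rightarrow> real" where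
  "bb n i j = (if tp (ix n) i j then w1 else w2)"

text \<open>Half-width of the bumps in the variable n x - y, in which the function has period
  1.\<close>

definition sz :: "nat \<Rightarrow> nat \<Rightarrow> 'n \<Rightarrow> real" where
  "sz n i j = real n * d (ix n) i j"

text \<open>Fourier coefficient at the frequency n h; the last factor is the phase caused by the
  shift y.\<close>

definition coef :: "nat \<Rightarrow> ('n \<Rightarrow> int) \<Rightarrow> complex" where
  "coef n h = (\<Sum>i\<in>I (ix n). \<Prod>j\<in>UNIV. of_real (sz n i j) * ft (bb n i j) (sz n i j * of_int (h j)) *
     char1 (- (of_int (h j) * y $ j)))"

definition F :: "nat \<Rightarrow> real ^ 'n \<Rightarrow> real" where
  "F = system_function y I d tp w1 w2"

lemma finI': "1 \<le> n \<Longrightarrow> finite (I (ix n))"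
  using finI dyadic_index_block by blast

lemma w_smooth: "smooth w1" "smooth w2"
  using w1 w2 by (auto simp: bump_def)

lemma w_support: "1 \<le> \<bar>x\<bar> \<Longrightarrow> w1 x = 0" "1 \<le> \<bar>x\<bar> \<Longrightarrow> w2 x = 0"
proof -
  assume "1 \<le> \<bar>x\<bar>"
  hence "x \<notin> {-1<..<1}" "x \<notin> {x. 1 / 2 \<le> \<bar>x\<bar> \<and> \<bar>x\<bar> < 1}" by auto
  thus "w1 x = 0" "w2 x = 0" using w1 w2 unfolding bump_def by blast+
qed

lemma w_range: "0 \<le> w1 x" "w1 x \<le> 1" "0 \<le> w2 x" "w2 x \<le> 1"
  using w1 w2 by (auto simp: bump_def image_subset_iff)

lemma bb_props: "smooth (bb n i j)" "1 \<le> \<bar>x\<bar> \<Longrightarrow> bb n i j x = 0" "0 \<le> bb n i j x" "bb n i j x \<le> 1"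
  using w_smooth w_support w_range by (auto simp: bb_def)

lemma sz_bounds:
  assumes "1 \<le> n" "i \<in> I (ix n)"
  shows "0 < sz n i j" "sz n i j \<le> 1 / 2" "c1 * real n powr (- (1 / real CARD('n) + \<tau>)) \<le> sz n i j"
    "sz n i j \<le> c2 * real n powr (- (1 / real CARD('n) - \<tau>))"
proof -
  note b = dyadic_index_block[OF assms(1)]
  have n0: "0 < real n" using assms(1) by simp
  show "0 < sz n i j" using dpos[OF b(2) assms(2)] n0 by (simp add: sz_def)
  have "sz n i j \<le> real n * (1 / (2 * real n))"
    unfolding sz_def using d_le[OF b(2) assms(2) b(1)] n0 by (intro mult_left_mono) auto
  thus "sz n i j \<le> 1 / 2" using n0 by simp
  have p: "real n * real n powr (- (1 + x)) = real n powr (- x)" for x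
    using powr_add[of "real n" 1 "- (1 + x)"] n0 by simp
  have "c1 * (real n * real n powr (- (1 + (1 / real CARD('n) + \<tau>)))) \<le> sz n i j"
    using mult_left_mono[OF d_lower[OF b(2) assms(2) b(1), of j], of "real n"] n0 by (simp add: sz_def mult_ac add_ac)
  thus "c1 * real n powr (- (1 / real CARD('n) + \<tau>)) \<le> sz n i j" unfolding p .
  have "sz n i j \<le> c2 * (real n * real n powr (- (1 + (1 / real CARD('n) - \<tau>))))"
    using mult_left_mono[OF d_upper[OF b(2) assms(2) b(1), of j], of "real n"] n0 by (simp add: sz_def mult_ac add_diff_eq)
  thus "sz n i j \<le> c2 * real n powr (- (1 / real CARD('n) - \<tau>))" unfolding p .
qed

definition fr :: "nat \<Rightarrow> real ^ 'n \<Rightarrow> 'n \<Rightarrow> real" where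
  "fr n x j = (real n * x $ j - y $ j) - of_int (round (real n * x $ j - y $ j))"

text \<open>The condition d \<le> 1/(2 n) makes \<open>sz\<close> at most 1/2, so in the sum over
  the lattice only the nearest point can contribute, and the infinite sum is a single
  product.\<close>

lemma F_eq:
  assumes "1 \<le> n"
  shows "F n x = (\<Sum>i\<in>I (ix n). \<Prod>j\<in>UNIV. bb n i j (fr n x j / sz n i j))"
  unfolding F_def system_function_def Let_def
proof (rule sum.cong[OF refl])
  fix i assume i: "i \<in> I (ix n)"
  define a\<^sub>0 :: "int ^ 'n" where "a\<^sub>0 = (\<chi> j. round (real n * x $ j - y $ j))"
  define G where "G = (\<lambda>a :: int ^ 'n. \<Prod>j\<in>UNIV. (if tp (ix n) i j then w1 else w2) ((x $ j - (of_int (a $ j) + y $ j) / real n) / d (ix n) i j))"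
  have arg: "(x $ j - (of_int (a $ j) + y $ j) / real n) / d (ix n) i j = (real n * x $ j - y $ j - of_int (a $ j)) / sz n i j" for a :: "int ^ 'n" and j
    using assms sz_bounds(1)[OF assms i, of j] by (simp add: sz_def field_simps)
  have G: "G a = (\<Prod>j\<in>UNIV. bb n i j ((real n * x $ j - y $ j - of_int (a $ j)) / sz n i j))" for a
    unfolding G_def arg by (simp add: bb_def)
  have z: "G a = 0" if ne: "a \<noteq> a\<^sub>0" for a
  proof -
    obtain j where j: "a $ j \<noteq> a\<^sub>0 $ j" using ne unfolding vec_eq_iff by blast
    note sb = sz_bounds[OF assms i, of j]
    have "1 / 2 \<le> \<bar>real n * x $ j - y $ j - of_int (a $ j)\<bar>"
    proof (rule ccontr)
      assume "\<not> ?thesis"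
      hence "round (real n * x $ j - y $ j) = a $ j" by (intro round_unique') auto
      thus False using j by (simp add: a\<^sub>0_def)
    qed
    hence "sz n i j \<le> \<bar>real n * x $ j - y $ j - of_int (a $ j)\<bar>" using sb(2) by linarith
    hence "1 \<le> \<bar>(real n * x $ j - y $ j - of_int (a $ j)) / sz n i j\<bar>" using sb(1) by (simp add: pos_le_divide_eq)
    hence "bb n i j ((real n * x $ j - y $ j - of_int (a $ j)) / sz n i j) = 0" by (rule bb_props)
    thus ?thesis unfolding G by (intro prod_zero) auto
  qed
  have "infsum G UNIV = infsum G {a\<^sub>0}" by (rule infsum_cong_neutral) (use z in auto)
  also have "\<dots> = G a\<^sub>0" by simp
  also have "\<dots> = (\<Prod>j\<in>UNIV. bb n i j (fr n x j / sz n i j))" unfolding G by (simp add: fr_def a\<^sub>0_def)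
  finally show "infsum (\<lambda>a :: int ^ 'n. \<Prod>j\<in>UNIV. (if tp (ix n) i j then w1 else w2) ((x $ j - (of_int (a $ j) + y $ j) / real n) / d (ix n) i j)) UNIV =
     (\<Prod>j\<in>UNIV. bb n i j (fr n x j / sz n i j))" by (simp add: G_def)
qed

text \<open>The series of \<open>periodized_bump\<close> are multiplied over the coordinates and
  then added over the finitely many i.\<close>

lemma F_fourier:
  assumes "1 \<le> n"
  shows "(\<lambda>h. norm (coef n h)) summable_on UNIV"
    "((\<lambda>h. coef n h * char1 (dotp (\<lambda>j. int n * h j) x)) has_sum of_real (F n x)) UNIV"
proof -
  define u where "u = (\<lambda>i j (h :: int). of_real (sz n i j) * ft (bb n i j) (sz n i j * of_int h) * char1 (- (of_int h * y $ j)))"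
  have c: "coef n h = (\<Sum>i\<in>I (ix n). \<Prod>j\<in>UNIV. u i j (h j))" for h by (simp add: coef_def u_def)
  have us: "(\<lambda>h. norm (u i j h)) summable_on UNIV" if "i \<in> I (ix n)" for i j
    using periodized_bump(1)[OF bb_props(1,2)[where n = n and i = i and j = j] sz_bounds(1,2)[OF assms that, of j]] by (simp add: u_def norm_mult)
  have us': "(\<lambda>h. norm (u i j h * char1 (of_int h * t))) summable_on UNIV" if "i \<in> I (ix n)" for i j t
    using us[OF that] by (simp add: norm_mult)
  have hs: "((\<lambda>h. u i j h * char1 (of_int h * (real n * x $ j))) has_sum of_real (bb n i j (fr n x j / sz n i j))) UNIV"
    if "i \<in> I (ix n)" for i j
  proof -
    have "char1 (- (of_int h * y $ j)) * char1 (of_int h * (real n * x $ j)) = char1 (of_int h * (real n * x $ j - y $ j))" for h :: int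
      by (simp add: char1_add[symmetric] algebra_simps)
    hence "u i j h * char1 (of_int h * (real n * x $ j)) =
       of_real (sz n i j) * ft (bb n i j) (sz n i j * of_int h) * char1 (of_int h * (real n * x $ j - y $ j))" for h
      by (simp add: u_def mult.assoc)
    thus ?thesis
      using periodized_bump(2)[OF bb_props(1,2)[where n = n and i = i and j = j] sz_bounds(1,2)[OF assms that, of j], of "real n * x $ j - y $ j"]
      by (simp add: fr_def)
  qed
  show "(\<lambda>h. norm (coef n h)) summable_on UNIV"
  proof (rule summable_on_comparison_test)
    show "(\<lambda>h. \<Sum>i\<in>I (ix n). norm (\<Prod>j\<in>UNIV. u i j (h j))) summable_on UNIV"
    proof (rule has_sum_imp_summable, rule has_sum_finite_sum[OF finI'[OF assms]])
      fix i assume i: "i \<in> I (ix n)"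
      show "((\<lambda>h. norm (\<Prod>j\<in>UNIV. u i j (h j))) has_sum infsum (\<lambda>h. norm (\<Prod>j\<in>UNIV. u i j (h j))) UNIV) UNIV"
        using has_sum_infsum[OF has_sum_prod_functions(1)[of "u i", OF us[OF i] has_sum_infsum[OF abs_summable_summable[OF us[OF i]]]]] .
    qed
    show "norm (coef n h) \<le> (\<Sum>i\<in>I (ix n). norm (\<Prod>j\<in>UNIV. u i j (h j)))" for h
      unfolding c by (rule norm_sum)
  qed auto
  have e: "char1 (dotp (\<lambda>j. int n * h j) x) = (\<Prod>j\<in>UNIV. char1 (of_int (h j) * (real n * x $ j)))" for h
    by (simp add: char1_dotp mult_ac)
  have "((\<lambda>h. \<Sum>i\<in>I (ix n). \<Prod>j\<in>UNIV. u i j (h j) * char1 (of_int (h j) * (real n * x $ j))) has_sum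
     (\<Sum>i\<in>I (ix n). \<Prod>j\<in>UNIV. of_real (bb n i j (fr n x j / sz n i j)))) UNIV"
  proof (rule has_sum_finite_sum[OF finI'[OF assms]])
    fix i assume i: "i \<in> I (ix n)"
    show "((\<lambda>h. \<Prod>j\<in>UNIV. u i j (h j) * char1 (of_int (h j) * (real n * x $ j))) has_sum
     (\<Prod>j\<in>UNIV. of_real (bb n i j (fr n x j / sz n i j)))) UNIV"
      by (rule has_sum_prod_functions(2)[OF us'[OF i] hs[OF i]])
  qed
  thus "((\<lambda>h. coef n h * char1 (dotp (\<lambda>j. int n * h j) x)) has_sum of_real (F n x)) UNIV"
    unfolding F_eq[OF assms] c e by (simp add: sum_distrib_right prod.distrib)
qed

end

lemma bump_integral_pos:
  assumes "smooth b" "\<And>x. 1 \<le> \<bar>x\<bar> \<Longrightarrow> b x = 0" "\<And>x. 0 \<le> b x" "b x\<^sub>0 \<noteq> 0"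
  shows "0 < (LINT x|lborel. b x)" "integrable lborel b"
proof -
  have c: "continuous_on UNIV b"
    using smooth_derivatives(2)[where D = 1 and m = 0, OF assms(1)] assms(2) by simp
  show int: "integrable lborel b"
    by (rule integrable_compact_support[where D = 1, OF c]) (use assms(2) in auto)
  define q where "q = b x\<^sub>0 / 2"
  have q: "0 < q" "q < b x\<^sub>0" using assms(3)[of x\<^sub>0] assms(4) by (auto simp: q_def)
  have "isCont b x\<^sub>0" using c by (simp add: continuous_on_eq_continuous_at)
  then obtain r where r: "0 < r" "\<And>x. \<bar>x - x\<^sub>0\<bar> < r \<Longrightarrow> \<bar>b x - b x\<^sub>0\<bar> < q"
    using q(1) unfolding continuous_at_eps_delta dist_real_def by blast
  define J where "J = {x\<^sub>0 - r / 2..x\<^sub>0 + r / 2}"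
  have le: "q * indicator J x \<le> b x" for x
  proof (cases "x \<in> J")
    case True
    hence "\<bar>x - x\<^sub>0\<bar> < r" using r(1) by (auto simp: J_def abs_less_iff)
    from r(2)[OF this] have "q < b x" unfolding q_def by linarith
    thus ?thesis using True by simp
  qed (simp add: assms(3))
  have "0 < q * r" using q r by simp
  also have "\<dots> = (LINT x|lborel. q * indicator J x)" using r(1) by (simp add: J_def)
  also have "\<dots> \<le> (LINT x|lborel. b x)"
    by (rule integral_mono[OF _ int le]) (use r(1) in \<open>simp add: J_def\<close>)
  finally show "0 < (LINT x|lborel. b x)" .
qed

lemma prob_space_cube: "prob_space (restrict_space lborel (cbox 0 1 :: (real ^ 'n) set))"
proof
  have "(\<Prod>b\<in>Basis. (1 :: real ^ 'n) \<bullet> b) = 1"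
    by (rule prod.neutral) (auto simp: Basis_vec_def inner_axis)
  moreover have "\<forall>b\<in>Basis. (0 :: real ^ 'n) \<bullet> b \<le> 1 \<bullet> b" by (auto simp: Basis_vec_def inner_axis)
  ultimately show "emeasure (restrict_space lborel (cbox 0 1 :: (real ^ 'n) set)) (space (restrict_space lborel (cbox 0 1))) = 1"
    by (simp add: space_restrict_space emeasure_restrict_space emeasure_lborel_cbox_eq)
qed

lemma leb_mean_restrict: "leb_mean f = (LINT x|restrict_space lborel (cbox 0 1). f x)"
  by (simp add: leb_mean_def set_lebesgue_integral_def integral_restrict_space)

lemma expectation_cube_char1:
  assumes "1 \<le> n"
  shows "(LINT x|restrict_space lborel (cbox 0 1). char1 (dotp (\<lambda>j. int n * h j) x)) = (if h = (\<lambda>_. 0) then 1 else 0)"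
proof -
  have "((\<lambda>j. int n * h j) = (\<lambda>_. 0)) \<longleftrightarrow> h = (\<lambda>_. 0)" using assms by (auto simp: fun_eq_iff)
  thus ?thesis using integral_cube_char1[of "\<lambda>j. int n * h j"]
    by (simp add: set_lebesgue_integral_def integral_restrict_space)
qed

context admissible_data
begin

lemma coef_0: "1 \<le> n \<Longrightarrow> coef n (\<lambda>_. 0) = of_real (leb_mean (F n))"
proof -
  assume n: "1 \<le> n"
  have "(LINT x|restrict_space lborel (cbox 0 1). complex_of_real (F n x)) = coef n (\<lambda>_. 0)"
    by (rule expectation_trig_series[where e = "\<lambda>h x. char1 (dotp (\<lambda>j. int n * h j) x)", OF prob_space_cube F_fourier[OF n]])
      (auto simp: expectation_cube_char1[OF n] intro!: measurable_restrict_space1)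
  thus ?thesis by (simp add: leb_mean_restrict)
qed

lemma F_measurable: "1 \<le> n \<Longrightarrow> F n \<in> borel_measurable borel"
proof -
  assume n: "1 \<le> n"
  have "(\<lambda>x. complex_of_real (F n x)) \<in> borel_measurable borel"
    by (rule trig_series_measurable[where e = "\<lambda>h x. char1 (dotp (\<lambda>j. int n * h j) x)", OF F_fourier(1)[OF n] _ F_fourier(2)[OF n]]) auto
  hence "(\<lambda>x. Re (complex_of_real (F n x))) \<in> borel_measurable borel" by measurable
  thus ?thesis by simp
qed

text \<open>Lower bound for the mass of either bump function; it converts sums of box volumes into
  multiples of the mean.\<close>

definition \<beta> :: real where "\<beta> = min (LINT x|lborel. w1 x) (LINT x|lborel. w2 x)"

lemma beta: "0 < \<beta>" "\<beta> \<le> (LINT x|lborel. bb n i j x)"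
proof -
  obtain x1 x2 where "w1 x1 \<noteq> 0" "w2 x2 \<noteq> 0" using w1 w2 by (auto simp: bump_def)
  thus "0 < \<beta>" using bump_integral_pos(1)[OF w_smooth(1) w_support(1) w_range(1)] bump_integral_pos(1)[OF w_smooth(2) w_support(2) w_range(3)]
    by (auto simp: \<beta>_def)
  show "\<beta> \<le> (LINT x|lborel. bb n i j x)" by (auto simp: \<beta>_def bb_def)
qed

text \<open>Allows all Fourier coefficients to be measured in units of the mean, the form in which
  the right-hand side of the theorem is stated.\<close>

lemma leb_mean_ge: 
  assumes "1 \<le> n"
  shows "\<beta> ^ CARD('n) * (\<Sum>i\<in>I (ix n). \<Prod>j\<in>UNIV. sz n i j) \<le> leb_mean (F n)"
proof -
  have "ft b 0 = of_real (LINT x|lborel. b x)" for b :: "real \<Rightarrow> real" by (simp add: ft_def)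
  hence "complex_of_real (leb_mean (F n)) = of_real (\<Sum>i\<in>I (ix n). \<Prod>j\<in>UNIV. sz n i j * (LINT x|lborel. bb n i j x))"
    unfolding coef_0[OF assms, symmetric] coef_def by simp
  hence eq: "leb_mean (F n) = (\<Sum>i\<in>I (ix n). \<Prod>j\<in>UNIV. sz n i j * (LINT x|lborel. bb n i j x))"
    by (simp only: of_real_eq_iff)
  have "\<beta> ^ CARD('n) * (\<Sum>i\<in>I (ix n). \<Prod>j\<in>UNIV. sz n i j) = (\<Sum>i\<in>I (ix n). \<Prod>j\<in>UNIV. sz n i j * \<beta>)"
    by (simp add: sum_distrib_left prod.distrib mult.commute)
  also have "\<dots> \<le> leb_mean (F n)" unfolding eq
    using sz_bounds(1)[OF assms] beta by (intro sum_mono prod_mono conjI mult_left_mono mult_nonneg_nonneg) (auto intro: less_imp_le)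
  finally show ?thesis .
qed

lemma leb_mean_nonneg:
  assumes "1 \<le> n"
  shows "0 \<le> leb_mean (F n)"
proof -
  have "0 \<le> \<beta> ^ CARD('n) * (\<Sum>i\<in>I (ix n). \<Prod>j\<in>UNIV. sz n i j)"
    using sz_bounds(1)[OF assms] beta(1) by (intro mult_nonneg_nonneg sum_nonneg prod_nonneg) (auto intro: less_imp_le)
  thus ?thesis using leb_mean_ge[OF assms] by linarith
qed

text \<open>The transform of a bump of width s decays once |h| exceeds 1 / s, and 1 / s is at most H
  / c1 with H = n^(1/k + \<tau>). The remaining sum of volumes is absorbed into the mean by
  \<open>leb_mean_ge\<close>.\<close>

lemma norm_coef_le:
  "\<exists>K\<ge>0. \<forall>n\<ge>1. \<forall>h. norm (coef n h) \<le> K * leb_mean (F n) *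
     (\<Prod>j\<in>UNIV. 1 / (1 + \<bar>real_of_int (h j)\<bar> / real n powr (1 / real CARD('n) + \<tau>)) ^ L)"
proof -
  let ?k = "CARD('n)"
  have s: "\<And>x. \<bar>x\<bar> > 1 \<Longrightarrow> w1 x = 0" "\<And>x. \<bar>x\<bar> > 1 \<Longrightarrow> w2 x = 0" using w_support by auto
  obtain K1 K2 where K: "0 \<le> K1" "\<And>s. norm (ft w1 s) \<le> K1 / (1 + \<bar>s\<bar>) ^ L" "0 \<le> K2" "\<And>s. norm (ft w2 s) \<le> K2 / (1 + \<bar>s\<bar>) ^ L"
    using ft_rapid_decay[where D = 1, OF w_smooth(1) s(1), of L] ft_rapid_decay[where D = 1, OF w_smooth(2) s(2), of L] by auto
  define K0 where "K0 = max K1 K2"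
  have K0: "0 \<le> K0" using K by (simp add: K0_def)
  have bK: "norm (ft (bb n i j) s) \<le> K0 / (1 + \<bar>s\<bar>) ^ L" for n i j s
  proof -
    have "K1 / (1 + \<bar>s\<bar>) ^ L \<le> K0 / (1 + \<bar>s\<bar>) ^ L" "K2 / (1 + \<bar>s\<bar>) ^ L \<le> K0 / (1 + \<bar>s\<bar>) ^ L"
      by (auto simp: K0_def intro!: divide_right_mono)
    thus ?thesis using K(2)[of s] K(4)[of s] by (auto simp: bb_def intro: order_trans)
  qed
  define Kc where "Kc = K0 / c1 ^ L"
  have Kc: "0 \<le> Kc" using K0 c1 by (simp add: Kc_def)
  have main: "norm (coef n h) \<le> (Kc / \<beta>) ^ ?k * leb_mean (F n) *
     (\<Prod>j\<in>UNIV. 1 / (1 + \<bar>real_of_int (h j)\<bar> / real n powr (1 / real ?k + \<tau>)) ^ L)" if n: "1 \<le> n" for n h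
  proof -
    define H where "H = real n powr (1 / real ?k + \<tau>)"
    have H: "0 < H" using n by (simp add: H_def)
    have one: "norm (of_real (sz n i j) * ft (bb n i j) (sz n i j * of_int (h j)) * char1 (- (of_int (h j) * y $ j))) \<le>
        sz n i j * (Kc * (1 / (1 + \<bar>real_of_int (h j)\<bar> / H) ^ L))" if i: "i \<in> I (ix n)" for i j
    proof -
      note sb = sz_bounds[OF n i, of j]
      have "c1 / H \<le> sz n i j"
        using sb(3) unfolding powr_minus_divide H_def by (simp only: times_divide_eq_right mult_1_right)
      hence "c1 / H * \<bar>real_of_int (h j)\<bar> \<le> sz n i j * \<bar>real_of_int (h j)\<bar>" by (intro mult_right_mono) auto
      hence ge: "c1 * (1 + \<bar>real_of_int (h j)\<bar> / H) \<le> 1 + \<bar>sz n i j * real_of_int (h j)\<bar>"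
        using c1 sb(1) by (simp add: abs_mult algebra_simps)
      have "norm (ft (bb n i j) (sz n i j * of_int (h j))) \<le> K0 / (1 + \<bar>sz n i j * real_of_int (h j)\<bar>) ^ L" by (rule bK)
      also have "\<dots> \<le> K0 / (c1 * (1 + \<bar>real_of_int (h j)\<bar> / H)) ^ L"
        using ge K0 c1 H by (intro divide_left_mono power_mono mult_pos_pos zero_less_power) (auto intro!: add_pos_nonneg mult_pos_pos)
      also have "\<dots> = Kc * (1 / (1 + \<bar>real_of_int (h j)\<bar> / H) ^ L)" by (simp add: Kc_def power_mult_distrib)
      finally have f: "norm (ft (bb n i j) (sz n i j * of_int (h j))) \<le> Kc * (1 / (1 + \<bar>real_of_int (h j)\<bar> / H) ^ L)" .
      show ?thesis using mult_left_mono[OF f, of "sz n i j"] sb(1) by (simp add: norm_mult)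
    qed
    have "norm (coef n h) \<le> (\<Sum>i\<in>I (ix n). \<Prod>j\<in>UNIV. sz n i j * (Kc * (1 / (1 + \<bar>real_of_int (h j)\<bar> / H) ^ L)))"
      unfolding coef_def using one
      by (intro order_trans[OF norm_sum] sum_mono) (simp only: prod_norm[symmetric], intro prod_mono conjI norm_ge_zero)
    also have "\<dots> = Kc ^ ?k * (\<Sum>i\<in>I (ix n). \<Prod>j\<in>UNIV. sz n i j) * (\<Prod>j\<in>UNIV. 1 / (1 + \<bar>real_of_int (h j)\<bar> / H) ^ L)"
      by (simp only: prod.distrib prod_constant sum_distrib_left sum_distrib_right mult_ac)
    also have "\<dots> \<le> Kc ^ ?k * (leb_mean (F n) / \<beta> ^ ?k) * (\<Prod>j\<in>UNIV. 1 / (1 + \<bar>real_of_int (h j)\<bar> / H) ^ L)"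
      using leb_mean_ge[OF n] beta(1) Kc H
      by (intro mult_right_mono mult_left_mono prod_nonneg) (auto simp: pos_le_divide_eq mult.commute)
    finally show ?thesis by (simp add: H_def power_divide)
  qed
  show ?thesis
    by (rule exI[of _ "(Kc / \<beta>) ^ ?k"]) (use main Kc beta(1) in auto)
qed

text \<open>The supports of the bump functions match the target intervals of the two types, which
  transfers disjointness from the pieces to the terms of \<open>F_eq\<close>.\<close>

lemma F_nonzero_term:
  assumes "1 \<le> n" "i \<in> I (ix n)" "x \<in> cbox 0 1" "(\<Prod>j\<in>UNIV. bb n i j (fr n x j / sz n i j)) \<noteq> 0"
  shows "x \<in> piece y (d (ix n)) (tp (ix n)) n i" "\<bar>fr n x j\<bar> < sz n i j"
proof -
  have lt: "\<bar>fr n x j\<bar> < sz n i j" and ge: "\<not> tp (ix n) i j \<Longrightarrow> sz n i j / 2 \<le> \<bar>fr n x j\<bar>" for j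
  proof -
    note sb = sz_bounds[OF assms(1,2), of j]
    have nz: "bb n i j (fr n x j / sz n i j) \<noteq> 0" using assms(4) by auto
    hence "\<not> 1 \<le> \<bar>fr n x j / sz n i j\<bar>" using bb_props(2) by blast
    thus "\<bar>fr n x j\<bar> < sz n i j" using sb(1) by (simp add: pos_le_divide_eq)
    assume "\<not> tp (ix n) i j"
    hence "w2 (fr n x j / sz n i j) \<noteq> 0" using nz by (simp add: bb_def)
    hence "1 / 2 \<le> \<bar>fr n x j / sz n i j\<bar>" using w2 unfolding bump_def by blast
    thus "sz n i j / 2 \<le> \<bar>fr n x j\<bar>" using sb(1) by (simp add: pos_le_divide_eq)
  qed
  show "\<bar>fr n x j\<bar> < sz n i j" by (rule lt)
  have "nint_dist (real n * x $ j - y $ j) = \<bar>fr n x j\<bar>" for j by (simp add: nint_dist_def fr_def)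
  thus "x \<in> piece y (d (ix n)) (tp (ix n)) n i"
    using lt ge assms(3) by (auto simp: piece_def target_interval_def sz_def)
qed

text \<open>On the cube at most one term is non-zero by disjointness, so the function lies between 0
  and 1; its support is contained in a product of sets where n t - y_j is within \<delta> of an
  integer. The measure is at most (6 \<delta>)^k, and \<delta>^k = c2^k n^(-1 + k \<tau>).\<close>

lemma leb_mean_le:
  "\<exists>K\<ge>0. \<forall>n\<ge>1. leb_mean (F n) \<le> K * real n powr (- 1 + real CARD('n) * \<tau>)"
proof -
  let ?k = "CARD('n)"
  have main: "leb_mean (F n) \<le> (6 * c2) ^ ?k * real n powr (- 1 + real ?k * \<tau>)" if n: "1 \<le> n" for n
  proof -
    define \<delta> where "\<delta> = c2 * real n powr (- (1 / real ?k - \<tau>))"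
    have \<delta>: "0 \<le> \<delta>" using c2 by (simp add: \<delta>_def)
    define A where "A = (\<lambda>j. {t \<in> {0..1}. \<bar>real n * t - y $ j - of_int (round (real n * t - y $ j))\<bar> < \<delta>})"
    have A: "(LINT t|lborel. indicator (A j) t) \<le> 6 * \<delta>" "integrable lborel (indicator (A j) :: real \<Rightarrow> real)" for j
      unfolding A_def by (rule measure_near_integers_le[OF n \<delta>])+
    define G where "G = (\<lambda>x :: real ^ 'n. \<Prod>j\<in>UNIV. indicator (A j) (x $ j) :: real)"
    have G: "integrable lborel G" "(LINT x|lborel. G x) = (\<Prod>j\<in>UNIV. LINT t|lborel. indicator (A j) t)"
      unfolding G_def using integrable_prod_coordinates[of "\<lambda>j. indicator (A j) :: real \<Rightarrow> real"]
        integral_prod_coordinates[of "\<lambda>j. indicator (A j) :: real \<Rightarrow> real"] A(2) by auto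
    have G0: "0 \<le> G x" for x by (simp add: G_def prod_nonneg)
    have bd: "0 \<le> F n x \<and> F n x \<le> G x" if x: "x \<in> cbox 0 1" for x
    proof -
      let ?t = "\<lambda>i. \<Prod>j\<in>UNIV. bb n i j (fr n x j / sz n i j)"
      have t01: "0 \<le> ?t i" "?t i \<le> 1" for i
        by (auto intro!: prod_nonneg prod_le_1 bb_props)
      show ?thesis
      proof (cases "\<exists>i\<in>I (ix n). ?t i \<noteq> 0")
        case False
        hence "F n x = 0" unfolding F_eq[OF n] by (intro sum.neutral) blast
        thus ?thesis using G0 by simp
      next
        case True
        then obtain i where i: "i \<in> I (ix n)" "?t i \<noteq> 0" by blast
        have others: "?t i' = 0" if "i' \<in> I (ix n) - {i}" for i'
        proof (rule ccontr)
          assume "?t i' \<noteq> 0"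
          hence "x \<in> piece y (d (ix n)) (tp (ix n)) n i'" using F_nonzero_term(1)[OF n _ x] that by blast
          moreover have "x \<in> piece y (d (ix n)) (tp (ix n)) n i" by (rule F_nonzero_term(1)[OF n i(1) x i(2)])
          moreover have "disjoint_family_on (piece y (d (ix n)) (tp (ix n)) n) (I (ix n))"
            by (rule disj) (use dyadic_index_block[OF n] in auto)
          ultimately show False using that i(1) unfolding disjoint_family_on_def by blast
        qed
        have "F n x = ?t i + (\<Sum>i'\<in>I (ix n) - {i}. ?t i')"
          unfolding F_eq[OF n] by (rule sum.remove[OF finI'[OF n] i(1)])
        also have "(\<Sum>i'\<in>I (ix n) - {i}. ?t i') = 0" by (rule sum.neutral) (use others in blast)
        finally have Fi: "F n x = ?t i" by simp
        have "x $ j \<in> A j" for j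
        proof -
          have "\<bar>fr n x j\<bar> < \<delta>"
            using F_nonzero_term(2)[OF n i(1) x i(2), of j] sz_bounds(4)[OF n i(1), of j] by (simp add: \<delta>_def)
          thus ?thesis using x by (auto simp: A_def fr_def mem_box_cart)
        qed
        hence "G x = 1" by (simp add: G_def)
        thus ?thesis using Fi t01[of i] by simp
      qed
    qed
    have [measurable]: "F n \<in> borel_measurable borel" by (rule F_measurable[OF n])
    have "leb_mean (F n) = (LINT x|lborel. indicator (cbox 0 1) x *\<^sub>R F n x)"
      by (simp add: leb_mean_def set_lebesgue_integral_def)
    also have "\<dots> \<le> (LINT x|lborel. G x)"
    proof (rule integral_mono[OF _ G(1)])
      show "integrable lborel (\<lambda>x. indicator (cbox 0 1) x *\<^sub>R F n x)"
        by (rule Bochner_Integration.integrable_bound[OF G(1)]) (use bd G0 in \<open>auto simp: indicator_def\<close>)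
      show "indicator (cbox 0 1) x *\<^sub>R F n x \<le> G x" for x using bd[of x] G0[of x] by (simp add: indicator_def)
    qed
    also have "\<dots> \<le> (\<Prod>j\<in>(UNIV :: 'n set). 6 * \<delta>)"
      unfolding G(2) using A(1) by (intro prod_mono conjI integral_nonneg) auto
    also have "\<dots> = (6 * c2) ^ ?k * (real n powr (- (1 / real ?k - \<tau>))) ^ ?k"
      by (simp add: \<delta>_def power_mult_distrib)
    also have "(real n powr (- (1 / real ?k - \<tau>))) ^ ?k = real n powr (- 1 + real ?k * \<tau>)"
      using n by (simp add: powr_realpow[symmetric] powr_powr algebra_simps)
    finally show ?thesis .
  qed
  show ?thesis by (rule exI[of _ "(6 * c2) ^ ?k"]) (use main c2 in auto)
qed

end

section \<open>Fourier decay of the densities near the hyperplane\<close>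

lemma less_last_idx_iff: "i < last_idx \<longleftrightarrow> i \<noteq> (last_idx :: 'n::{finite,wellorder})"
proof -
  have "i \<le> (last_idx :: 'n)" unfolding last_idx_def by simp
  thus ?thesis by auto
qed

lemma UNIV_last_idx: "(UNIV :: 'n::{finite,wellorder} set) = insert last_idx {..<last_idx}"
  by (auto simp: less_last_idx_iff)

text \<open>One-dimensional factor of \<open>smoothed_box\<close>: the indicator of [-B, B]
  convolved with a scaled bump.\<close>

definition conv_box :: "real \<Rightarrow> real \<Rightarrow> (real \<Rightarrow> real) \<Rightarrow> real \<Rightarrow> real" where
  "conv_box B r b v = (LINT u|lborel. indicator {- B..B} u * b ((v - u) / r))"

text \<open>The transform of a convolution is a product: the indicator contributes at most 2 B, and
  all decay comes from the bump. Fubini applies because the integrand is bounded with support in a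
  rectangle.\<close>

lemma conv_box:
  assumes "smooth b" "\<And>x. \<bar>x\<bar> > 2 \<Longrightarrow> b x = 0" "\<And>x. 0 \<le> b x" "\<And>x. b x \<le> 1" "0 < r" "0 < B"
  shows "integrable lborel (conv_box B r b)" "0 \<le> conv_box B r b v"
    "norm (ft (conv_box B r b) s) \<le> 2 * B * r * norm (ft b (r * s))"
    "ft (conv_box B r b) 0 = of_real (2 * B * r * (LINT x|lborel. b x))"
    "integrable lborel (\<lambda>u. indicator {- B..B} u * b ((v - u) / r))"
proof -
  have bc: "continuous_on UNIV b"
    using smooth_derivatives(2)[where D = 2 and m = 0, OF assms(1,2)] by simp
  have [measurable]: "b \<in> borel_measurable borel" using bc by (rule borel_measurable_continuous_onI)
  define f where "f = (\<lambda>u v. indicator {- B..B} u * b ((v - u) / r))"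
  define E where "E = B + 2 * r"
  have fz: "norm (f u v) \<le> indicator ({- B..B} \<times> {- E..E}) (u, v)" for u v
  proof (cases "u \<in> {- B..B}")
    case True
    show ?thesis
    proof (cases "v \<in> {- E..E}")
      case False
      hence "2 * r < \<bar>v - u\<bar>" using True by (auto simp: E_def)
      hence "2 < \<bar>(v - u) / r\<bar>" using assms(5) by (simp add: pos_less_divide_eq)
      thus ?thesis using assms(2) by (simp add: f_def)
    qed (use True assms(3,4) in \<open>simp add: f_def\<close>)
  qed (simp add: f_def)
  have [measurable]: "(\<lambda>(u, v). f u v) \<in> borel_measurable (lborel \<Otimes>\<^sub>M lborel)" unfolding f_def by measurable
  have fin: "emeasure (lborel \<Otimes>\<^sub>M lborel) ({- B..B} \<times> {- E..E}) < \<infinity>"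
    by (subst lborel.emeasure_pair_measure_Times) (auto simp: ennreal_mult_less_top emeasure_lborel_Icc_eq)
  have ii: "integrable (lborel \<Otimes>\<^sub>M lborel) (indicator ({- B..B} \<times> {- E..E}) :: real \<times> real \<Rightarrow> real)"
    using fin by (intro integrable_real_indicator) auto
  have intf: "integrable (lborel \<Otimes>\<^sub>M lborel) (\<lambda>(u, v). f u v)"
    by (rule Bochner_Integration.integrable_bound[OF ii]) (use fz in auto)
  have intc: "integrable (lborel \<Otimes>\<^sub>M lborel) (\<lambda>(u, v). of_real (f u v) * char1 (- s * v))" for s
    by (rule Bochner_Integration.integrable_bound[OF ii]) (use fz in \<open>auto simp: norm_mult simp del: of_real_mult\<close>)
  have cb: "conv_box B r b v = (LINT u|lborel. f u v)" for v by (simp add: conv_box_def f_def)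
  have cbf: "conv_box B r b = (\<lambda>v. LINT u|lborel. f u v)" by (rule ext) (rule cb)
  show "integrable lborel (conv_box B r b)" unfolding cbf
    using lborel_pair.integrable_snd[of f] intf by simp
  show "0 \<le> conv_box B r b v" unfolding conv_box_def using assms(3) by (intro Bochner_Integration.integral_nonneg) auto
  have bint: "integrable lborel b" by (rule integrable_compact_support[OF bc assms(2)])
  show i1: "integrable lborel (\<lambda>u. indicator {- B..B} u * b ((v - u) / r))" for v
  proof (rule Bochner_Integration.integrable_bound[where f = "indicator {- B..B} :: real \<Rightarrow> real"])
    show "AE u in lborel. norm (indicator {- B..B} u * b ((v - u) / r)) \<le> norm (indicator {- B..B} u :: real)"
      using assms(3,4) by (intro always_eventually allI) (simp add: indicator_def)
    show "integrable lborel (indicator {- B..B} :: real \<Rightarrow> real)"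
      by (intro integrable_real_indicator) (auto simp: emeasure_lborel_Icc_eq)
  qed auto
  have inner: "(LINT v|lborel. of_real (f u v) * char1 (- s * v)) = (indicator {- B..B} u *\<^sub>R char1 (- s * u)) * (of_real r * ft b (r * s))" for u s
  proof -
    have "(LINT v|lborel. of_real (f u v) * char1 (- s * v)) =
       \<bar>r\<bar> *\<^sub>R (LINT v|lborel. of_real (f u (u + r * v)) * char1 (- s * (u + r * v)))"
      by (rule lborel_integral_real_affine) (use assms(5) in auto)
    also have "(\<lambda>v. of_real (f u (u + r * v)) * char1 (- s * (u + r * v))) =
       (\<lambda>v. (indicator {- B..B} u *\<^sub>R char1 (- s * u)) * (of_real (b v) * char1 (- (r * s) * v)))"
    proof
      fix v
      have "char1 (- s * (u + r * v)) = char1 (- s * u) * char1 (- (r * s) * v)"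
        by (simp add: char1_add[symmetric] algebra_simps)
      thus "of_real (f u (u + r * v)) * char1 (- s * (u + r * v)) =
         (indicator {- B..B} u *\<^sub>R char1 (- s * u)) * (of_real (b v) * char1 (- (r * s) * v))"
        using assms(5) by (simp add: f_def scaleR_conv_of_real mult_ac)
    qed
    also have "(LINT v|lborel. (indicator {- B..B} u *\<^sub>R char1 (- s * u)) * (of_real (b v) * char1 (- (r * s) * v))) =
        (indicator {- B..B} u *\<^sub>R char1 (- s * u)) * ft b (r * s)"
      unfolding ft_def by (rule integral_mult_right_zero)
    finally show ?thesis using assms(5) by (simp add: scaleR_conv_of_real mult_ac)
  qed
  have ftc: "ft (conv_box B r b) s = (LINT u|lborel. indicator {- B..B} u *\<^sub>R char1 (- s * u)) * (of_real r * ft b (r * s))" for s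
  proof -
    have "ft (conv_box B r b) s = (LINT v|lborel. (LINT u|lborel. of_real (f u v) * char1 (- s * v)))"
      unfolding ft_def cb by (simp flip: integral_complex_of_real)
    also have "\<dots> = (LINT u|lborel. (LINT v|lborel. of_real (f u v) * char1 (- s * v)))"
      by (rule lborel_pair.Fubini_integral) (rule intc)
    finally show ?thesis unfolding inner integral_mult_left_zero .
  qed
  have "norm (LINT u|lborel. indicator {- B..B} u *\<^sub>R char1 (- s * u)) \<le> (LINT u|lborel. norm (indicator {- B..B} u *\<^sub>R char1 (- s * u)))"
    by (rule integral_norm_bound)
  also have "\<dots> = 2 * B" using assms(6) by simp
  finally have "norm (LINT u|lborel. indicator {- B..B} u *\<^sub>R char1 (- s * u)) * (r * norm (ft b (r * s))) \<le>
      2 * B * (r * norm (ft b (r * s)))"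
    using assms(5) by (intro mult_right_mono) auto
  thus "norm (ft (conv_box B r b) s) \<le> 2 * B * r * norm (ft b (r * s))"
    unfolding ftc norm_mult norm_of_real abs_of_pos[OF assms(5)] by (simp only: mult.assoc)
  have "(\<lambda>u. indicator {- B..B} u *\<^sub>R char1 (- 0 * u)) = (\<lambda>u. complex_of_real (indicator {- B..B} u))"
    by (simp add: scaleR_conv_of_real fun_eq_iff)
  hence "(LINT u|lborel. indicator {- B..B} u *\<^sub>R char1 (- 0 * u)) = complex_of_real (LINT u|lborel. indicator {- B..B} u)"
    by (simp only: integral_complex_of_real)
  also have "(LINT u|lborel. indicator {- B..B} u) = 2 * B" using assms(6) by simp
  finally have "(LINT u|lborel. indicator {- B..B} u *\<^sub>R char1 (- 0 * u)) = of_real (2 * B)" .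
  moreover have "ft b (r * 0) = of_real (LINT x|lborel. b x)" by (simp add: ft_def)
  ultimately show "ft (conv_box B r b) 0 = of_real (2 * B * r * (LINT x|lborel. b x))"
    unfolding ftc by simp
qed

lemma smoothed_box_eq:
  fixes B r :: "'n::{finite,wellorder} \<Rightarrow> real"
  assumes "\<And>i. smooth (\<beta> i)" "\<And>i x. \<bar>x\<bar> > 2 \<Longrightarrow> \<beta> i x = 0" "\<And>i x. 0 \<le> \<beta> i x" "\<And>i x. \<beta> i x \<le> 1"
    and "\<And>i. i < last_idx \<Longrightarrow> 0 < B i \<and> 0 < r i"
  shows "smoothed_box B r \<beta> v = (\<Prod>i<last_idx. conv_box (B i) (r i) (\<beta> i) (v i))"
proof -
  interpret product_sigma_finite "\<lambda>_ :: 'n. lborel :: real measure" ..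
  have "indicator (box_low B) u * bump_low r \<beta> (\<lambda>i. v i - u i) = (\<Prod>i<last_idx. indicator {- B i..B i} (u i) * \<beta> i ((v i - u i) / r i))" for u
  proof -
    have "indicator (box_low B) u = (\<Prod>i<last_idx. indicator {- B i..B i} (u i) :: real)"
    proof (cases "u \<in> box_low B")
      case True
      thus ?thesis by (simp add: box_low_def)
    next
      case False
      then obtain i where "i < last_idx" "u i \<notin> {- B i..B i}" by (auto simp: box_low_def)
      hence "\<exists>i\<in>{..<last_idx}. (indicator {- B i..B i} (u i) :: real) = 0" by (intro bexI[of _ i]) auto
      hence "(\<Prod>i<last_idx. indicator {- B i..B i} (u i) :: real) = 0" by (intro prod_zero) auto
      thus ?thesis using False by simp
    qed
    thus ?thesis by (simp add: bump_low_def prod.distrib)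
  qed
  hence "smoothed_box B r \<beta> v = (LINT u|(\<Pi>\<^sub>M i\<in>{..<last_idx}. lborel). (\<Prod>i<last_idx. indicator {- B i..B i} (u i) * \<beta> i ((v i - u i) / r i)))"
    unfolding smoothed_box_def lebesgue_low_def by simp
  also have "\<dots> = (\<Prod>i<last_idx. (LINT s|lborel. indicator {- B i..B i} s * \<beta> i ((v i - s) / r i)))"
    by (rule product_integral_prod) (use assms in \<open>auto intro!: conv_box(5)\<close>)
  finally show ?thesis by (simp add: conv_box_def)
qed

lemma orthogonal_matrix_cancel:
  fixes Q :: "real ^ 'n ^ 'n"
  assumes "orthogonal_matrix Q"
  shows "Q *v (transpose Q *v x) = x" "transpose Q *v (Q *v x) = x"
proof -
  have "Q ** transpose Q = mat 1" "transpose Q ** Q = mat 1" using assms unfolding orthogonal_matrix_def by auto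
  thus "Q *v (transpose Q *v x) = x" "transpose Q *v (Q *v x) = x"
    unfolding matrix_vector_mul_assoc by (simp_all only: matrix_vector_mul_lid)
qed

lemma orthogonal_matrix_expansion:
  fixes Q :: "real ^ 'n ^ 'n"
  assumes "orthogonal_matrix Q"
  shows "x $ i = (\<Sum>j\<in>UNIV. (transpose Q *v x) $ j * Q $ i $ j)"
proof -
  have "x $ i = (Q *v (transpose Q *v x)) $ i" by (simp only: orthogonal_matrix_cancel[OF assms])
  also have "\<dots> = (\<Sum>j\<in>UNIV. Q $ i $ j * (transpose Q *v x) $ j)"
    unfolding matrix_vector_mult_def[of Q] by (simp only: vec_lambda_beta)
  finally show ?thesis by (simp only: mult.commute)
qed

text \<open>Checked on boxes: the preimage of a box under the motion is the image of a translated
  box under the transpose, and orthogonal maps preserve Lebesgue measure.\<close>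

lemma lborel_distr_orthogonal:
  fixes Q :: "real ^ 'n::{finite,wellorder} ^ 'n::{finite,wellorder}"
  assumes "orthogonal_matrix Q"
  shows "lborel = distr lborel borel (\<lambda>x. Q *v x + t)"
proof (rule lborel_eqI)
  define T where "T = (\<lambda>x. Q *v x + t)"
  have Tm: "T \<in> borel_measurable borel" unfolding T_def
    by (intro borel_measurable_continuous_onI continuous_intros matrix_vector_mult_linear_continuous_on)
  note QQ = orthogonal_matrix_cancel[OF assms]
  fix l u :: "real ^ 'n::{finite,wellorder}" assume le: "\<And>b. b \<in> Basis \<Longrightarrow> l \<bullet> b \<le> u \<bullet> b"
  have vi: "T -` box l u = (\<lambda>x. transpose Q *v x) ` box (l - t) (u - t)"
  proof (intro set_eqI iffI)
    fix x assume "x \<in> T -` box l u"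
    hence "Q *v x \<in> box (l - t) (u - t)" by (auto simp: T_def mem_box algebra_simps)
    moreover have "x = transpose Q *v (Q *v x)" by (simp only: QQ)
    ultimately show "x \<in> (\<lambda>x. transpose Q *v x) ` box (l - t) (u - t)" by blast
  next
    fix x assume "x \<in> (\<lambda>x. transpose Q *v x) ` box (l - t) (u - t)"
    then obtain z where "x = transpose Q *v z" "z \<in> box (l - t) (u - t)" by blast
    moreover from this have "Q *v x = z" by (simp only: QQ)
    ultimately show "x \<in> T -` box l u" by (auto simp: T_def mem_box algebra_simps)
  qed
  have ot: "orthogonal_transformation (\<lambda>x. transpose Q *v x)"
    unfolding orthogonal_transformation_matrix matrix_of_matrix_vector_mul
    using assms by (simp only: matrix_vector_mul_linear orthogonal_matrix_transpose simp_thms)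
  have lm: "box (l - t) (u - t) \<in> lmeasurable" by simp
  have sb: "T -` box l u \<in> sets borel" using measurable_sets[OF Tm, of "box l u"] by simp
  have lm': "T -` box l u \<in> lmeasurable" unfolding vi by (rule measurable_orthogonal_image[OF ot lm])
  have m: "measure lebesgue (T -` box l u) = measure lebesgue (box (l - t) (u - t))"
    unfolding vi by (rule measure_orthogonal_image[OF ot lm])
  have "emeasure (distr lborel borel T) (box l u) = emeasure lborel (T -` box l u)"
    using Tm by (subst emeasure_distr) auto
  also have "\<dots> = emeasure lebesgue (T -` box l u)" using sb by simp
  also have "\<dots> = ennreal (measure lebesgue (T -` box l u))"
    using lm' by (intro emeasure_eq_measure2) auto
  also have "\<dots> = ennreal (\<Prod>b\<in>Basis. (u - l) \<bullet> b)"
  proof -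
    have "(l - t) \<bullet> b \<le> (u - t) \<bullet> b" if "b \<in> Basis" for b using le[OF that] by (simp add: inner_diff_left)
    hence "measure lborel (box (l - t) (u - t)) = (\<Prod>b\<in>Basis. ((u - t) - (l - t)) \<bullet> b)"
      by (intro measure_lborel_box) auto
    thus ?thesis unfolding m by (simp add: measure_completion)
  qed
  finally show "emeasure (distr lborel borel (\<lambda>x. Q *v x + t)) (box l u) = ennreal (\<Prod>b\<in>Basis. (u - l) \<bullet> b)"
    by (simp add: T_def)
qed simp

text \<open>In rotated coordinates the density is a product. The factors other than the last do not
  involve \<eta> and have rapidly decaying transforms; the last one, normalised, has a transform of
  modulus at most 1. Hence there is decay in every direction orthogonal to \<alpha>, uniformly in
  \<eta>.\<close>

lemma mu_properties:
  fixes \<alpha> :: "real ^ 'n::{finite,wellorder}"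
  assumes "mu_data \<alpha> H B r \<beta> Q t"
  shows "\<And>\<eta>. 0 < \<eta> \<Longrightarrow> integrable lborel (mu B r \<beta> Q t \<eta>)" "\<And>\<eta> x. 0 < \<eta> \<Longrightarrow> 0 \<le> mu B r \<beta> Q t \<eta> x"
    "\<And>\<eta>. 0 < \<eta> \<Longrightarrow> (LINT x|lborel. mu B r \<beta> Q t \<eta> x) = 1"
    "\<exists>C\<ge>0. \<forall>\<eta>>0. \<forall>j\<noteq>last_idx. \<forall>h. norm (LINT x|lborel. of_real (mu B r \<beta> Q t \<eta> x) * char1 (dotp h x)) \<le>
       C / (1 + \<bar>(transpose Q *v (\<chi> i. of_int (h i))) $ j\<bar>) ^ L"
proof -
  have Br: "\<And>i. i < last_idx \<Longrightarrow> 0 < B i \<and> 0 < r i" and bump: "\<And>i. bump {-2..2} (\<beta> i)" and orth: "orthogonal_matrix Q"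
    using assms by (auto simp: mu_data_def rotation_matrix_def)
  have supp: "\<beta> i x = 0" if "\<bar>x\<bar> > 2" for i x
  proof -
    have "x \<notin> {-2..2}" using that by auto
    thus ?thesis using bump[of i] unfolding bump_def by blast
  qed
  have sm: "smooth (\<beta> i)" and b01: "0 \<le> \<beta> i x" "\<beta> i x \<le> 1"
    and nz: "\<exists>x. \<beta> i x \<noteq> 0" for i x
    using bump[of i] by (auto simp: bump_def image_subset_iff)
  have ipos: "0 < (LINT x|lborel. \<beta> i x)" and bint: "integrable lborel (\<beta> i)" for i
  proof -
    have c: "continuous_on UNIV (\<beta> i)"
      using smooth_derivatives(2)[where D = 2 and m = 0, OF sm supp, of i] by simp
    show int: "integrable lborel (\<beta> i)" by (rule integrable_compact_support[OF c supp])
    \<comment> \<open>A continuous non-negative function with integral zero vanishes identically,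
      contradicting \<open>nz\<close>.\<close>
    have "(LINT x|lborel. \<beta> i x) \<noteq> 0"
    proof
      assume z: "(LINT x|lborel. \<beta> i x) = 0"
      have "(\<beta> i has_integral 0) UNIV" using has_integral_integral_lborel[OF int] z by simp
      moreover have "\<beta> i integrable_on UNIV" "integral UNIV (\<beta> i) = 0" using calculation by (auto simp: has_integral_iff)
      ultimately have ic: "(\<beta> i has_integral 0) (cbox (- \<bar>x\<bar> - 1) (\<bar>x\<bar> + 1))" for x
      proof -
        have "\<beta> i integrable_on cbox (- \<bar>x\<bar> - 1) (\<bar>x\<bar> + 1)"
          using \<open>\<beta> i integrable_on UNIV\<close> integrable_on_subcbox by blast
        moreover have "integral (cbox (- \<bar>x\<bar> - 1) (\<bar>x\<bar> + 1)) (\<beta> i) \<le> integral UNIV (\<beta> i)"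
          using calculation \<open>\<beta> i integrable_on UNIV\<close> b01 by (intro integral_subset_le) auto
        moreover have "0 \<le> integral (cbox (- \<bar>x\<bar> - 1) (\<bar>x\<bar> + 1)) (\<beta> i)"
          using b01 by (intro Henstock_Kurzweil_Integration.integral_nonneg calculation) auto
        ultimately show ?thesis using \<open>integral UNIV (\<beta> i) = 0\<close> by (auto simp: has_integral_iff)
      qed
      have "\<beta> i x = 0" for x
        by (rule has_integral_0_cbox_imp_0[OF continuous_on_subset[OF c] _ ic[of x]]) (use b01 in \<open>auto simp: box_real\<close>)
      thus False using nz by blast
    qed
    thus "0 < (LINT x|lborel. \<beta> i x)" using Bochner_Integration.integral_nonneg[of lborel "\<beta> i"] b01 by (simp add: less_le)
  qed
  define \<phi> where "\<phi> = (\<lambda>\<eta> j. if j = last_idx then (\<lambda>v. \<beta> last_idx (v / \<eta>)) else conv_box (B j) (r j) (\<beta> j))"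
  have cb: "integrable lborel (conv_box (B j) (r j) (\<beta> j))" "0 \<le> conv_box (B j) (r j) (\<beta> j) v"
    "norm (ft (conv_box (B j) (r j) (\<beta> j)) s) \<le> 2 * B j * r j * norm (ft (\<beta> j) (r j * s))"
    "ft (conv_box (B j) (r j) (\<beta> j)) 0 = of_real (2 * B j * r j * (LINT x|lborel. \<beta> j x))" if "j \<noteq> last_idx" for j v s
    using conv_box(1)[where b = "\<beta> j" and B = "B j" and r = "r j", OF sm supp b01]
      conv_box(2)[where b = "\<beta> j" and B = "B j" and r = "r j" and v = v, OF sm supp b01]
      conv_box(3)[where b = "\<beta> j" and B = "B j" and r = "r j" and s = s, OF sm supp b01]
      conv_box(4)[where b = "\<beta> j" and B = "B j" and r = "r j", OF sm supp b01]
      Br[of j] that unfolding less_last_idx_iff by blast+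
  have \<phi>int: "integrable lborel (\<phi> \<eta> j)" if "0 < \<eta>" for \<eta> j
    using cb(1)[of j] lborel_integrable_real_affine[OF bint[of last_idx], of "1 / \<eta>" 0] that
    by (auto simp: \<phi>_def)
  have \<phi>0: "0 \<le> \<phi> \<eta> j v" for \<eta> j v using cb(2)[of j v] b01 by (auto simp: \<phi>_def)
  define m where "m = (\<lambda>\<eta> j. LINT v|lborel. \<phi> \<eta> j v)"
  have ft0: "ft g 0 = of_real (LINT v|lborel. g v)" for g :: "real \<Rightarrow> real" by (simp add: ft_def)
  have mpos: "0 < m \<eta> j" if "0 < \<eta>" for \<eta> j
  proof (cases "j = last_idx")
    case True
    have "complex_of_real (m \<eta> j) = of_real \<eta> * ft (\<beta> last_idx) (\<eta> * 0)"
      using ft_scale[OF that, of "\<beta> last_idx" 0] ft0[of "\<phi> \<eta> j"] True by (simp add: m_def \<phi>_def)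
    also have "\<dots> = of_real (\<eta> * (LINT x|lborel. \<beta> last_idx x))" by (simp add: ft0)
    finally have "m \<eta> j = \<eta> * (LINT x|lborel. \<beta> last_idx x)" by (simp only: of_real_eq_iff)
    thus ?thesis using that ipos by simp
  next
    case False
    have "complex_of_real (m \<eta> j) = of_real (2 * B j * r j * (LINT x|lborel. \<beta> j x))"
      using cb(4)[OF False] ft0[of "\<phi> \<eta> j"] False by (simp add: m_def \<phi>_def)
    hence "m \<eta> j = 2 * B j * r j * (LINT x|lborel. \<beta> j x)" by (simp only: of_real_eq_iff)
    thus ?thesis using ipos[of j] Br[of j] False unfolding less_last_idx_iff by simp
  qed
  have raw: "mu_dagger_raw B r \<beta> \<eta> x = (\<Prod>j\<in>UNIV. \<phi> \<eta> j (x $ j))" for \<eta> x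
  proof -
    have "mu_dagger_raw B r \<beta> \<eta> x = (\<Prod>j<last_idx. conv_box (B j) (r j) (\<beta> j) (x $ j)) * \<beta> last_idx (x $ last_idx / \<eta>)"
      unfolding mu_dagger_raw_def using smoothed_box_eq[OF sm supp b01 Br, where v = "($) x"] by simp
    also have "(\<Prod>j<last_idx. conv_box (B j) (r j) (\<beta> j) (x $ j)) = (\<Prod>j<last_idx. \<phi> \<eta> j (x $ j))"
      by (intro prod.cong) (auto simp: \<phi>_def)
    finally show ?thesis by (simp add: UNIV_last_idx \<phi>_def mult.commute)
  qed
  have rawint: "integrable lborel (mu_dagger_raw B r \<beta> \<eta>)" "(LINT x|lborel. mu_dagger_raw B r \<beta> \<eta> x) = (\<Prod>j\<in>UNIV. m \<eta> j)" if "0 < \<eta>" for \<eta>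
    using integrable_prod_coordinates[of "\<phi> \<eta>"] integral_prod_coordinates[of "\<phi> \<eta>"] \<phi>int[OF that]
    unfolding raw[abs_def] m_def by auto
  have Mpos: "0 < (\<Prod>j\<in>(UNIV :: 'n set). m \<eta> j)" if "0 < \<eta>" for \<eta> using mpos[OF that] by (intro prod_pos) auto
  define p where "p = (\<lambda>\<eta> x. mu_dagger B r \<beta> \<eta> x)"
  have p: "p \<eta> x = (\<Prod>j\<in>UNIV. \<phi> \<eta> j (x $ j) / m \<eta> j)" if "0 < \<eta>" for \<eta> x
    unfolding p_def mu_dagger_def rawint(2)[OF that] raw by (simp add: prod_dividef)
  define T where "T = (\<lambda>x. Q *v x + t)"
  note QQ = orthogonal_matrix_cancel[OF orth]
  have invT: "inv (rigid_motion Q t) (T x) = x" for x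
  proof -
    have "inj (rigid_motion Q t)"
    proof (rule injI)
      fix x z assume "rigid_motion Q t x = rigid_motion Q t z"
      hence "transpose Q *v (Q *v x) = transpose Q *v (Q *v z)" by (simp add: rigid_motion_def)
      thus "x = z" by (simp only: QQ)
    qed
    from inv_f_f[OF this, of x] show ?thesis by (simp add: rigid_motion_def T_def)
  qed
  have muT: "mu B r \<beta> Q t \<eta> (T x) = p \<eta> x" for \<eta> x unfolding mu_def invT p_def ..
  have mu_inv: "mu B r \<beta> Q t \<eta> x = p \<eta> (transpose Q *v (x - t))" for \<eta> x
  proof -
    have "T (transpose Q *v (x - t)) = x" unfolding T_def QQ by simp
    thus ?thesis using muT[of \<eta> "transpose Q *v (x - t)"] by simp
  qed
  have Tm [measurable]: "T \<in> borel_measurable borel" unfolding T_def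
    by (intro borel_measurable_continuous_onI continuous_intros matrix_vector_mult_linear_continuous_on)
  have Qm: "(\<lambda>x. transpose Q *v (x - t)) \<in> borel_measurable borel"
    by (intro borel_measurable_continuous_onI continuous_intros continuous_on_compose2[OF matrix_vector_mult_linear_continuous_on]) auto
  have pint: "integrable lborel (p \<eta>)" "(LINT x|lborel. p \<eta> x) = 1" if "0 < \<eta>" for \<eta>
  proof -
    have "(LINT z|lborel. mu_dagger_raw B r \<beta> \<eta> z) \<noteq> 0"
      unfolding rawint(2)[OF that] using Mpos[OF that] by (rule less_imp_neq[symmetric])
    thus "integrable lborel (p \<eta>)" "(LINT x|lborel. p \<eta> x) = 1"
      using rawint(1)[OF that] unfolding p_def mu_dagger_def by simp_all
  qed
  have mum: "mu B r \<beta> Q t \<eta> \<in> borel_measurable borel" if "0 < \<eta>" for \<eta>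
    unfolding mu_inv[abs_def] using measurable_compose[OF Qm, of "p \<eta>" borel] borel_measurable_integrable[OF pint(1)[OF that]] by simp
  note leq = lborel_distr_orthogonal[OF orth, of t, folded T_def]
  show "integrable lborel (mu B r \<beta> Q t \<eta>)" if "0 < \<eta>" for \<eta>
    by (subst leq, subst integrable_distr_eq) (use mum[OF that] pint[OF that] muT in auto)
  show "0 \<le> mu B r \<beta> Q t \<eta> x" if "0 < \<eta>" for \<eta> x
    unfolding mu_inv p[OF that] by (intro prod_nonneg ballI divide_nonneg_pos \<phi>0 mpos[OF that])
  show "(LINT x|lborel. mu B r \<beta> Q t \<eta> x) = 1" if "0 < \<eta>" for \<eta>
    by (subst leq, subst integral_distr) (use mum[OF that] pint[OF that] muT in auto)
  have "\<exists>C\<ge>0. \<forall>s. norm (ft (\<phi> \<eta> j) s) / m \<eta> j \<le> C / (1 + \<bar>s\<bar>) ^ L" if j: "j \<noteq> last_idx" and e: "0 < \<eta>" for j \<eta>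
  proof -
    have Bj: "0 < B j" "0 < r j" using Br j unfolding less_last_idx_iff by auto
    obtain C where C: "0 \<le> C" "\<And>s. norm (ft (\<beta> j) s) \<le> C / (1 + \<bar>s\<bar>) ^ L"
      using ft_rapid_decay[where D = 2, OF sm supp, of j L] by auto
    define q where "q = min 1 (r j)"
    have q: "0 < q" "q \<le> 1" "q \<le> r j" using Bj by (auto simp: q_def)
    have "norm (ft (\<phi> \<eta> j) s) / m \<eta> j \<le> (2 * B j * r j * (C / q ^ L) / m \<eta> j) / (1 + \<bar>s\<bar>) ^ L" for s
    proof -
      have "q * \<bar>s\<bar> \<le> r j * \<bar>s\<bar>" using q by (intro mult_right_mono) auto
      hence "q * (1 + \<bar>s\<bar>) \<le> 1 + \<bar>r j * s\<bar>" using q Bj by (simp add: abs_mult algebra_simps)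
      hence "C / (1 + \<bar>r j * s\<bar>) ^ L \<le> C / (q * (1 + \<bar>s\<bar>)) ^ L"
        using q C(1) by (intro divide_left_mono power_mono mult_pos_pos zero_less_power) auto
      hence "norm (ft (\<beta> j) (r j * s)) \<le> (C / q ^ L) / (1 + \<bar>s\<bar>) ^ L"
        using C(2)[of "r j * s"] by (simp add: power_mult_distrib)
      hence "2 * B j * r j * norm (ft (\<beta> j) (r j * s)) \<le> 2 * B j * r j * ((C / q ^ L) / (1 + \<bar>s\<bar>) ^ L)"
        using Bj by (intro mult_left_mono) auto
      hence "norm (ft (\<phi> \<eta> j) s) \<le> 2 * B j * r j * (C / q ^ L) / (1 + \<bar>s\<bar>) ^ L"
        using cb(3)[OF j, of s] j by (simp add: \<phi>_def)
      hence "norm (ft (\<phi> \<eta> j) s) / m \<eta> j \<le> (2 * B j * r j * (C / q ^ L) / (1 + \<bar>s\<bar>) ^ L) / m \<eta> j"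
        using mpos[OF e, of j] by (intro divide_right_mono) auto
      thus ?thesis by (simp add: mult_ac)
    qed
    moreover have "0 \<le> 2 * B j * r j * (C / q ^ L) / m \<eta> j" using Bj C(1) q mpos[OF e, of j] by simp
    ultimately show ?thesis by blast
  qed
  \<comment> \<open>The constants obtained at \<eta> = 1 serve for every \<eta>, since the factors
    with index other than \<open>last_idx\<close> are the same.\<close>
  from this[OF _ zero_less_one] obtain C where C: "\<And>j. j \<noteq> last_idx \<Longrightarrow> 0 \<le> C j"
    "\<And>j s. j \<noteq> last_idx \<Longrightarrow> norm (ft (\<phi> 1 j) s) / m 1 j \<le> C j / (1 + \<bar>s\<bar>) ^ L" by metis
  have \<phi>1: "\<phi> \<eta> j = \<phi> 1 j" "m \<eta> j = m 1 j" if "j \<noteq> last_idx" for \<eta> j using that by (auto simp: \<phi>_def m_def)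
  define C0 where "C0 = (\<Sum>j\<in>UNIV - {last_idx}. C j)"
  have C0: "C j \<le> C0" if "j \<noteq> last_idx" for j unfolding C0_def using that C(1) by (intro member_le_sum) auto
  have C00: "0 \<le> C0" unfolding C0_def using C(1) by (intro sum_nonneg) auto
  have ratio: "norm (ft (\<phi> \<eta> j) s) / m \<eta> j \<le> 1" if "0 < \<eta>" for \<eta> j s
  proof -
    have "norm (ft (\<phi> \<eta> j) s) \<le> m \<eta> j"
      using norm_ft_le[of "\<phi> \<eta> j" s] \<phi>0 by (simp add: m_def)
    thus ?thesis using mpos[OF that, of j] by (simp add: pos_divide_le_eq)
  qed
  have main: "norm (LINT x|lborel. of_real (mu B r \<beta> Q t \<eta> x) * char1 (dotp h x)) \<le>
       C0 / (1 + \<bar>(transpose Q *v (\<chi> i. of_int (h i))) $ j\<bar>) ^ L" if e: "0 < \<eta>" and j: "j \<noteq> last_idx" for \<eta> h j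
  proof -
    define z :: "real ^ 'n::{finite,wellorder}" where "z = transpose Q *v (\<chi> i. of_int (h i))"
    have dz: "dotp h (T x) = dotp h t + (\<Sum>i\<in>UNIV. z $ i * x $ i)" for x
    proof -
      have "dotp h v = (\<chi> i. of_int (h i)) \<bullet> v" for v :: "real ^ 'n::{finite,wellorder}" by (simp add: dotp_def inner_vec_def)
      hence "dotp h (T x) = dotp h t + (\<chi> i. of_int (h i)) \<bullet> (Q *v x)" by (simp add: T_def inner_add_right)
      also have "(\<chi> i. of_int (h i)) \<bullet> (Q *v x) = z \<bullet> x"
        by (simp only: z_def transpose_matrix_vector dot_lmul_matrix)
      finally show ?thesis by (simp add: inner_vec_def)
    qed
    have "(LINT x|lborel. of_real (mu B r \<beta> Q t \<eta> x) * char1 (dotp h x)) =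
      (LINT x|lborel. of_real (p \<eta> x) * char1 (dotp h (T x)))"
      by (subst leq, subst integral_distr) (use mum[OF e] muT in auto)
    also have "(\<lambda>x. of_real (p \<eta> x) * char1 (dotp h (T x))) =
      (\<lambda>x. char1 (dotp h t) * (\<Prod>i\<in>UNIV. (of_real (\<phi> \<eta> i (x $ i)) * char1 (z $ i * x $ i)) / of_real (m \<eta> i)))"
    proof
      fix x
      have "(\<Prod>i\<in>UNIV. (of_real (\<phi> \<eta> i (x $ i)) * char1 (z $ i * x $ i)) / of_real (m \<eta> i)) =
        (\<Prod>i\<in>UNIV. of_real (\<phi> \<eta> i (x $ i) / m \<eta> i) * char1 (z $ i * x $ i))"
        by (intro prod.cong refl) simp
      also have "\<dots> = of_real (p \<eta> x) * (\<Prod>i\<in>UNIV. char1 (z $ i * x $ i))"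
        unfolding p[OF e] by (simp only: prod.distrib of_real_prod)
      also have "(\<Prod>i\<in>UNIV. char1 (z $ i * x $ i)) = char1 (\<Sum>i\<in>UNIV. z $ i * x $ i)"
        by (rule char1_sum[symmetric]) simp
      finally show "of_real (p \<eta> x) * char1 (dotp h (T x)) =
        char1 (dotp h t) * (\<Prod>i\<in>UNIV. (of_real (\<phi> \<eta> i (x $ i)) * char1 (z $ i * x $ i)) / of_real (m \<eta> i))"
        unfolding dz char1_add by (simp only: mult_ac)
    qed
    also have "(LINT x|lborel. char1 (dotp h t) * (\<Prod>i\<in>UNIV. (of_real (\<phi> \<eta> i (x $ i)) * char1 (z $ i * x $ i)) / of_real (m \<eta> i))) =
      char1 (dotp h t) * (LINT x|lborel. (\<Prod>i\<in>UNIV. (of_real (\<phi> \<eta> i (x $ i)) * char1 (z $ i * x $ i)) / of_real (m \<eta> i)))"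
      by (rule integral_mult_right_zero)
    also have "(LINT x|lborel. (\<Prod>i\<in>UNIV. (of_real (\<phi> \<eta> i ((x :: real ^ 'n::{finite,wellorder}) $ i)) * char1 (z $ i * x $ i)) / of_real (m \<eta> i))) =
      (\<Prod>i\<in>UNIV. (LINT v|lborel. (of_real (\<phi> \<eta> i v) * char1 (z $ i * v)) / of_real (m \<eta> i)))"
    proof (rule integral_prod_coordinates)
      fix i
      have "integrable lborel (\<lambda>v. of_real (\<phi> \<eta> i v) * char1 (z $ i * v))"
      proof (rule Bochner_Integration.integrable_bound[OF \<phi>int[OF e, of i]])
        have [measurable]: "\<phi> \<eta> i \<in> borel_measurable borel" using borel_measurable_integrable[OF \<phi>int[OF e, of i]] by simp
        show "(\<lambda>v. of_real (\<phi> \<eta> i v) * char1 (z $ i * v)) \<in> borel_measurable lborel" by measurable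
      qed (simp add: norm_mult)
      thus "integrable lborel (\<lambda>v. (of_real (\<phi> \<eta> i v) * char1 (z $ i * v)) / of_real (m \<eta> i))" by simp
    qed
    also have "\<dots> = (\<Prod>i\<in>UNIV. ft (\<phi> \<eta> i) (- (z $ i)) / of_real (m \<eta> i))" by (simp add: ft_def)
    finally have "norm (LINT x|lborel. of_real (mu B r \<beta> Q t \<eta> x) * char1 (dotp h x)) = (\<Prod>i\<in>UNIV. norm (ft (\<phi> \<eta> i) (- (z $ i))) / m \<eta> i)"
      using mpos[OF e] by (simp add: norm_mult prod_norm[symmetric] norm_divide less_imp_le)
    also have "\<dots> = (norm (ft (\<phi> \<eta> j) (- (z $ j))) / m \<eta> j) * (\<Prod>i\<in>UNIV - {j}. norm (ft (\<phi> \<eta> i) (- (z $ i))) / m \<eta> i)"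
      by (rule prod.remove) auto
    also have "\<dots> \<le> (norm (ft (\<phi> \<eta> j) (- (z $ j))) / m \<eta> j) * 1"
      using ratio[OF e] mpos[OF e] by (intro mult_left_mono prod_le_1) (auto intro: less_imp_le divide_nonneg_pos)
    also have "\<dots> \<le> C j / (1 + \<bar>z $ j\<bar>) ^ L" using C(2)[OF j, of "- (z $ j)"] \<phi>1[OF j, of \<eta>] by simp
    also have "\<dots> \<le> C0 / (1 + \<bar>z $ j\<bar>) ^ L" using C0[OF j] by (intro divide_right_mono) auto
    finally show ?thesis by (simp add: z_def)
  qed
  show "\<exists>C\<ge>0. \<forall>\<eta>>0. \<forall>j\<noteq>last_idx. \<forall>h. norm (LINT x|lborel. of_real (mu B r \<beta> Q t \<eta> x) * char1 (dotp h x)) \<le>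
       C / (1 + \<bar>(transpose Q *v (\<chi> i. of_int (h i))) $ j\<bar>) ^ L"
    using main C00 by blast
qed

section \<open>From the dual exponent to the Diophantine inequality\<close>

lemma nint_dist_le: "nint_dist x \<le> \<bar>x - of_int m\<bar>"
  unfolding nint_dist_def by (rule round_diff_minimal)

lemma nint_dist_nonneg: "0 \<le> nint_dist x"
  by (simp add: nint_dist_def)

lemma real_vec_eq_0_iff: "real_vec n = 0 \<longleftrightarrow> n = 0"
  by (simp add: real_vec_def vec_eq_iff)

lemma infinite_nonzero_multiples:
  assumes "(n :: int ^ 'd) \<noteq> 0"
  shows "infinite (range (\<lambda>m. (\<chi> i. int (Suc m) * n $ i)))"
proof -
  obtain i where i: "n $ i \<noteq> 0" using assms by (auto simp: vec_eq_iff)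
  have "inj (\<lambda>m. (\<chi> i. int (Suc m) * n $ i))"
  proof (rule injI)
    fix m m' assume "(\<chi> i. int (Suc m) * n $ i) = (\<chi> i. int (Suc m') * n $ i)"
    from arg_cong[OF this, of "\<lambda>v. v $ i"] have "int (Suc m) * n $ i = int (Suc m') * n $ i" by simp
    thus "m = m'" using i by simp
  qed
  thus ?thesis using finite_imageD infinite_UNIV_nat by blast
qed

text \<open>For w = 0 the defining inequality says that a distance to the nearest integer is less
  than 1, which every non-zero n satisfies.\<close>

lemma dual_exponent_nonneg: "0 \<le> dual_exponent (x :: real ^ 'd)"
proof -
  define S where "S = {n :: int ^ 'd. nint_dist (real_vec n \<bullet> x) < infnorm (real_vec n) powr (- 0)}"
  have sub: "range (\<lambda>m. (\<chi> i :: 'd. int (Suc m) * (1 :: int ^ 'd) $ i)) \<subseteq> S"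
  proof
    fix n :: "int ^ 'd" assume "n \<in> range (\<lambda>m. (\<chi> i :: 'd. int (Suc m) * (1 :: int ^ 'd) $ i))"
    hence "n \<noteq> 0" by (auto simp: vec_eq_iff)
    hence "infnorm (real_vec n) \<noteq> 0" by (simp add: infnorm_eq_0 real_vec_eq_0_iff)
    moreover have "nint_dist (real_vec n \<bullet> x) \<le> 1 / 2"
      unfolding nint_dist_def by (metis abs_minus_commute of_int_round_abs_le)
    ultimately show "n \<in> S" by (simp add: S_def)
  qed
  have "(1 :: int ^ 'd) \<noteq> 0" by (auto simp: vec_eq_iff)
  hence "infinite S" using infinite_nonzero_multiples sub finite_subset by blast
  hence "ereal 0 \<in> {ereal w | w. infinite {n :: int ^ 'd. nint_dist (real_vec n \<bullet> x) < infnorm (real_vec n) powr (- w)}}"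
    unfolding S_def by blast
  hence "ereal 0 \<le> dual_exponent x" unfolding dual_exponent_def by (rule Sup_upper)
  thus ?thesis by (simp add: zero_ereal_def)
qed

text \<open>Above the exponent only finitely many n fail the inequality with c = 1, and a smaller c
  repairs these. This needs a positive distance for every non-zero n: a vanishing distance would
  persist for all multiples of n and produce infinitely many failures.\<close>

lemma dual_exponent_bound:
  fixes x :: "real ^ 'd"
  assumes "dual_exponent x < ereal w"
  shows "\<exists>c>0. \<forall>n. n \<noteq> 0 \<longrightarrow> c * infnorm (real_vec n) powr (- w) \<le> nint_dist (real_vec n \<bullet> x)"
proof -
  define S where "S = {n :: int ^ 'd. nint_dist (real_vec n \<bullet> x) < infnorm (real_vec n) powr (- w)}"
  have fin: "finite S"
  proof (rule ccontr)
    assume "infinite S"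
    hence "ereal w \<in> {ereal w | w. infinite {n :: int ^ 'd. nint_dist (real_vec n \<bullet> x) < infnorm (real_vec n) powr (- w)}}"
      unfolding S_def by blast
    hence "ereal w \<le> dual_exponent x" unfolding dual_exponent_def by (rule Sup_upper)
    thus False using assms by simp
  qed
  have ipos: "0 < infnorm (real_vec n) powr (- w)" if "n \<noteq> 0" for n :: "int ^ 'd"
    using that by (simp add: infnorm_eq_0 real_vec_eq_0_iff)
  have npos: "0 < nint_dist (real_vec n \<bullet> x)" if n: "n \<noteq> 0" for n
  proof (rule ccontr)
    assume "\<not> ?thesis"
    hence "nint_dist (real_vec n \<bullet> x) = 0" using nint_dist_nonneg[of "real_vec n \<bullet> x"] by linarith
    hence eq: "real_vec n \<bullet> x = of_int (round (real_vec n \<bullet> x))" by (simp add: nint_dist_def)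
    have "range (\<lambda>m. (\<chi> i. int (Suc m) * n $ i)) \<subseteq> S"
    proof
      fix n' assume "n' \<in> range (\<lambda>m. (\<chi> i. int (Suc m) * n $ i))"
      then obtain m where m: "n' = (\<chi> i. int (Suc m) * n $ i)" by blast
      have "n' \<noteq> 0" using n by (auto simp: m vec_eq_iff)
      have "real_vec n' = real (Suc m) *\<^sub>R real_vec n" by (simp add: m real_vec_def vec_eq_iff)
      hence "real_vec n' \<bullet> x = of_int (int (Suc m) * round (real_vec n \<bullet> x))" using eq by simp
      hence "nint_dist (real_vec n' \<bullet> x) \<le> 0"
        using nint_dist_le[of "real_vec n' \<bullet> x" "int (Suc m) * round (real_vec n \<bullet> x)"] by simp
      thus "n' \<in> S" using ipos[OF \<open>n' \<noteq> 0\<close>] unfolding S_def mem_Collect_eq by linarith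
    qed
    thus False using infinite_nonzero_multiples[OF n] fin finite_subset by blast
  qed
  define c where "c = Min (insert 1 ((\<lambda>n. nint_dist (real_vec n \<bullet> x) / infnorm (real_vec n) powr (- w)) ` (S - {0})))"
  have fi: "finite (insert 1 ((\<lambda>n. nint_dist (real_vec n \<bullet> x) / infnorm (real_vec n) powr (- w)) ` (S - {0})))"
    using fin by blast
  have "0 < c" unfolding c_def using fi npos ipos by (subst Min_gr_iff) (auto intro!: divide_pos_pos simp: infnorm_eq_0 real_vec_eq_0_iff)
  moreover have "c * infnorm (real_vec n) powr (- w) \<le> nint_dist (real_vec n \<bullet> x)" if n: "n \<noteq> 0" for n
  proof (cases "n \<in> S")
    case True
    hence "c \<le> nint_dist (real_vec n \<bullet> x) / infnorm (real_vec n) powr (- w)"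
      unfolding c_def using fi n by (intro Min_le) auto
    thus ?thesis using ipos[OF n] by (simp add: pos_le_divide_eq)
  next
    case False
    have "c \<le> 1" unfolding c_def using fi by (intro Min_le) auto
    hence "c * infnorm (real_vec n) powr (- w) \<le> 1 * infnorm (real_vec n) powr (- w)" by (intro mult_right_mono) auto
    thus ?thesis using False by (simp add: S_def)
  qed
  ultimately show ?thesis by blast
qed

lemma fst_idx_less_iff: "fst_idx < i \<longleftrightarrow> i \<noteq> (fst_idx :: 'n::{finite,wellorder})"
proof -
  have "(fst_idx :: 'n) \<le> i" unfolding fst_idx_def by simp
  thus ?thesis by auto
qed

lemma infnorm_real_2_le:
  fixes v w :: int
  assumes "\<bar>real_of_int v\<bar> \<le> M" "\<bar>real_of_int w\<bar> \<le> M"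
  shows "infnorm (real_vec (vector [v, w] :: int ^ 2)) \<le> M"
proof -
  have "\<bar>real_vec (vector [v, w] :: int ^ 2) \<bullet> b\<bar> \<le> M" if "b \<in> Basis" for b
  proof -
    obtain i :: 2 where "b = axis i 1" using \<open>b \<in> Basis\<close> by (auto simp: Basis_vec_def)
    moreover have "i = 1 \<or> i = 2" using exhaust_2 by blast
    ultimately show ?thesis using assms by (auto simp: inner_axis real_vec_def)
  qed
  thus ?thesis unfolding infnorm_Max by (subst Max_le_iff) auto
qed

lemma inner_real_2: "real_vec (vector [v, w] :: int ^ 2) \<bullet> (vector [p, q] :: real ^ 2) = of_int v * p + of_int w * q"
  by (simp add: inner_vec_def real_vec_def sum_2)

text \<open>For k \<ge> 3 the maximum is taken over a non-empty finite set of non-negative values,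
  so a finite \<open>omega2\<close> is an honest real number.\<close>

lemma omega2_properties:
  fixes \<alpha> :: "real ^ 'n::{finite,wellorder}"
  assumes card: "CARD('n) \<ge> 3" and fin: "omega2 \<alpha> < \<infinity>"
  defines "\<omega> \<equiv> real_of_ereal (omega2 \<alpha>)"
  shows "0 \<le> \<omega>" "\<And>i j. i \<noteq> fst_idx \<Longrightarrow> i < j \<Longrightarrow> dual_exponent (vector [\<alpha> $ i, \<alpha> $ j] :: real ^ 2) \<le> ereal \<omega>"
proof -
  define S where "S = {dual_exponent (vector [\<alpha> $ i, \<alpha> $ j] :: real ^ 2) | i j. fst_idx < i \<and> i < j}"
  have "S \<subseteq> (\<lambda>(i, j). dual_exponent (vector [\<alpha> $ i, \<alpha> $ j] :: real ^ 2)) ` UNIV" by (auto simp: S_def)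
  hence finS: "finite S" by (rule finite_subset) simp
  have om: "omega2 \<alpha> = Max S" by (simp add: omega2_def S_def)
  have "\<exists>i j :: 'n. i \<noteq> fst_idx \<and> j \<noteq> fst_idx \<and> i \<noteq> j"
  proof (rule ccontr)
    assume no: "\<not> ?thesis"
    have "(UNIV :: 'n set) \<subseteq> {fst_idx, SOME i. i \<noteq> fst_idx}"
    proof
      fix j :: 'n
      show "j \<in> {fst_idx, SOME i. i \<noteq> fst_idx}"
      proof (cases "j = fst_idx")
        case False
        hence "(SOME i. i \<noteq> fst_idx) \<noteq> (fst_idx :: 'n)" by (rule someI)
        thus ?thesis using no False by blast
      qed simp
    qed
    hence "CARD('n) \<le> card {fst_idx, SOME i :: 'n. i \<noteq> fst_idx}" by (intro card_mono) auto
    also have "\<dots> \<le> 2" by (simp add: card_insert_if)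
    finally show False using card by simp
  qed
  then obtain i j :: 'n where "i \<noteq> fst_idx" "j \<noteq> fst_idx" "i \<noteq> j" by blast
  then obtain i j :: 'n where ij: "fst_idx < i" "i < j" by (metis fst_idx_less_iff linorder_neqE)
  have mem: "dual_exponent (vector [\<alpha> $ i, \<alpha> $ j] :: real ^ 2) \<in> S" if "fst_idx < i" "i < j" for i j
    using that by (auto simp: S_def)
  have "0 \<le> omega2 \<alpha>"
    unfolding om by (rule order_trans[OF dual_exponent_nonneg Max_ge[OF finS mem[OF ij]]])
  hence er: "omega2 \<alpha> = ereal \<omega>" using fin by (cases "omega2 \<alpha>") (auto simp: \<omega>_def)
  show "0 \<le> \<omega>" using \<open>0 \<le> omega2 \<alpha>\<close> er by simp
  show "dual_exponent (vector [\<alpha> $ i, \<alpha> $ j] :: real ^ 2) \<le> ereal \<omega>" if "i \<noteq> fst_idx" "i < j" for i j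
    using Max_ge[OF finS mem[of i j]] that unfolding er[symmetric] om fst_idx_less_iff by simp
qed

text \<open>Adding \<tau> puts the exponent strictly above all dual exponents involved, as
  \<open>dual_exponent_bound\<close> demands, at a cost of order \<tau>. The least of the finitely
  many constants, capped at 1, serves for all pairs.\<close>

lemma diophantine_direction_exists:
  fixes \<alpha> :: "real ^ 'n::{finite,wellorder}"
  assumes card: "CARD('n) \<ge> 3" and a1: "\<alpha> $ fst_idx = 1" and fin: "omega2 \<alpha> < \<infinity>" and "0 < \<tau>"
  shows "\<exists>c a. diophantine_direction (($) \<alpha>) fst_idx (real_of_ereal (omega2 \<alpha>) + \<tau>) c a"
proof -
  define \<omega> where "\<omega> = real_of_ereal (omega2 \<alpha>)"
  note om = omega2_properties[OF card fin, folded \<omega>_def]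
  have "\<exists>c>0. \<forall>n. n \<noteq> 0 \<longrightarrow> c * infnorm (real_vec n) powr (- (\<omega> + \<tau>)) \<le> nint_dist (real_vec n \<bullet> (vector [\<alpha> $ i, \<alpha> $ j] :: real ^ 2))"
    if "i \<noteq> fst_idx \<and> i < j" for i j
    by (rule dual_exponent_bound) (use om(2)[of i j] that assms(4) in \<open>auto intro: le_less_trans\<close>)
  then obtain cc where cc: "\<And>i j. i \<noteq> fst_idx \<and> i < j \<Longrightarrow> 0 < cc i j"
    "\<And>i j n. i \<noteq> fst_idx \<and> i < j \<Longrightarrow> n \<noteq> 0 \<Longrightarrow> cc i j * infnorm (real_vec n) powr (- (\<omega> + \<tau>)) \<le> nint_dist (real_vec n \<bullet> (vector [\<alpha> $ i, \<alpha> $ j] :: real ^ 2))"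
    by metis
  define c where "c = Min (insert 1 ((\<lambda>(i, j). cc i j) ` {(i, j). i \<noteq> fst_idx \<and> i < j}))"
  have c0: "0 < c" unfolding c_def using cc(1) by (subst Min_gr_iff) auto
  have c1: "c \<le> 1" unfolding c_def by (intro Min_le) auto
  have cij: "c \<le> cc i j" if "i \<noteq> fst_idx" "i < j" for i j unfolding c_def using that by (intro Min_le) auto
  have main: "c * M powr (- (\<omega> + \<tau>)) \<le> \<bar>of_int u + of_int v * \<alpha> $ i + of_int w * \<alpha> $ j\<bar>"
    if "i \<noteq> fst_idx" "i < j" "1 \<le> M" "\<bar>of_int u\<bar> \<le> M" "\<bar>of_int v\<bar> \<le> M" "\<bar>of_int w\<bar> \<le> M" "(u, v, w) \<noteq> (0, 0, 0)"
    for i j and u v w :: int and M :: real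
  proof (cases "v = 0 \<and> w = 0")
    \<comment> \<open>The bound for the dual exponent says nothing about the zero vector (v, w);
      here u is a non-zero integer and c \<le> 1 suffices.\<close>
    case True
    hence "1 \<le> \<bar>real_of_int u\<bar>" using that by auto
    moreover have "M powr (- (\<omega> + \<tau>)) \<le> M powr 0" using that(3) om(1) assms(4) by (intro powr_mono) auto
    hence "c * M powr (- (\<omega> + \<tau>)) \<le> 1 * 1" using c0 c1 that(3) by (intro mult_mono) auto
    ultimately show ?thesis using True by simp
  next
    case False
    define n :: "int ^ 2" where "n = vector [v, w]"
    have n0: "n \<noteq> 0" using False by (auto simp: n_def vec_eq_iff forall_2)
    have ip: "0 < infnorm (real_vec n)" using n0 by (simp add: infnorm_pos_lt real_vec_eq_0_iff)
    have iM: "infnorm (real_vec n) \<le> M" unfolding n_def using that by (intro infnorm_real_2_le)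
    have "c * M powr (- (\<omega> + \<tau>)) \<le> cc i j * infnorm (real_vec n) powr (- (\<omega> + \<tau>))"
      using cij[OF that(1,2)] c0 ip iM om(1) assms(4) by (intro mult_mono powr_mono2') auto
    also have "\<dots> \<le> nint_dist (of_int v * \<alpha> $ i + of_int w * \<alpha> $ j)"
      using cc(2)[of i j n] that(1,2) n0 unfolding n_def inner_real_2 by auto
    also have "\<dots> \<le> \<bar>of_int v * \<alpha> $ i + of_int w * \<alpha> $ j - of_int (- u)\<bar>" by (rule nint_dist_le)
    finally show ?thesis by (simp add: add_ac)
  qed
  define a where "a = Max (range (\<lambda>j. \<bar>\<alpha> $ j\<bar>))"
  have "diophantine_direction (($) \<alpha>) fst_idx (\<omega> + \<tau>) c a"
  proof
    show "\<bar>\<alpha> $ j\<bar> \<le> a" for j unfolding a_def by (intro Max_ge) auto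
    fix i j :: 'n and u v w :: int and M :: real
    assume h: "i \<noteq> fst_idx" "j \<noteq> fst_idx" "i \<noteq> j" "1 \<le> M" "\<bar>of_int u\<bar> \<le> M" "\<bar>of_int v\<bar> \<le> M" "\<bar>of_int w\<bar> \<le> M" "(u, v, w) \<noteq> (0, 0, 0)"
    show "c * M powr (- (\<omega> + \<tau>)) \<le> \<bar>of_int u + of_int v * \<alpha> $ i + of_int w * \<alpha> $ j\<bar>"
    proof (cases "i < j")
      case True
      thus ?thesis using main[of i j M u v w] h by auto
    next
      case False
      hence "j < i" using h(3) by simp
      thus ?thesis using main[of j i M u w v] h by (auto simp: add_ac)
    qed
  qed (use a1 card om(1) assms(4) c0 in auto)
  thus ?thesis unfolding \<omega>_def by blast
qed

section \<open>Comparison of the variances\<close>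

text \<open>Its parameter \<open>\<omega>\<close> will be the exponent of the hyperplane plus
  \<tau>.\<close>

locale variance_setting = admissible_data y I d tp w1 w2 c1 c2 \<tau> + diophantine_direction "($) \<alpha>" fst_idx \<omega> c a
  for y :: "real ^ 'n::{finite,wellorder}" and I d tp w1 w2 c1 c2 \<tau>
    and \<alpha> :: "real ^ 'n::{finite,wellorder}" and \<omega> c a +
  fixes H B r bt Q t
  assumes mu_data: "mu_data \<alpha> H B r bt Q t" and tau: "0 < \<tau>" "\<tau> < 1 / real CARD('n)"
begin

abbreviation lam :: "nat \<Rightarrow> real" where "lam n \<equiv> leb_mean (F n)"
abbreviation cube :: "(real ^ 'n::{finite,wellorder}) measure" where "cube \<equiv> restrict_space lborel (cbox 0 1)"

text \<open>Constant of \<open>near_of_transpose\<close>: a sum over k columns of Q, each with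
  coefficient at most 1 + a.\<close>

definition a\<^sub>0 :: real where "a\<^sub>0 = real CARD('n) * (1 + a)"
text \<open>Of the exponent 2 \<tau>, one \<tau> covers the factor n^\<tau> in the effective range
  n^(1/k + \<tau>) of h, the other is the margin over which rapid decay becomes a large negative
  power of n n'.\<close>

definition RR :: "nat \<Rightarrow> nat \<Rightarrow> real" where "RR n n' = a\<^sub>0 * real (n * n') powr (2 * \<tau>)"
definition SS where "SS n n' = sol n n' (n powr (1 / real CARD('n)) * RR n n') (n' powr (1 / real CARD('n)) * RR n n') (RR n n')"
definition PP where "PP n n' = {(h, h') \<in> SS n n'. parallel h h'}"
text \<open>Made into a probability measure so that \<open>product_expectation_diff_le\<close> can
  compare it with \<open>cube\<close>.\<close>

definition nu :: "real \<Rightarrow> (real ^ 'n::{finite,wellorder}) measure" where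
  "nu \<eta> = density lborel (\<lambda>x. ennreal (mu B r bt Q t \<eta> x))"
definition gg :: "nat \<Rightarrow> real ^ 'n::{finite,wellorder} \<Rightarrow> real" where "gg n x = F n x - lam n"
definition DD :: "real \<Rightarrow> nat \<Rightarrow> nat \<Rightarrow> real" where
  "DD \<eta> n n' = (LINT x|nu \<eta>. gg n x * gg n' x) - (LINT x|cube. gg n x * gg n' x)"

lemma k3: "3 \<le> real CARD('n)"
  using card3 by simp

lemma a0_ge_1: "1 \<le> a\<^sub>0"
  using mult_mono[of 1 "real CARD('n)" 1 "1 + a"] k3 a_ge_1 by (simp add: a\<^sub>0_def)

text \<open>Expand \<xi> in the columns of Q. The last column is \<alpha> / |\<alpha>|, and its
  contribution to \<xi>_i - \<alpha>_i \<xi>_1 cancels because \<alpha>_1 = 1. What remains are the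
  coordinates in which the density has Fourier decay.\<close>

lemma near_of_transpose:
  assumes "0 \<le> \<rho>" "\<And>j. j \<noteq> last_idx \<Longrightarrow> \<bar>(transpose Q *v (\<chi> i. of_int (\<xi> i))) $ j\<bar> \<le> \<rho>"
  shows "near (a\<^sub>0 * \<rho>) \<xi>"
  unfolding near_def
proof
  fix i
  have orth: "orthogonal_matrix Q" and ax: "Q *v axis last_idx 1 = (1 / norm \<alpha>) *\<^sub>R \<alpha>"
    using mu_data by (auto simp: mu_data_def rotation_matrix_def)
  define z where "z = transpose Q *v (\<chi> i. of_int (\<xi> i))"
  have col: "(Q *v axis j 1) $ i = Q $ i $ j" for i j by (simp add: matrix_vector_mult_basis column_def)
  have ot: "orthogonal_transformation (\<lambda>x. Q *v x)"
    unfolding orthogonal_transformation_matrix matrix_of_matrix_vector_mul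
    using orth by (simp only: matrix_vector_mul_linear simp_thms)
  have Qle: "\<bar>Q $ i $ j\<bar> \<le> 1" for i j
  proof -
    have "\<bar>(Q *v axis j 1) $ i\<bar> \<le> norm (Q *v axis j 1)" by (rule component_le_norm_cart)
    also have "\<dots> = norm (axis j (1 :: real) :: real ^ 'n::{finite,wellorder})" by (rule orthogonal_transformation_norm[OF ot])
    finally show ?thesis unfolding col by simp
  qed
  have Ql: "Q $ i $ last_idx = \<alpha> $ i / norm \<alpha>" for i
    using arg_cong[OF ax, of "\<lambda>v. v $ i"] unfolding col by simp
  have ex: "of_int (\<xi> i) = (\<Sum>j\<in>UNIV. z $ j * Q $ i $ j)" for i
    using orthogonal_matrix_expansion[OF orth, of "\<chi> i. of_int (\<xi> i)" i] unfolding z_def[symmetric] by simp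
  have "of_int (\<xi> i) - \<alpha> $ i * of_int (\<xi> fst_idx) = (\<Sum>j\<in>UNIV. z $ j * (Q $ i $ j - \<alpha> $ i * Q $ fst_idx $ j))"
    unfolding ex by (simp add: sum_distrib_left sum_subtractf[symmetric] algebra_simps)
  also have "\<bar>\<dots>\<bar> \<le> (\<Sum>j\<in>UNIV. \<bar>z $ j * (Q $ i $ j - \<alpha> $ i * Q $ fst_idx $ j)\<bar>)" by (rule sum_abs)
  also have "\<dots> \<le> (\<Sum>j\<in>(UNIV :: 'n set). \<rho> * (1 + a))"
  proof (rule sum_mono)
    fix j
    show "\<bar>z $ j * (Q $ i $ j - \<alpha> $ i * Q $ fst_idx $ j)\<bar> \<le> \<rho> * (1 + a)"
    proof (cases "j = last_idx")
      case True
      hence "Q $ i $ j - \<alpha> $ i * Q $ fst_idx $ j = 0" using alpha_i0 by (simp add: Ql)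
      thus ?thesis using assms(1) a_ge_1 by simp
    next
      case False
      have "\<bar>\<alpha> $ i * Q $ fst_idx $ j\<bar> \<le> a * 1"
        unfolding abs_mult using alpha_le Qle a_ge_1 by (intro mult_mono) auto
      hence "\<bar>Q $ i $ j - \<alpha> $ i * Q $ fst_idx $ j\<bar> \<le> 1 + a" using Qle[of i j] by linarith
      thus ?thesis unfolding abs_mult using assms(2)[OF False] assms(1) a_ge_1 by (intro mult_mono) (auto simp: z_def)
    qed
  qed
  also have "\<dots> = a\<^sub>0 * \<rho>" by (simp add: a\<^sub>0_def)
  finally show "\<bar>of_int (\<xi> i) - \<alpha> $ i * of_int (\<xi> fst_idx)\<bar> \<le> a\<^sub>0 * \<rho>" .
qed

definition Hn :: "nat \<Rightarrow> real" where "Hn n = real n powr (1 / real CARD('n) + \<tau>)"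
text \<open>Decay profile of the coefficients in \<open>norm_coef_le\<close>. It is used with order
  L + 2: the 2 makes the sums over h converge, the L gives a large negative power outside the
  effective range.\<close>

definition ww :: "nat \<Rightarrow> nat \<Rightarrow> ('n \<Rightarrow> int) \<Rightarrow> real" where
  "ww L n h = (\<Prod>j\<in>UNIV. 1 / (1 + \<bar>real_of_int (h j)\<bar> / Hn n) ^ L)"

lemma Hn_ge_1: "1 \<le> n \<Longrightarrow> 1 \<le> Hn n"
  unfolding Hn_def using k3 tau by (intro ge_one_powr_ge_zero) auto

lemma ww_factor:
  assumes "1 \<le> n"
  shows "0 \<le> 1 / (1 + \<bar>real_of_int z\<bar> / Hn n) ^ L \<and> 1 / (1 + \<bar>real_of_int z\<bar> / Hn n) ^ L \<le> 1"
proof -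
  have "1 \<le> (1 + \<bar>real_of_int z\<bar> / Hn n) ^ L" using Hn_ge_1[OF assms] by (intro one_le_power) simp
  thus ?thesis by (simp add: divide_le_eq_1)
qed

lemma ww_bounds: "1 \<le> n \<Longrightarrow> 0 \<le> ww L n h \<and> ww L n h \<le> 1"
  unfolding ww_def using ww_factor by (intro conjI prod_nonneg prod_le_1 ballI) blast+

lemma ww_add: "ww (L + M) n h = ww L n h * ww M n h"
  by (simp add: ww_def power_add prod.distrib[symmetric])

lemma ww_tail:
  assumes "1 \<le> n" "0 < \<rho>" "Hn n * \<rho> < \<bar>real_of_int (h j)\<bar>"
  shows "ww L n h \<le> 1 / \<rho> ^ L"
proof -
  have H: "1 \<le> Hn n" by (rule Hn_ge_1[OF assms(1)])
  have "ww L n h = 1 / (1 + \<bar>real_of_int (h j)\<bar> / Hn n) ^ L * (\<Prod>i\<in>UNIV - {j}. 1 / (1 + \<bar>real_of_int (h i)\<bar> / Hn n) ^ L)"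
    unfolding ww_def by (rule prod.remove) auto
  also have "\<dots> \<le> 1 / (1 + \<bar>real_of_int (h j)\<bar> / Hn n) ^ L * 1"
    using ww_factor[OF assms(1)] by (intro mult_left_mono prod_le_1) blast+
  also have "\<dots> \<le> 1 / \<rho> ^ L"
  proof -
    have "\<rho> < \<bar>real_of_int (h j)\<bar> / Hn n" using assms(3) H by (simp add: pos_less_divide_eq mult.commute)
    hence "\<rho> ^ L \<le> (1 + \<bar>real_of_int (h j)\<bar> / Hn n) ^ L" using assms(2) by (intro power_mono) auto
    moreover have "0 < \<rho> ^ L" using assms(2) by simp
    ultimately show ?thesis by (simp add: frac_le)
  qed
  finally show ?thesis .
qed

text \<open>The sum is of order \<open>Hn n\<close> to the power k, that is n^(1 + k \<tau>), and
  \<tau> < 1/k makes this at most n^2.\<close>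

lemma sum_ww_2_le:
  assumes "1 \<le> n" "finite X"
  shows "(\<Sum>h\<in>X. ww 2 n h) \<le> 3 ^ CARD('n) * (real n)\<^sup>2"
proof -
  have H: "1 \<le> Hn n" by (rule Hn_ge_1[OF assms(1)])
  have "(\<Sum>h\<in>X. ww 2 n h) \<le> (\<Prod>j\<in>(UNIV :: 'n set). 1 + 2 * Hn n)"
    unfolding ww_def using H
    by (intro sum_prod_functions_le[OF assms(2)]) (auto intro!: sum_quadratic_decay_int_le)
  also have "\<dots> \<le> (\<Prod>j\<in>(UNIV :: 'n set). 3 * Hn n)" using H by (intro prod_mono) auto
  also have "\<dots> = 3 ^ CARD('n) * Hn n ^ CARD('n)" by (simp add: power_mult_distrib)
  also have "Hn n ^ CARD('n) = n powr ((1 / real CARD('n) + \<tau>) * real CARD('n))"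
    using assms(1) by (simp add: Hn_def powr_realpow[symmetric] powr_powr)
  also have "\<dots> \<le> n powr 2"
  proof (rule powr_mono)
    have "\<tau> * real CARD('n) \<le> 1" using tau k3 by (simp add: pos_less_divide_eq less_imp_le)
    thus "(1 / real CARD('n) + \<tau>) * real CARD('n) \<le> 2" using k3 by (simp add: distrib_right)
  qed (use assms(1) in auto)
  finally show ?thesis using assms(1) by simp
qed

lemma prob_space_nu: "0 < \<eta> \<Longrightarrow> prob_space (nu \<eta>)"
proof
  assume e: "0 < \<eta>"
  have "emeasure (nu \<eta>) (space (nu \<eta>)) = (\<integral>\<^sup>+ x. ennreal (mu B r bt Q t \<eta> x) \<partial>lborel)"
    unfolding nu_def using borel_measurable_integrable[OF mu_properties(1)[OF mu_data e]]
    by (subst emeasure_density) auto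
  also have "\<dots> = ennreal (LINT x|lborel. mu B r bt Q t \<eta> x)"
    by (rule nn_integral_eq_integral) (use mu_properties(1,2)[OF mu_data e] in auto)
  finally show "emeasure (nu \<eta>) (space (nu \<eta>)) = 1" using mu_properties(3)[OF mu_data e] by simp
qed

lemma integral_nu:
  fixes f :: "real ^ 'n::{finite,wellorder} \<Rightarrow> 'b::{banach, second_countable_topology}"
  assumes "0 < \<eta>" "f \<in> borel_measurable borel"
  shows "(LINT x|nu \<eta>. f x) = (LINT x|lborel. mu B r bt Q t \<eta> x *\<^sub>R f x)"
  unfolding nu_def using borel_measurable_integrable[OF mu_properties(1)[OF mu_data assms(1)]] mu_properties(2)[OF mu_data assms(1)] assms(2)
  by (intro integral_density) auto

lemma measurable_nu: "f \<in> borel_measurable borel \<Longrightarrow> f \<in> borel_measurable (nu \<eta>)"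
  by (simp add: nu_def)

text \<open>5/2 = 2 + 1/2: the tail has to beat the factor (n n')^2 from \<open>sum_ww_2_le\<close>
  and still leave (n n')^(-1/2), which the target power dominates.\<close>

lemma exponent_L: "\<exists>L. 5 / 2 \<le> \<tau> * real L"
proof
  have "5 / (2 * \<tau>) \<le> real (nat \<lceil>5 / (2 * \<tau>)\<rceil>)" by (rule real_nat_ceiling_ge)
  hence "\<tau> * (5 / (2 * \<tau>)) \<le> \<tau> * real (nat \<lceil>5 / (2 * \<tau>)\<rceil>)" using tau by (intro mult_left_mono) auto
  thus "5 / 2 \<le> \<tau> * real (nat \<lceil>5 / (2 * \<tau>)\<rceil>)" using tau by simp
qed

text \<open>
  Pairs of frequencies outside \<open>SS n n'\<close> are negligible: one of the three rapidly decaying factors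
  is at most a large negative power of \<open>n n'\<close>.
\<close>

lemma pair_bound:
  "\<exists>K\<ge>0. \<forall>\<eta> n n'. 0 < \<eta> \<longrightarrow> 1 \<le> n \<longrightarrow> 1 \<le> n' \<longrightarrow>
     \<bar>DD \<eta> n n'\<bar> \<le> K * (lam n * lam n' * (card (SS n n') + real (n * n') powr (- 1 / 2)))"
proof -
  obtain L where L: "5 / 2 \<le> \<tau> * real L" using exponent_L by blast
  obtain K1 where K1: "0 \<le> K1" "\<And>n h. 1 \<le> n \<Longrightarrow> norm (coef n h) \<le> K1 * lam n * ww (L + 2) n h"
    using norm_coef_le[of "L + 2"] unfolding ww_def Hn_def by blast
  obtain C0 where C0: "0 \<le> C0" "\<And>\<eta> j h. 0 < \<eta> \<Longrightarrow> j \<noteq> last_idx \<Longrightarrow>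
     norm (LINT x|lborel. of_real (mu B r bt Q t \<eta> x) * char1 (dotp h x)) \<le> C0 / (1 + \<bar>(transpose Q *v (\<chi> i. of_int (h i))) $ j\<bar>) ^ L"
    using mu_properties(4)[OF mu_data, of L] by blast
  define K where "K = K1\<^sup>2 * C0 * 9 ^ CARD('n)"
  have main: "\<bar>DD \<eta> n n'\<bar> \<le> K * (lam n * lam n' * (card (SS n n') + real (n * n') powr (- 1 / 2)))"
    if e: "0 < \<eta>" and n: "1 \<le> n" and n': "1 \<le> n'" for \<eta> n n'
  proof -
    define T where "T = real (n * n')"
    have n1: "1 \<le> real n" "1 \<le> real n'" using n n' by auto
    have T1: "1 \<le> T" "real n \<le> T" "real n' \<le> T"
      using mult_mono[of 1 "real n" 1 "real n'"] mult_mono[of "real n" "real n" 1 "real n'"] mult_mono[of 1 "real n" "real n'" "real n'"] n1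
      by (auto simp: T_def)
    define \<rho> where "\<rho> = T powr \<tau>"
    have \<rho>1: "1 \<le> \<rho>" unfolding \<rho>_def using T1 tau by (intro ge_one_powr_ge_zero) auto
    have \<rho>2: "T powr (2 * \<tau>) = \<rho> * \<rho>" unfolding \<rho>_def by (simp flip: powr_add)
    have \<rho>L: "1 / \<rho> ^ L \<le> T powr (- 5 / 2)"
    proof -
      have "\<rho> ^ L = T powr (\<tau> * L)" using T1 by (simp add: \<rho>_def powr_realpow[symmetric] powr_powr)
      hence "1 / \<rho> ^ L = T powr (- (\<tau> * L))" by (simp add: powr_minus_divide)
      also have "\<dots> \<le> T powr (- 5 / 2)" using L T1 by (intro powr_mono) auto
      finally show ?thesis .
    qed
    define \<xi> where "\<xi> = (\<lambda>h h' :: 'n \<Rightarrow> int. \<lambda>j. int n * h j + int n' * h' j)"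
    define e1 where "e1 = (\<lambda>(h :: 'n \<Rightarrow> int) (x :: real ^ 'n::{finite,wellorder}). char1 (dotp (\<lambda>j. int n * h j) x))"
    define e2 where "e2 = (\<lambda>(h :: 'n \<Rightarrow> int) (x :: real ^ 'n::{finite,wellorder}). char1 (dotp (\<lambda>j. int n' * h j) x))"
    define J where "J = (\<lambda>h h'. (LINT x|nu \<eta>. e1 h x * e2 h' x) - (LINT x|cube. e1 h x * e2 h' x))"
    have ee: "e1 h x * e2 h' x = char1 (dotp (\<xi> h h') x)" for h h' x
      by (simp add: e1_def e2_def \<xi>_def dotp_add char1_add)
    interpret N: prob_space "nu \<eta>" by (rule prob_space_nu[OF e])
    have cubeJ: "(LINT x|cube. char1 (dotp g x)) = (if g = (\<lambda>_. 0) then 1 else 0)" for g :: "'n \<Rightarrow> int"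
      using integral_cube_char1[of g] by (simp add: set_lebesgue_integral_def integral_restrict_space)
    \<comment> \<open>The product of the exponentials is the constant 1, and both measures have
      total mass 1.\<close>
    have J0: "J h h' = 0" if "\<xi> h h' = (\<lambda>_. 0)" for h h'
    proof -
      have "dotp (\<lambda>_. 0) x = 0" for x :: "real ^ 'n::{finite,wellorder}" by (simp add: dotp_def)
      thus ?thesis unfolding J_def ee that cubeJ by (simp add: N.prob_space)
    qed
    have J1: "norm (J h h') \<le> C0 / (1 + \<bar>(transpose Q *v (\<chi> i. of_int (\<xi> h h' i))) $ j\<bar>) ^ L"
      if "\<xi> h h' \<noteq> (\<lambda>_. 0)" "j \<noteq> last_idx" for h h' j
    proof -
      have "J h h' = (LINT x|lborel. of_real (mu B r bt Q t \<eta> x) * char1 (dotp (\<xi> h h') x))"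
        unfolding J_def ee cubeJ using that(1)
        by (subst integral_nu[OF e]) (auto simp: scaleR_conv_of_real)
      thus ?thesis using C0(2)[OF e that(2)] by simp
    qed
    have J2: "norm (J h h') \<le> C0" for h h'
    proof (cases "\<xi> h h' = (\<lambda>_. 0)")
      case False
      obtain j :: 'n where j: "j \<noteq> last_idx" using exists_other by blast
      have "C0 / (1 + \<bar>(transpose Q *v (\<chi> i. of_int (\<xi> h h' i))) $ j\<bar>) ^ L \<le> C0 / 1"
        using C0(1) by (intro divide_left_mono one_le_power) (auto intro!: zero_less_power add_pos_nonneg)
      thus ?thesis using J1[OF False j] by simp
    qed (use J0 C0 in simp)
    define trm where "trm = (\<lambda>h h'. ww (L + 2) n h * ww (L + 2) n' h' * norm (J h h'))"
    have wt: "ww (L + 2) m h \<le> ww 2 m h" "ww (L + 2) m h \<le> 1" "0 \<le> ww (L + 2) m h" "0 \<le> ww 2 m h" if "1 \<le> m" for m h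
      using ww_bounds[OF that] unfolding ww_add by (auto simp: mult_left_le_one_le mult_le_one)
    have t_tail: "trm h h' \<le> C0 * (T powr (- 5 / 2) * (ww 2 n h * ww 2 n' h'))"
      if "h \<noteq> (\<lambda>_. 0)" "h' \<noteq> (\<lambda>_. 0)" "(h, h') \<notin> SS n n'" for h h'
    proof (cases "\<xi> h h' = (\<lambda>_. 0)")
      case True
      have "trm h h' = 0" unfolding trm_def J0[OF True] by simp
      moreover have "0 \<le> C0 * (T powr (- 5 / 2) * (ww 2 n h * ww 2 n' h'))"
        by (intro mult_nonneg_nonneg C0(1) wt(4) n n' powr_ge_zero)
      ultimately show ?thesis by linarith
    next
      case False
      \<comment> \<open>Splits the exponent of \<open>RR\<close>: m^\<tau> is at most \<rho> because
        m \<le> n n', and the other \<rho> is the margin used in \<open>ww_tail\<close>.\<close>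
      have RRge: "Hn m * \<rho> \<le> m powr (1 / real CARD('n)) * RR n n'" if m: "1 \<le> real m" "real m \<le> T" for m
      proof -
        have "Hn m * \<rho> = m powr (1 / real CARD('n)) * (m powr \<tau> * \<rho>)" by (simp add: Hn_def powr_add)
        also have "\<dots> \<le> m powr (1 / real CARD('n)) * (\<rho> * \<rho>)"
          unfolding \<rho>_def using m tau by (intro mult_left_mono mult_right_mono powr_mono2) auto
        also have "\<dots> \<le> m powr (1 / real CARD('n)) * (a\<^sub>0 * (\<rho> * \<rho>))"
          using a0_ge_1 \<rho>1 mult_right_mono[of 1 a\<^sub>0 "\<rho> * \<rho>"] by (intro mult_left_mono) auto
        finally show ?thesis unfolding RR_def T_def[symmetric] \<rho>2 .
      qed
      have "\<exists>j. \<xi> h h' j \<noteq> 0" using False by (auto simp: fun_eq_iff)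
      hence "(\<exists>j. n powr (1 / real CARD('n)) * RR n n' < \<bar>real_of_int (h j)\<bar>) \<or> (\<exists>j. n' powr (1 / real CARD('n)) * RR n n' < \<bar>real_of_int (h' j)\<bar>) \<or> \<not> near (RR n n') (\<xi> h h')"
        using that unfolding SS_def sol_def \<xi>_def by (auto simp: fun_eq_iff not_le)
      then consider j where "Hn n * \<rho> < \<bar>real_of_int (h j)\<bar>" | j where "Hn n' * \<rho> < \<bar>real_of_int (h' j)\<bar>"
        | "\<not> near (RR n n') (\<xi> h h')"
        using RRge[of n] RRge[of n'] n1 T1 by (meson le_less_trans)
      thus ?thesis
      proof cases
        case 1
        have "ww L n h \<le> T powr (- 5 / 2)" using ww_tail[of n \<rho> h j L] n 1 \<rho>1 \<rho>L by linarith
        hence "ww (L + 2) n h \<le> T powr (- 5 / 2) * ww 2 n h"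
          unfolding ww_add using wt(4)[OF n] by (intro mult_right_mono)
        hence "trm h h' \<le> (T powr (- 5 / 2) * ww 2 n h) * ww 2 n' h' * C0"
          unfolding trm_def using wt[OF n] wt[OF n'] J2 C0(1) by (intro mult_mono) auto
        thus ?thesis by (simp add: mult_ac)
      next
        case 2
        have "ww L n' h' \<le> T powr (- 5 / 2)" using ww_tail[of n' \<rho> h' j L] n' 2 \<rho>1 \<rho>L by linarith
        hence "ww (L + 2) n' h' \<le> T powr (- 5 / 2) * ww 2 n' h'"
          unfolding ww_add using wt(4)[OF n'] by (intro mult_right_mono)
        hence "trm h h' \<le> ww 2 n h * (T powr (- 5 / 2) * ww 2 n' h') * C0"
          unfolding trm_def using wt[OF n] wt[OF n'] J2 C0(1) by (intro mult_mono) auto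
        thus ?thesis by (simp add: mult_ac)
      next
        case 3
        \<comment> \<open>By \<open>near_of_transpose\<close>, a frequency that is not near the line
          has a large coordinate in a direction of decay.\<close>
        have "\<exists>j. j \<noteq> last_idx \<and> \<rho> < \<bar>(transpose Q *v (\<chi> i. of_int (\<xi> h h' i))) $ j\<bar>"
        proof (rule ccontr)
          assume "\<not> ?thesis"
          hence "near (a\<^sub>0 * \<rho>) (\<xi> h h')" using \<rho>1 by (intro near_of_transpose) (auto simp: not_less)
          moreover have "a\<^sub>0 * \<rho> \<le> RR n n'"
            unfolding RR_def T_def[symmetric] \<rho>2 using a0_ge_1 \<rho>1 by (intro mult_left_mono) auto
          ultimately have "near (RR n n') (\<xi> h h')" unfolding near_def by (meson order_trans)
          thus False using 3 by simp
        qed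
        then obtain j where j: "j \<noteq> last_idx" "\<rho> < \<bar>(transpose Q *v (\<chi> i. of_int (\<xi> h h' i))) $ j\<bar>" by blast
        have "norm (J h h') \<le> C0 / (1 + \<bar>(transpose Q *v (\<chi> i. of_int (\<xi> h h' i))) $ j\<bar>) ^ L" by (rule J1[OF False j(1)])
        also have "\<dots> \<le> C0 / \<rho> ^ L" using C0(1) j(2) \<rho>1
          by (intro divide_left_mono power_mono mult_pos_pos zero_less_power) auto
        also have "\<dots> = C0 * (1 / \<rho> ^ L)" by simp
        also have "\<dots> \<le> C0 * T powr (- 5 / 2)" using \<rho>L C0(1) by (rule mult_left_mono)
        finally have "trm h h' \<le> ww 2 n h * ww 2 n' h' * (C0 * T powr (- 5 / 2))"
          unfolding trm_def using wt[OF n] wt[OF n'] by (intro mult_mono) auto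
        thus ?thesis by (simp add: mult_ac)
      qed
    qed
    have t_all: "trm h h' \<le> C0 * ((if (h, h') \<in> SS n n' then 1 else 0) + T powr (- 5 / 2) * (ww 2 n h * ww 2 n' h'))"
      if "h \<noteq> (\<lambda>_. 0)" "h' \<noteq> (\<lambda>_. 0)" for h h'
    proof (cases "(h, h') \<in> SS n n'")
      case True
      have "trm h h' \<le> 1 * 1 * C0"
        unfolding trm_def using wt[OF n] wt[OF n'] J2 C0(1) by (intro mult_mono) auto
      moreover have "0 \<le> C0 * (T powr (- 5 / 2) * (ww 2 n h * ww 2 n' h'))"
        by (intro mult_nonneg_nonneg C0(1) wt(4) n n' powr_ge_zero)
      ultimately show ?thesis using True by (simp add: distrib_left)
    qed (use t_tail[OF that] in simp)
    have lam0: "0 \<le> lam n" "0 \<le> lam n'" by (rule leb_mean_nonneg[OF n] leb_mean_nonneg[OF n'])+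
    have bound: "(\<Sum>h\<in>X. \<Sum>h'\<in>Y. norm (coef n h) * norm (coef n' h') * norm (J h h')) \<le>
        K * (lam n * lam n' * (card (SS n n') + T powr (- 1 / 2)))"
      if X: "finite X" "(\<lambda>_. 0) \<notin> X" and Y: "finite Y" "(\<lambda>_. 0) \<notin> Y" for X Y
    proof -
      have finS: "finite (SS n n')" unfolding SS_def by (rule finite_sol)
      have "(\<Sum>h\<in>X. \<Sum>h'\<in>Y. norm (coef n h) * norm (coef n' h') * norm (J h h')) \<le>
         (\<Sum>h\<in>X. \<Sum>h'\<in>Y. (K1 * lam n * ww (L + 2) n h) * (K1 * lam n' * ww (L + 2) n' h') * norm (J h h'))"
        using K1 n n' lam0 wt by (intro sum_mono mult_right_mono mult_mono mult_nonneg_nonneg) auto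
      also have "\<dots> = K1\<^sup>2 * (lam n * lam n') * (\<Sum>h\<in>X. \<Sum>h'\<in>Y. trm h h')"
        by (simp add: trm_def sum_distrib_left power2_eq_square mult_ac)
      also have "\<dots> \<le> K1\<^sup>2 * (lam n * lam n') * (C0 * (9 ^ CARD('n) * (card (SS n n') + T powr (- 1 / 2))))"
      proof (rule mult_left_mono)
        have "(\<Sum>h\<in>X. \<Sum>h'\<in>Y. trm h h') \<le>
          (\<Sum>h\<in>X. \<Sum>h'\<in>Y. C0 * ((if (h, h') \<in> SS n n' then 1 else 0) + T powr (- 5 / 2) * (ww 2 n h * ww 2 n' h')))"
          using X(2) Y(2) by (intro sum_mono t_all) auto
        also have "\<dots> = C0 * ((\<Sum>h\<in>X. \<Sum>h'\<in>Y. if (h, h') \<in> SS n n' then 1 else 0) +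
           T powr (- 5 / 2) * ((\<Sum>h\<in>X. ww 2 n h) * (\<Sum>h'\<in>Y. ww 2 n' h')))"
          unfolding sum_product by (simp only: sum.distrib sum_distrib_left distrib_left)
        also have "\<dots> \<le> C0 * (9 ^ CARD('n) * (card (SS n n') + T powr (- 1 / 2)))"
        proof (rule mult_left_mono)
          have "(\<Sum>h\<in>X. \<Sum>h'\<in>Y. if (h, h') \<in> SS n n' then 1 else 0 :: real) = (\<Sum>z\<in>X \<times> Y. if z \<in> SS n n' then 1 else 0)"
            by (simp add: sum.cartesian_product)
          also have "\<dots> = card (X \<times> Y \<inter> SS n n')"
            by (subst sum.inter_restrict[symmetric]) (use X(1) Y(1) in auto)
          also have "\<dots> \<le> card (SS n n')" using card_mono[OF finS, of "X \<times> Y \<inter> SS n n'"] by simp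
          finally have s1: "(\<Sum>h\<in>X. \<Sum>h'\<in>Y. if (h, h') \<in> SS n n' then 1 else 0 :: real) \<le> card (SS n n')" .
          have "(\<Sum>h\<in>X. ww 2 n h) * (\<Sum>h'\<in>Y. ww 2 n' h') \<le> (3 ^ CARD('n) * (real n)\<^sup>2) * (3 ^ CARD('n) * (real n')\<^sup>2)"
            by (rule mult_mono[OF sum_ww_2_le[OF n X(1)] sum_ww_2_le[OF n' Y(1)]]) (use wt(4)[OF n'] in \<open>auto intro: sum_nonneg\<close>)
          also have "\<dots> = 9 ^ CARD('n) * T\<^sup>2"
            by (simp add: T_def power_mult_distrib mult_ac flip: power_mult_distrib[of "3::real" 3, simplified])
          finally have "T powr (- 5 / 2) * ((\<Sum>h\<in>X. ww 2 n h) * (\<Sum>h'\<in>Y. ww 2 n' h')) \<le> T powr (- 5 / 2) * (9 ^ CARD('n) * T\<^sup>2)"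
            by (intro mult_left_mono) auto
          also have "\<dots> = 9 ^ CARD('n) * (T powr (- 5 / 2) * T powr 2)" using T1 by simp
          also have "T powr (- 5 / 2) * T powr 2 = T powr (- 1 / 2)" by (simp only: powr_add[symmetric]) simp
          finally have s2: "T powr (- 5 / 2) * ((\<Sum>h\<in>X. ww 2 n h) * (\<Sum>h'\<in>Y. ww 2 n' h')) \<le> 9 ^ CARD('n) * T powr (- 1 / 2)" .
          have "real (card (SS n n')) \<le> 9 ^ CARD('n) * card (SS n n')"
            using mult_right_mono[of 1 "9 ^ CARD('n)" "real (card (SS n n'))"] by (simp add: one_le_power)
          thus "(\<Sum>h\<in>X. \<Sum>h'\<in>Y. if (h, h') \<in> SS n n' then 1 else 0) + T powr (- 5 / 2) * ((\<Sum>h\<in>X. ww 2 n h) * (\<Sum>h'\<in>Y. ww 2 n' h'))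
            \<le> 9 ^ CARD('n) * (card (SS n n') + T powr (- 1 / 2))"
            using s1 s2 by (simp add: distrib_left)
        qed (rule C0)
        finally show "(\<Sum>h\<in>X. \<Sum>h'\<in>Y. trm h h') \<le> C0 * (9 ^ CARD('n) * (card (SS n n') + T powr (- 1 / 2)))" .
      qed (use lam0 in simp)
      also have "\<dots> = K * (lam n * lam n' * (card (SS n n') + T powr (- 1 / 2)))" by (simp only: K_def mult_ac)
      finally show ?thesis .
    qed
    have e_meas: "(\<lambda>x. char1 (dotp g x)) \<in> borel_measurable borel" for g :: "'n \<Rightarrow> int" by measurable
    \<comment> \<open>By \<open>coef_0\<close> the constant coefficients are the means, so these
      integrands are the complex versions of the products of centred functions in
      \<open>DD\<close>.\<close>
    have "norm ((LINT x|nu \<eta>. (of_real (F n x) - coef n (\<lambda>_. 0)) * (of_real (F n' x) - coef n' (\<lambda>_. 0))) -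
       (LINT x|cube. (of_real (F n x) - coef n (\<lambda>_. 0)) * (of_real (F n' x) - coef n' (\<lambda>_. 0)))) \<le>
       K * (lam n * lam n' * (card (SS n n') + T powr (- 1 / 2)))"
    proof (rule product_expectation_diff_le[where e = e1 and e' = e2])
      show "prob_space (nu \<eta>)" by (rule prob_space_nu[OF e])
      show "prob_space cube" by (rule prob_space_cube)
      show "((\<lambda>h. coef n h * e1 h x) has_sum of_real (F n x)) UNIV" for x unfolding e1_def by (rule F_fourier[OF n])
      show "((\<lambda>h. coef n' h * e2 h x) has_sum of_real (F n' x)) UNIV" for x unfolding e2_def by (rule F_fourier[OF n'])
    qed (use bound F_fourier(1)[OF n] F_fourier(1)[OF n'] e_meas in
        \<open>auto simp: J_def e1_def e2_def dotp_def[of "\<lambda>_. 0"] intro!: measurable_nu measurable_restrict_space1\<close>)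
    moreover have "(of_real (F n x) - coef n (\<lambda>_. 0)) * (of_real (F n' x) - coef n' (\<lambda>_. 0)) = of_real (gg n x * gg n' x)" for x
      by (simp add: coef_0[OF n] coef_0[OF n'] gg_def)
    ultimately have "norm (complex_of_real (DD \<eta> n n')) \<le> K * (lam n * lam n' * (card (SS n n') + T powr (- 1 / 2)))"
      unfolding DD_def by (simp only: integral_complex_of_real of_real_diff)
    thus ?thesis unfolding norm_of_real T_def .
  qed
  have "0 \<le> K" using C0(1) by (simp add: K_def)
  with main show ?thesis by blast
qed

end

text \<open>The counting of parallel pairs is done for n' \<le> n; counting the diagonal twice is
  harmless for non-negative terms.\<close>

lemma sum_symmetric_le:
  fixes g :: "nat \<Rightarrow> nat \<Rightarrow> real"
  assumes "\<And>n n'. g n n' = g n' n" "\<And>n n'. 0 \<le> g n n'"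
  shows "(\<Sum>n=1..N. \<Sum>n'=1..N. g n n') \<le> 2 * (\<Sum>n'=1..N. \<Sum>n=n'..N. g n n')"
proof -
  have half: "(\<Sum>n'=1..N. \<Sum>n=1..N. if n' \<le> n then g n n' else 0) = (\<Sum>n'=1..N. \<Sum>n=n'..N. g n n')"
  proof (rule sum.cong[OF refl])
    fix n' assume "n' \<in> {1..N}"
    hence "{1..N} \<inter> {n. n' \<le> n} = {n'..N}" by auto
    thus "(\<Sum>n=1..N. if n' \<le> n then g n n' else 0) = (\<Sum>n=n'..N. g n n')"
      by (simp add: sum.inter_restrict[symmetric] sum.If_cases)
  qed
  have "(\<Sum>n=1..N. \<Sum>n'=1..N. g n n') \<le> (\<Sum>n=1..N. \<Sum>n'=1..N. (if n' \<le> n then g n n' else 0) + (if n \<le> n' then g n n' else 0))"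
    using assms(2) by (intro sum_mono) auto
  also have "\<dots> = (\<Sum>n=1..N. \<Sum>n'=1..N. if n' \<le> n then g n n' else 0) + (\<Sum>n=1..N. \<Sum>n'=1..N. if n \<le> n' then g n n' else 0)"
    by (simp only: sum.distrib)
  also have "(\<Sum>n=1..N. \<Sum>n'=1..N. if n' \<le> n then g n n' else 0) = (\<Sum>n'=1..N. \<Sum>n=1..N. if n' \<le> n then g n n' else 0)"
    by (rule sum.swap)
  also have "(\<Sum>n=1..N. \<Sum>n'=1..N. if n \<le> n' then g n n' else 0) = (\<Sum>n'=1..N. \<Sum>n=1..N. if n' \<le> n then g n n' else 0)"
    using assms(1) by (intro sum.cong refl) auto
  finally show ?thesis unfolding half by simp
qed

section \<open>From the counting bounds to the comparison of variances\<close>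

context variance_setting
begin

lemma RR_swap: "RR n n' = RR n' n"
  by (simp add: RR_def mult.commute)

lemma PP_swap: "card (PP n n') = card (PP n' n)"
proof -
  have par: "parallel h h' \<longleftrightarrow> parallel h' h" for h h' :: "'n \<Rightarrow> int"
    unfolding parallel_def by (metis mult.commute)
  have sw: "(h, h') \<in> SS n n' \<longleftrightarrow> (h', h) \<in> SS n' n" for h h' n n'
    unfolding SS_def sol_def RR_swap[of n' n] by (auto simp: add.commute)
  have "PP n' n = prod.swap ` PP n n'"
    by (auto simp: PP_def image_iff sw[of _ _ n' n] par)
  thus ?thesis by (simp add: card_image)
qed

lemma RR_ge_1: "1 \<le> n \<Longrightarrow> 1 \<le> n' \<Longrightarrow> 1 \<le> RR n n'"
proof -
  assume "1 \<le> n" "1 \<le> n'"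
  hence "1 \<le> real (n * n')" by (simp flip: of_nat_mult add: Suc_leI)
  hence "1 \<le> real (n * n') powr (2 * \<tau>)" using tau by (intro ge_one_powr_ge_zero) auto
  thus ?thesis using a0_ge_1 mult_mono[of 1 a\<^sub>0 1 "real (n * n') powr (2 * \<tau>)"] by (simp add: RR_def)
qed

lemma RR_powr: "RR n n' powr q = a\<^sub>0 powr q * real (n * n') powr (2 * \<tau> * q)"
  by (simp only: RR_def powr_mult powr_powr)

text \<open>With A = n^(1/k) R one has A A' = (n n')^(1/k) R^2, and A'^k = n' R^k meets the size
  condition of \<open>card_nonparallel\<close> exactly. The powers of R add up to (2k + 2) + 2 (2 +
  \<omega>) = q, and each contributes 2 \<tau> to the exponent.\<close>

lemma card_SS_le:
  "\<exists>C\<ge>0. \<forall>n n'. 1 \<le> n \<longrightarrow> 1 \<le> n' \<longrightarrow> card (SS n n') \<le>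
     C * real (n * n') powr ((2 + \<omega>) / real CARD('n) - 1 / 2 + 2 * \<tau> * (2 * real CARD('n) + 6 + 2 * \<omega>)) + card (PP n n')"
proof -
  let ?k = "real CARD('n)"
  obtain C where C: "0 \<le> C" "\<And>n n' A A' R. 0 < n' \<and> n' \<le> n \<and> 1 \<le> A' \<and> A' \<le> A \<and> 1 \<le> R \<and> A' ^ CARD('n) \<le> n' * R ^ CARD('n) \<Longrightarrow>
     card {(h, h') \<in> sol n n' A A' R. \<not> parallel h h'} \<le> C * R ^ (2 * CARD('n) + 2) * (A * A') powr (2 + \<omega>) / sqrt (real (n * n'))"
    using card_nonparallel by blast
  define q where "q = 2 * ?k + 6 + 2 * \<omega>"
  define E where "E = (2 + \<omega>) / ?k - 1 / 2 + 2 * \<tau> * q"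
  have main: "card (SS n n') \<le> C * a\<^sub>0 powr q * real (n * n') powr E + card (PP n n')" if n': "1 \<le> n'" "n' \<le> n" for n n'
  proof -
    define R T where "R = RR n n'" and "T = real (n * n')"
    define A A' where "A = n powr (1 / ?k) * R" and "A' = n' powr (1 / ?k) * R"
    have R1: "1 \<le> R" unfolding R_def using RR_ge_1 n' by simp
    have Tpos: "0 < T" using n' by (simp add: T_def)
    have "1 \<le> n' powr (1 / ?k)" using n' k3 by (intro ge_one_powr_ge_zero) auto
    hence A'1: "1 \<le> A'" using R1 mult_mono[of 1 "n' powr (1 / ?k)" 1 R] by (simp add: A'_def)
    have AA': "A' \<le> A" unfolding A_def A'_def using n' R1 k3 by (intro mult_right_mono powr_mono2) auto
    have Ak: "A' ^ CARD('n) \<le> n' * R ^ CARD('n)"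
      using n' k3 by (simp add: A'_def power_mult_distrib powr_powr flip: powr_realpow)
    have np: "card {(h, h') \<in> SS n n'. \<not> parallel h h'} \<le> C * R ^ (2 * CARD('n) + 2) * (A * A') powr (2 + \<omega>) / sqrt T"
      unfolding SS_def T_def R_def[symmetric] A_def[symmetric] A'_def[symmetric]
      by (rule C(2)) (use n' A'1 AA' R1 Ak in auto)
    have "A * A' = T powr (1 / ?k) * R powr 2"
      using R1 by (simp add: A_def A'_def T_def powr_mult power2_eq_square mult_ac)
    hence "(A * A') powr (2 + \<omega>) = T powr ((2 + \<omega>) / ?k) * R powr (2 * (2 + \<omega>))"
      by (simp add: powr_mult powr_powr del: powr_numeral)
    moreover have "R ^ (2 * CARD('n) + 2) = R powr (2 * ?k + 2)"
    proof -
      have "R powr real (2 * CARD('n) + 2) = R ^ (2 * CARD('n) + 2)" by (rule powr_realpow) (use R1 in simp)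
      thus ?thesis by (simp only: of_nat_add of_nat_mult of_nat_numeral)
    qed
    ultimately have "C * R ^ (2 * CARD('n) + 2) * (A * A') powr (2 + \<omega>) / sqrt T =
        C * (R powr (2 * ?k + 2) * R powr (2 * (2 + \<omega>))) * (T powr ((2 + \<omega>) / ?k) * T powr (- (1 / 2)))"
      using Tpos by (simp add: powr_minus_divide powr_half_sqrt)
    also have "R powr (2 * ?k + 2) * R powr (2 * (2 + \<omega>)) = R powr q"
      unfolding powr_add[symmetric] by (rule arg_cong[where f = "\<lambda>x. R powr x"]) (simp add: q_def)
    also have "R powr q = a\<^sub>0 powr q * T powr (2 * \<tau> * q)" unfolding R_def T_def by (rule RR_powr)
    also have "C * (a\<^sub>0 powr q * T powr (2 * \<tau> * q)) * (T powr ((2 + \<omega>) / ?k) * T powr (- (1 / 2))) = C * a\<^sub>0 powr q * T powr E"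
    proof -
      have "T powr E = T powr (2 * \<tau> * q) * (T powr ((2 + \<omega>) / ?k) * T powr (- (1 / 2)))"
        unfolding powr_add[symmetric] by (rule arg_cong[where f = "\<lambda>x. T powr x"]) (simp add: E_def)
      thus ?thesis by (simp only: mult_ac)
    qed
    finally have np': "card {(h, h') \<in> SS n n'. \<not> parallel h h'} \<le> C * a\<^sub>0 powr q * T powr E" by (rule order_trans[OF np eq_refl])
    have "{(h, h') \<in> SS n n'. \<not> parallel h h'} \<union> PP n n' = SS n n'" by (auto simp: PP_def)
    hence "card (SS n n') \<le> card {(h, h') \<in> SS n n'. \<not> parallel h h'} + card (PP n n')"
      using card_Un_le[of "{(h, h') \<in> SS n n'. \<not> parallel h h'}" "PP n n'"] by (simp only:)
    thus ?thesis using np' unfolding T_def by linarith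
  qed
  \<comment> \<open>Exchanging h and h' along with n and n' is a bijection, which extends the bound
    beyond n' \<le> n.\<close>
  have card_swap: "card (SS n n') = card (SS n' n)" for n n'
  proof -
    have sw: "(h, h') \<in> SS n n' \<longleftrightarrow> (h', h) \<in> SS n' n" for h h' n n'
      unfolding SS_def sol_def RR_swap[of n' n] by (auto simp: add.commute)
    have "SS n' n = prod.swap ` SS n n'" by (force simp: image_iff sw[of _ _ n' n])
    thus ?thesis by (simp add: card_image)
  qed
  have "card (SS n n') \<le> C * a\<^sub>0 powr q * real (n * n') powr E + card (PP n n')" if "1 \<le> n" "1 \<le> n'" for n n'
  proof (cases "n' \<le> n")
    case False
    hence "card (SS n' n) \<le> C * a\<^sub>0 powr q * real (n' * n) powr E + card (PP n' n)" using main[of n n'] that by simp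
    thus ?thesis by (simp add: card_swap[of n n'] PP_swap[of n n'] mult.commute)
  qed (use main that in auto)
  moreover have "0 \<le> C * a\<^sub>0 powr q" using C by simp
  ultimately show ?thesis unfolding E_def q_def by blast
qed

text \<open>In \<open>card_parallel\<close> the product A A' brings two powers of R and the windows
  for the coordinates of p bring k more, whence k + 2.\<close>

lemma card_PP_le:
  "\<exists>C\<ge>0. \<forall>n n'. 1 \<le> n \<longrightarrow> 1 \<le> n' \<longrightarrow>
     card (PP n n') \<le> C * real (n * n') powr (1 / real CARD('n) + 2 * \<tau> * (real CARD('n) + 2))"
proof -
  let ?k = "real CARD('n)"
  define q where "q = ?k + 2"
  have "card (PP n n') \<le> 20 * 3 ^ CARD('n) * a\<^sub>0 powr q * real (n * n') powr (1 / ?k + 2 * \<tau> * q)" if n: "1 \<le> n" "1 \<le> n'" for n n'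
  proof -
    define R T where "R = RR n n'" and "T = real (n * n')"
    have R1: "1 \<le> R" unfolding R_def using RR_ge_1 n by simp
    have A1: "1 \<le> m powr (1 / ?k) * R" if "1 \<le> m" for m :: nat
    proof -
      have "1 \<le> m powr (1 / ?k)" using that k3 by (intro ge_one_powr_ge_zero) auto
      thus ?thesis using R1 mult_mono[of 1 "m powr (1 / ?k)" 1 R] by simp
    qed
    have "card (PP n n') \<le> 20 * ((n powr (1 / ?k) * R) * (n' powr (1 / ?k) * R)) * (3 * R) ^ CARD('n)"
      unfolding PP_def SS_def R_def[symmetric] by (rule card_parallel) (use A1 n R1 in auto)
    also have "\<dots> = 20 * 3 ^ CARD('n) * (T powr (1 / ?k) * (R powr 2 * R powr ?k))"
      using R1 by (simp add: T_def powr_mult power_mult_distrib power2_eq_square powr_realpow mult_ac)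
    also have "R powr 2 * R powr ?k = R powr q" by (simp add: q_def powr_add[symmetric] add.commute)
    also have "R powr q = a\<^sub>0 powr q * T powr (2 * \<tau> * q)" unfolding R_def T_def by (rule RR_powr)
    finally show ?thesis by (simp add: T_def powr_add mult_ac)
  qed
  moreover have "0 \<le> 20 * 3 ^ CARD('n) * a\<^sub>0 powr q" by simp
  ultimately show ?thesis unfolding q_def by blast
qed

text \<open>\<open>leb_mean_le\<close> supplies precisely the weight of
  \<open>sum_parallel_bounded\<close>, whose ordered sum is half of the symmetric one up to the
  diagonal.\<close>

lemma sum_PP_bounded:
  assumes "(2 + \<omega>) / real CARD('n) + \<tau> * (2 * real CARD('n) + 8 * (4 + 2 * \<omega> + real CARD('n))) \<le> 11 / 12"
  shows "\<exists>C\<ge>0. \<forall>N. (\<Sum>n=1..N. \<Sum>n'=1..N. lam n * lam n' * card (PP n n')) \<le> C"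
proof -
  define g where "g = (\<lambda>n n'. real (n * n') powr (- 1 + real CARD('n) * \<tau>) * card (PP n n'))"
  obtain C where C: "0 \<le> C" "\<And>N. (\<Sum>n'=1..N. \<Sum>n=n'..N. g n n') \<le> C"
    using sum_parallel_bounded[OF a0_ge_1 tau(1) assms] unfolding g_def PP_def SS_def RR_def by blast
  obtain K where K: "0 \<le> K" "\<And>n. 1 \<le> n \<Longrightarrow> lam n \<le> K * real n powr (- 1 + real CARD('n) * \<tau>)" using leb_mean_le by blast
  have "(\<Sum>n=1..N. \<Sum>n'=1..N. lam n * lam n' * card (PP n n')) \<le> K\<^sup>2 * (2 * C)" for N
  proof -
    have "(\<Sum>n=1..N. \<Sum>n'=1..N. lam n * lam n' * card (PP n n')) \<le>
      (\<Sum>n=1..N. \<Sum>n'=1..N. (K * real n powr (- 1 + real CARD('n) * \<tau>)) * (K * real n' powr (- 1 + real CARD('n) * \<tau>)) * card (PP n n'))"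
      using K leb_mean_nonneg by (intro sum_mono mult_right_mono mult_mono) auto
    also have "\<dots> = K\<^sup>2 * (\<Sum>n=1..N. \<Sum>n'=1..N. g n n')"
      by (simp add: g_def sum_distrib_left power2_eq_square powr_mult mult_ac)
    also have "\<dots> \<le> K\<^sup>2 * (2 * (\<Sum>n'=1..N. \<Sum>n=n'..N. g n n'))"
      by (intro mult_left_mono sum_symmetric_le) (auto simp: g_def PP_swap mult.commute)
    also have "\<dots> \<le> K\<^sup>2 * (2 * C)" using C(2) by (intro mult_left_mono) auto
    finally show ?thesis .
  qed
  moreover have "0 \<le> K\<^sup>2 * (2 * C)" using C(1) by simp
  ultimately show ?thesis by blast
qed

text \<open>Absolute summability of the coefficients gives a uniform bound, which makes products
  integrable against any probability measure.\<close>

lemma gg_bounded: "1 \<le> n \<Longrightarrow> \<exists>b. \<forall>x. \<bar>gg n x\<bar> \<le> b"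
proof -
  assume n: "1 \<le> n"
  have "\<bar>gg n x\<bar> \<le> infsum (\<lambda>h. norm (coef n h)) UNIV + \<bar>lam n\<bar>" for x
  proof -
    have "norm (complex_of_real (F n x)) \<le> infsum (\<lambda>h. norm (coef n h * char1 (dotp (\<lambda>j. int n * h j) x))) UNIV"
      using norm_infsum_bound[of "\<lambda>h. coef n h * char1 (dotp (\<lambda>j. int n * h j) x)" UNIV] F_fourier(1)[OF n]
      unfolding infsumI[OF F_fourier(2)[OF n]] by (simp add: norm_mult)
    hence "\<bar>F n x\<bar> \<le> infsum (\<lambda>h. norm (coef n h)) UNIV" by (simp add: norm_mult)
    thus ?thesis unfolding gg_def by linarith
  qed
  thus ?thesis by blast
qed

lemma gg_measurable: "1 \<le> n \<Longrightarrow> gg n \<in> borel_measurable borel"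
  unfolding gg_def[abs_def] using F_measurable by (intro borel_measurable_diff) auto

text \<open>Expanding the square reduces the problem to pairs (n, n'); the same expansion is valid
  for both probability measures.\<close>

lemma variance_diff_eq:
  assumes e: "0 < \<eta>"
  shows "variance_density F N (mu B r bt Q t \<eta>) - variance_leb F N = (\<Sum>n=1..N. \<Sum>n'=1..N. DD \<eta> n n')"
proof -
  define G where "G = (\<lambda>x. (\<Sum>n=1..N. gg n x)\<^sup>2)"
  have Gm: "G \<in> borel_measurable borel"
    unfolding G_def using gg_measurable by (intro borel_measurable_power borel_measurable_sum) auto
  have Gs: "G = (\<lambda>x. \<Sum>n=1..N. \<Sum>n'=1..N. gg n x * gg n' x)"
    by (simp add: G_def power2_eq_square sum_product fun_eq_iff)
  have int: "integrable M (\<lambda>x. gg n x * gg n' x)" if M: "prob_space M" and meas: "\<And>f :: real ^ 'n::{finite,wellorder} \<Rightarrow> real. f \<in> borel_measurable borel \<Longrightarrow> f \<in> borel_measurable M"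
    and n: "n \<in> {1..N}" "n' \<in> {1..N}" for M n n'
  proof -
    obtain b b' where b: "\<And>x. \<bar>gg n x\<bar> \<le> b" "\<And>x. \<bar>gg n' x\<bar> \<le> b'" using gg_bounded[of n] gg_bounded[of n'] n by auto
    interpret M: prob_space M by fact
    have b0: "0 \<le> b" using b(1)[of 0] by linarith
    have bb: "norm (gg n x * gg n' x) \<le> b * b'" for x
      unfolding real_norm_def abs_mult by (intro mult_mono b b0 abs_ge_zero)
    show ?thesis
    proof (rule M.integrable_const_bound[where B = "b * b'"])
      show "AE x in M. norm (gg n x * gg n' x) \<le> b * b'" using bb by (intro always_eventually allI)
      show "(\<lambda>x. gg n x * gg n' x) \<in> borel_measurable M"
        by (rule meas) (use gg_measurable[of n] gg_measurable[of n'] n in \<open>auto intro: borel_measurable_times\<close>)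
    qed
  qed
  have I: "(LINT x|M. G x) = (\<Sum>n=1..N. \<Sum>n'=1..N. LINT x|M. gg n x * gg n' x)"
    if "prob_space M" "\<And>f :: real ^ 'n::{finite,wellorder} \<Rightarrow> real. f \<in> borel_measurable borel \<Longrightarrow> f \<in> borel_measurable M" for M
    unfolding Gs using int[OF that]
    by (subst Bochner_Integration.integral_sum, force, intro sum.cong refl, subst Bochner_Integration.integral_sum, auto)
  have "variance_density F N (mu B r bt Q t \<eta>) = (LINT x|lborel. mu B r bt Q t \<eta> x *\<^sub>R G x)"
    unfolding variance_density_def G_def gg_def by (simp add: mult.commute)
  also have "\<dots> = (LINT x|nu \<eta>. G x)" by (rule integral_nu[OF e Gm, symmetric])
  also have "\<dots> = (\<Sum>n=1..N. \<Sum>n'=1..N. LINT x|nu \<eta>. gg n x * gg n' x)"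
    by (rule I[OF prob_space_nu[OF e] measurable_nu])
  finally have 1: "variance_density F N (mu B r bt Q t \<eta>) = (\<Sum>n=1..N. \<Sum>n'=1..N. LINT x|nu \<eta>. gg n x * gg n' x)" .
  have "variance_leb F N = (LINT x|cube. G x)"
    unfolding variance_leb_def leb_mean_restrict[of "\<lambda>x. (\<Sum>n=1..N. F n x - lam n)\<^sup>2"] G_def gg_def ..
  also have "\<dots> = (\<Sum>n=1..N. \<Sum>n'=1..N. LINT x|cube. gg n x * gg n' x)"
    by (rule I[OF prob_space_cube]) (rule measurable_restrict_space1, simp)
  finally show ?thesis unfolding 1 DD_def by (simp add: sum_subtractf)
qed

text \<open>
  The parallel frequency pairs are not controlled pair by pair when the target exponent is small,
  but then their total contribution is bounded, and it is absorbed by the first non-zero term of the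
  right-hand side.
\<close>

lemma variance_bound:
  assumes E1: "(2 + \<omega>) / real CARD('n) - 1 / 2 + 2 * \<tau> * (2 * real CARD('n) + 6 + 2 * \<omega>) \<le> E"
    and E2: "1 / real CARD('n) + 2 * \<tau> * (real CARD('n) + 2) \<le> E \<or>
      (2 + \<omega>) / real CARD('n) + \<tau> * (2 * real CARD('n) + 8 * (4 + 2 * \<omega> + real CARD('n))) \<le> 11 / 12"
  shows "\<exists>C. \<forall>\<eta> N. 0 < \<eta> \<longrightarrow> \<bar>variance_density F N (mu B r bt Q t \<eta>) - variance_leb F N\<bar> \<le>
     C * (\<Sum>n=1..N. \<Sum>n'=1..N. lam n * lam n' * real (n * n') powr E)"
proof -
  define W where "W = (\<lambda>N. \<Sum>n=1..N. \<Sum>n'=1..N. lam n * lam n' * real (n * n') powr E)"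
  define S where "S = (\<lambda>N. \<Sum>n=1..N. \<Sum>n'=1..N. lam n * lam n' * card (PP n n'))"
  have lam0: "0 \<le> lam n" if "1 \<le> n" for n by (rule leb_mean_nonneg[OF that])
  have W0: "0 \<le> W N" for N unfolding W_def by (intro sum_nonneg mult_nonneg_nonneg lam0) auto
  obtain K where K: "0 \<le> K" "\<And>\<eta> n n'. 0 < \<eta> \<Longrightarrow> 1 \<le> n \<Longrightarrow> 1 \<le> n' \<Longrightarrow>
     \<bar>DD \<eta> n n'\<bar> \<le> K * (lam n * lam n' * (card (SS n n') + real (n * n') powr (- 1 / 2)))"
    using pair_bound by blast
  obtain C1 where C1: "0 \<le> C1" "\<And>n n'. 1 \<le> n \<Longrightarrow> 1 \<le> n' \<Longrightarrow> card (SS n n') \<le>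
     C1 * real (n * n') powr ((2 + \<omega>) / real CARD('n) - 1 / 2 + 2 * \<tau> * (2 * real CARD('n) + 6 + 2 * \<omega>)) + card (PP n n')"
    using card_SS_le by blast
  have T1: "1 \<le> real (n * n')" if "1 \<le> n" "1 \<le> n'" for n n' using that by (simp flip: of_nat_mult add: Suc_leI)
  have "0 \<le> (2 + \<omega>) / real CARD('n)" "0 \<le> 2 * \<tau> * (2 * real CARD('n) + 6 + 2 * \<omega>)"
    using omega_nonneg tau by (auto intro!: mult_nonneg_nonneg divide_nonneg_nonneg)
  \<comment> \<open>So the error (n n')^(-1/2) of \<open>pair_bound\<close> is dominated by the
    target power.\<close>
  hence E0: "- 1 / 2 \<le> E" using E1 by linarith
  have D: "\<bar>DD \<eta> n n'\<bar> \<le> K * (C1 + 1) * (lam n * lam n' * real (n * n') powr E) + K * (lam n * lam n' * card (PP n n'))"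
    if "0 < \<eta>" "1 \<le> n" "1 \<le> n'" for \<eta> n n'
  proof -
    have "C1 * real (n * n') powr ((2 + \<omega>) / real CARD('n) - 1 / 2 + 2 * \<tau> * (2 * real CARD('n) + 6 + 2 * \<omega>)) \<le> C1 * real (n * n') powr E"
      using C1(1) E1 T1[OF that(2,3)] by (intro mult_left_mono powr_mono) auto
    moreover have "real (n * n') powr (- 1 / 2) \<le> real (n * n') powr E"
      using E0 T1[OF that(2,3)] by (intro powr_mono) auto
    ultimately have "card (SS n n') + real (n * n') powr (- 1 / 2) \<le> (C1 + 1) * real (n * n') powr E + card (PP n n')"
      using C1(2)[OF that(2,3)] unfolding distrib_right mult_1_left by linarith
    hence "K * (lam n * lam n' * (card (SS n n') + real (n * n') powr (- 1 / 2))) \<le>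
       K * (lam n * lam n' * ((C1 + 1) * real (n * n') powr E + card (PP n n')))"
      using K(1) lam0[OF that(2)] lam0[OF that(3)] by (intro mult_left_mono) auto
    also have "\<dots> = K * (C1 + 1) * (lam n * lam n' * real (n * n') powr E) + K * (lam n * lam n' * card (PP n n'))"
      by (simp add: algebra_simps)
    finally show ?thesis using K(2)[OF that] by linarith
  qed
  have V: "\<bar>variance_density F N (mu B r bt Q t \<eta>) - variance_leb F N\<bar> \<le> K * (C1 + 1) * W N + K * S N" if e: "0 < \<eta>" for \<eta> N
  proof -
    have "\<bar>\<Sum>n=1..N. \<Sum>n'=1..N. DD \<eta> n n'\<bar> \<le> (\<Sum>n=1..N. \<Sum>n'=1..N. \<bar>DD \<eta> n n'\<bar>)"
      by (intro order_trans[OF sum_abs] sum_mono sum_abs)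
    also have "\<dots> \<le> (\<Sum>n=1..N. \<Sum>n'=1..N. K * (C1 + 1) * (lam n * lam n' * real (n * n') powr E) + K * (lam n * lam n' * card (PP n n')))"
      by (intro sum_mono D e) auto
    also have "\<dots> = K * (C1 + 1) * W N + K * S N"
      unfolding W_def S_def by (simp only: sum.distrib sum_distrib_left)
    finally show ?thesis unfolding variance_diff_eq[OF e] .
  qed
  have "\<exists>C2. \<forall>N. S N \<le> C2 * W N"
    using E2
  proof
    assume E: "1 / real CARD('n) + 2 * \<tau> * (real CARD('n) + 2) \<le> E"
    obtain C2 where C2: "0 \<le> C2" "\<And>n n'. 1 \<le> n \<Longrightarrow> 1 \<le> n' \<Longrightarrow>
       card (PP n n') \<le> C2 * real (n * n') powr (1 / real CARD('n) + 2 * \<tau> * (real CARD('n) + 2))"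
      using card_PP_le by blast
    have "S N \<le> C2 * W N" for N
    proof -
      have "S N \<le> (\<Sum>n=1..N. \<Sum>n'=1..N. lam n * lam n' * (C2 * real (n * n') powr E))"
        unfolding S_def
      proof (intro sum_mono mult_left_mono)
        fix n n' assume n: "n \<in> {1..N}" "n' \<in> {1..N}"
        have "card (PP n n') \<le> C2 * real (n * n') powr (1 / real CARD('n) + 2 * \<tau> * (real CARD('n) + 2))"
          by (rule C2(2)) (use n in auto)
        also have "\<dots> \<le> C2 * real (n * n') powr E"
          using C2(1) E T1[of n n'] n by (intro mult_left_mono powr_mono) auto
        finally show "card (PP n n') \<le> C2 * real (n * n') powr E" .
        show "0 \<le> lam n * lam n'" using n by (intro mult_nonneg_nonneg lam0) auto
      qed
      also have "\<dots> = C2 * W N" unfolding W_def sum_distrib_left by (intro sum.cong refl) (simp only: mult_ac)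
      finally show ?thesis .
    qed
    thus ?thesis by blast
  next
    assume "(2 + \<omega>) / real CARD('n) + \<tau> * (2 * real CARD('n) + 8 * (4 + 2 * \<omega> + real CARD('n))) \<le> 11 / 12"
    then obtain C3 where C3: "0 \<le> C3" "\<And>N. S N \<le> C3" using sum_PP_bounded unfolding S_def by blast
    show ?thesis
    proof (cases "\<exists>n\<ge>1. lam n \<noteq> 0")
      case False
      hence "S N = 0" for N unfolding S_def by (intro sum.neutral ballI) auto
      thus ?thesis by (intro exI[of _ 0]) auto
    next
      case True
      \<comment> \<open>For N < m the sum \<open>S\<close> is zero; for N \<ge> m the term with both
        indices m already gives W N \<ge> w. The ratio \<open>C3 / w\<close> depends on the function
        system, but not on N or \<eta>.\<close>
      define m where "m = (LEAST n. 1 \<le> n \<and> lam n \<noteq> 0)"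
      have m: "1 \<le> m" "lam m \<noteq> 0" using LeastI_ex[OF True] by (auto simp: m_def)
      have zero: "lam n = 0" if "1 \<le> n" "n < m" for n
        using not_less_Least[of n "\<lambda>n. 1 \<le> n \<and> lam n \<noteq> 0"] that by (auto simp: m_def)
      define w where "w = lam m * lam m * real (m * m) powr E"
      have "0 < lam m" using m lam0[OF m(1)] by linarith
      hence w: "0 < w" unfolding w_def using m by (intro mult_pos_pos) auto
      have "S N \<le> C3 / w * W N" for N
      proof (cases "m \<le> N")
        case True
        have mN: "m \<in> {1..N}" using m True by simp
        have "w \<le> (\<Sum>n'=1..N. lam m * lam n' * real (m * n') powr E)"
          unfolding w_def using mN m by (intro member_le_sum) (auto intro!: mult_nonneg_nonneg lam0)
        also have "\<dots> \<le> W N"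
          unfolding W_def using mN by (intro member_le_sum[where f = "\<lambda>n. \<Sum>n'=1..N. lam n * lam n' * real (n * n') powr E"]) (auto intro!: sum_nonneg mult_nonneg_nonneg lam0)
        finally have "C3 / w * w \<le> C3 / w * W N" using w C3(1) by (intro mult_left_mono) auto
        thus ?thesis using C3(2)[of N] w by simp
      next
        case False
        hence "S N = 0" unfolding S_def using zero by (intro sum.neutral ballI) auto
        thus ?thesis using W0[of N] w C3(1) by simp
      qed
      thus ?thesis by blast
    qed
  qed
  then obtain C2 where C2: "\<And>N. S N \<le> C2 * W N" by blast
  have "\<bar>variance_density F N (mu B r bt Q t \<eta>) - variance_leb F N\<bar> \<le> (K * (C1 + 1) + K * C2) * W N" if "0 < \<eta>" for \<eta> N
    using V[OF that, of N] mult_left_mono[OF C2[of N] K(1)] by (simp add: distrib_right mult.assoc)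
  thus ?thesis unfolding W_def by blast
qed

end

text \<open>The part \<open>Q\<close> \<tau> of the exponent pays for the powers of R and for
  \<omega> + \<tau> in place of \<omega>; the part 36 P \<tau> settles the parallel pairs. If P
  \<tau> \<ge> 1/12, it is at least 3 and the direct count is good enough; so it is if 1 + \<omega>
  \<ge> k/2. Otherwise the bounds 1/2 for (1 + \<omega>)/k, 1/3 for 1/k and 1/12 for P \<tau> add up
  to the 11/12 needed for convergence.\<close>

lemma exponent_conditions:
  fixes k \<omega> \<tau> :: real
  assumes k: "3 \<le> k" and om: "0 \<le> \<omega>" and tau: "0 < \<tau>" "\<tau> < 1 / k"
  defines "P \<equiv> 1 + 2 * k + 8 * (6 + 2 * k)"
  defines "E \<equiv> (2 * \<omega> + 4 - k + 2 * k * (2 * (2 * k + 8 + 2 * \<omega>) + 1 + 36 * P) * \<tau>) / (2 * k)"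
  shows "(2 + (\<omega> + \<tau>)) / k - 1 / 2 + 2 * \<tau> * (2 * k + 6 + 2 * (\<omega> + \<tau>)) \<le> E"
    and "1 / k + 2 * \<tau> * (k + 2) \<le> E \<or>
      (2 + (\<omega> + \<tau>)) / k + \<tau> * (2 * k + 8 * (4 + 2 * (\<omega> + \<tau>) + k)) \<le> 11 / 12"
proof -
  define Q where "Q = 2 * (2 * k + 8 + 2 * \<omega>) + 1"
  have "1 / k \<le> 1" using k by simp
  hence t1: "\<tau> \<le> 1" using tau by linarith
  have tk: "\<tau> / k \<le> \<tau>" using k tau divide_left_mono[of 1 k \<tau>] by simp
  have E: "E = (2 + \<omega>) / k - 1 / 2 + Q * \<tau> + 36 * (P * \<tau>)"
    unfolding E_def Q_def[symmetric] using k by (simp add: field_simps)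
  have P0: "0 < P" using k by (simp add: P_def)
  have P\<tau>: "0 < P * \<tau>" using P0 tau by simp
  have split: "(2 + (\<omega> + \<tau>)) / k = (2 + \<omega>) / k + \<tau> / k" by (simp add: add_divide_distrib)
  have "\<tau> * (2 * (2 * k + 6 + 2 * (\<omega> + \<tau>)) + 1) \<le> \<tau> * Q"
    using tau t1 by (intro mult_left_mono) (auto simp: Q_def)
  hence "\<tau> + 2 * \<tau> * (2 * k + 6 + 2 * (\<omega> + \<tau>)) \<le> Q * \<tau>" by (simp add: distrib_left mult_ac)
  thus "(2 + (\<omega> + \<tau>)) / k - 1 / 2 + 2 * \<tau> * (2 * k + 6 + 2 * (\<omega> + \<tau>)) \<le> E"
    unfolding E split using tk P\<tau> by linarith
  have "\<tau> * (2 * (k + 2)) \<le> \<tau> * Q" using tau k om by (intro mult_left_mono) (auto simp: Q_def)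
  hence first: "1 / k + 2 * \<tau> * (k + 2) \<le> E" if "1 / k \<le> (2 + \<omega>) / k - 1 / 2 + 36 * (P * \<tau>)"
    unfolding E using that by (simp add: mult_ac)
  show "1 / k + 2 * \<tau> * (k + 2) \<le> E \<or>
      (2 + (\<omega> + \<tau>)) / k + \<tau> * (2 * k + 8 * (4 + 2 * (\<omega> + \<tau>) + k)) \<le> 11 / 12"
  proof (cases "1 / 12 \<le> P * \<tau>")
    case True
    moreover have "0 \<le> (2 + \<omega>) / k" using k om by simp
    ultimately show ?thesis using first \<open>1 / k \<le> 1\<close> by linarith
  next
    case small: False
    have s: "(2 + \<omega>) / k = (1 + \<omega>) / k + 1 / k" by (simp add: add_divide_distrib)
    show ?thesis
    proof (cases "k / 2 \<le> 1 + \<omega>")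
      case True
      hence "1 / 2 \<le> (1 + \<omega>) / k" using k by (simp add: field_simps)
      thus ?thesis using first s P\<tau> by linarith
    next
      case False
      hence "(1 + \<omega>) / k \<le> 1 / 2" using k by (simp add: field_simps)
      moreover have "1 / k \<le> 1 / 3" using k by (simp add: field_simps)
      \<comment> \<open>In this case 2 \<omega> < k - 2 and \<tau> \<le> 1, so \<open>P\<close>,
        which does not involve \<omega>, bounds the coefficient of \<tau>.\<close>
      moreover have "\<tau> * (1 + (2 * k + 8 * (4 + 2 * (\<omega> + \<tau>) + k))) \<le> \<tau> * P"
        using tau t1 False k unfolding P_def by (intro mult_left_mono) auto
      hence "\<tau> + \<tau> * (2 * k + 8 * (4 + 2 * (\<omega> + \<tau>) + k)) \<le> P * \<tau>" by (simp add: distrib_left mult_ac)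
      ultimately show ?thesis unfolding split s using tk small by linarith
    qed
  qed
qed

text \<open>Replacing the lower size constant by its minimum with 1 only weakens the lower bound on
  the widths and provides the normalisation of \<open>admissible_data\<close>.\<close>

lemma variance_settingI:
  fixes \<alpha> :: "real ^ 'n::{finite,wellorder}"
  assumes "diophantine_direction (($) \<alpha>) fst_idx \<omega> c a" "mu_data \<alpha> H B r \<beta> Q t"
    and "0 < \<tau>" "\<tau> < 1 / real CARD('n)" "admissible_system \<tau> f"
  shows "\<exists>y I d tp w1 w2 c1 c2. variance_setting y I d tp w1 w2 c1 c2 \<tau> \<alpha> \<omega> c a H B r \<beta> Q t \<and>
    (\<forall>n\<ge>1. f n = admissible_data.F y I d tp w1 w2 n)"
proof -
  obtain y I d tp w1 w2 c1 c2 where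
    f: "\<forall>n\<ge>1. f n = system_function y I d tp w1 w2 n"
    and sys: "\<forall>m\<ge>1. finite (I m)" "\<forall>m\<ge>1. \<forall>i\<in>I m. \<forall>j. 0 < d m i j"
      "\<forall>m\<ge>1. \<forall>i\<in>I m. \<forall>j. \<forall>n\<in>dyadic_block m. d m i j \<le> 1 / (2 * real n)"
      "\<forall>m\<ge>1. \<forall>n\<in>dyadic_block m. disjoint_family_on (piece y (d m) (tp m) n) (I m) \<and>
         property_P y n (\<Union>i\<in>I m. piece y (d m) (tp m) n i)"
      "bump {-1<..<1} w1" "bump {x. 1 / 2 \<le> \<bar>x\<bar> \<and> \<bar>x\<bar> < 1} w2"
    and c: "0 < c1" "0 < c2" "\<forall>m\<ge>1. \<forall>i\<in>I m. \<forall>j. \<forall>n\<in>dyadic_block m.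
      c1 * real n powr (- (1 + 1 / real CARD('n) + \<tau>)) \<le> d m i j \<and> d m i j \<le> c2 * real n powr (- (1 + 1 / real CARD('n) - \<tau>))"
    using assms(5) unfolding admissible_system_def by - (elim exE conjE, rule that)
  have adm: "admissible_data y I d tp w1 w2 (min c1 1) c2 \<tau>"
  proof
    fix m i j n assume mi: "1 \<le> m" "i \<in> I m" "n \<in> dyadic_block m"
    have "min c1 1 * real n powr (- (1 + 1 / real CARD('n) + \<tau>)) \<le> c1 * real n powr (- (1 + 1 / real CARD('n) + \<tau>))"
      by (intro mult_right_mono) auto
    also have "\<dots> \<le> d m i j" using c(3) mi by blast
    finally show "min c1 1 * real n powr (- (1 + 1 / real CARD('n) + \<tau>)) \<le> d m i j" .
  qed (use sys c in auto)
  have "variance_setting y I d tp w1 w2 (min c1 1) c2 \<tau> \<alpha> \<omega> c a H B r \<beta> Q t"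
    if "diophantine_direction (($) \<alpha>) fst_idx \<omega> c a" for c a
    by (intro variance_setting.intro adm that variance_setting_axioms.intro assms(2-4))
  moreover have "f n = admissible_data.F y I d tp w1 w2 n" if "1 \<le> n" for n
    using f that by (simp add: admissible_data.F_def[OF adm])
  ultimately show ?thesis using assms(1) by blast
qed

theorem mainTheorem11:
  fixes \<alpha> :: "real ^ 'n::{finite,wellorder}" and H :: "(real ^ 'n::{finite,wellorder}) set" and c :: real
  assumes "CARD('n) \<ge> 3"
    and "\<alpha> $ fst_idx = 1"
    and "H = {x. \<alpha> \<bullet> x = c}"
    and "omega2 \<alpha> < \<infinity>"
  shows "\<exists>K. \<forall>\<tau> f B r \<beta> Q t.
    0 < \<tau> \<and> \<tau> < 1 / real CARD('n) \<and> admissible_system \<tau> f \<and> mu_data \<alpha> H B r \<beta> Q t \<longrightarrow>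
    (\<exists>C E \<delta>.
       (\<forall>n n'. \<bar>E n n'\<bar> \<le> K * \<tau>) \<and>
       ((\<lambda>(n, n'). \<delta> n n') \<longlongrightarrow> 0) (filtercomap (\<lambda>(n, n'). n * n') (at_top :: nat filter)) \<and>
       (\<forall>\<eta> N. 0 < \<eta> \<and> \<eta> \<le> 1 \<longrightarrow>
          \<bar>variance_density f N (mu B r \<beta> Q t \<eta>) - variance_leb f N\<bar>
          \<le> C * (\<Sum>n=1..N. \<Sum>n'=1..N. leb_mean (f n) * leb_mean (f n') *
                 real (n * n') powr
                   ((2 * real_of_ereal (omega2 \<alpha>) + 4 - real CARD('n) + E n n' + \<delta> n n')
                    / (2 * real CARD('n))))))"
proof -
  define k \<omega> where "k = real CARD('n)" and "\<omega> = real_of_ereal (omega2 \<alpha>)"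
  \<comment> \<open>The coefficient of \<tau> in \<open>exponent_conditions\<close>, which involves
    only k and \<omega> and can therefore be fixed before \<tau> and the function system.\<close>
  define K where "K = 2 * k * (2 * (2 * k + 8 + 2 * \<omega>) + 1 + 36 * (1 + 2 * k + 8 * (6 + 2 * k)))"
  have k3: "3 \<le> k" using assms(1) by (simp add: k_def)
  have om: "0 \<le> \<omega>" unfolding \<omega>_def by (rule omega2_properties(1)[OF assms(1,4)])
  have K0: "0 \<le> K" using k3 om by (simp add: K_def)
  have main: "\<exists>C. \<forall>\<eta> N. 0 < \<eta> \<longrightarrow> \<bar>variance_density f N (mu B r \<beta> Q t \<eta>) - variance_leb f N\<bar> \<le>
      C * (\<Sum>n=1..N. \<Sum>n'=1..N. leb_mean (f n) * leb_mean (f n') * real (n * n') powr ((2 * \<omega> + 4 - k + K * \<tau>) / (2 * k)))"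
    if tau: "0 < \<tau>" "\<tau> < 1 / real CARD('n)" and f: "admissible_system \<tau> f" and mu: "mu_data \<alpha> H B r \<beta> Q t"
    for \<tau> f B r \<beta> Q t
  proof -
    obtain c a where dio: "diophantine_direction (($) \<alpha>) fst_idx (\<omega> + \<tau>) c a"
      using diophantine_direction_exists[OF assms(1,2,4) tau(1)] unfolding \<omega>_def by blast
    obtain y I d tp w1 w2 c1 c2 where vs: "variance_setting y I d tp w1 w2 c1 c2 \<tau> \<alpha> (\<omega> + \<tau>) c a H B r \<beta> Q t"
      and fF: "\<forall>n\<ge>1. f n = admissible_data.F y I d tp w1 w2 n"
      using variance_settingI[OF dio mu tau f] by blast
    let ?F = "admissible_data.F y I d tp w1 w2"
    \<comment> \<open>The system is prescribed only for n \<ge> 1, so \<open>f\<close> and the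
      function of the locale may differ at 0; all sums start at 1.\<close>
    have "(\<Sum>n=1..N. f n x - leb_mean (f n)) = (\<Sum>n=1..N. ?F n x - leb_mean (?F n))" for N x
      using fF by (intro sum.cong) auto
    hence var: "variance_density f N \<nu> = variance_density ?F N \<nu>" "variance_leb f N = variance_leb ?F N" for N \<nu>
      by (simp_all only: variance_density_def variance_leb_def)
    have "(\<Sum>n=1..N. \<Sum>n'=1..N. leb_mean (f n) * leb_mean (f n') * real (n * n') powr e) =
        (\<Sum>n=1..N. \<Sum>n'=1..N. leb_mean (?F n) * leb_mean (?F n') * real (n * n') powr e)" for N e
      using fF by (intro sum.cong refl) auto
    thus ?thesis
      unfolding var
      using variance_setting.variance_bound[OF vs exponent_conditions(1,2)[OF k3 om tau[folded k_def], unfolded k_def]]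
      by (simp only: K_def k_def)
  qed
  show ?thesis
  proof (rule exI[of _ K], intro allI impI, elim conjE)
    fix \<tau> and f :: "nat \<Rightarrow> real ^ 'n::{finite,wellorder} \<Rightarrow> real" and B r \<beta> Q t
    assume h: "0 < \<tau>" "\<tau> < 1 / real CARD('n)" "admissible_system \<tau> f" "mu_data \<alpha> H B r \<beta> Q t"
    obtain C where C: "\<And>\<eta> N. 0 < \<eta> \<Longrightarrow> \<bar>variance_density f N (mu B r \<beta> Q t \<eta>) - variance_leb f N\<bar> \<le>
      C * (\<Sum>n=1..N. \<Sum>n'=1..N. leb_mean (f n) * leb_mean (f n') * real (n * n') powr ((2 * \<omega> + 4 - k + K * \<tau>) / (2 * k)))"
      using main[OF h] by blast
    \<comment> \<open>The witnesses are the constant K \<tau> for \<open>E\<close> and 0 for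
      \<open>\<delta>\<close>: working with \<omega> + \<tau> has moved the o(1) loss into the
      O(\<tau>) term.\<close>
    have "((\<lambda>(n, n'). 0 :: real) \<longlongrightarrow> 0) (filtercomap (\<lambda>(n, n'). n * n') (at_top :: nat filter))"
      unfolding case_prod_beta by (rule tendsto_const)
    thus "\<exists>C E \<delta>.
       (\<forall>n n'. \<bar>E n n'\<bar> \<le> K * \<tau>) \<and>
       ((\<lambda>(n, n'). \<delta> n n') \<longlongrightarrow> 0) (filtercomap (\<lambda>(n, n'). n * n') (at_top :: nat filter)) \<and>
       (\<forall>\<eta> N. 0 < \<eta> \<and> \<eta> \<le> 1 \<longrightarrow>
          \<bar>variance_density f N (mu B r \<beta> Q t \<eta>) - variance_leb f N\<bar>
          \<le> C * (\<Sum>n=1..N. \<Sum>n'=1..N. leb_mean (f n) * leb_mean (f n') *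
                 real (n * n') powr
                   ((2 * real_of_ereal (omega2 \<alpha>) + 4 - real CARD('n) + E n n' + \<delta> n n')
                    / (2 * real CARD('n)))))"
      by - (rule exI[of _ C], rule exI[of _ "\<lambda>_ _. K * \<tau>"], rule exI[of _ "\<lambda>_ _. 0"],
        intro conjI allI impI, use K0 h(1) C[unfolded \<omega>_def k_def] in \<open>auto\<close>)
  qed
qed

end
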